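(* Assume the time-harmonic problem is well-posed at the frequency $\omega>0$ (in the sense given in the context). Let $\psi\in L(\Omega)$ and let $U\in V(\Omega)$ be the unique solution of $i\omega(U,w)_{\varepsilon,\mu}+a(U,w)=(\psi,w)_{\varepsilon,\mu}$ for all $w\in V(\Omega)$. Let $\mathscr U_0\in\mathscr V_{\rm I}(\Omega)$ satisfy $J(\mathscr U_0)=0$. Assume that $\psi\in K(\Omega)^\perp$ and that $\mathscr U_0\in\mathscr V(\Omega)\cap\mathscr K(\Omega)^\perp$. Then $$\mathscr U_0=\operatorname{Re}\Big(U+\sum_{\ell\ge2}U_\ell\Big),$$ where, for each $\ell\ge2$, $U_\ell$ is an element of $V(\Omega)$ satisfying $i\ell\omega(U_\ell,v)_{\varepsilon,\mu}+a(U_\ell,v)=0$ for all $v\in V(\Omega)$.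
   Context: Geometry and coefficients. $\Omega\subset\mathbb R^3$ is a Lipschitz domain with outward unit normal $\boldsymbol n$; its boundary $\Gamma=\partial\Omega$ is partitioned into two relatively open disjoint subsets $\Gamma_{\rm P},\Gamma_{\rm I}$ (either may be empty) with $\overline{\Gamma_{\rm P}}\cap\overline{\Gamma_{\rm I}}=\emptyset$. The measurable, uniformly bounded functions $\varepsilon,\mu,\sigma$ on $\Omega$ take values in real symmetric $3\times3$ matrices; $\varepsilon,\mu$ are uniformly elliptic; $\sigma=0$ outside a set $\Omega_\sigma\subset\Omega$ with Lipschitz boundary and $\sigma$ is uniformly elliptic on $\Omega_\sigma$. On $\Gamma_{\rm I}$, $Z$ is a measurable, uniformly bounded, real symmetric-matrix-valued function which is tangential ($Z\boldsymbol n=0$, so it acts on tangent vectors) and uniformly elliptic on tangent vectors; $Y=Z^{-1}$ is its inverse (on the tangent plane). $\boldsymbol v_\tau=\boldsymbol n\times(\boldsymbol v\times\boldsymbol n)$ is the tangential trace. $T=2\pi/\omega$. Spaces. For $\mathbb K=\mathbb R$ or $\mathbb C$: $\boldsymbol{\mathcal X}(\Omega,\mathbb K)$ is the space of $\boldsymbol v\in L^2(\Omega,\mathbb K)^3$ with $\nabla\times\boldsymbol v\in L^2(\Omega,\mathbb K)^3$ and $\boldsymbol v_\tau|_{\Gamma_{\rm I}}\in L^2(\Gamma_{\rm I},\mathbb K)^3$; $\boldsymbol{\mathcal X}_{\Gamma_{\rm P}}(\Omega,\mathbb K)$ is its subspace of fields with $\boldsymbol v_\tau=0$ on $\Gamma_{\rm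 P}$. $L(\Omega)=L^2(\Omega,\mathbb C)^3\times L^2(\Omega,\mathbb C)^3$ and $V(\Omega)=\boldsymbol{\mathcal X}_{\Gamma_{\rm P}}(\Omega,\mathbb C)\times\boldsymbol{\mathcal X}(\Omega,\mathbb C)$; $\mathscr L(\Omega),\mathscr V(\Omega)$ are their real-valued counterparts. $\mathscr V_{\rm I}(\Omega)=\{[\boldsymbol e,\boldsymbol h]\in\mathscr V(\Omega): \boldsymbol e\times\boldsymbol n+Z\boldsymbol h_\tau=0\text{ on }\Gamma_{\rm I}\}$. Inner product: $([\boldsymbol v,\boldsymbol w],[\boldsymbol v',\boldsymbol w'])_{\varepsilon,\mu}=(\varepsilon\boldsymbol v,\boldsymbol v')_\Omega+(\mu\boldsymbol w,\boldsymbol w')_\Omega$ ($L^2$ inner products, conjugate-linear in the second argument), with norm $\|\cdot\|_{\varepsilon,\mu}$. $K(\Omega)$ is the set of $[\boldsymbol e,\boldsymbol h]\in V(\Omega)$ with $\boldsymbol e\times\boldsymbol n=\boldsymbol h\times\boldsymbol n=0$ on $\Gamma_{\rm I}$ and $\nabla\times\boldsymbol e=\nabla\times\boldsymbol h=0$ in $\Omega$; $\mathscr K(\Omega)$ is its real-valued counterpart; $K(\Omega)^\perp$ and $\mathscr K(\Omega)^\perp$ are the orthogonal complements in $L(\Omega)$, resp. $\mathscr L(\Omega)$, for $(\cdot,\cdot)_{\varepsilon,\mu}$. Sesquilinear form: $a([\boldsymbol e,\boldsymbol h],[\boldsymbol v,\boldsymbol w])=(\sigma\boldsymbol e,\boldsymbol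 v)_\Omega+(Y\boldsymbol e_\tau,\boldsymbol v_\tau)_{\Gamma_{\rm I}}+(Z\boldsymbol h_\tau,\boldsymbol w_\tau)_{\Gamma_{\rm I}}+(\boldsymbol h,\nabla\times\boldsymbol v)_\Omega-(\boldsymbol e,\nabla\times\boldsymbol w)_\Omega$. Well-posedness at frequency $\omega$: for every $\phi\in L(\Omega)$ there is a unique $S_\omega\phi\in V(\Omega)$ with $i\omega(S_\omega\phi,w)_{\varepsilon,\mu}+a(S_\omega\phi,w)=(\phi,w)_{\varepsilon,\mu}$ for all $w\in V(\Omega)$, and $|||S_\omega\phi|||\le C_{\rm stab}\|\phi\|_{\varepsilon,\mu}$ for a constant $C_{\rm stab}$ independent of $\phi$, where $|||[\boldsymbol v,\boldsymbol w]|||^2=\omega^2\|[\boldsymbol v,\boldsymbol w]\|_{\varepsilon,\mu}^2+(Y\boldsymbol v_\tau,\boldsymbol v_\tau)_{\Gamma_{\rm I}}+(\mu^{-1}\nabla\times\boldsymbol v,\nabla\times\boldsymbol v)_\Omega+(\varepsilon^{-1}\sigma\boldsymbol v,\sigma\boldsymbol v)_\Omega+(Z\boldsymbol w_\tau,\boldsymbol w_\tau)_{\Gamma_{\rm I}}+(\varepsilon^{-1}\nabla\times\boldsymbol w,\nabla\times\boldsymbol w)_\Omega$. Propagator and functional. For $\mathscr U_0\in\mathscr V_{\rm I}(\Omega)$ there is a unique $\mathscr U\in C^1(0,T;\mathscr L(\Omega))\cap C^0(0,T;\mathscr V_{\rm I}(\Omega))$ with $\mathscr U(0)=\mathscr U_0$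 and $(\dot{\mathscr U}(t),v)_{\varepsilon,\mu}+a(\mathscr U(t),v)=(\operatorname{Re}(\psi e^{i\omega t}),v)_{\varepsilon,\mu}$ for all $v\in\mathscr V(\Omega)$, $t\in(0,T)$. Set $P_{\psi,\omega}\mathscr U_0=\mathscr U(T)$ (extended by continuity to $\mathscr L(\Omega)$) and $J(\mathscr U_0)=\frac12\|P_{\psi,\omega}\mathscr U_0-\mathscr U_0\|_{\varepsilon,\mu}^2$. *)

theory Defs
  imports "HOL-Analysis.Analysis"
begin

section \<open>Vectors with complex entries\<close>

definition cvec :: "real^3 \<Rightarrow> complex^3" where
  "cvec x = (\<chi> i. complex_of_real (x $ i))"

definition mat_app :: "real^3^3 \<Rightarrow> complex^3 \<Rightarrow> complex^3" where
  "mat_app A v = map_matrix complex_of_real A *v v"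

definition hdot :: "complex^3 \<Rightarrow> complex^3 \<Rightarrow> complex" where
  "hdot v w = (\<Sum>i\<in>UNIV. v $ i * cnj (w $ i))"

text \<open>Bilinear pairing of a complex vector with a real one; used to test against real test fields.\<close>

definition bdot :: "complex^3 \<Rightarrow> real^3 \<Rightarrow> complex" where
  "bdot v x = (\<Sum>i\<in>UNIV. v $ i * complex_of_real (x $ i))"

definition ccross :: "complex^3 \<Rightarrow> complex^3 \<Rightarrow> complex^3" where
  "ccross a b = vector [a$2 * b$3 - a$3 * b$2,
                        a$3 * b$1 - a$1 * b$3,
                        a$1 * b$2 - a$2 * b$1]"

section \<open>Lipschitz domains, surface measure, outward normal\<close>

text \<open>Near each boundary point the set is the strict subgraph, in some direction \<open>e\<close>, of a
  Lipschitz function \<open>\<gamma>\<close> on the plane orthogonal to \<open>e\<close>; \<open>x - (x \<bullet> e) *\<^sub>R e\<close> is the orthogonal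
  projection of \<open>x\<close> onto that plane.\<close>

definition lipschitz_boundary :: "(real^3) set \<Rightarrow> bool" where
  "lipschitz_boundary S \<longleftrightarrow>
     (\<forall>p\<in>frontier S. \<exists>e r L. \<exists>\<gamma> :: real^3 \<Rightarrow> real.
        norm e = 1 \<and> r > 0 \<and> lipschitz_on L {y. y \<bullet> e = 0} \<gamma> \<and>
        S \<inter> ball p r = {x \<in> ball p r. x \<bullet> e < \<gamma> (x - (x \<bullet> e) *\<^sub>R e)})"

definition lipschitz_domain :: "(real^3) set \<Rightarrow> bool" where
  "lipschitz_domain S \<longleftrightarrow> open S \<and> connected S \<and> S \<noteq> {} \<and> lipschitz_boundary S"

text \<open>Two-dimensional Hausdorff measure, normalised (factor \<open>pi / 4\<close>) to be the area on planes.
  The outer measure below is a metric outer measure, hence countably additive on Borel sets, so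
  that \<open>measure_of\<close> does not degenerate.\<close>

definition hausdorff2_pre :: "real \<Rightarrow> (real^3) set \<Rightarrow> ennreal" where
  "hausdorff2_pre d A =
     (INF C \<in> {C :: nat \<Rightarrow> (real^3) set.
                 A \<subseteq> (\<Union>i. C i) \<and> (\<forall>i. bounded (C i) \<and> diameter (C i) \<le> d)}.
        (\<Sum>i. ennreal (pi / 4 * (diameter (C i))\<^sup>2)))"

definition hausdorff2 :: "(real^3) measure" where
  "hausdorff2 = measure_of UNIV (sets borel) (\<lambda>A. SUP d\<in>{0<..}. hausdorff2_pre d A)"

text \<open>Surface measure on a piece of a Lipschitz boundary.\<close>

definition surface :: "(real^3) set \<Rightarrow> (real^3) measure" where
  "surface G = completion (restrict_space hausdorff2 G)"

text \<open>At \<open>x\<close> the set blows up to the half space with outward normal \<open>\<nu>\<close>. For a Lipschitz subgraph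
  this holds where \<open>\<gamma>\<close> is differentiable, i.e. at almost every boundary point, and then \<open>\<nu>\<close> is the
  usual outward unit normal.\<close>

definition outward_unit_normal_at :: "(real^3) set \<Rightarrow> real^3 \<Rightarrow> real^3 \<Rightarrow> bool" where
  "outward_unit_normal_at S x \<nu> \<longleftrightarrow>
     norm \<nu> = 1 \<and>
     (\<forall>c>0. \<exists>d>0. \<forall>y\<in>ball x d.
        (\<nu> \<bullet> (y - x) < - c * norm (y - x) \<longrightarrow> y \<in> S) \<and>
        (\<nu> \<bullet> (y - x) > c * norm (y - x) \<longrightarrow> y \<notin> S))"

section \<open>Square integrable fields, weak curl, tangential trace\<close>

text \<open>Elements of \<open>L\<^sup>2\<close> are represented by functions, and identified when equal almost everywhere.\<close>

definition sq_integrable :: "'a measure \<Rightarrow> ('a \<Rightarrow> complex^3) \<Rightarrow> bool" where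
  "sq_integrable M f \<longleftrightarrow> f \<in> borel_measurable M \<and> integrable M (\<lambda>x. (norm (f x))\<^sup>2)"

definition L2_ip :: "'a measure \<Rightarrow> ('a \<Rightarrow> complex^3) \<Rightarrow> ('a \<Rightarrow> complex^3) \<Rightarrow> complex" where
  "L2_ip M f g = (LINT x|M. hdot (f x) (g x))"

definition pderiv3 :: "3 \<Rightarrow> (real^3 \<Rightarrow> real) \<Rightarrow> real^3 \<Rightarrow> real" where
  "pderiv3 i f x = frechet_derivative f (at x) (axis i 1)"

coinductive smooth :: "(real^3 \<Rightarrow> real) \<Rightarrow> bool" where
  "(\<And>x. f differentiable (at x)) \<Longrightarrow> (\<And>i. smooth (pderiv3 i f)) \<Longrightarrow> smooth f"

definition fsupport :: "(real^3 \<Rightarrow> real^3) \<Rightarrow> (real^3) set" where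
  "fsupport \<phi> = closure {x. \<phi> x \<noteq> 0}"

definition test_fields :: "(real^3 \<Rightarrow> real^3) set" where
  "test_fields = {\<phi>. (\<forall>i. smooth (\<lambda>x. \<phi> x $ i)) \<and> compact (fsupport \<phi>)}"

definition classical_curl :: "(real^3 \<Rightarrow> real^3) \<Rightarrow> real^3 \<Rightarrow> real^3" where
  "classical_curl \<phi> x =
     vector [pderiv3 2 (\<lambda>y. \<phi> y $ 3) x - pderiv3 3 (\<lambda>y. \<phi> y $ 2) x,
             pderiv3 3 (\<lambda>y. \<phi> y $ 1) x - pderiv3 1 (\<lambda>y. \<phi> y $ 3) x,
             pderiv3 1 (\<lambda>y. \<phi> y $ 2) x - pderiv3 2 (\<lambda>y. \<phi> y $ 1) x]"

definition has_curl ::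
  "(real^3) set \<Rightarrow> (real^3 \<Rightarrow> complex^3) \<Rightarrow> (real^3 \<Rightarrow> complex^3) \<Rightarrow> bool" where
  "has_curl S v c \<longleftrightarrow>
     sq_integrable (lebesgue_on S) v \<and> sq_integrable (lebesgue_on S) c \<and>
     (\<forall>\<phi>\<in>test_fields. fsupport \<phi> \<subseteq> S \<longrightarrow>
        (LINT x|lebesgue_on S. bdot (c x) (\<phi> x)) =
        (LINT x|lebesgue_on S. bdot (v x) (classical_curl \<phi> x)))"

definition curl :: "(real^3) set \<Rightarrow> (real^3 \<Rightarrow> complex^3) \<Rightarrow> real^3 \<Rightarrow> complex^3" where
  "curl S v = (SOME c. has_curl S v c)"

text \<open>The tangential trace of \<open>v\<close> on the part \<open>G\<close> of the boundary, when it is a square integrable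
  tangential field \<open>g\<close>: the (distributional) trace of a field with square integrable curl is given
  by Green's formula, whose boundary term is the integral of
  \<open>(n \<times> v) \<cdot> \<phi> = (n \<times> v\<^sub>\<tau>) \<cdot> \<phi>\<close>.  The test fields vanish near the rest of the boundary.\<close>

definition has_ttrace ::
  "(real^3) set \<Rightarrow> (real^3 \<Rightarrow> real^3) \<Rightarrow> (real^3) set \<Rightarrow>
   (real^3 \<Rightarrow> complex^3) \<Rightarrow> (real^3 \<Rightarrow> complex^3) \<Rightarrow> bool" where
  "has_ttrace S n G v g \<longleftrightarrow>
     sq_integrable (surface G) g \<and>
     (AE x in surface G. bdot (g x) (n x) = 0) \<and>
     (\<forall>\<phi>\<in>test_fields. fsupport \<phi> \<inter> (frontier S - G) = {} \<longrightarrow>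
        (LINT x|lebesgue_on S. bdot (curl S v x) (\<phi> x)) -
        (LINT x|lebesgue_on S. bdot (v x) (classical_curl \<phi> x)) =
        (LINT x|surface G. bdot (ccross (cvec (n x)) (g x)) (\<phi> x)))"

definition ttrace ::
  "(real^3) set \<Rightarrow> (real^3 \<Rightarrow> real^3) \<Rightarrow> (real^3) set \<Rightarrow>
   (real^3 \<Rightarrow> complex^3) \<Rightarrow> real^3 \<Rightarrow> complex^3" where
  "ttrace S n G v = (SOME g. has_ttrace S n G v g)"

section \<open>Geometry and coefficients\<close>

record maxwell =
  Dom :: "(real^3) set"
  GamP :: "(real^3) set"
  GamI :: "(real^3) set"
  nrml :: "real^3 \<Rightarrow> real^3"
  eps :: "real^3 \<Rightarrow> real^3^3"
  mu :: "real^3 \<Rightarrow> real^3^3"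
  sig :: "real^3 \<Rightarrow> real^3^3"
  Dom_sig :: "(real^3) set"
  Zimp :: "real^3 \<Rightarrow> real^3^3"
  Yimp :: "real^3 \<Rightarrow> real^3^3"

definition sym_bounded_coeff :: "(real^3) measure \<Rightarrow> (real^3 \<Rightarrow> real^3^3) \<Rightarrow> bool" where
  "sym_bounded_coeff M A \<longleftrightarrow>
     A \<in> borel_measurable M \<and>
     (AE x in M. transpose (A x) = A x) \<and>
     (\<exists>C. AE x in M. norm (A x) \<le> C)"

definition unif_elliptic :: "(real^3) measure \<Rightarrow> (real^3 \<Rightarrow> real^3^3) \<Rightarrow> bool" where
  "unif_elliptic M A \<longleftrightarrow> (\<exists>c>0. AE x in M. \<forall>\<xi>. c * (norm \<xi>)\<^sup>2 \<le> \<xi> \<bullet> (A x *v \<xi>))"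

definition maxwell_setting :: "maxwell \<Rightarrow> bool" where
  "maxwell_setting D \<longleftrightarrow>
     lipschitz_domain (Dom D) \<and>
     GamP D \<union> GamI D = frontier (Dom D) \<and> GamP D \<inter> GamI D = {} \<and>
     openin (top_of_set (frontier (Dom D))) (GamP D) \<and>
     openin (top_of_set (frontier (Dom D))) (GamI D) \<and>
     closure (GamP D) \<inter> closure (GamI D) = {} \<and>
     nrml D \<in> borel_measurable (surface (frontier (Dom D))) \<and>
     (AE x in surface (frontier (Dom D)). outward_unit_normal_at (Dom D) x (nrml D x)) \<and>
     sym_bounded_coeff (lebesgue_on (Dom D)) (eps D) \<and>
     unif_elliptic (lebesgue_on (Dom D)) (eps D) \<and>
     sym_bounded_coeff (lebesgue_on (Dom D)) (mu D) \<and>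
     unif_elliptic (lebesgue_on (Dom D)) (mu D) \<and>
     sym_bounded_coeff (lebesgue_on (Dom D)) (sig D) \<and>
     open (Dom_sig D) \<and> Dom_sig D \<subseteq> Dom D \<and> lipschitz_boundary (Dom_sig D) \<and>
     (AE x in lebesgue_on (Dom D). x \<notin> Dom_sig D \<longrightarrow> sig D x = 0) \<and>
     unif_elliptic (lebesgue_on (Dom_sig D)) (sig D) \<and>
     sym_bounded_coeff (surface (GamI D)) (Zimp D) \<and>
     (AE x in surface (GamI D). Zimp D x *v nrml D x = 0) \<and>
     (\<exists>c>0. AE x in surface (GamI D). \<forall>\<xi>. nrml D x \<bullet> \<xi> = 0 \<longrightarrow>
        c * (norm \<xi>)\<^sup>2 \<le> \<xi> \<bullet> (Zimp D x *v \<xi>)) \<and>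
     (AE x in surface (GamI D).
        Yimp D x *v nrml D x = 0 \<and>
        (\<forall>\<xi>. nrml D x \<bullet> \<xi> = 0 \<longrightarrow>
          Yimp D x *v (Zimp D x *v \<xi>) = \<xi> \<and> Zimp D x *v (Yimp D x *v \<xi>) = \<xi>))"

section \<open>Function spaces\<close>

text \<open>A pair of fields \<open>[e, h]\<close> is one function into \<open>\<complex>\<^sup>3 \<times> \<complex>\<^sup>3\<close>.\<close>

type_synonym emfield = "real^3 \<Rightarrow> (complex^3) \<times> (complex^3)"

abbreviation epart :: "emfield \<Rightarrow> real^3 \<Rightarrow> complex^3" where
  "epart U \<equiv> (\<lambda>x. fst (U x))"

abbreviation hpart :: "emfield \<Rightarrow> real^3 \<Rightarrow> complex^3" where
  "hpart U \<equiv> (\<lambda>x. snd (U x))"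

abbreviation dcurl :: "maxwell \<Rightarrow> (real^3 \<Rightarrow> complex^3) \<Rightarrow> real^3 \<Rightarrow> complex^3" where
  "dcurl D v \<equiv> curl (Dom D) v"

abbreviation itrace :: "maxwell \<Rightarrow> (real^3 \<Rightarrow> complex^3) \<Rightarrow> real^3 \<Rightarrow> complex^3" where
  "itrace D v \<equiv> ttrace (Dom D) (nrml D) (GamI D) v"

definition space_X :: "maxwell \<Rightarrow> (real^3 \<Rightarrow> complex^3) set" where
  "space_X D = {v. (\<exists>c. has_curl (Dom D) v c) \<and>
                   (\<exists>g. has_ttrace (Dom D) (nrml D) (GamI D) v g)}"

definition space_XP :: "maxwell \<Rightarrow> (real^3 \<Rightarrow> complex^3) set" where
  "space_XP D = {v \<in> space_X D. has_ttrace (Dom D) (nrml D) (GamP D) v (\<lambda>x. 0)}"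

definition space_L :: "maxwell \<Rightarrow> emfield set" where
  "space_L D = {U. sq_integrable (lebesgue_on (Dom D)) (epart U) \<and>
                   sq_integrable (lebesgue_on (Dom D)) (hpart U)}"

definition space_V :: "maxwell \<Rightarrow> emfield set" where
  "space_V D = {U. epart U \<in> space_XP D \<and> hpart U \<in> space_X D}"

definition re_pair :: "(complex^3) \<times> (complex^3) \<Rightarrow> (complex^3) \<times> (complex^3)" where
  "re_pair p = (\<chi> i. complex_of_real (Re (fst p $ i)), \<chi> i. complex_of_real (Re (snd p $ i)))"

text \<open>The real-valued counterparts of the spaces consist of the elements whose values have, almost
  everywhere in the domain, zero imaginary part.\<close>

definition real_valued :: "maxwell \<Rightarrow> emfield \<Rightarrow> bool" where
  "real_valued D U \<longleftrightarrow> (AE x in lebesgue_on (Dom D). re_pair (U x) = U x)"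

definition real_L :: "maxwell \<Rightarrow> emfield set" where
  "real_L D = {U \<in> space_L D. real_valued D U}"

definition real_V :: "maxwell \<Rightarrow> emfield set" where
  "real_V D = {U \<in> space_V D. real_valued D U}"

definition real_VI :: "maxwell \<Rightarrow> emfield set" where
  "real_VI D = {U \<in> real_V D.
     AE x in surface (GamI D).
       ccross (itrace D (epart U) x) (cvec (nrml D x)) +
       mat_app (Zimp D x) (itrace D (hpart U) x) = 0}"

definition em_ip :: "maxwell \<Rightarrow> emfield \<Rightarrow> emfield \<Rightarrow> complex" where
  "em_ip D U W =
     L2_ip (lebesgue_on (Dom D)) (\<lambda>x. mat_app (eps D x) (epart U x)) (epart W) +
     L2_ip (lebesgue_on (Dom D)) (\<lambda>x. mat_app (mu D x) (hpart U x)) (hpart W)"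

definition em_norm :: "maxwell \<Rightarrow> emfield \<Rightarrow> real" where
  "em_norm D U = sqrt (Re (em_ip D U U))"

definition space_K :: "maxwell \<Rightarrow> emfield set" where
  "space_K D = {U \<in> space_V D.
     (AE x in surface (GamI D).
        ccross (itrace D (epart U) x) (cvec (nrml D x)) = 0 \<and>
        ccross (itrace D (hpart U) x) (cvec (nrml D x)) = 0) \<and>
     (AE x in lebesgue_on (Dom D). dcurl D (epart U) x = 0 \<and> dcurl D (hpart U) x = 0)}"

definition real_K :: "maxwell \<Rightarrow> emfield set" where
  "real_K D = {U \<in> space_K D. real_valued D U}"

definition K_perp :: "maxwell \<Rightarrow> emfield set" where
  "K_perp D = {U \<in> space_L D. \<forall>W\<in>space_K D. em_ip D U W = 0}"

definition real_K_perp :: "maxwell \<Rightarrow> emfield set" where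
  "real_K_perp D = {U \<in> real_L D. \<forall>W\<in>real_K D. em_ip D U W = 0}"

section \<open>Sesquilinear form and time-harmonic well-posedness\<close>

definition em_form :: "maxwell \<Rightarrow> emfield \<Rightarrow> emfield \<Rightarrow> complex" where
  "em_form D U W =
     L2_ip (lebesgue_on (Dom D)) (\<lambda>x. mat_app (sig D x) (epart U x)) (epart W) +
     L2_ip (surface (GamI D)) (\<lambda>x. mat_app (Yimp D x) (itrace D (epart U) x)) (itrace D (epart W)) +
     L2_ip (surface (GamI D)) (\<lambda>x. mat_app (Zimp D x) (itrace D (hpart U) x)) (itrace D (hpart W)) +
     L2_ip (lebesgue_on (Dom D)) (hpart U) (dcurl D (epart W)) -
     L2_ip (lebesgue_on (Dom D)) (epart U) (dcurl D (hpart W))"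

definition triple_norm :: "maxwell \<Rightarrow> real \<Rightarrow> emfield \<Rightarrow> real" where
  "triple_norm D \<omega> U = sqrt (\<omega>\<^sup>2 * (em_norm D U)\<^sup>2 + Re (
     L2_ip (surface (GamI D)) (\<lambda>x. mat_app (Yimp D x) (itrace D (epart U) x)) (itrace D (epart U)) +
     L2_ip (lebesgue_on (Dom D))
       (\<lambda>x. mat_app (matrix_inv (mu D x)) (dcurl D (epart U) x)) (dcurl D (epart U)) +
     L2_ip (lebesgue_on (Dom D))
       (\<lambda>x. mat_app (matrix_inv (eps D x)) (mat_app (sig D x) (epart U x)))
       (\<lambda>x. mat_app (sig D x) (epart U x)) +
     L2_ip (surface (GamI D)) (\<lambda>x. mat_app (Zimp D x) (itrace D (hpart U) x)) (itrace D (hpart U)) +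
     L2_ip (lebesgue_on (Dom D))
       (\<lambda>x. mat_app (matrix_inv (eps D x)) (dcurl D (hpart U) x)) (dcurl D (hpart U))))"

definition harmonic_solution :: "maxwell \<Rightarrow> real \<Rightarrow> emfield \<Rightarrow> emfield \<Rightarrow> bool" where
  "harmonic_solution D \<omega> \<phi> U \<longleftrightarrow>
     U \<in> space_V D \<and>
     (\<forall>w\<in>space_V D. \<i> * complex_of_real \<omega> * em_ip D U w + em_form D U w = em_ip D \<phi> w)"

definition well_posed :: "maxwell \<Rightarrow> real \<Rightarrow> bool" where
  "well_posed D \<omega> \<longleftrightarrow>
     (\<exists>Cstab. \<forall>\<phi>\<in>space_L D. \<exists>S.
        harmonic_solution D \<omega> \<phi> S \<and>
        (\<forall>S'. harmonic_solution D \<omega> \<phi> S' \<longrightarrow> (AE x in lebesgue_on (Dom D). S' x = S x)) \<and>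
        triple_norm D \<omega> S \<le> Cstab * em_norm D \<phi>)"

section \<open>Propagator and functional\<close>

definition V_norm :: "maxwell \<Rightarrow> emfield \<Rightarrow> real" where
  "V_norm D U = sqrt ((em_norm D U)\<^sup>2 + Re (
     L2_ip (lebesgue_on (Dom D)) (dcurl D (epart U)) (dcurl D (epart U)) +
     L2_ip (lebesgue_on (Dom D)) (dcurl D (hpart U)) (dcurl D (hpart U)) +
     L2_ip (surface (GamI D)) (itrace D (epart U)) (itrace D (epart U)) +
     L2_ip (surface (GamI D)) (itrace D (hpart U)) (itrace D (hpart U))))"

text \<open>The field \<open>Re (\<psi> exp (i \<omega> t))\<close>.\<close>

definition source_at :: "emfield \<Rightarrow> real \<Rightarrow> real \<Rightarrow> emfield" where
  "source_at \<psi> \<omega> t = (\<lambda>x. re_pair (cis (\<omega> * t) *s fst (\<psi> x), cis (\<omega> * t) *s snd (\<psi> x)))"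

abbreviation period :: "real \<Rightarrow> real" where
  "period \<omega> \<equiv> 2 * pi / \<omega>"

text \<open>\<open>R\<close> solves the evolution problem with initial value \<open>U0\<close> and is of class \<open>C\<^sup>1\<close> on \<open>[0, T]\<close>
  (one-sided derivatives at the end points) with values in \<open>real_L\<close>, and \<open>C\<^sup>0\<close> with values in
  \<open>real_VI\<close>; \<open>R'\<close> is its time derivative.\<close>

definition evolution :: "maxwell \<Rightarrow> emfield \<Rightarrow> real \<Rightarrow> emfield \<Rightarrow> (real \<Rightarrow> emfield) \<Rightarrow> bool" where
  "evolution D \<psi> \<omega> U0 R \<longleftrightarrow>
     (AE x in lebesgue_on (Dom D). R 0 x = U0 x) \<and>
     (\<forall>t\<in>{0..period \<omega>}. R t \<in> real_VI D \<and>
        ((\<lambda>s. V_norm D (\<lambda>x. R s x - R t x)) \<longlongrightarrow> 0) (at t within {0..period \<omega>})) \<and>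
     (\<exists>R'.
        (\<forall>t\<in>{0..period \<omega>}. R' t \<in> real_L D \<and>
           ((\<lambda>s. em_norm D (\<lambda>x. (R s x - R t x) /\<^sub>R (s - t) - R' t x)) \<longlongrightarrow> 0)
             (at t within {0..period \<omega>}) \<and>
           ((\<lambda>s. em_norm D (\<lambda>x. R' s x - R' t x)) \<longlongrightarrow> 0) (at t within {0..period \<omega>})) \<and>
        (\<forall>t\<in>{0<..<period \<omega>}. \<forall>v\<in>real_V D.
           em_ip D (R' t) v + em_form D (R t) v = em_ip D (source_at \<psi> \<omega> t) v))"

text \<open>The second branch is the extension by continuity from initial values that admit a solution to
  their limits in \<open>real_L\<close>. Solutions are unique up to null sets, so the choices are immaterial.\<close>

definition propagator :: "maxwell \<Rightarrow> emfield \<Rightarrow> real \<Rightarrow> emfield \<Rightarrow> emfield" where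
  "propagator D \<psi> \<omega> U0 =
     (if \<exists>R. evolution D \<psi> \<omega> U0 R
      then (SOME R. evolution D \<psi> \<omega> U0 R) (period \<omega>)
      else (SOME W. W \<in> real_L D \<and>
              (\<exists>Us Rs. (\<forall>k::nat. Us k \<in> real_VI D \<and> evolution D \<psi> \<omega> (Us k) (Rs k)) \<and>
                 (\<lambda>k. em_norm D (\<lambda>x. Us k x - U0 x)) \<longlonglongrightarrow> 0 \<and>
                 (\<lambda>k. em_norm D (\<lambda>x. Rs k (period \<omega>) x - W x)) \<longlonglongrightarrow> 0)))"

definition functional_J :: "maxwell \<Rightarrow> emfield \<Rightarrow> real \<Rightarrow> emfield \<Rightarrow> real" where
  "functional_J D \<psi> \<omega> U0 = 1 / 2 * (em_norm D (\<lambda>x. propagator D \<psi> \<omega> U0 x - U0 x))\<^sup>2"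

end

theory Submission
  imports Defs
begin

text \<open>
  Let \<open>R\<close> be the evolution from \<open>U\<^sub>0\<close>; \<open>J(U\<^sub>0) = 0\<close> says that \<open>R\<close> is \<open>T\<close>-periodic. Its Fourier
  coefficients \<open>c\<^sub>l\<close> in time lie in \<open>V\<close>, because the curl and the trace are closed operators, and
  integrating the equation against \<open>exp(-i l \<omega> t)\<close> gives
  \<open>i l \<omega> (c\<^sub>l, v) + a(c\<^sub>l, v) = 0\<close> for \<open>l \<noteq> 1, -1\<close>, while \<open>2 c\<^sub>1\<close> solves the time-harmonic problem and
  so equals \<open>U\<close>. The mean \<open>c\<^sub>0\<close> satisfies \<open>a(c\<^sub>0, \<cdot>) = 0\<close>, hence lies in \<open>K\<close> with \<open>\<sigma> e = 0\<close>, so that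
  \<open>(R(t), c\<^sub>0)\<close> is constant in \<open>t\<close> and equals \<open>(U\<^sub>0, c\<^sub>0) = 0\<close>; thus \<open>c\<^sub>0 = 0\<close>. Since \<open>R\<close> is real and of
  class \<open>C\<^sup>1\<close>, its Fourier series converges at \<open>t = 0\<close>, and \<open>U\<^sub>0 = 2 Re \<Sum>\<^bsub>l \<ge> 1\<^esub> c\<^sub>l\<close>.
\<close>

section \<open>Hermitian algebra in \<open>\<complex>\<^sup>3\<close>\<close>

text \<open>The obstacle is that \<open>curl\<close> and \<open>ttrace\<close> are choices among
  functions obeying weak identities, so nothing can be computed from them before weak curls and
  traces are known to be unique almost everywhere. For traces this takes the fundamental lemma of
  the calculus of variations with respect to surface measure, hence the finiteness of Hausdorff
  measure on compact parts of a Lipschitz boundary. Afterwards every field is carried together with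
  one explicit curl and one explicit trace. The properties that must survive the passage to Fourier
  coefficients are then equalities between pairings with fixed square integrable fields, and for
  that reason a coefficient is characterised by its pairings alone. In both forms the matrix
  coefficients are moved to the test side, so that the solution enters undisturbed. The factor 2 has
  its origin in the source: Re(\<psi> exp(i \<omega> t)) carries only half of \<psi> at frequency
  \<omega>. The series is identified with the initial value by testing with real fields, where it
  becomes a scalar Fourier series, and then choosing the difference itself as the test
  field.\<close>

lemma hdot_add_left: "hdot (a + b) c = hdot a c + hdot b c"
  by (simp add: hdot_def distrib_right sum.distrib)

lemma hdot_diff_left: "hdot (a - b) c = hdot a c - hdot b c"
  by (simp add: hdot_def left_diff_distrib sum_subtractf)

lemma hdot_scale_left: "hdot (k *s a) c = k * hdot a c"
  by (simp add: hdot_def sum_distrib_left mult.assoc)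

lemma hdot_zero_left [simp]: "hdot 0 c = 0"
  by (simp add: hdot_def)

lemma hdot_commute: "hdot b a = cnj (hdot a b)"
  by (simp add: hdot_def mult.commute)

lemma hdot_zero_right [simp]: "hdot c 0 = 0"
  by (simp add: hdot_def)

lemma hdot_scale_right: "hdot a (k *s b) = cnj k * hdot a b"
  unfolding hdot_commute[of a "k *s b"] hdot_scale_left by (simp add: hdot_commute[of a b])

lemma Re_hdot: "Re (hdot a b) = a \<bullet> b"
  by (simp add: hdot_def inner_vec_def inner_complex_def)

lemma hdot_self: "hdot a a = complex_of_real ((norm a)\<^sup>2)"
  using Re_hdot[of a a] hdot_commute[of a a]
  by (simp add: complex_eq_iff power2_norm_eq_inner)

lemma norm_vscale: "norm (k *s (a::complex^3)) = cmod k * norm a"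
  by (simp add: norm_vec_def L2_set_def norm_mult power_mult_distrib real_sqrt_mult
      flip: sum_distrib_left)

lemma scaleR_vscale: "r *\<^sub>R (a::complex^3) = complex_of_real r *s a"
  by (simp add: vec_eq_iff scaleR_conv_of_real[where 'a = complex])

text \<open>Rotating \<open>a\<close> by a unimodular \<open>k\<close> makes the product real and
  nonnegative; it is then a real inner product, to which the real Cauchy-Schwarz inequality
  applies.\<close>

lemma norm_hdot_le: "cmod (hdot a b) \<le> norm a * norm b"
proof (cases "hdot a b = 0")
  case False
  define k where "k = cnj (hdot a b) / cmod (hdot a b)"
  have k: "cmod k = 1" using False by (simp add: k_def norm_divide)
  have "k * hdot a b = cmod (hdot a b)"
    using False complex_norm_square[of "hdot a b"]
    by (simp add: k_def field_simps power2_eq_square)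
  then have "cmod (hdot a b) = Re (hdot (k *s a) b)"
    by (simp add: hdot_scale_left)
  also have "\<dots> \<le> norm (k *s a) * norm b"
    by (simp only: Re_hdot norm_cauchy_schwarz)
  finally show ?thesis by (simp add: norm_vscale k)
qed simp

lemma measurable_vec_iff:
  fixes f :: "'a \<Rightarrow> 'b::euclidean_space ^ 'n::finite"
  shows "f \<in> borel_measurable M \<longleftrightarrow> (\<forall>i. (\<lambda>x. f x $ i) \<in> borel_measurable M)"
proof
  assume "f \<in> borel_measurable M"
  then show "\<forall>i. (\<lambda>x. f x $ i) \<in> borel_measurable M"
    by (intro allI borel_measurable_continuous_on[where f="\<lambda>v. v $ _"]) (auto intro: continuous_intros)
next
  assume a: "\<forall>i. (\<lambda>x. f x $ i) \<in> borel_measurable M"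
  have "(\<lambda>x. f x \<bullet> b) \<in> borel_measurable M" if "b \<in> Basis" for b
  proof -
    have "(\<lambda>x. \<Sum>i\<in>UNIV. f x $ i \<bullet> b $ i) \<in> borel_measurable M"
      using a by (intro borel_measurable_sum borel_measurable_inner) auto
    then show ?thesis by (simp add: inner_vec_def)
  qed
  then show "f \<in> borel_measurable M"
    by (subst borel_measurable_euclidean_space) auto
qed

lemma measurable_vscale [measurable (raw)]:
  fixes f :: "'a \<Rightarrow> complex^3"
  assumes "k \<in> borel_measurable M" "f \<in> borel_measurable M"
  shows "(\<lambda>x. k x *s f x) \<in> borel_measurable M"
  using assms by (auto simp: measurable_vec_iff intro: borel_measurable_times)

lemma measurable_hdot [measurable (raw)]:
  assumes "f \<in> borel_measurable M" "g \<in> borel_measurable M"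
  shows "(\<lambda>x. hdot (f x) (g x)) \<in> borel_measurable M"
  using assms unfolding hdot_def measurable_vec_iff
  by (intro borel_measurable_sum borel_measurable_times)
    (auto intro: borel_measurable_continuous_on[OF continuous_on_cnj[OF continuous_on_id]])

section \<open>Square integrable fields\<close>

definition L2_norm :: "'a measure \<Rightarrow> ('a \<Rightarrow> complex^3) \<Rightarrow> real" where
  "L2_norm M f = sqrt (LINT x|M. (norm (f x))\<^sup>2)"

lemma sq_meas [measurable_dest]: "sq_integrable M f \<Longrightarrow> f \<in> borel_measurable M"
  by (simp add: sq_integrable_def)

lemma sq_integrable_bound:
  assumes "sq_integrable M g" "f \<in> borel_measurable M" "AE x in M. norm (f x) \<le> C * norm (g x)"
  shows "sq_integrable M f"
  unfolding sq_integrable_def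
proof (intro conjI)
  show "integrable M (\<lambda>x. (norm (f x))\<^sup>2)"
  proof (rule Bochner_Integration.integrable_bound)
    show "integrable M (\<lambda>x. C\<^sup>2 * (norm (g x))\<^sup>2)"
      using assms(1) by (simp add: sq_integrable_def)
    show "(\<lambda>x. (norm (f x))\<^sup>2) \<in> borel_measurable M" using assms(2) by measurable
    show "AE x in M. norm ((norm (f x))\<^sup>2) \<le> norm (C\<^sup>2 * (norm (g x))\<^sup>2)"
      using assms(3) by eventually_elim (simp flip: power_mult_distrib, rule power_mono, auto)
  qed
qed (use assms in auto)

lemma sq_integrable_add:
  assumes "sq_integrable M f" "sq_integrable M g"
  shows "sq_integrable M (\<lambda>x. f x + g x)"
  unfolding sq_integrable_def
proof (intro conjI)
  have [measurable]: "f \<in> borel_measurable M" "g \<in> borel_measurable M"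
    using assms by (auto simp: sq_integrable_def)
  show "(\<lambda>x. f x + g x) \<in> borel_measurable M" by measurable
  show "integrable M (\<lambda>x. (norm (f x + g x))\<^sup>2)"
  proof (rule Bochner_Integration.integrable_bound)
    show "integrable M (\<lambda>x. 2 * (norm (f x))\<^sup>2 + 2 * (norm (g x))\<^sup>2)"
      using assms by (simp add: sq_integrable_def)
    show "(\<lambda>x. (norm (f x + g x))\<^sup>2) \<in> borel_measurable M" by measurable
    have "(norm (a + b))\<^sup>2 \<le> 2 * (norm a)\<^sup>2 + 2 * (norm b)\<^sup>2" for a b :: "complex^3"
    proof -
      have "(norm (a + b))\<^sup>2 \<le> (norm a + norm b)\<^sup>2"
        by (simp add: norm_triangle_ineq power_mono)
      also have "\<dots> \<le> 2 * (norm a)\<^sup>2 + 2 * (norm b)\<^sup>2"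
        using sum_squares_bound[of "norm a" "norm b"] by (simp add: power2_sum)
      finally show ?thesis .
    qed
    then show "AE x in M. norm ((norm (f x + g x))\<^sup>2) \<le> norm (2 * (norm (f x))\<^sup>2 + 2 * (norm (g x))\<^sup>2)"
      by simp
  qed
qed

lemma sq_integrable_scale:
  assumes "sq_integrable M f" shows "sq_integrable M (\<lambda>x. k *s f x)"
  using assms by (intro sq_integrable_bound[OF assms, of _ "cmod k"])
    (auto simp: norm_vscale sq_integrable_def)

lemma sq_integrable_scaleR:
  assumes "sq_integrable M f" shows "sq_integrable M (\<lambda>x. r *\<^sub>R f x)"
  unfolding scaleR_vscale by (rule sq_integrable_scale[OF assms])

lemma sq_integrable_zero [simp]: "sq_integrable M (\<lambda>x. 0)"
  by (simp add: sq_integrable_def)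

lemma sq_integrable_diff:
  assumes "sq_integrable M f" "sq_integrable M g"
  shows "sq_integrable M (\<lambda>x. f x - g x)"
  using sq_integrable_add[OF assms(1) sq_integrable_scaleR[OF assms(2), of "-1"]] by simp

lemma sq_integrable_sum:
  assumes "\<And>i. i \<in> I \<Longrightarrow> sq_integrable M (f i)"
  shows "sq_integrable M (\<lambda>x. \<Sum>i\<in>I. f i x)"
  using assms by (induction I rule: infinite_finite_induct) (auto intro: sq_integrable_add)

lemma integrable_norm_mult:
  assumes "sq_integrable M f" "sq_integrable M g"
  shows "integrable M (\<lambda>x. norm (f x) * norm (g x))"
proof (rule Bochner_Integration.integrable_bound)
  show "integrable M (\<lambda>x. (norm (f x))\<^sup>2 + (norm (g x))\<^sup>2)"
    using assms by (simp add: sq_integrable_def)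
  show "(\<lambda>x. norm (f x) * norm (g x)) \<in> borel_measurable M"
    using assms[THEN sq_meas] by measurable
  have "a * b \<le> a\<^sup>2 + b\<^sup>2" if "a \<ge> 0" "b \<ge> 0" for a b :: real
    using sum_squares_bound[of a b] that mult_nonneg_nonneg[OF that] by linarith
  then show "AE x in M. norm (norm (f x) * norm (g x)) \<le> norm ((norm (f x))\<^sup>2 + (norm (g x))\<^sup>2)"
    by (intro always_eventually) (simp add: abs_mult)
qed

lemma integrable_hdot:
  assumes "sq_integrable M f" "sq_integrable M g"
  shows "integrable M (\<lambda>x. hdot (f x) (g x))"
proof (rule Bochner_Integration.integrable_bound[OF integrable_norm_mult[OF assms]])
  show "(\<lambda>x. hdot (f x) (g x)) \<in> borel_measurable M"
    using assms[THEN sq_meas] by measurable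
qed (auto simp: norm_hdot_le)

lemma L2_ip_add_left:
  assumes "sq_integrable M f" "sq_integrable M g" "sq_integrable M h"
  shows "L2_ip M (\<lambda>x. f x + g x) h = L2_ip M f h + L2_ip M g h"
  using assms by (simp add: L2_ip_def hdot_add_left integrable_hdot)

lemma L2_ip_diff_left:
  assumes "sq_integrable M f" "sq_integrable M g" "sq_integrable M h"
  shows "L2_ip M (\<lambda>x. f x - g x) h = L2_ip M f h - L2_ip M g h"
  using assms by (simp add: L2_ip_def hdot_diff_left integrable_hdot)

lemma L2_ip_scale_left: "L2_ip M (\<lambda>x. k *s f x) h = k * L2_ip M f h"
  by (simp add: L2_ip_def hdot_scale_left)

lemma L2_ip_scaleR_left: "L2_ip M (\<lambda>x. r *\<^sub>R f x) h = r * L2_ip M f h"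
  by (simp add: scaleR_vscale L2_ip_scale_left)

lemma L2_ip_commute: "L2_ip M g f = cnj (L2_ip M f g)"
  unfolding L2_ip_def by (subst hdot_commute) (rule Bochner_Integration.integral_cnj)

lemma L2_ip_add_right:
  assumes "sq_integrable M f" "sq_integrable M g" "sq_integrable M h"
  shows "L2_ip M h (\<lambda>x. f x + g x) = L2_ip M h f + L2_ip M h g"
  using L2_ip_add_left[OF assms] L2_ip_commute[of M h] by simp

lemma L2_ip_diff_right:
  assumes "sq_integrable M f" "sq_integrable M g" "sq_integrable M h"
  shows "L2_ip M h (\<lambda>x. f x - g x) = L2_ip M h f - L2_ip M h g"
  using L2_ip_diff_left[OF assms] L2_ip_commute[of M h] by simp

lemma L2_ip_scale_right: "L2_ip M h (\<lambda>x. k *s f x) = cnj k * L2_ip M h f"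
  using L2_ip_scale_left[of M k f h] L2_ip_commute[of M h] by simp

lemma L2_ip_zero_left [simp]: "L2_ip M (\<lambda>x. 0) h = 0"
  by (simp add: L2_ip_def)

lemma L2_ip_zero_right [simp]: "L2_ip M h (\<lambda>x. 0) = 0"
  by (simp add: L2_ip_def)

lemma L2_ip_sum_left:
  assumes "\<And>i. i \<in> I \<Longrightarrow> sq_integrable M (f i)" "sq_integrable M h"
  shows "L2_ip M (\<lambda>x. \<Sum>i\<in>I. f i x) h = (\<Sum>i\<in>I. L2_ip M (f i) h)"
  using assms
  by (induction I rule: infinite_finite_induct) (auto simp: L2_ip_add_left sq_integrable_sum)

lemma L2_ip_sum_right:
  assumes "\<And>i. i \<in> I \<Longrightarrow> sq_integrable M (f i)" "sq_integrable M h"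
  shows "L2_ip M h (\<lambda>x. \<Sum>i\<in>I. f i x) = (\<Sum>i\<in>I. L2_ip M h (f i))"
  using L2_ip_sum_left[of I M f h] assms L2_ip_commute[of M h] by simp

lemma L2_ip_cong_AE:
  assumes "AE x in M. f x = f' x" "AE x in M. g x = g' x"
    "f \<in> borel_measurable M" "f' \<in> borel_measurable M" "g \<in> borel_measurable M" "g' \<in> borel_measurable M"
  shows "L2_ip M f g = L2_ip M f' g'"
  unfolding L2_ip_def using assms by (intro integral_cong_AE) (auto intro: measurable_hdot)

section \<open>The seminorm of L2: Cauchy-Schwarz and triangle inequality\<close>

lemma L2_norm_nonneg [simp]: "L2_norm M f \<ge> 0"
  by (simp add: L2_norm_def)

lemma L2_norm_sq: "(L2_norm M f)\<^sup>2 = (LINT x|M. (norm (f x))\<^sup>2)"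
  by (simp add: L2_norm_def)

lemma L2_ip_self: "L2_ip M f f = complex_of_real ((L2_norm M f)\<^sup>2)"
  unfolding L2_ip_def L2_norm_sq hdot_self by (rule integral_complex_of_real)

lemma L2_norm_eq_0:
  assumes "sq_integrable M f" "L2_norm M f = 0" shows "AE x in M. f x = 0"
proof -
  have "(LINT x|M. (norm (f x))\<^sup>2) = 0" using assms(2) L2_norm_sq[of M f] by simp
  then have "AE x in M. (norm (f x))\<^sup>2 = 0"
    using assms(1) by (subst (asm) integral_nonneg_eq_0_iff_AE) (auto simp: sq_integrable_def)
  then show ?thesis by simp
qed

text \<open>The quadratic polynomial t \<mapsto> \<integral>(u + t v)^2 is nonnegative, so its
  discriminant is not positive. The lemma is used with the pointwise norms of two fields as u and
  v.\<close>

lemma integral_mult_le_sqrt: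
  fixes u v :: "'a \<Rightarrow> real"
  assumes "integrable M (\<lambda>x. (u x)\<^sup>2)" "integrable M (\<lambda>x. (v x)\<^sup>2)" "integrable M (\<lambda>x. u x * v x)"
  shows "(LINT x|M. u x * v x)\<^sup>2 \<le> (LINT x|M. (u x)\<^sup>2) * (LINT x|M. (v x)\<^sup>2)"
proof -
  define A B C where "A = (LINT x|M. (u x)\<^sup>2)" "B = (LINT x|M. u x * v x)" "C = (LINT x|M. (v x)\<^sup>2)"
  have nn: "A + 2 * t * B + t\<^sup>2 * C \<ge> 0" for t
  proof -
    have "0 \<le> (LINT x|M. (u x + t * v x)\<^sup>2)" by simp
    also have "(\<lambda>x. (u x + t * v x)\<^sup>2) = (\<lambda>x. (u x)\<^sup>2 + 2 * t * (u x * v x) + t\<^sup>2 * (v x)\<^sup>2)"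
      by (auto simp: fun_eq_iff power2_eq_square algebra_simps)
    also have "(LINT x|M. \<dots> x) = A + 2 * t * B + t\<^sup>2 * C"
      unfolding A_B_C_def using assms by simp
    finally show ?thesis .
  qed
  have "C \<ge> 0" by (simp add: A_B_C_def)
  show "B\<^sup>2 \<le> A * C"
  proof (cases "C = 0")
    case True
    have "B = 0"
    proof (rule ccontr)
      assume "B \<noteq> 0"
      \<comment> \<open>With C = 0 the polynomial is affine, and this t gives it the value
        -1.\<close>
      then show False using nn[of "- (A + 1) / (2 * B)"] True by (simp add: field_simps)
    qed
    then show ?thesis using True by simp
  next
    case False
    then have "C > 0" using \<open>C \<ge> 0\<close> by simp
    \<comment> \<open>The minimum of the polynomial, with value A - B^2 / C.\<close>
    then show ?thesis using nn[of "- B / C"] by (simp add: field_simps power2_eq_square)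
  qed
qed

lemma L2_cauchy_schwarz:
  assumes "sq_integrable M f" "sq_integrable M g"
  shows "cmod (L2_ip M f g) \<le> L2_norm M f * L2_norm M g"
proof -
  have "cmod (L2_ip M f g) \<le> (LINT x|M. norm (f x) * norm (g x))"
    unfolding L2_ip_def
    using integrable_hdot[OF assms] integrable_norm_mult[OF assms]
    by (intro order_trans[OF integral_norm_bound integral_mono]) (auto simp: norm_hdot_le)
  also have "\<dots> \<le> L2_norm M f * L2_norm M g"
  proof (rule power2_le_imp_le)
    show "(LINT x|M. norm (f x) * norm (g x))\<^sup>2 \<le> (L2_norm M f * L2_norm M g)\<^sup>2"
      unfolding power_mult_distrib L2_norm_sq
      using assms integrable_norm_mult[OF assms]
      by (intro integral_mult_le_sqrt) (auto simp: sq_integrable_def)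
  qed simp
  finally show ?thesis .
qed

lemma L2_norm_triangle:
  assumes "sq_integrable M f" "sq_integrable M g"
  shows "L2_norm M (\<lambda>x. f x + g x) \<le> L2_norm M f + L2_norm M g"
proof (rule power2_le_imp_le)
  have "L2_ip M (\<lambda>x. f x + g x) (\<lambda>x. f x + g x) =
      L2_ip M f f + L2_ip M f g + cnj (L2_ip M f g) + L2_ip M g g"
    using assms by (simp add: L2_ip_add_left L2_ip_add_right sq_integrable_add L2_ip_commute[of M g f])
  then have "(L2_norm M (\<lambda>x. f x + g x))\<^sup>2 = (L2_norm M f)\<^sup>2 + 2 * Re (L2_ip M f g) + (L2_norm M g)\<^sup>2"
    unfolding L2_ip_self by (simp add: complex_eq_iff)
  also have "\<dots> \<le> (L2_norm M f + L2_norm M g)\<^sup>2"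
    using order_trans[OF complex_Re_le_cmod L2_cauchy_schwarz[OF assms]] by (simp add: power2_sum)
  finally show "(L2_norm M (\<lambda>x. f x + g x))\<^sup>2 \<le> (L2_norm M f + L2_norm M g)\<^sup>2" .
qed simp

lemma L2_norm_scale: "L2_norm M (\<lambda>x. k *s f x) = cmod k * L2_norm M f"
  by (simp add: L2_norm_def norm_vscale power_mult_distrib real_sqrt_mult)

lemma L2_norm_scaleR: "L2_norm M (\<lambda>x. r *\<^sub>R f x) = \<bar>r\<bar> * L2_norm M f"
  by (simp add: scaleR_vscale L2_norm_scale)

lemma L2_norm_zero [simp]: "L2_norm M (\<lambda>x. 0) = 0"
  by (simp add: L2_norm_def)

lemma L2_norm_minus_commute: "L2_norm M (\<lambda>x. f x - g x) = L2_norm M (\<lambda>x. g x - f x)"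
  by (simp add: L2_norm_def norm_minus_commute)

lemma L2_norm_sum:
  assumes "\<And>i. i \<in> I \<Longrightarrow> sq_integrable M (f i)"
  shows "L2_norm M (\<lambda>x. \<Sum>i\<in>I. f i x) \<le> (\<Sum>i\<in>I. L2_norm M (f i))"
  using assms
proof (induction I rule: infinite_finite_induct)
  case (insert i I)
  then have "L2_norm M (\<lambda>x. f i x + (\<Sum>i\<in>I. f i x)) \<le> L2_norm M (f i) + L2_norm M (\<lambda>x. \<Sum>i\<in>I. f i x)"
    by (intro L2_norm_triangle sq_integrable_sum) auto
  with insert show ?case by fastforce
qed auto

lemma L2_norm_triangle_diff:
  assumes "sq_integrable M f" "sq_integrable M g" "sq_integrable M h"
  shows "L2_norm M (\<lambda>x. f x - h x) \<le> L2_norm M (\<lambda>x. f x - g x) + L2_norm M (\<lambda>x. g x - h x)"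
  using L2_norm_triangle[OF sq_integrable_diff[OF assms(1,2)] sq_integrable_diff[OF assms(2,3)]] by simp

lemma L2_norm_cong_AE:
  assumes "AE x in M. f x = g x" "f \<in> borel_measurable M" "g \<in> borel_measurable M"
  shows "L2_norm M f = L2_norm M g"
  unfolding L2_norm_def using assms by (intro arg_cong[of _ _ sqrt] integral_cong_AE) auto

section \<open>Completeness of L2\<close>

lemma nn_integral_sq:
  assumes "sq_integrable M f"
  shows "(\<integral>\<^sup>+x. ennreal ((norm (f x))\<^sup>2) \<partial>M) = ennreal ((L2_norm M f)\<^sup>2)"
  unfolding L2_norm_sq using assms by (intro nn_integral_eq_integral) (auto simp: sq_integrable_def)

lemma L2_norm_le_nn_integral:
  assumes "f \<in> borel_measurable M" "(\<integral>\<^sup>+x. ennreal ((norm (f x))\<^sup>2) \<partial>M) \<le> ennreal (C\<^sup>2)" "C \<ge> 0"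
  shows "sq_integrable M f" "L2_norm M f \<le> C"
proof -
  have "integrable M (\<lambda>x. (norm (f x))\<^sup>2)"
    using assms by (intro integrableI_nonneg) (auto intro: order_le_less_trans)
  then show sq: "sq_integrable M f" using assms(1) by (simp add: sq_integrable_def)
  show "L2_norm M f \<le> C"
    using assms(2,3) by (simp add: nn_integral_sq[OF sq] power2_le_iff_abs_le ennreal_le_iff)
qed

text \<open>The squared norms of the increments are at most 16^(-k), so the weight 4^k still leaves
  a summable series. Hence the weighted squares have a finite sum at almost every point, the
  increments there are O(2^(-k)), and the telescoping series converges absolutely.\<close>

lemma L2_fast_cauchy_AE:
  assumes sq: "\<And>k. sq_integrable M (G k)"
    and small: "\<And>k. L2_norm M (\<lambda>x. G (Suc k) x - G k x) \<le> (1/4)^k"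
  shows "AE x in M. convergent (\<lambda>k. G k x)"
proof -
  let ?d = "\<lambda>k x. norm (G (Suc k) x - G k x)"
  have [measurable]: "G k \<in> borel_measurable M" for k using sq by (auto simp: sq_integrable_def)
  have "(\<integral>\<^sup>+x. (\<Sum>k. ennreal (4^k * (?d k x)\<^sup>2)) \<partial>M) = (\<Sum>k. \<integral>\<^sup>+x. ennreal (4^k * (?d k x)\<^sup>2) \<partial>M)"
    by (rule nn_integral_suminf) measurable
  also have "\<dots> \<le> (\<Sum>k. ennreal ((1/4)^k))"
  proof (rule suminf_le)
    fix k
    have "(\<integral>\<^sup>+x. ennreal (4^k * (?d k x)\<^sup>2) \<partial>M) = ennreal (4^k) * (\<integral>\<^sup>+x. ennreal ((?d k x)\<^sup>2) \<partial>M)"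
      by (subst nn_integral_cmult[symmetric]) (auto simp: ennreal_mult)
    also have "\<dots> = ennreal (4^k * (L2_norm M (\<lambda>x. G (Suc k) x - G k x))\<^sup>2)"
      by (subst nn_integral_sq[OF sq_integrable_diff[OF sq sq]]) (simp add: ennreal_mult)
    also have "\<dots> \<le> ennreal ((1/4)^k)"
    proof (rule ennreal_leI)
      have "4^k * (L2_norm M (\<lambda>x. G (Suc k) x - G k x))\<^sup>2 \<le> 4^k * ((1/4)^k)\<^sup>2"
        by (intro mult_left_mono power_mono small) auto
      also have "\<dots> = (1/4)^k" by (simp add: power2_eq_square power_divide)
      finally show "4^k * (L2_norm M (\<lambda>x. G (Suc k) x - G k x))\<^sup>2 \<le> (1/4)^k" .
    qed
    finally show "(\<integral>\<^sup>+x. ennreal (4^k * (?d k x)\<^sup>2) \<partial>M) \<le> ennreal ((1/4)^k)" .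
  qed auto
  also have "\<dots> < \<infinity>"
    by (subst suminf_ennreal2) (auto intro!: summable_geometric)
  finally have "AE x in M. (\<Sum>k. ennreal (4^k * (?d k x)\<^sup>2)) \<noteq> \<infinity>"
    by (intro nn_integral_noteq_infinite) auto
  then show ?thesis
  proof eventually_elim
    case (elim x)
    then have "summable (\<lambda>k. 4^k * (?d k x)\<^sup>2)"
      by (intro summable_suminf_not_top) simp_all
    then have "Bseq (\<lambda>k. 4^k * (?d k x)\<^sup>2)"
      by (rule convergent_imp_Bseq[OF convergentI[OF summable_LIMSEQ_zero]])
    then obtain C where C: "C > 0" "\<And>k. 4^k * (?d k x)\<^sup>2 \<le> C"
      unfolding Bseq_def by (metis abs_le_D1 real_norm_def)
    have p4: "((2::real)^k)\<^sup>2 = 4^k" for k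
      by (simp add: power2_eq_square flip: power_mult_distrib)
    have "?d k x \<le> sqrt C * (1/2)^k" for k
    proof -
      have "(2^k * ?d k x)\<^sup>2 \<le> C" using C(2)[of k] p4[of k] by (simp add: power_mult_distrib)
      then have "2^k * ?d k x \<le> sqrt C" by (rule real_le_rsqrt)
      then show ?thesis by (simp add: field_simps power_divide)
    qed
    moreover have "summable (\<lambda>k. sqrt C * (1/2)^k)"
      by (intro summable_mult summable_geometric) simp
    ultimately have "summable (\<lambda>k. ?d k x)"
      by - (rule summable_comparison_test'[where g = "\<lambda>k. sqrt C * (1/2)^k" and N = 0], simp_all)
    then have "summable (\<lambda>k. G (Suc k) x - G k x)" by (rule summable_norm_cancel)
    then have "convergent (\<lambda>n. \<Sum>k<n. G (Suc k) x - G k x)" by (simp add: summable_iff_convergent)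
    then have "convergent (\<lambda>n. G n x - G 0 x)" by (simp add: sum_lessThan_telescope[of "\<lambda>k. G k x"])
    then have "convergent (\<lambda>n. (G n x - G 0 x) + G 0 x)"
      by (intro convergent_add convergent_const)
    then show ?case by simp
  qed
qed

lemma L2_complete:
  assumes sq: "\<And>n. sq_integrable M (F n)"
    and cauchy: "\<And>e. e > 0 \<Longrightarrow> \<exists>N. \<forall>m\<ge>N. \<forall>n\<ge>N. L2_norm M (\<lambda>x. F m x - F n x) \<le> e"
  obtains f where "sq_integrable M f" "(\<lambda>n. L2_norm M (\<lambda>x. F n x - f x)) \<longlonglongrightarrow> 0"
proof -
  have [measurable]: "F k \<in> borel_measurable M" for k using sq by (auto simp: sq_integrable_def)
  have "\<exists>N. \<forall>k. \<forall>m\<ge>N k. \<forall>n\<ge>N k. L2_norm M (\<lambda>x. F m x - F n x) \<le> (1/4)^k"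
    by (intro choice allI cauchy) auto
  then obtain N where N: "\<And>k m n. m \<ge> N k \<Longrightarrow> n \<ge> N k \<Longrightarrow> L2_norm M (\<lambda>x. F m x - F n x) \<le> (1/4)^k"
    by blast
  \<comment> \<open>Summing all the \<open>N j\<close> puts both \<open>r k\<close> and
    \<open>r (Suc k)\<close> beyond \<open>N k\<close>, as consecutive members are compared; the
    summand k makes \<open>r k\<close> tend to infinity.\<close>
  define r where "r k = k + (\<Sum>j\<le>k. N j)" for k
  have r: "r k \<ge> N k" "r k \<ge> k" "r (Suc k) \<ge> N k" for k
    using member_le_sum[of k "{..k}" N] by (simp_all add: r_def)
  define f where "f x = lim (\<lambda>k. F (r k) x)" for x
  have [measurable]: "f \<in> borel_measurable M"
    unfolding f_def by (rule borel_measurable_lim_metric) measurable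
  have "AE x in M. convergent (\<lambda>k. F (r k) x)"
    by (rule L2_fast_cauchy_AE) (auto intro: sq N r)
  then have lim: "AE x in M. (\<lambda>k. F (r k) x) \<longlonglongrightarrow> f x"
    by eventually_elim (simp add: f_def convergent_LIMSEQ_iff)
  \<comment> \<open>Fatou's lemma along the subsequence: the almost everywhere limit inherits the
    bound \<open>e\<close> that holds for all later members of the original sequence.\<close>
  have key: "sq_integrable M (\<lambda>x. F n x - f x)" "L2_norm M (\<lambda>x. F n x - f x) \<le> e"
    if e: "e > 0" "\<And>m. m \<ge> K \<Longrightarrow> L2_norm M (\<lambda>x. F n x - F m x) \<le> e" for n e K
  proof -
    have "(\<integral>\<^sup>+x. ennreal ((norm (F n x - f x))\<^sup>2) \<partial>M)
        = (\<integral>\<^sup>+x. liminf (\<lambda>k. ennreal ((norm (F n x - F (r k) x))\<^sup>2)) \<partial>M)"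
    proof (rule nn_integral_cong_AE)
      show "AE x in M. ennreal ((norm (F n x - f x))\<^sup>2)
          = liminf (\<lambda>k. ennreal ((norm (F n x - F (r k) x))\<^sup>2))"
        using lim
      proof eventually_elim
        case (elim x)
        have "(\<lambda>k. ennreal ((norm (F n x - F (r k) x))\<^sup>2)) \<longlonglongrightarrow> ennreal ((norm (F n x - f x))\<^sup>2)"
          by (intro tendsto_intros tendsto_ennrealI elim)
        then show ?case by (metis lim_imp_Liminf trivial_limit_sequentially)
      qed
    qed
    also have "\<dots> \<le> liminf (\<lambda>k. \<integral>\<^sup>+x. ennreal ((norm (F n x - F (r k) x))\<^sup>2) \<partial>M)"
      by (rule nn_integral_liminf) measurable
    also have "\<dots> \<le> limsup (\<lambda>k. \<integral>\<^sup>+x. ennreal ((norm (F n x - F (r k) x))\<^sup>2) \<partial>M)"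
      by (rule Liminf_le_Limsup) simp
    also have "\<dots> \<le> ennreal (e\<^sup>2)"
    proof (rule Limsup_bounded)
      show "\<forall>\<^sub>F k in sequentially. (\<integral>\<^sup>+x. ennreal ((norm (F n x - F (r k) x))\<^sup>2) \<partial>M) \<le> ennreal (e\<^sup>2)"
        using eventually_ge_at_top[of K]
      proof eventually_elim
        case (elim k)
        then have "r k \<ge> K" using r(2)[of k] by linarith
        then show ?case
          by (subst nn_integral_sq[OF sq_integrable_diff[OF sq sq]]) (auto intro!: ennreal_leI power_mono e)
      qed
    qed
    finally have "(\<integral>\<^sup>+x. ennreal ((norm (F n x - f x))\<^sup>2) \<partial>M) \<le> ennreal (e\<^sup>2)" .
    from L2_norm_le_nn_integral[OF _ this] show "sq_integrable M (\<lambda>x. F n x - f x)" "L2_norm M (\<lambda>x. F n x - f x) \<le> e"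
      using e(1) by auto
  qed
  obtain N1 where N1: "\<And>m n. m \<ge> N1 \<Longrightarrow> n \<ge> N1 \<Longrightarrow> L2_norm M (\<lambda>x. F m x - F n x) \<le> 1"
    using cauchy[of 1] by auto
  have "sq_integrable M (\<lambda>x. F N1 x - f x)" by (rule key(1)[of 1 N1]) (auto intro: N1)
  from sq_integrable_diff[OF sq[of N1] this] have "sq_integrable M f" by simp
  moreover have "(\<lambda>n. L2_norm M (\<lambda>x. F n x - f x)) \<longlonglongrightarrow> 0"
  proof (rule LIMSEQ_I)
    fix e :: real assume "e > 0"
    then obtain K where K: "\<And>m n. m \<ge> K \<Longrightarrow> n \<ge> K \<Longrightarrow> L2_norm M (\<lambda>x. F m x - F n x) \<le> e / 2"
      using cauchy[of "e/2"] by auto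
    show "\<exists>no. \<forall>n\<ge>no. norm (L2_norm M (\<lambda>x. F n x - f x) - 0) < e"
    proof (intro exI allI impI)
      fix n assume "n \<ge> K"
      then have "L2_norm M (\<lambda>x. F n x - f x) \<le> e / 2"
        using \<open>e > 0\<close> K[of n] by (intro key(2)[where K=K]) auto
      then show "norm (L2_norm M (\<lambda>x. F n x - f x) - 0) < e" using \<open>e > 0\<close> by simp
    qed
  qed
  ultimately show ?thesis by (rule that)
qed

section \<open>Smooth bump functions\<close>

text \<open>The derivatives of exp(-1/t) are combinations of the functions exp(-1/t) / t^n. Carrying
  the exponent n makes the family closed under differentiation.\<close>

definition flat_exp :: "nat \<Rightarrow> real \<Rightarrow> real" where
  "flat_exp n t = (if t \<le> 0 then 0 else exp (- (1 / t)) / t ^ n)"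

lemma power_div_fact_le_exp:
  fixes x :: real assumes "x \<ge> 0" shows "x ^ n / fact n \<le> exp x"
proof -
  have "(\<Sum>k\<in>{n}. inverse (fact k) * x ^ k) \<le> (\<Sum>k. inverse (fact k) * x ^ k)"
    using assms by (intro sum_le_suminf summable_exp) auto
  then show ?thesis by (simp add: exp_def scaleR_conv_of_real field_simps)
qed

text \<open>A single term of the exponential series at 1/t bounds exp(1/t) from below. The index n +
  2 leaves a factor t^2, one power more than a difference quotient at 0 consumes.\<close>

lemma flat_exp_bound: "t > 0 \<Longrightarrow> flat_exp n t \<le> fact (n + 2) * t\<^sup>2"
proof -
  assume t: "t > 0"
  have "(1 / t) ^ (n + 2) / fact (n + 2) \<le> exp (1 / t)"
    using t by (intro power_div_fact_le_exp) simp
  then have "1 \<le> exp (1 / t) * (fact (n + 2) * t ^ (n + 2))"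
    using t by (simp add: field_simps del: fact_Suc power_Suc)
  then have "exp (- (1 / t)) \<le> fact (n + 2) * t ^ (n + 2)"
    by (simp add: exp_minus field_simps del: fact_Suc power_Suc)
  then have "exp (- (1 / t)) \<le> (fact (n + 2) * t\<^sup>2) * t ^ n"
    by (simp only: power_add mult.assoc mult.commute[of "t^n"])
  then show ?thesis using t by (simp add: flat_exp_def divide_le_eq del: fact_Suc power_Suc)
qed

lemma flat_exp_nonneg: "flat_exp n t \<ge> 0"
  by (simp add: flat_exp_def)

lemma flat_exp_deriv:
  "(flat_exp n has_real_derivative flat_exp (n + 2) t - n * flat_exp (n + 1) t) (at t)"
proof -
  consider "t < 0" | "t > 0" | "t = 0" by linarith
  then show ?thesis
  proof cases
    case 1
    have "((\<lambda>_. 0) has_real_derivative 0) (at t)" by simp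
    then have "(flat_exp n has_real_derivative 0) (at t)"
      by (rule has_field_derivative_transform_within_open[of _ _ _ "{..<0}"])
        (use 1 in \<open>auto simp: flat_exp_def\<close>)
    then show ?thesis using 1 by (simp add: flat_exp_def)
  next
    case 2
    have e: "((\<lambda>t. exp (- (1 / t))) has_real_derivative exp (- (1 / t)) / t\<^sup>2) (at t)"
      using 2 by (auto intro!: derivative_eq_intros simp: power2_eq_square)
    have p: "((\<lambda>t. inverse (t ^ n)) has_real_derivative - (n / t ^ (n + 1))) (at t)"
    proof (cases n)
      case (Suc m)
      have "((\<lambda>t. inverse (t ^ n)) has_real_derivative
          - (inverse (t ^ n) * (n * t ^ (n - 1)) * inverse (t ^ n))) (at t)"
        using 2 by (auto intro!: derivative_eq_intros)
      moreover have "inverse (t ^ n) * (n * t ^ (n - 1)) * inverse (t ^ n) = n / t ^ (n + 1)"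
        using 2 Suc by (simp add: divide_simps)
      ultimately show ?thesis by simp
    qed simp
    have eq: "exp (- (1 / t)) * - (n / t ^ (n + 1)) + exp (- (1 / t)) / t\<^sup>2 * inverse (t ^ n) =
        flat_exp (n + 2) t - n * flat_exp (n + 1) t"
      using 2 by (simp add: flat_exp_def divide_simps power2_eq_square)
    have "((\<lambda>t. exp (- (1 / t)) * inverse (t ^ n)) has_real_derivative
        flat_exp (n + 2) t - n * flat_exp (n + 1) t) (at t)"
      by (rule DERIV_cong[OF DERIV_mult[OF e p]]) (use eq in \<open>simp add: mult.commute\<close>)
    then show ?thesis
      by (rule has_field_derivative_transform_within_open[of _ _ _ "{0<..}"])
        (use 2 in \<open>auto simp: flat_exp_def divide_inverse\<close>)
  next
    case 3
    \<comment> \<open>By \<open>flat_exp_bound\<close> the quotient is at most a constant times |y|;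
      the claimed derivative is 0 here as well, since \<open>flat_exp\<close> vanishes at 0.\<close>
    have "(\<lambda>y. (flat_exp n y - flat_exp n 0) / (y - 0)) \<midarrow>0\<rightarrow> 0"
    proof (rule Lim_null_comparison)
      show "\<forall>\<^sub>F y in at 0. norm ((flat_exp n y - flat_exp n 0) / (y - 0)) \<le> fact (n + 2) * \<bar>y\<bar>"
      proof (rule always_eventually, rule allI)
        fix y :: real
        show "norm ((flat_exp n y - flat_exp n 0) / (y - 0)) \<le> fact (n + 2) * \<bar>y\<bar>"
        proof (cases "y > 0")
          case True
          then have "flat_exp n y / y \<le> fact (n + 2) * y"
            using flat_exp_bound[of y n]
            by (simp add: divide_le_eq power2_eq_square mult.assoc del: fact_Suc)
          then show ?thesis using True flat_exp_nonneg[of n y]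
            by (simp add: flat_exp_def[of n 0] del: fact_Suc)
        qed (simp add: flat_exp_def mult_nonneg_nonpos del: fact_Suc)
      qed
      show "(\<lambda>y::real. fact (n + 2) * \<bar>y\<bar>) \<midarrow>0\<rightarrow> 0"
        using tendsto_mult[OF tendsto_const tendsto_rabs_zero[OF tendsto_ident_at[of 0 UNIV]], of "fact (n + 2)"]
        by (simp del: fact_Suc)
    qed
    then have "(flat_exp n has_real_derivative 0) (at 0)"
      by (simp add: has_field_derivative_iff)
    then show ?thesis using 3 by (simp add: flat_exp_def)
  qed
qed

lemma flat_exp_le_1: "flat_exp 0 t \<le> 1"
  by (simp add: flat_exp_def)

text \<open>Scaling by k sharpens the smooth ramp into a jump. The limit at s = 0 is 0, in agreement
  with the indicator of an open box.\<close>

lemma flat_exp_scaled_tendsto: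
  "(\<lambda>k. flat_exp 0 (real k * s)) \<longlonglongrightarrow> (if s > 0 then 1 else 0)"
proof (cases "s > 0")
  case True
  have "(\<lambda>k. exp (- ((1 / s) * (1 / real k)))) \<longlonglongrightarrow> exp (- ((1 / s) * 0))"
    by (intro tendsto_intros lim_1_over_n)
  moreover have "\<forall>\<^sub>F k in sequentially. exp (- ((1 / s) * (1 / real k))) = flat_exp 0 (real k * s)"
    using eventually_gt_at_top[of 0]
    by eventually_elim (use True in \<open>auto simp: flat_exp_def mult_le_0_iff mult.commute\<close>)
  ultimately show ?thesis using True by (auto elim: Lim_transform_eventually)
next
  case False
  then show ?thesis by (simp add: flat_exp_def mult_nonneg_nonpos)
qed

text \<open>An algebra given by generators and closed under partial derivatives, hence an invariant
  for the coinduction that proves its members \<open>smooth\<close>.\<close>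

inductive_set bumps :: "(real^3 \<Rightarrow> real) set" where
  bumps_atom: "(\<lambda>x. flat_exp n (a * x $ i + b)) \<in> bumps"
| bumps_const: "(\<lambda>x. c) \<in> bumps"
| bumps_add: "f \<in> bumps \<Longrightarrow> g \<in> bumps \<Longrightarrow> (\<lambda>x. f x + g x) \<in> bumps"
| bumps_mult: "f \<in> bumps \<Longrightarrow> g \<in> bumps \<Longrightarrow> (\<lambda>x. f x * g x) \<in> bumps"

lemma pderiv3_eq: "(f has_derivative f') (at x) \<Longrightarrow> pderiv3 i f x = f' (axis i 1)"
  by (simp add: pderiv3_def frechet_derivative_at[symmetric])

lemma pderiv3_add:
  assumes "f differentiable (at x)" "g differentiable (at x)"
  shows "pderiv3 i (\<lambda>x. f x + g x) x = pderiv3 i f x + pderiv3 i g x"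
proof -
  obtain f' g' where *: "(f has_derivative f') (at x)" "(g has_derivative g') (at x)"
    using assms by (auto simp: differentiable_def)
  show ?thesis
    using pderiv3_eq[OF has_derivative_add[OF *]] *[THEN pderiv3_eq] by simp
qed

lemma pderiv3_diff:
  assumes "f differentiable (at x)" "g differentiable (at x)"
  shows "pderiv3 i (\<lambda>x. f x - g x) x = pderiv3 i f x - pderiv3 i g x"
proof -
  obtain f' g' where *: "(f has_derivative f') (at x)" "(g has_derivative g') (at x)"
    using assms by (auto simp: differentiable_def)
  show ?thesis
    using pderiv3_eq[OF has_derivative_diff[OF *]] *[THEN pderiv3_eq] by simp
qed

lemma pderiv3_mult:
  assumes "f differentiable (at x)" "g differentiable (at x)"
  shows "pderiv3 i (\<lambda>x. f x * g x) x = f x * pderiv3 i g x + pderiv3 i f x * g x"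
proof -
  obtain f' g' where *: "(f has_derivative f') (at x)" "(g has_derivative g') (at x)"
    using assms by (auto simp: differentiable_def)
  show ?thesis
    using pderiv3_eq[OF has_derivative_mult[OF *]] *[THEN pderiv3_eq] by simp
qed

lemma bumps_differentiable:
  assumes "f \<in> bumps"
  shows "(\<forall>x. f differentiable (at x)) \<and> (\<forall>i. pderiv3 i f \<in> bumps)"
  using assms
proof induction
  case (bumps_atom n a i b)
  have d: "((\<lambda>x::real^3. flat_exp n (a * x $ i + b)) has_derivative
      (\<lambda>h. (flat_exp (n + 2) (a * x $ i + b) - n * flat_exp (n + 1) (a * x $ i + b)) * (a * h $ i))) (at x)"
    for x
  proof -
    have "((\<lambda>x::real^3. a * x $ i + b) has_derivative (\<lambda>h. a * h $ i)) (at x)"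
      by (auto intro!: derivative_eq_intros bounded_linear.has_derivative[OF bounded_linear_vec_nth])
    from has_derivative_compose[OF this flat_exp_deriv[unfolded has_field_derivative_def]]
    show ?thesis .
  qed
  have "pderiv3 j (\<lambda>x. flat_exp n (a * x $ i + b)) =
      (\<lambda>x. (flat_exp (n + 2) (a * x $ i + b) + (- real n) * flat_exp (n + 1) (a * x $ i + b)) * (a * axis j 1 $ i))"
    for j by (rule ext) (simp add: pderiv3_eq[OF d])
  moreover have "(\<lambda>x::real^3. (flat_exp (n + 2) (a * x $ i + b) + (- real n) * flat_exp (n + 1) (a * x $ i + b)) * (a * axis j 1 $ i)) \<in> bumps"
    for j :: 3
    by (intro bumps.intros(2-4) bumps.intros(1))
  ultimately have "pderiv3 j (\<lambda>x. flat_exp n (a * x $ i + b)) \<in> bumps" for j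
    by simp
  with d show ?case by (auto simp: differentiable_def)
next
  case (bumps_const c)
  have "pderiv3 j (\<lambda>x. c) = (\<lambda>x. 0)" for j
    by (rule ext) (simp add: pderiv3_eq[OF has_derivative_const])
  then show ?case by (auto intro: bumps.intros)
next
  case (bumps_add f g)
  then have "pderiv3 j (\<lambda>x. f x + g x) = (\<lambda>x. pderiv3 j f x + pderiv3 j g x)" for j
    by (intro ext pderiv3_add) auto
  with bumps_add show ?case by (auto intro: bumps.intros)
next
  case (bumps_mult f g)
  then have "pderiv3 j (\<lambda>x. f x * g x) = (\<lambda>x. f x * pderiv3 j g x + pderiv3 j f x * g x)" for j
    by (intro ext pderiv3_mult) auto
  with bumps_mult show ?case by (auto intro!: bumps.intros)
qed

lemma bumps_smooth: "f \<in> bumps \<Longrightarrow> smooth f"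
  by (coinduction arbitrary: f rule: smooth.coinduct) (use bumps_differentiable in blast)

lemma bumps_prod: "(\<And>i. i \<in> I \<Longrightarrow> f i \<in> bumps) \<Longrightarrow> (\<lambda>x. \<Prod>i\<in>I. f i x) \<in> bumps"
  by (induction I rule: infinite_finite_induct) (auto intro: bumps.intros)

text \<open>A smooth function with values in [0, 1] that vanishes off the box and tends pointwise to
  its indicator as k grows; it replaces mollification by convolution.\<close>

definition box_bump :: "nat \<Rightarrow> real^3 \<Rightarrow> real^3 \<Rightarrow> real^3 \<Rightarrow> real" where
  "box_bump k a b x =
     (\<Prod>i\<in>UNIV. flat_exp 0 (real k * (x $ i - a $ i)) * flat_exp 0 (real k * (b $ i - x $ i)))"

lemma box_bump_bumps: "box_bump k a b \<in> bumps"
proof -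
  have eq: "box_bump k a b = (\<lambda>x. \<Prod>i\<in>UNIV. flat_exp 0 (real k * x $ i + (- real k * a $ i)) *
      flat_exp 0 ((- real k) * x $ i + real k * b $ i))"
    by (simp add: box_bump_def fun_eq_iff algebra_simps)
  show ?thesis unfolding eq by (intro bumps_prod bumps_mult bumps_atom)
qed

lemma box_bump_range: "0 \<le> box_bump k a b x" "box_bump k a b x \<le> 1"
  unfolding box_bump_def
  by (intro prod_nonneg prod_le_1 ballI conjI mult_nonneg_nonneg mult_le_one flat_exp_nonneg flat_exp_le_1)+

lemma box_bump_tendsto: "(\<lambda>k. box_bump k a b x) \<longlonglongrightarrow> indicator (box a b) x"
proof -
  have "(\<lambda>k. box_bump k a b x) \<longlonglongrightarrow>
      (\<Prod>i\<in>UNIV. (if x $ i - a $ i > 0 then 1 else 0) * (if b $ i - x $ i > 0 then 1 else 0))"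
    unfolding box_bump_def by (intro tendsto_prod tendsto_mult flat_exp_scaled_tendsto)
  also have "(\<Prod>i\<in>UNIV. (if x $ i - a $ i > 0 then 1 else 0) * (if b $ i - x $ i > 0 then 1 else (0::real)))
      = indicator (box a b) x"
    by (auto simp: indicator_def mem_box_cart prod_zero_iff split: if_splits)
  finally show ?thesis .
qed

lemma box_bump_outside: "x \<notin> box a b \<Longrightarrow> box_bump k a b x = 0"
proof -
  assume "x \<notin> box a b"
  then obtain i where "x $ i - a $ i \<le> 0 \<or> b $ i - x $ i \<le> 0"
    by (auto simp: mem_box_cart not_less)
  then have "flat_exp 0 (real k * (x $ i - a $ i)) * flat_exp 0 (real k * (b $ i - x $ i)) = 0"
    by (auto simp: flat_exp_def mult_nonneg_nonpos)
  then show ?thesis unfolding box_bump_def by (intro prod_zero) auto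
qed

section \<open>Test fields\<close>

lemma smoothD:
  assumes "smooth f" shows "f differentiable (at x)" "smooth (pderiv3 i f)"
  using assms by (auto elim: smooth.cases)

lemma smooth_continuous: "smooth f \<Longrightarrow> continuous_on UNIV f"
  by (meson continuous_at_imp_continuous_on differentiable_imp_continuous_within smoothD(1))

lemma box_bump_test_field:
  defines "\<phi> \<equiv> \<lambda>k a b i x. box_bump k a b x *\<^sub>R axis i 1"
  shows "\<phi> k a b i \<in> test_fields" "fsupport (\<phi> k a b i) \<subseteq> closure (box a b)"
proof -
  have sub: "{x. \<phi> k a b i x \<noteq> 0} \<subseteq> box a b"
    using box_bump_outside by (auto simp: \<phi>_def)
  then show s: "fsupport (\<phi> k a b i) \<subseteq> closure (box a b)"
    unfolding fsupport_def by (rule closure_mono)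
  have "compact (fsupport (\<phi> k a b i))"
    unfolding fsupport_def compact_closure using bounded_subset[OF bounded_box sub] .
  moreover have "smooth (\<lambda>x. \<phi> k a b i x $ j)" for j
  proof (cases "i = j")
    case True
    then show ?thesis using bumps_smooth[OF box_bump_bumps] by (simp add: \<phi>_def axis_def)
  next
    case False
    then show ?thesis using bumps_smooth[OF bumps_const[of 0]] by (simp add: \<phi>_def axis_def)
  qed
  ultimately show "\<phi> k a b i \<in> test_fields" by (simp add: test_fields_def)
qed

lemma test_field_continuous:
  assumes "\<phi> \<in> test_fields"
  shows "continuous_on UNIV \<phi>" "continuous_on UNIV (classical_curl \<phi>)"
proof -
  have sm: "smooth (\<lambda>x. \<phi> x $ i)" for i using assms by (simp add: test_fields_def)
  have "continuous_on UNIV (\<lambda>x. \<chi> i. \<phi> x $ i)"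
    by (intro continuous_on_vec_lambda smooth_continuous sm)
  then show "continuous_on UNIV \<phi>" by simp
  have c: "continuous_on UNIV (pderiv3 j (\<lambda>x. \<phi> x $ i))" for i j
    by (rule smooth_continuous[OF smoothD(2)[OF sm]])
  have "continuous_on UNIV (\<lambda>x. classical_curl \<phi> x $ i)" for i
    using exhaust_3[of i] by (auto simp: classical_curl_def vector_3 intro!: continuous_on_diff c)
  then have "continuous_on UNIV (\<lambda>x. \<chi> i. classical_curl \<phi> x $ i)"
    by (intro continuous_on_vec_lambda)
  then show "continuous_on UNIV (classical_curl \<phi>)" by simp
qed

lemma pderiv3_zero_off_support:
  assumes "x \<notin> closure {x. f x \<noteq> 0}" shows "pderiv3 i f x = 0"
proof -
  have "((\<lambda>_. 0) has_derivative (\<lambda>_. 0)) (at x)" by simp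
  then have "(f has_derivative (\<lambda>_. 0)) (at x)"
    by (rule has_derivative_transform_within_open[of _ _ _ _ "- closure {x. f x \<noteq> 0}"])
      (use assms closure_subset[of "{x. f x \<noteq> 0}"] in auto)
  then show ?thesis by (simp add: pderiv3_eq)
qed

lemma component_support: "closure {x. \<phi> x $ i \<noteq> 0} \<subseteq> fsupport \<phi>"
  unfolding fsupport_def by (intro closure_mono) auto

lemma off_fsupport:
  assumes "x \<notin> fsupport \<phi>" shows "\<phi> x = 0" "classical_curl \<phi> x = 0"
proof -
  show "\<phi> x = 0" using assms closure_subset[of "{x. \<phi> x \<noteq> 0}"] by (auto simp: fsupport_def)
  have "pderiv3 j (\<lambda>x. \<phi> x $ i) x = 0" for i j
    using assms component_support[of \<phi> i] by (intro pderiv3_zero_off_support) auto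
  then show "classical_curl \<phi> x = 0" by (simp add: classical_curl_def vec_eq_iff forall_3)
qed

section \<open>Integration by parts\<close>

lemma integral_translate_lborel:
  fixes F :: "real^3 \<Rightarrow> real"
  assumes "F \<in> borel_measurable borel"
  shows "(LINT x|lborel. F (c + x)) = (LINT x|lborel. F x)"
proof -
  have "(LINT x|lborel. F x) = (LINT x|distr lborel borel ((+) c). F x)"
    by (simp add: lborel_distr_plus)
  also have "\<dots> = (LINT x|lborel. F (c + x))"
    using assms by (intro integral_distr) auto
  finally show ?thesis ..
qed

lemma integrable_compact_support:
  fixes f :: "real^3 \<Rightarrow> real"
  assumes "continuous_on UNIV f" "compact K" "\<And>x. x \<notin> K \<Longrightarrow> f x = 0"
  shows "integrable lborel f"
proof -
  have "integrable lborel (\<lambda>x. indicator K x *\<^sub>R f x)"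
    by (rule borel_integrable_compact[OF assms(2) continuous_on_subset[OF assms(1)]]) simp
  moreover have "indicator K x *\<^sub>R f x = f x" for x using assms(3)[of x] by (cases "x \<in> K") auto
  ultimately show ?thesis by (simp only:)
qed

text \<open>Translation invariance of Lebesgue measure makes the integral of every difference
  quotient vanish, and dominated convergence passes to the derivative. No iterated integration is
  involved.\<close>

lemma integral_pderiv3_zero:
  assumes diff: "\<And>x. f differentiable (at x)" and cont: "continuous_on UNIV (pderiv3 i f)"
    and comp: "compact (closure {x. f x \<noteq> 0})"
  shows "(LINT x|lborel. pderiv3 i f x) = 0"
proof -
  define K where "K = closure {x. f x \<noteq> 0}"
  define e :: "real^3" where "e = axis i 1"
  have e: "norm e = 1" by (simp add: e_def norm_eq_1 inner_axis_axis)
  have fK: "f x = 0" "pderiv3 i f x = 0" if "x \<notin> K" for x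
    using that closure_subset[of "{x. f x \<noteq> 0}"] pderiv3_zero_off_support[of x f]
    by (auto simp: K_def)
  have fc: "continuous_on UNIV f"
    using diff by (meson continuous_at_imp_continuous_on differentiable_imp_continuous_within)
  have "compact (pderiv3 i f ` K)"
    using comp cont by (intro compact_continuous_image) (auto simp: K_def intro: continuous_on_subset)
  then obtain B0 where B0: "\<And>x. x \<in> K \<Longrightarrow> \<bar>pderiv3 i f x\<bar> \<le> B0"
    by (fastforce dest!: compact_imp_bounded simp: bounded_iff)
  define B where "B = max B0 0"
  have B: "\<bar>pderiv3 i f x\<bar> \<le> B" for x
    using B0[of x] fK(2)[of x] by (cases "x \<in> K") (auto simp: B_def)
  obtain R where R: "R > 0" "K \<subseteq> cball 0 R"
    using comp[folded K_def] by (metis ball_subset_cball bounded_subset_ballD compact_imp_bounded order_trans)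
  have line: "((\<lambda>t. f (x + t *\<^sub>R e)) has_real_derivative pderiv3 i f (x + t *\<^sub>R e)) (at t)" for x t
  proof -
    obtain f' where f': "(f has_derivative f') (at (x + t *\<^sub>R e))"
      using diff by (auto simp: differentiable_def)
    have "((\<lambda>t. x + t *\<^sub>R e) has_derivative (\<lambda>h. h *\<^sub>R e)) (at t)"
      by (auto intro!: derivative_eq_intros)
    from has_derivative_compose[OF this f']
    have "((\<lambda>t. f (x + t *\<^sub>R e)) has_derivative (\<lambda>h. f' (h *\<^sub>R e))) (at t)" .
    moreover have "f' (h *\<^sub>R e) = pderiv3 i f (x + t *\<^sub>R e) * h" for h
      using linear_scale[OF has_derivative_linear[OF f']] pderiv3_eq[OF f', of i]
      by (simp add: e_def mult.commute)
    ultimately show ?thesis by (simp add: has_field_derivative_def)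
  qed
  define h where "h n = 1 / real (Suc n)" for n
  have h: "0 < h n" "h n \<le> 1" for n by (auto simp: h_def)
  have h0: "h \<longlonglongrightarrow> 0" unfolding h_def by (rule LIMSEQ_Suc[OF lim_1_over_n])
  define q where "q n x = (f (x + h n *\<^sub>R e) - f x) / h n" for n x
  \<comment> \<open>The mean value theorem on the segment in direction \<open>e\<close> supplies the
    uniform bound for dominated convergence.\<close>
  have lip: "\<bar>q n x\<bar> \<le> B" for n x
  proof -
    obtain z where "f (x + h n *\<^sub>R e) - f (x + 0 *\<^sub>R e) = (h n - 0) * pderiv3 i f (x + z *\<^sub>R e)"
      using MVT2[of 0 "h n" "\<lambda>t. f (x + t *\<^sub>R e)" "\<lambda>t. pderiv3 i f (x + t *\<^sub>R e)"] h(1)[of n] line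
      by blast
    then have "q n x = pderiv3 i f (x + z *\<^sub>R e)" using h(1)[of n] by (simp add: q_def)
    then show ?thesis using B by simp
  qed
  \<comment> \<open>The increments are at most 1, so outside this larger ball neither x nor its
    translate meets the support.\<close>
  have q0: "q n x = 0" if "x \<notin> cball 0 (R + 1)" for n x
  proof -
    have x: "norm x > R + 1" using that by simp
    have "norm x \<le> norm (x + h n *\<^sub>R e) + norm (h n *\<^sub>R e)"
      using norm_triangle_ineq4[of "x + h n *\<^sub>R e" "h n *\<^sub>R e"] by simp
    then have "norm (x + h n *\<^sub>R e) > R" using x e h[of n] by simp
    then have "x \<notin> K" "x + h n *\<^sub>R e \<notin> K" using x R by auto
    then show ?thesis by (simp add: q_def fK)
  qed
  have fm [measurable]: "f \<in> borel_measurable borel" by (rule borel_measurable_continuous_onI[OF fc])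
  have int_f: "integrable lborel f"
    by (rule integrable_compact_support[OF fc comp fK(1)[unfolded K_def]])
  have int_q: "(LINT x|lborel. q n x) = 0" for n
  proof -
    have "continuous_on UNIV (\<lambda>x. f (h n *\<^sub>R e + x))"
      by (rule continuous_on_compose2[OF fc]) (auto intro!: continuous_intros)
    then have "integrable lborel (\<lambda>x. f (h n *\<^sub>R e + x))"
    proof (rule integrable_compact_support)
      show "compact (cball 0 (R + 1) :: (real^3) set)" by simp
      show "f (h n *\<^sub>R e + x) = 0" if "x \<notin> cball 0 (R + 1)" for x
      proof -
        have x: "norm x > R + 1" using that by simp
        have "norm x \<le> norm (x + h n *\<^sub>R e) + norm (h n *\<^sub>R e)"
          using norm_triangle_ineq4[of "x + h n *\<^sub>R e" "h n *\<^sub>R e"] by simp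
        then have "norm (x + h n *\<^sub>R e) > R" using x e h[of n] by simp
        then have "h n *\<^sub>R e + x \<notin> K" using R by (auto simp: add.commute)
        then show ?thesis by (rule fK(1))
      qed
    qed
    then show ?thesis
      using int_f integral_translate_lborel[OF fm, of "h n *\<^sub>R e"]
      by (simp add: q_def add.commute)
  qed
  have "(\<lambda>n. LINT x|lborel. q n x) \<longlonglongrightarrow> (LINT x|lborel. pderiv3 i f x)"
  proof (rule integral_dominated_convergence)
    show "pderiv3 i f \<in> borel_measurable lborel"
      using borel_measurable_continuous_onI[OF cont] by simp
    show "q n \<in> borel_measurable lborel" for n unfolding q_def by measurable
    show "integrable lborel (\<lambda>x::real^3. B * indicator (cball 0 (R + 1)) x)"
      using emeasure_lborel_cball_finite[of "0::real^3" "R + 1"]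
      by (intro integrable_mult_right integrable_real_indicator) auto
    show "AE x in lborel. (\<lambda>n. q n x) \<longlonglongrightarrow> pderiv3 i f x"
    proof (rule AE_I2)
      fix x
      have "(\<lambda>t. (f (x + (0 + t) *\<^sub>R e) - f (x + 0 *\<^sub>R e)) / t) \<midarrow>0\<rightarrow> pderiv3 i f (x + 0 *\<^sub>R e)"
        using line[of x 0] unfolding DERIV_def .
      moreover have "filterlim h (at 0) sequentially"
        unfolding filterlim_at using h(1)
        by (auto intro!: h0 always_eventually less_imp_neq[symmetric])
      ultimately have "(\<lambda>n. (f (x + (0 + h n) *\<^sub>R e) - f (x + 0 *\<^sub>R e)) / h n) \<longlonglongrightarrow> pderiv3 i f (x + 0 *\<^sub>R e)"
        by (rule filterlim_compose)
      then show "(\<lambda>n. q n x) \<longlonglongrightarrow> pderiv3 i f x" by (simp add: q_def)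
    qed
    show "AE x in lborel. norm (q n x) \<le> B * indicator (cball 0 (R + 1)) x" for n
    proof (rule AE_I2)
      fix x
      show "norm (q n x) \<le> B * indicator (cball 0 (R + 1)) x"
        using lip[of n x] q0[of x n] by (cases "x \<in> cball 0 (R + 1)") auto
    qed
  qed
  then show ?thesis by (simp add: int_q LIMSEQ_const_iff)
qed

text \<open>The integrand of the difference is the divergence of \<open>\<phi> \<times> \<zeta>\<close>.\<close>

lemma curl_by_parts:
  assumes \<phi>: "\<phi> \<in> test_fields" and \<zeta>: "\<zeta> \<in> test_fields"
  shows "(LINT x|lborel. classical_curl \<phi> x \<bullet> \<zeta> x) = (LINT x|lborel. \<phi> x \<bullet> classical_curl \<zeta> x)"
proof -
  have sm: "smooth (\<lambda>x. \<phi> x $ i)" "smooth (\<lambda>x. \<zeta> x $ i)" for i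
    using assms by (auto simp: test_fields_def)
  \<comment> \<open>\<open>w 2 3\<close>, \<open>w 3 1\<close> and \<open>w 1 2\<close> are the
    components of \<phi> \<times> \<zeta>.\<close>
  define w where "w j k x = \<phi> x $ j * \<zeta> x $ k - \<phi> x $ k * \<zeta> x $ j" for j k x
  have dm: "(\<lambda>x. \<phi> x $ j * \<zeta> x $ k) differentiable (at x)" for j k x
    by (intro differentiable_mult smoothD sm)
  have pd: "pderiv3 i (w j k) x =
      (\<phi> x $ j * pderiv3 i (\<lambda>x. \<zeta> x $ k) x + pderiv3 i (\<lambda>x. \<phi> x $ j) x * \<zeta> x $ k) -
      (\<phi> x $ k * pderiv3 i (\<lambda>x. \<zeta> x $ j) x + pderiv3 i (\<lambda>x. \<phi> x $ k) x * \<zeta> x $ j)" for i j k x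
    unfolding w_def by (simp add: pderiv3_diff pderiv3_mult dm smoothD sm)
  have sup: "closure {x. w j k x \<noteq> 0} \<subseteq> fsupport \<phi>" for j k
    unfolding fsupport_def by (intro closure_mono) (auto simp: w_def)
  have comp: "compact (closure {x. w j k x \<noteq> 0})" for j k
    using \<phi> compact_Int_closed[of "fsupport \<phi>" "closure {x. w j k x \<noteq> 0}"] sup[of j k]
    by (simp add: test_fields_def Int_absorb1)
  have cont: "continuous_on UNIV (pderiv3 i (w j k))" for i j k
    unfolding pd[abs_def] by (intro continuous_intros smooth_continuous smoothD sm)
  have dw: "w j k differentiable (at x)" for j k x
    unfolding w_def by (intro differentiable_diff dm)
  have int0: "(LINT x|lborel. pderiv3 i (w j k) x) = 0" for i j k
    by (rule integral_pderiv3_zero[OF dw cont comp])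
  have int: "integrable lborel (pderiv3 i (w j k))" for i j k
    using comp by (rule integrable_compact_support[OF cont]) (rule pderiv3_zero_off_support)
  have "integrable lborel (\<lambda>x. classical_curl \<phi> x \<bullet> \<zeta> x)" "integrable lborel (\<lambda>x. \<phi> x \<bullet> classical_curl \<zeta> x)"
    using \<phi> by (intro integrable_compact_support[of _ "fsupport \<phi>"] continuous_on_inner test_field_continuous assms;
       simp add: off_fsupport test_fields_def)+
  then have "(LINT x|lborel. classical_curl \<phi> x \<bullet> \<zeta> x) - (LINT x|lborel. \<phi> x \<bullet> classical_curl \<zeta> x) =
      (LINT x|lborel. classical_curl \<phi> x \<bullet> \<zeta> x - \<phi> x \<bullet> classical_curl \<zeta> x)"
    by simp
  also have "\<dots> = (LINT x|lborel. pderiv3 1 (w 2 3) x + pderiv3 2 (w 3 1) x + pderiv3 3 (w 1 2) x)"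
    by (intro Bochner_Integration.integral_cong refl)
      (simp add: pd classical_curl_def inner_vec_def sum_3 algebra_simps)
  also have "\<dots> = 0" using int int0 by simp
  finally show ?thesis by simp
qed

section \<open>The fundamental lemma of the calculus of variations\<close>

text \<open>The set where u is positive is only M-measurable. It is exchanged for a member of
  \<open>G\<close> equal to it up to a null set, where the integral is known to be zero; a
  nonnegative function with zero integral vanishes almost everywhere. The sign s treats u and -u
  together.\<close>

lemma AE_zero_of_borel_integrals:
  fixes u :: "'a \<Rightarrow> real"
  assumes int: "integrable M u"
    and sets: "\<And>A. A \<in> sets M \<Longrightarrow> \<exists>B\<in>G. AE x in M. x \<in> A \<longleftrightarrow> x \<in> B"
    and meas: "\<And>B. B \<in> G \<Longrightarrow> (\<lambda>x. indicator B x * u x) \<in> borel_measurable M"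
    and zero: "\<And>B. B \<in> G \<Longrightarrow> (LINT x|M. indicator B x * u x) = 0"
  shows "AE x in M. u x = 0"
proof -
  have pos: "AE x in M. \<not> s * u x > 0" if s: "s = 1 \<or> s = -1" for s :: real
  proof -
    define A where "A = {x \<in> space M. s * u x > 0}"
    have um [measurable]: "u \<in> borel_measurable M" using int by simp
    have A [measurable]: "A \<in> sets M" unfolding A_def by measurable
    obtain B where B: "B \<in> G" "AE x in M. x \<in> A \<longleftrightarrow> x \<in> B" using sets[OF A] by auto
    have "(LINT x|M. indicator A x * (s * u x)) = s * (LINT x|M. indicator A x * u x)"
      by (subst Bochner_Integration.integral_mult_right_zero[symmetric]) (simp add: mult_ac)
    also have "(LINT x|M. indicator A x * u x) = (LINT x|M. indicator B x * u x)"
      using B(2) meas[OF B(1)] by (intro integral_cong_AE) (auto simp: indicator_def)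
    finally have "(LINT x|M. indicator A x * (s * u x)) = 0" using zero[OF B(1)] by simp
    moreover have "integrable M (\<lambda>x. indicator A x * (s * u x))"
      using integrable_mult_indicator[OF A integrable_mult_right[OF int, of s]] by simp
    moreover have "AE x in M. 0 \<le> indicator A x * (s * u x)"
      by (intro always_eventually) (auto simp: A_def indicator_def)
    ultimately have "AE x in M. indicator A x * (s * u x) = 0"
      using integral_nonneg_eq_0_iff_AE by blast
    with AE_space show ?thesis by eventually_elim (auto simp: A_def indicator_def split: if_splits)
  qed
  show ?thesis using pos[of 1, simplified] pos[of "-1", simplified] by eventually_elim simp
qed

text \<open>The last condition is what completions of Borel measures satisfy.\<close>

definition tame :: "(real^3) measure \<Rightarrow> bool" where
  "tame M \<longleftrightarrow> (\<lambda>x. x) \<in> measurable M borel \<and>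
     (\<forall>K. compact K \<longrightarrow> emeasure M (K \<inter> space M) < \<infinity>) \<and>
     (\<forall>A\<in>sets M. \<exists>B\<in>sets borel. AE x in M. x \<in> A \<longleftrightarrow> x \<in> B)"

lemma tame_measurable:
  assumes "tame M" "f \<in> borel_measurable borel" shows "f \<in> borel_measurable M"
proof -
  have "(\<lambda>x. x) \<in> measurable M borel" using assms(1) by (simp add: tame_def)
  from measurable_compose[OF this assms(2)] show ?thesis .
qed

lemma tame_sets:
  assumes "tame M" "B \<in> sets borel" shows "B \<inter> space M \<in> sets M"
  using measurable_sets[of "\<lambda>x. x" M borel B] assms by (simp add: tame_def vimage_def Int_def conj_commute)

lemma tame_box_finite:
  assumes "tame M" shows "emeasure M (box a b \<inter> space M) < \<infinity>"
proof -
  have "emeasure M (box a b \<inter> space M) \<le> emeasure M (cbox a b \<inter> space M)"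
    using box_subset_cbox[of a b] by (intro emeasure_mono tame_sets[OF assms]) auto
  also have "\<dots> < \<infinity>" using assms by (auto simp: tame_def)
  finally show ?thesis .
qed

text \<open>Since t \<le> 1 + t^2, square integrability implies integrability on sets of finite
  measure.\<close>

lemma integrable_mult_finite_set:
  fixes f :: "'a \<Rightarrow> complex^3"
  assumes sq: "sq_integrable M f" and B: "B \<inter> space M \<in> sets M" and fin: "emeasure M (B \<inter> space M) < \<infinity>"
  shows "integrable M (\<lambda>x. indicator B x *\<^sub>R f x)"
proof -
  have [measurable]: "f \<in> borel_measurable M" using sq by (simp add: sq_integrable_def)
  have "integrable M (\<lambda>x. indicator (B \<inter> space M) x *\<^sub>R f x)"
  proof (rule Bochner_Integration.integrable_bound)
    show "integrable M (\<lambda>x. indicator (B \<inter> space M) x + (norm (f x))\<^sup>2)"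
      using sq B fin by (auto simp: sq_integrable_def)
    show "(\<lambda>x. indicator (B \<inter> space M) x *\<^sub>R f x) \<in> borel_measurable M" using B by measurable
    have "t \<le> 1 + t\<^sup>2" for t :: real using sum_squares_bound[of 1 t] by (simp, sos)
    then show "AE x in M. norm (indicator (B \<inter> space M) x *\<^sub>R f x) \<le> norm (indicator (B \<inter> space M) x + (norm (f x))\<^sup>2)"
      by (intro always_eventually) (auto simp: indicator_def)
  qed
  moreover have "integrable M (\<lambda>x. indicat_real (B \<inter> space M) x *\<^sub>R f x) = integrable M (\<lambda>x. indicat_real B x *\<^sub>R f x)"
    by (intro Bochner_Integration.integrable_cong) (auto simp: indicator_def)
  ultimately show ?thesis by (simp only:)
qed

text \<open>A bump times a unit vector is an admissible test field that picks out one component. The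
  bumps converge to the indicator of the box and are dominated by it.\<close>

lemma fundamental_lemma_box:
  fixes f :: "real^3 \<Rightarrow> complex^3"
  assumes M: "tame M" and sq: "sq_integrable M f" and ab: "cbox a b \<subseteq> W"
    and zero: "\<And>\<phi>. \<phi> \<in> test_fields \<Longrightarrow> fsupport \<phi> \<subseteq> W \<Longrightarrow> (LINT x|M. bdot (f x) (\<phi> x)) = 0"
  shows "(LINT x|M. indicator (box a b) x *\<^sub>R f x) = 0"
proof -
  have [measurable]: "f \<in> borel_measurable M" using sq by (simp add: sq_integrable_def)
  have box [measurable]: "indicat_real (box a b) \<in> borel_measurable M"
    by (rule tame_measurable[OF M]) simp
  have int: "integrable M (\<lambda>x. indicator (box a b) x *\<^sub>R f x)"
    by (rule integrable_mult_finite_set[OF sq tame_sets[OF M] tame_box_finite[OF M]]) simp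
  have bm: "box_bump k a b \<in> borel_measurable M" for k
    by (rule tame_measurable[OF M borel_measurable_continuous_onI])
      (rule smooth_continuous[OF bumps_smooth[OF box_bump_bumps]])
  have fb: "integrable M (\<lambda>x. box_bump k a b x *\<^sub>R f x)" for k
  proof (rule Bochner_Integration.integrable_bound[OF int])
    show "(\<lambda>x. box_bump k a b x *\<^sub>R f x) \<in> borel_measurable M" using bm by measurable
    show "AE x in M. norm (box_bump k a b x *\<^sub>R f x) \<le> norm (indicator (box a b) x *\<^sub>R f x)"
      using box_bump_range[of k a b] box_bump_outside[of _ a b k]
      by (intro always_eventually allI) (auto simp: indicator_def intro: mult_left_le_one_le)
  qed
  have "(LINT x|M. box_bump k a b x *\<^sub>R f x) = 0" for k
  proof -
    have "(LINT x|M. box_bump k a b x *\<^sub>R f x) $ i = 0" for i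
    proof -
      have "(LINT x|M. box_bump k a b x *\<^sub>R f x) $ i = (LINT x|M. (box_bump k a b x *\<^sub>R f x) $ i)"
        by (rule integral_bounded_linear[OF bounded_linear_vec_nth fb, symmetric])
      also have "\<dots> = (LINT x|M. bdot (f x) (box_bump k a b x *\<^sub>R axis i 1))"
        by (intro Bochner_Integration.integral_cong)
          (simp_all add: bdot_def axis_def if_distrib scaleR_conv_of_real[where 'a = complex] sum.delta mult.commute cong: if_cong)
      also have "\<dots> = 0"
        using box_bump_test_field[where k=k and a=a and b=b and i=i] ab
          closure_minimal[OF box_subset_cbox[of a b] closed_cbox]
        by (intro zero) auto
      finally show ?thesis .
    qed
    then show ?thesis by (simp add: vec_eq_iff)
  qed
  moreover have "(\<lambda>k. LINT x|M. box_bump k a b x *\<^sub>R f x) \<longlonglongrightarrow> (LINT x|M. indicator (box a b) x *\<^sub>R f x)"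
  proof (rule integral_dominated_convergence)
    show "integrable M (\<lambda>x. norm (indicator (box a b) x *\<^sub>R f x))" using int by (rule integrable_norm)
    show "AE x in M. (\<lambda>k. box_bump k a b x *\<^sub>R f x) \<longlonglongrightarrow> indicator (box a b) x *\<^sub>R f x"
      by (intro AE_I2 tendsto_scaleR box_bump_tendsto tendsto_const)
    show "AE x in M. norm (box_bump k a b x *\<^sub>R f x) \<le> norm (indicator (box a b) x *\<^sub>R f x)" for k
      using box_bump_range[of k a b] box_bump_outside[of _ a b k]
      by (intro always_eventually allI) (auto simp: indicator_def intro: mult_left_le_one_le)
  qed (use fb int in auto)
  ultimately show ?thesis by (simp add: LIMSEQ_const_iff)
qed

text \<open>Open boxes generate the Borel sets and are stable under intersection, so Dynkin's lemma
  extends the vanishing of integrals from boxes to all Borel sets. The lemma serves two measures: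
  Lebesgue measure on the domain, for curls, and surface measure, for traces.\<close>

lemma fundamental_lemma:
  fixes f :: "real^3 \<Rightarrow> complex^3"
  assumes M: "tame M" and W: "open W" and AEW: "AE x in M. x \<in> W" and sq: "sq_integrable M f"
    and zero: "\<And>\<phi>. \<phi> \<in> test_fields \<Longrightarrow> fsupport \<phi> \<subseteq> W \<Longrightarrow> (LINT x|M. bdot (f x) (\<phi> x)) = 0"
  shows "AE x in M. f x = 0"
proof -
  have [measurable]: "f \<in> borel_measurable M" using sq by (simp add: sq_integrable_def)
  \<comment> \<open>Restriction to one box makes the field integrable, and the norm of
    \<open>?g\<close> dominates all limits formed below.\<close>
  have local: "AE x in M. x \<in> box a b \<longrightarrow> f x = 0" if ab: "cbox a b \<subseteq> W" for a b
  proof -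
    let ?g = "\<lambda>x. indicat_real (box a b) x *\<^sub>R f x"
    have int: "integrable M ?g"
      by (rule integrable_mult_finite_set[OF sq tame_sets[OF M] tame_box_finite[OF M]]) simp
    have intB: "integrable M (\<lambda>x. indicat_real B x *\<^sub>R ?g x)" if "B \<in> sets borel" for B
    proof -
      have "integrable M (\<lambda>x. indicat_real (B \<inter> space M) x *\<^sub>R ?g x)"
        by (rule integrable_mult_indicator[OF tame_sets[OF M that] int])
      moreover have "integrable M (\<lambda>x. indicat_real (B \<inter> space M) x *\<^sub>R ?g x) = integrable M (\<lambda>x. indicat_real B x *\<^sub>R ?g x)"
        by (intro Bochner_Integration.integrable_cong) (auto simp: indicator_def)
      ultimately show ?thesis by (simp only:)
    qed
    have borel: "(LINT x|M. indicat_real B x *\<^sub>R ?g x) = 0" if "B \<in> sets borel" for B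
    proof -
      have gen: "B \<in> sigma_sets UNIV (range (\<lambda>(a, b). box a b :: (real^3) set))"
        using that by (subst (asm) borel_eq_box) simp
      have set: "sigma_sets UNIV (range (\<lambda>(a, b). box a b :: (real^3) set)) = sets borel"
        by (subst borel_eq_box) simp
      have stable: "Int_stable (range (\<lambda>(a, b). box a b :: (real^3) set))"
        by (auto simp: Int_stable_def box_Int_box split: prod.splits)
      have sub: "range (\<lambda>(a, b). box a b :: (real^3) set) \<subseteq> Pow UNIV" by simp
      from stable sub gen show ?thesis
      proof (induction rule: sigma_sets_induct_disjoint)
        case (basic A)
        then obtain c d where A: "A = box c d" by (metis (no_types, lifting) case_prod_conv rangeE surj_pair)
        obtain c' d' where cd: "A \<inter> box a b = box c' d'" unfolding A using box_Int_box[of c d a b] by blast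
        \<comment> \<open>The case of an empty intersection is set apart because the closed box with
          the same corners may be nonempty and leave \<open>W\<close>.\<close>
        have "cbox c' d' \<subseteq> W \<or> box c' d' = {}"

        proof (cases "box c' d' = {}")
          case False
          have sub: "box c' d' \<subseteq> box a b" using cd by auto
          then have "box a b \<noteq> {}" using False by auto
          then have "cbox c' d' \<subseteq> cbox a b" using closure_mono[OF sub] False by (simp add: closure_box)
          then show ?thesis using ab by auto
        qed simp
        then have "(LINT x|M. indicat_real (box c' d') x *\<^sub>R f x) = 0"
          using fundamental_lemma_box[OF M sq _ zero] by (auto simp: indicator_def)
        moreover have "indicat_real A x *\<^sub>R ?g x = indicat_real (box c' d') x *\<^sub>R f x" for x
          by (simp add: cd[symmetric] indicator_inter_arith)
        ultimately show ?case by (simp only:)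
      next
        case empty
        then show ?case by simp
      next
        case A: (compl A)
        have "(LINT x|M. indicat_real (UNIV - A) x *\<^sub>R ?g x) = (LINT x|M. ?g x - indicat_real A x *\<^sub>R ?g x)"
          by (intro Bochner_Integration.integral_cong) (auto simp: indicator_def)
        also have "\<dots> = 0"
          using int intB[of A] A set fundamental_lemma_box[OF M sq ab zero] by simp
        finally show ?case .
      next
        case A: (union A)
        have As: "A i \<in> sets borel" for i using A(2) set by auto
        have "(\<lambda>n. LINT x|M. (\<Sum>i<n. indicat_real (A i) x *\<^sub>R ?g x)) \<longlonglongrightarrow> (LINT x|M. indicat_real (\<Union>i. A i) x *\<^sub>R ?g x)"
        proof (rule integral_dominated_convergence)
          show "(\<lambda>x. indicat_real (\<Union>i. A i) x *\<^sub>R ?g x) \<in> borel_measurable M"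
            using intB[of "\<Union>i. A i"] As by auto
          show "(\<lambda>x. \<Sum>i<n. indicat_real (A i) x *\<^sub>R ?g x) \<in> borel_measurable M" for n
            using intB[OF As] by (intro borel_measurable_sum) auto
          show "integrable M (\<lambda>x. norm (?g x))" using int by (rule integrable_norm)
          have sum: "(\<Sum>i<n. indicat_real (A i) x) = indicat_real (\<Union>i<n. A i) x" for n x
            using A(1) by (subst indicator_UN_disjoint) (auto simp: disjoint_family_on_def)
          have sumg: "(\<Sum>i<n. indicat_real (A i) x *\<^sub>R ?g x) = indicat_real (\<Union>i<n. A i) x *\<^sub>R ?g x" for n x
            unfolding sum[symmetric] by (rule scaleR_sum_left[symmetric])
          show "AE x in M. (\<lambda>n. \<Sum>i<n. indicat_real (A i) x *\<^sub>R ?g x) \<longlonglongrightarrow> indicat_real (\<Union>i. A i) x *\<^sub>R ?g x"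
            unfolding sumg
            by (intro AE_I2 tendsto_scaleR tendsto_const LIMSEQ_indicator_UN)
          show "AE x in M. norm (\<Sum>i<n. indicat_real (A i) x *\<^sub>R ?g x) \<le> norm (?g x)" for n
            unfolding sumg by (intro AE_I2) (auto simp: indicator_def)
        qed
        moreover have "(LINT x|M. (\<Sum>i<n. indicat_real (A i) x *\<^sub>R ?g x)) = 0" for n
          using intB[OF As] A(3) by (subst Bochner_Integration.integral_sum) auto
        ultimately show ?case
          by (simp add: LIMSEQ_const_iff)
      qed
    qed
    \<comment> \<open>Real functionals reduce the field to the scalar lemma; the coordinates along
      the real basis of the complex space cover real and imaginary parts.\<close>
    have comp: "AE x in M. L (?g x) = 0" if L: "bounded_linear (L :: complex^3 \<Rightarrow> real)" for L
    proof (rule AE_zero_of_borel_integrals[where G = "sets borel"])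
      show "integrable M (\<lambda>x. L (?g x))" by (rule integrable_bounded_linear[OF L int])
      show "\<exists>B\<in>sets borel. AE x in M. x \<in> A \<longleftrightarrow> x \<in> B" if "A \<in> sets M" for A
        using M that by (auto simp: tame_def)
      have eq: "indicat_real B x * L (?g x) = L (indicat_real B x *\<^sub>R ?g x)" for B x
        using linear_scale[OF bounded_linear.linear[OF L], of "indicat_real B x" "?g x"] by simp
      show "(\<lambda>x. indicat_real B x * L (?g x)) \<in> borel_measurable M" if "B \<in> sets borel" for B
        unfolding eq using integrable_bounded_linear[OF L intB[OF that]] by (rule borel_measurable_integrable)
      show "(LINT x|M. indicat_real B x * L (?g x)) = 0" if "B \<in> sets borel" for B
        unfolding eq using integral_bounded_linear[OF L intB[OF that]] borel[OF that]
          linear_0[OF bounded_linear.linear[OF L]] by simp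
    qed
    have "AE x in M. \<forall>b\<in>Basis. ?g x \<bullet> b = 0"
      by (subst AE_finite_all) (intro finite_Basis ballI comp bounded_linear_inner_left)+
    then show ?thesis
      by eventually_elim (simp only: euclidean_all_zero_iff, auto)
  qed
  \<comment> \<open>By Lindelof's theorem countably many boxes suffice, so the exceptional null sets
    can be united.\<close>
  have "\<exists>\<F>. \<Union>\<F> = W \<and> countable \<F> \<and> (\<forall>S\<in>\<F>. \<exists>a b. S = box a b \<and> cbox a b \<subseteq> W)"
  proof -
    define \<F> where "\<F> = {box a b | a b. cbox a b \<subseteq> W}"
    have op: "open S" if "S \<in> \<F>" for S using that by (auto simp: \<F>_def)
    obtain \<F>' where F: "\<F>' \<subseteq> \<F>" "countable \<F>'" "\<Union>\<F>' = \<Union>\<F>"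
      using Lindelof[OF op] .
    have "\<Union>\<F> = W"
    proof (intro equalityI subsetI)
      fix x assume "x \<in> \<Union>\<F>"
      then obtain a b where "x \<in> box a b" "cbox a b \<subseteq> W" unfolding \<F>_def by blast
      then show "x \<in> W" using box_subset_cbox by blast
    next
      fix x assume "x \<in> W"
      then obtain a b where "cbox a b \<subseteq> W" "x \<in> box a b"
        using open_contains_cbox[OF W] by metis
      then show "x \<in> \<Union>\<F>" unfolding \<F>_def by blast
    qed
    moreover have "\<forall>S\<in>\<F>'. \<exists>a b. S = box a b \<and> cbox a b \<subseteq> W" using F(1) unfolding \<F>_def by blast
    ultimately show ?thesis using F(2,3) by metis
  qed
  then obtain \<F> where F: "\<Union>\<F> = W" "countable \<F>" "\<forall>S\<in>\<F>. \<exists>a b. S = box a b \<and> cbox a b \<subseteq> W"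
    by blast
  have each: "AE x in M. x \<in> S \<longrightarrow> f x = 0" if S: "S \<in> \<F>" for S
  proof -
    obtain a b where ab: "S = box a b" "cbox a b \<subseteq> W" using F(3) S by metis
    show ?thesis unfolding ab(1) by (rule local[OF ab(2)])
  qed
  have "AE x in M. \<forall>S\<in>\<F>. x \<in> S \<longrightarrow> f x = 0"
    by (rule AE_ball_countable[OF F(2), THEN iffD2]) (rule ballI, rule each)
  with AEW show ?thesis
  proof eventually_elim
    case (elim x)
    then obtain S where "S \<in> \<F>" "x \<in> S" using F(1) by (metis UnionE)
    then show ?case using elim(2) by blast
  qed
qed

section \<open>Surface measure on Lipschitz boundaries\<close>

lemma sets_hausdorff2 [simp]: "sets hausdorff2 = sets borel"
  unfolding hausdorff2_def using sets.sigma_sets_eq[of "borel :: (real^3) measure"] by simp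

lemma space_hausdorff2 [simp]: "space hausdorff2 = UNIV"
  by (simp add: hausdorff2_def)

text \<open>An inequality suffices: it holds whether or not \<open>measure_of\<close> degenerates.\<close>

lemma hausdorff2_le: "emeasure hausdorff2 A \<le> (SUP d\<in>{0<..}. hausdorff2_pre d A)"
  unfolding hausdorff2_def emeasure_measure_of_conv by simp

lemma hausdorff2_pre_mono: "A \<subseteq> B \<Longrightarrow> hausdorff2_pre d A \<le> hausdorff2_pre d B"
  unfolding hausdorff2_pre_def by (intro INF_superset_mono) auto

text \<open>The image of the standard basis under an orthogonal map that sends the first axis to
  \<open>e\<close>; the last clause is the bound of the norm by the sum of the coordinates in this
  basis.\<close>

lemma orthonormal_frame:
  fixes e :: "real^3" assumes "norm e = 1"
  obtains u w where "norm u = 1" "norm w = 1" "u \<bullet> e = 0" "w \<bullet> e = 0"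
    "\<And>z. norm z \<le> \<bar>z \<bullet> e\<bar> + \<bar>z \<bullet> u\<bar> + \<bar>z \<bullet> w\<bar>"
proof -
  obtain f :: "real^3 \<Rightarrow> real^3" where f: "orthogonal_transformation f" "f (axis 1 1) = e"
    using orthogonal_transformation_exists_1[of "axis 1 1" e] assms by (auto simp: norm_eq_1 inner_axis_axis)
  have ip: "f x \<bullet> f y = x \<bullet> y" for x y using f(1) by (simp add: orthogonal_transformation_def)
  show ?thesis
  proof (rule that[of "f (axis 2 1)" "f (axis 3 1)"])
    fix z
    obtain y where y: "z = f y"
      using orthogonal_transformation_surj[OF f(1)] by (metis surjD)
    have "norm z = norm y" using ip[of y y] y by (simp add: norm_eq_sqrt_inner)
    also have "\<dots> \<le> (\<Sum>i\<in>UNIV. \<bar>y $ i\<bar>)" by (rule norm_le_l1_cart)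
    also have "\<dots> = \<bar>z \<bullet> e\<bar> + \<bar>z \<bullet> f (axis 2 1)\<bar> + \<bar>z \<bullet> f (axis 3 1)\<bar>"
      unfolding y f(2)[symmetric] ip by (simp add: sum_3 inner_axis)
    finally show "norm z \<le> \<bar>z \<bullet> e\<bar> + \<bar>z \<bullet> f (axis 2 1)\<bar> + \<bar>z \<bullet> f (axis 3 1)\<bar>" .
  qed (auto simp: norm_eq_1 ip inner_axis_axis f(2)[symmetric])
qed

text \<open>The tangential square of side 2r about p is divided into n^2 cells of side h = 2r/n.
  Over one cell the graph has diameter at most 2(1 + L)h, and n^2 pieces of this size give n^2
  (pi/4) (2(1 + L)h)^2 = 4 pi (r(1 + L))^2, a bound free of n and therefore of d.\<close>

lemma lipschitz_graph_pre_bound: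
  fixes e p :: "real^3" and \<gamma> :: "real^3 \<Rightarrow> real"
  assumes e: "norm e = 1" and r: "r > 0" and lip: "lipschitz_on L {y. y \<bullet> e = 0} \<gamma>" and d: "d > 0"
  shows "hausdorff2_pre d {x \<in> ball p r. x \<bullet> e = \<gamma> (x - (x \<bullet> e) *\<^sub>R e)} \<le> ennreal (4 * pi * (r * (1 + L))\<^sup>2)"
proof -
  define A where "A = {x \<in> ball p r. x \<bullet> e = \<gamma> (x - (x \<bullet> e) *\<^sub>R e)}"
  have L: "L \<ge> 0" using lip by (rule lipschitz_on_nonneg)
  obtain u w where uw: "norm u = 1" "norm w = 1" "u \<bullet> e = 0" "w \<bullet> e = 0"
    and nb: "\<And>z. norm z \<le> \<bar>z \<bullet> e\<bar> + \<bar>z \<bullet> u\<bar> + \<bar>z \<bullet> w\<bar>"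
    by (rule orthonormal_frame[OF e]) blast
  have ee: "e \<bullet> e = 1" using e by (simp add: norm_eq_1)
  \<comment> \<open>The tangential part of x - y is controlled by its two coordinates and the
    component along \<open>e\<close> by L times the tangential part, whence the factor 1 +
    L.\<close>
  have dist: "norm (x - y) \<le> (1 + L) * (\<bar>(x - y) \<bullet> u\<bar> + \<bar>(x - y) \<bullet> w\<bar>)" if "x \<in> A" "y \<in> A" for x y
  proof -
    let ?P = "\<lambda>x. x - (x \<bullet> e) *\<^sub>R e"
    have "\<bar>(x - y) \<bullet> e\<bar> = \<bar>\<gamma> (?P x) - \<gamma> (?P y)\<bar>"
      using that by (simp add: A_def inner_diff_left)
    also have "\<dots> \<le> L * norm (?P x - ?P y)"
      using lipschitz_onD[OF lip, of "?P x" "?P y"] by (simp add: dist_norm inner_diff_left ee)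
    finally have xe: "\<bar>(x - y) \<bullet> e\<bar> \<le> L * norm (?P x - ?P y)" .
    have "?P x - ?P y = ?P (x - y)"
      by (simp add: inner_diff_left scaleR_diff_left)
    moreover have "?P z \<bullet> e = 0" "?P z \<bullet> u = z \<bullet> u" "?P z \<bullet> w = z \<bullet> w" for z
      using uw ee by (simp_all add: inner_diff_left inner_commute[of e u] inner_commute[of e w])
    ultimately have "norm (?P x - ?P y) \<le> \<bar>(x - y) \<bullet> u\<bar> + \<bar>(x - y) \<bullet> w\<bar>"
      using nb[of "?P (x - y)"] by (simp only: abs_zero add_0)
    from mult_left_mono[OF this L] xe nb[of "x - y"] show ?thesis
      by (simp only: distrib_right mult_1 distrib_left)
  qed
  \<comment> \<open>Chosen so that the diameter bound 2(1 + L)h = 4r(1 + L)/n stays below d.\<close>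
  obtain n :: nat where n: "real n > 4 * r * (1 + L) / d" using reals_Archimedean2 by blast
  have "4 * r * (1 + L) / d \<ge> 0" using r L d by simp
  then have n0: "n > 0" using n by linarith
  define h where "h = 2 * r / n"
  have h: "h > 0" using n0 r by (simp add: h_def)
  have hd: "(1 + L) * (2 * h) \<le> d"
    using n n0 d by (simp add: h_def field_simps)
  \<comment> \<open>The cell number in direction v. The ball is open, so the shifted coordinate lies
    strictly between 0 and 2r and the number is below n.\<close>
  define c where "c v x = nat \<lfloor>(x \<bullet> v - p \<bullet> v + r) / h\<rfloor>" for v x
  have c_lt: "c v x < n" and c_eq: "real (c v x) = of_int \<lfloor>(x \<bullet> v - p \<bullet> v + r) / h\<rfloor>"
    if "x \<in> A" "norm v = 1" for v x
  proof -
    have "\<bar>x \<bullet> v - p \<bullet> v\<bar> \<le> norm (x - p)"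
      using Cauchy_Schwarz_ineq2[of "x - p" v] that by (simp add: inner_diff_left)
    also have "\<dots> < r" using that by (simp add: A_def dist_norm norm_minus_commute)
    finally have t: "0 < x \<bullet> v - p \<bullet> v + r" "x \<bullet> v - p \<bullet> v + r < 2 * r" by linarith+
    have "n * h = 2 * r" using n0 by (simp add: h_def)
    with t h have b: "0 \<le> (x \<bullet> v - p \<bullet> v + r) / h" "(x \<bullet> v - p \<bullet> v + r) / h < n"
      by (simp_all add: divide_less_eq)
    then show "real (c v x) = of_int \<lfloor>(x \<bullet> v - p \<bullet> v + r) / h\<rfloor>" by (simp add: c_def)
    show "c v x < n" using b unfolding c_def by linarith
  qed
  have close: "\<bar>(x - y) \<bullet> v\<bar> \<le> h" if "x \<in> A" "y \<in> A" "norm v = 1" "c v x = c v y" for x y v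
  proof -
    have "\<lfloor>(x \<bullet> v - p \<bullet> v + r) / h\<rfloor> = \<lfloor>(y \<bullet> v - p \<bullet> v + r) / h\<rfloor>"
      using c_eq[OF that(1,3)] c_eq[OF that(2,3)] that(4) by simp
    then have "\<bar>(x \<bullet> v - p \<bullet> v + r) / h - (y \<bullet> v - p \<bullet> v + r) / h\<bar> < 1"
      by linarith
    then show ?thesis using h by (simp add: diff_divide_distrib[symmetric] abs_divide inner_diff_left)
  qed
  \<comment> \<open>An index below n^2 encodes a pair of cell numbers as quotient and remainder; all
    later pieces are empty, so the series over the cover is a finite sum.\<close>
  define C where "C k = {x \<in> A. k < n * n \<and> c u x = k div n \<and> c w x = k mod n}" for k
  have diam: "diameter (C k) \<le> (1 + L) * (2 * h)" for k
  proof (rule diameter_le)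
    show "C k \<noteq> {} \<or> 0 \<le> (1 + L) * (2 * h)" using L h by simp
    fix x y assume xy: "x \<in> C k" "y \<in> C k"
    then have "norm (x - y) \<le> (1 + L) * (\<bar>(x - y) \<bullet> u\<bar> + \<bar>(x - y) \<bullet> w\<bar>)"
      by (intro dist) (auto simp: C_def)
    also have "\<dots> \<le> (1 + L) * (h + h)"
      using xy uw L by (intro mult_left_mono add_mono close) (auto simp: C_def)
    finally show "norm (x - y) \<le> (1 + L) * (2 * h)" by simp
  qed
  have bounded: "bounded (C k)" for k
    by (rule bounded_subset[OF bounded_ball[of p r]]) (auto simp: C_def A_def)
  have cover: "A \<subseteq> (\<Union>k. C k)"
  proof
    fix x assume x: "x \<in> A"
    have lt: "c u x < n" "c w x < n" using c_lt[OF x] uw by auto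
    have "c u x * n + c w x < Suc (c u x) * n" using lt(2) by simp
    also have "\<dots> \<le> n * n" using lt(1) by (intro mult_le_mono1) simp
    finally have "c u x * n + c w x < n * n" .
    then have "x \<in> C (c u x * n + c w x)" using x lt by (simp add: C_def)
    then show "x \<in> (\<Union>k. C k)" by blast
  qed
  have "hausdorff2_pre d A \<le> (\<Sum>k. ennreal (pi / 4 * (diameter (C k))\<^sup>2))"
    unfolding hausdorff2_pre_def
    by (intro INF_lower) (use cover bounded diam hd in \<open>auto intro: order_trans\<close>)
  also have "\<dots> = (\<Sum>k<n*n. ennreal (pi / 4 * (diameter (C k))\<^sup>2))"
    by (rule suminf_finite) (auto simp: C_def)
  also have "\<dots> \<le> (\<Sum>k<n*n. ennreal (pi / 4 * ((1 + L) * (2 * h))\<^sup>2))"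
    by (intro sum_mono ennreal_leI mult_left_mono power_mono diam diameter_ge_0 bounded) auto
  also have "\<dots> = ennreal (4 * pi * (r * (1 + L))\<^sup>2)"
  proof -
    have "real (n * n) * (pi / 4 * ((1 + L) * (2 * h))\<^sup>2) = 4 * pi * (r * (1 + L))\<^sup>2"
      using n0 by (simp add: h_def power2_eq_square field_simps)
    then show ?thesis
      by (subst sum_ennreal) (auto simp: mult.commute)
  qed
  finally show ?thesis unfolding A_def .
qed

text \<open>Inside the ball of a Lipschitz chart the frontier is contained in the graph: points
  below it belong to the open set S, points above it are away from S. The bound for graphs does not
  depend on d and passes to the supremum.\<close>

lemma lipschitz_boundary_locally_finite:
  assumes S: "open S" "lipschitz_boundary S"
  shows "\<exists>r>0. emeasure hausdorff2 (frontier S \<inter> ball p r) < \<infinity>"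
proof (cases "p \<in> frontier S")
  case False
  then obtain r where "r > 0" "ball p r \<subseteq> - frontier S"
    using open_contains_ball[of "- frontier S"] by (auto simp: open_Compl)
  then have "frontier S \<inter> ball p r = {}" by blast
  with \<open>r > 0\<close> show ?thesis by (intro exI[of _ r]) simp
next
  case True
  obtain e r L and \<gamma> :: "real^3 \<Rightarrow> real" where *: "norm e = 1" "r > 0" "lipschitz_on L {y. y \<bullet> e = 0} \<gamma>"
    "S \<inter> ball p r = {x \<in> ball p r. x \<bullet> e < \<gamma> (x - (x \<bullet> e) *\<^sub>R e)}"
    using bspec[OF S(2)[unfolded lipschitz_boundary_def] True] by (elim exE conjE)
  define P where "P x = x - (x \<bullet> e) *\<^sub>R e" for x :: "real^3"
  have ee: "e \<bullet> e = 1" using *(1) by (simp add: norm_eq_1)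
  have "continuous_on UNIV (\<lambda>x. \<gamma> (P x))"
    by (rule continuous_on_compose2[OF lipschitz_on_continuous_on[OF *(3)]])
      (auto simp: P_def inner_diff_left ee intro!: continuous_intros)
  then have op: "open {x. x \<bullet> e > \<gamma> (P x)}"
    by (intro open_Collect_less continuous_intros)
  have "frontier S \<inter> ball p r \<subseteq> {x \<in> ball p r. x \<bullet> e = \<gamma> (P x)}"
  proof
    fix x assume x: "x \<in> frontier S \<inter> ball p r"
    then have "x \<notin> S" "x \<in> closure S" using S(1) by (auto simp: frontier_def interior_open)
    then have "\<not> x \<bullet> e < \<gamma> (P x)" using *(4) x by (auto simp: P_def)
    \<comment> \<open>The part of the ball strictly above the graph is open and disjoint from S, so
      it misses the closure of S.\<close>
    moreover have "\<not> x \<bullet> e > \<gamma> (P x)"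
    proof
      assume "x \<bullet> e > \<gamma> (P x)"
      then have "x \<in> {x. x \<bullet> e > \<gamma> (P x)} \<inter> ball p r" using x by simp
      moreover have "open ({x. x \<bullet> e > \<gamma> (P x)} \<inter> ball p r)" using op by (intro open_Int) auto
      ultimately obtain y where "y \<in> S" "y \<in> {x. x \<bullet> e > \<gamma> (P x)} \<inter> ball p r"
        using \<open>x \<in> closure S\<close> by (meson closure_iff_nhds_not_empty disjoint_iff order_refl)
      then have "y \<in> S \<inter> ball p r" "\<gamma> (P y) < y \<bullet> e" by auto
      then show False unfolding *(4) P_def by auto
    qed
    ultimately show "x \<in> {x \<in> ball p r. x \<bullet> e = \<gamma> (P x)}" using x by auto
  qed
  then have "hausdorff2_pre d (frontier S \<inter> ball p r) \<le> ennreal (4 * pi * (r * (1 + L))\<^sup>2)" if "d > 0" for d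
    unfolding P_def by (rule order_trans[OF hausdorff2_pre_mono lipschitz_graph_pre_bound[OF *(1-3) that]])
  then have "(SUP d\<in>{0<..}. hausdorff2_pre d (frontier S \<inter> ball p r)) \<le> ennreal (4 * pi * (r * (1 + L))\<^sup>2)"
    by (intro SUP_least) simp
  with hausdorff2_le have "emeasure hausdorff2 (frontier S \<inter> ball p r) \<le> ennreal (4 * pi * (r * (1 + L))\<^sup>2)"
    by (rule order_trans)
  also have "\<dots> < \<infinity>" by simp
  finally show ?thesis using *(2) by blast
qed

lemma lipschitz_boundary_compact_finite:
  assumes S: "open S" "lipschitz_boundary S" and K: "compact K"
  shows "emeasure hausdorff2 (frontier S \<inter> K) < \<infinity>"
proof -
  obtain r where r: "\<And>p. r p > 0 \<and> emeasure hausdorff2 (frontier S \<inter> ball p (r p)) < \<infinity>"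
    using lipschitz_boundary_locally_finite[OF S] by metis
  obtain F where F: "F \<subseteq> K" "finite F" "K \<subseteq> (\<Union>p\<in>F. ball p (r p))"
  proof (rule compactE_image[OF K, of K "\<lambda>p. ball p (r p)"])
    show "K \<subseteq> (\<Union>p\<in>K. ball p (r p))"
    proof
      fix x assume "x \<in> K"
      then show "x \<in> (\<Union>p\<in>K. ball p (r p))" using r[of x] by (intro UN_I[of x]) auto
    qed
  qed auto
  have bor: "frontier S \<inter> ball p (r p) \<in> sets borel" for p by simp
  have "emeasure hausdorff2 (frontier S \<inter> K) \<le> emeasure hausdorff2 (\<Union>p\<in>F. frontier S \<inter> ball p (r p))"
    using F(2,3) by (intro emeasure_mono) (auto intro!: sets.finite_UN)
  also have "\<dots> \<le> (\<Sum>p\<in>F. emeasure hausdorff2 (frontier S \<inter> ball p (r p)))"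
    by (rule emeasure_subadditive_finite[OF F(2)]) (use bor in auto)
  also have "\<dots> < \<infinity>" using r F(2) by (simp add: less_top)
  finally show ?thesis .
qed

lemma sets_completion_mod_null:
  assumes "A \<in> sets (completion N)"
  shows "\<exists>B\<in>sets N. AE x in completion N. x \<in> A \<longleftrightarrow> x \<in> B"
proof (intro bexI)
  show "main_part N A \<in> sets N" by (rule main_part_sets[OF assms])
  have eq: "main_part N A \<union> null_part N A = A" by (rule main_part_null_part_Un[OF assms])
  have "AE x in completion N. x \<notin> null_part N A"
    by (intro AE_completion AE_notin_null_part assms)
  then show "AE x in completion N. x \<in> A \<longleftrightarrow> x \<in> main_part N A"
    by eventually_elim (use eq in auto)
qed

lemma space_surface [simp]: "space (surface G) = G"
  by (simp add: surface_def space_restrict_space)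

text \<open>The Lipschitz property of the boundary enters through the finiteness on compact sets;
  the other two requirements hold because \<open>surface\<close> is the completion of a restricted
  Borel measure.\<close>

lemma tame_surface:
  assumes S: "open S" "lipschitz_boundary S" and G: "G \<in> sets borel" "G \<subseteq> frontier S"
  shows "tame (surface G)"
  unfolding tame_def
proof (intro conjI allI impI ballI)
  show "(\<lambda>x. x) \<in> borel_measurable (surface G)"
    unfolding surface_def by (intro measurable_completion measurable_restrict_space1) (simp add: measurable_def)
next
  fix K :: "(real^3) set" assume K: "compact K"
  then have "K \<inter> G \<in> sets borel" using sets.Int[OF borel_compact[OF K] G(1)] by simp
  then have "emeasure (surface G) (K \<inter> G) = emeasure hausdorff2 (K \<inter> G)"
    unfolding surface_def using G(1)
    by (subst emeasure_completion) (auto simp: sets_restrict_space_iff emeasure_restrict_space)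
  also have "\<dots> \<le> emeasure hausdorff2 (frontier S \<inter> K)"
    using G borel_compact[OF K] by (intro emeasure_mono) auto
  also have "\<dots> < \<infinity>" by (rule lipschitz_boundary_compact_finite[OF S K])
  finally show "emeasure (surface G) (K \<inter> space (surface G)) < \<infinity>" by simp
next
  fix A assume "A \<in> sets (surface G)"
  then obtain B where B: "B \<in> sets (restrict_space hausdorff2 G)" "AE x in surface G. x \<in> A \<longleftrightarrow> x \<in> B"
    using sets_completion_mod_null unfolding surface_def by blast
  then have "B \<in> sets borel" using G(1) by (simp add: sets_restrict_space_iff)
  with B(2) show "\<exists>B\<in>sets borel. AE x in surface G. x \<in> A \<longleftrightarrow> x \<in> B" by blast
qed

lemma tame_lebesgue_on:
  assumes S: "open S" shows "tame (lebesgue_on S)"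
  unfolding tame_def
proof (intro conjI allI impI ballI)
  have Sl: "S \<in> sets lebesgue" using S by (simp add: borel_open)
  show "(\<lambda>x. x) \<in> borel_measurable (lebesgue_on S)"
    by (intro measurable_restrict_space1 measurable_completion) simp
  fix K :: "(real^3) set" assume K: "compact K"
  then have Kl: "K \<in> sets lebesgue" by (simp add: borel_compact)
  have "emeasure (lebesgue_on S) (K \<inter> S) = emeasure lebesgue (K \<inter> S)"
    using Sl by (intro emeasure_restrict_space) auto
  also have "\<dots> \<le> emeasure lebesgue K" using Kl by (intro emeasure_mono) auto
  also have "\<dots> < \<infinity>"
    using emeasure_compact_finite[OF K] K by (simp add: emeasure_completion borel_compact)
  finally show "emeasure (lebesgue_on S) (K \<inter> space (lebesgue_on S)) < \<infinity>"
    by (simp add: space_restrict_space)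
next
  have Sl: "S \<in> sets lebesgue" using S by (simp add: borel_open)
  fix A assume "A \<in> sets (lebesgue_on S)"
  then have "A \<in> sets lebesgue" using Sl by (simp add: sets_restrict_space_iff)
  from sets_completion_mod_null[OF this] obtain B where
    B: "B \<in> sets lborel" "AE x in lebesgue. x \<in> A \<longleftrightarrow> x \<in> B" by blast
  have "AE x in lebesgue_on S. x \<in> A \<longleftrightarrow> x \<in> B"
    using B(2) Sl by (subst AE_restrict_space_iff) auto
  with B(1) show "\<exists>B\<in>sets borel. AE x in lebesgue_on S. x \<in> A \<longleftrightarrow> x \<in> B" by auto
qed

lemma surface_mono_AE:
  assumes G: "G \<in> sets borel" and F: "F \<in> sets borel" and sub: "G \<subseteq> F" and AE: "AE x in surface F. P x"
  shows "AE x in surface G. P x"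
proof -
  have "AE x in restrict_space hausdorff2 F. P x" using AE unfolding surface_def by (rule AE_completion_iff[THEN iffD1])
  then have "AE x in hausdorff2. x \<in> F \<longrightarrow> P x" using F by (simp add: AE_restrict_space_iff)
  then have "AE x in hausdorff2. x \<in> G \<longrightarrow> P x" by eventually_elim (use sub in auto)
  then have "AE x in restrict_space hausdorff2 G. P x" using G by (simp add: AE_restrict_space_iff)
  then show ?thesis unfolding surface_def by (rule AE_completion)
qed

text \<open>The normal is given on the whole boundary but used on its pieces. A preimage in the
  completion is a Borel set together with a subset of a null set; cutting both down to
  \<open>G\<close> gives such a decomposition again.\<close>

lemma surface_mono_measurable:
  assumes G: "G \<in> sets borel" and F: "F \<in> sets borel" and sub: "G \<subseteq> F" and f: "f \<in> borel_measurable (surface F)"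
  shows "f \<in> borel_measurable (surface G)"
proof (rule measurableI)
  fix B :: "'a set" assume "B \<in> sets borel"
  then have "f -` B \<inter> F \<in> sets (surface F)" using measurable_sets[OF f] by simp
  then obtain C N N' where C: "f -` B \<inter> F = C \<union> N" "N \<subseteq> N'" "N' \<in> null_sets (restrict_space hausdorff2 F)"
    "C \<in> sets (restrict_space hausdorff2 F)"
    unfolding surface_def by (elim sets_completionE)
  have *: "N' \<in> sets borel" "emeasure hausdorff2 N' = 0" "N' \<subseteq> F" "C \<in> sets borel"
    using C F by (auto simp: null_sets_def sets_restrict_space_iff emeasure_restrict_space)
  have "N' \<inter> G \<in> null_sets (restrict_space hausdorff2 G)"
  proof -
    have "emeasure hausdorff2 (N' \<inter> G) \<le> emeasure hausdorff2 N'" by (rule emeasure_mono) (use * in auto)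
    then show ?thesis
      using * G by (auto simp: null_sets_def sets_restrict_space_iff emeasure_restrict_space)
  qed
  moreover have "C \<inter> G \<in> sets (restrict_space hausdorff2 G)" using * G by (simp add: sets_restrict_space_iff)
  moreover have "f -` B \<inter> G = (C \<inter> G) \<union> (N \<inter> G)" using C(1) sub by blast
  ultimately have "f -` B \<inter> G \<in> sets (surface G)"
    unfolding surface_def using C(2) by (intro sets_completionI[of _ "C \<inter> G" "N \<inter> G" "N' \<inter> G"]) auto
  then show "f -` B \<inter> space (surface G) \<in> sets (surface G)" by simp
qed simp

section \<open>Weak integrals of curves in \<open>L\<^sup>2\<close>\<close>

definition L2_cont_on :: "'a measure \<Rightarrow> real \<Rightarrow> (real \<Rightarrow> 'a \<Rightarrow> complex^3) \<Rightarrow> bool" where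
  "L2_cont_on M T f \<longleftrightarrow> (\<forall>t\<in>{0..T}. sq_integrable M (f t) \<and>
     ((\<lambda>s. L2_norm M (\<lambda>x. f s x - f t x)) \<longlongrightarrow> 0) (at t within {0..T}))"

lemma L2_cont_onD:
  assumes "L2_cont_on M T f" "t \<in> {0..T}"
  shows "sq_integrable M (f t)" "((\<lambda>s. L2_norm M (\<lambda>x. f s x - f t x)) \<longlongrightarrow> 0) (at t within {0..T})"
  using assms by (auto simp: L2_cont_on_def)

lemma L2_cont_on_ip:
  assumes f: "L2_cont_on M T f" and w: "sq_integrable M w"
  shows "continuous_on {0..T} (\<lambda>t. L2_ip M (f t) w)"
  unfolding continuous_on_def
proof
  fix t assume t: "t \<in> {0..T}"
  have "((\<lambda>s. L2_ip M (f s) w - L2_ip M (f t) w) \<longlongrightarrow> 0) (at t within {0..T})"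
  proof (rule Lim_null_comparison)
    show "\<forall>\<^sub>F s in at t within {0..T}. norm (L2_ip M (f s) w - L2_ip M (f t) w)
        \<le> L2_norm M (\<lambda>x. f s x - f t x) * L2_norm M w"
      unfolding eventually_at_filter
    proof (rule always_eventually, intro allI impI)
      fix s assume s: "s \<noteq> t" "s \<in> {0..T}"
      have "L2_ip M (f s) w - L2_ip M (f t) w = L2_ip M (\<lambda>x. f s x - f t x) w"
        using L2_cont_onD(1)[OF f] s t w by (simp add: L2_ip_diff_left)
      then show "norm (L2_ip M (f s) w - L2_ip M (f t) w) \<le> L2_norm M (\<lambda>x. f s x - f t x) * L2_norm M w"
        using L2_cauchy_schwarz[OF sq_integrable_diff[OF L2_cont_onD(1)[OF f s(2)] L2_cont_onD(1)[OF f t]] w]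
        by simp
    qed
    show "((\<lambda>s. L2_norm M (\<lambda>x. f s x - f t x) * L2_norm M w) \<longlongrightarrow> 0) (at t within {0..T})"
      using tendsto_mult_left_zero[OF L2_cont_onD(2)[OF f t], of "L2_norm M w"] .
  qed
  then show "((\<lambda>s. L2_ip M (f s) w) \<longlongrightarrow> L2_ip M (f t) w) (at t within {0..T})"
    by (rule Lim_null[THEN iffD2])
qed

lemma L2_cont_on_bounded:
  assumes f: "L2_cont_on M T f"
  obtains B where "B \<ge> 0" "\<And>t. t \<in> {0..T} \<Longrightarrow> L2_norm M (f t) \<le> B"
proof -
  have "continuous_on {0..T} (\<lambda>t. L2_norm M (f t))"
    unfolding continuous_on_def
  proof
    fix t assume t: "t \<in> {0..T}"
    have "((\<lambda>s. L2_norm M (f s) - L2_norm M (f t)) \<longlongrightarrow> 0) (at t within {0..T})"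
    proof (rule Lim_null_comparison)
      show "\<forall>\<^sub>F s in at t within {0..T}. norm (L2_norm M (f s) - L2_norm M (f t)) \<le> L2_norm M (\<lambda>x. f s x - f t x)"
        unfolding eventually_at_filter
      proof (rule always_eventually, intro allI impI)
        fix s assume s: "s \<noteq> t" "s \<in> {0..T}"
        note sq = L2_cont_onD(1)[OF f s(2)] L2_cont_onD(1)[OF f t]
        have "L2_norm M (f s) \<le> L2_norm M (\<lambda>x. f s x - f t x) + L2_norm M (f t)"
          using L2_norm_triangle[OF sq_integrable_diff[OF sq] sq(2)] by simp
        moreover have "L2_norm M (f t) \<le> L2_norm M (\<lambda>x. f t x - f s x) + L2_norm M (f s)"
          using L2_norm_triangle[OF sq_integrable_diff[OF sq(2,1)] sq(1)] by simp
        ultimately show "norm (L2_norm M (f s) - L2_norm M (f t)) \<le> L2_norm M (\<lambda>x. f s x - f t x)"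
          using L2_norm_minus_commute[of M "f s" "f t"] by simp
      qed
    qed (rule L2_cont_onD(2)[OF f t])
    then show "((\<lambda>s. L2_norm M (f s)) \<longlongrightarrow> L2_norm M (f t)) (at t within {0..T})"
      by (rule Lim_null[THEN iffD2])
  qed
  then have "bounded ((\<lambda>t. L2_norm M (f t)) ` {0..T})"
    by (intro compact_imp_bounded compact_continuous_image) auto
  then obtain B where "\<forall>t\<in>{0..T}. L2_norm M (f t) \<le> B"
    by (auto simp: bounded_iff abs_le_iff)
  then show ?thesis by (intro that[of "max B 0"]) (auto intro: max.coboundedI1)
qed

text \<open>The values of the curve are functions with a seminorm rather than points of a metric
  type, so uniform continuity is derived directly, with \<delta> a Lebesgue number of the cover by
  balls of local continuity.\<close>

lemma L2_cont_on_uniform: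
  assumes f: "L2_cont_on M T f" and e: "e > 0"
  obtains \<delta> where "\<delta> > 0" "\<And>s t. s \<in> {0..T} \<Longrightarrow> t \<in> {0..T} \<Longrightarrow> \<bar>s - t\<bar> < \<delta> \<Longrightarrow> L2_norm M (\<lambda>x. f s x - f t x) \<le> e"
proof -
  have "\<exists>d>0. \<forall>s\<in>{0..T}. \<bar>s - t\<bar> < d \<longrightarrow> L2_norm M (\<lambda>x. f s x - f t x) < e / 2" if t: "t \<in> {0..T}" for t
  proof -
    obtain d where d: "d > 0" "\<And>s. s \<in> {0..T} \<Longrightarrow> s \<noteq> t \<Longrightarrow> dist s t < d \<Longrightarrow> dist (L2_norm M (\<lambda>x. f s x - f t x)) 0 < e / 2"
      using tendstoD[OF L2_cont_onD(2)[OF f t], of "e/2"] e unfolding eventually_at by auto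
    have "L2_norm M (\<lambda>x. f s x - f t x) < e / 2" if "s \<in> {0..T}" "\<bar>s - t\<bar> < d" for s
      using d(2)[of s] that e by (cases "s = t") (auto simp: dist_real_def)
    with d(1) show ?thesis by blast
  qed
  then obtain d where d: "\<And>t. t \<in> {0..T} \<Longrightarrow> d t > 0"
    "\<And>s t. t \<in> {0..T} \<Longrightarrow> s \<in> {0..T} \<Longrightarrow> \<bar>s - t\<bar> < d t \<Longrightarrow> L2_norm M (\<lambda>x. f s x - f t x) < e / 2"
    by metis
  obtain \<delta> where \<delta>: "\<delta> > 0" "\<And>t. t \<in> {0..T} \<Longrightarrow> \<exists>G\<in>(\<lambda>t. ball t (d t)) ` {0..T}. ball t \<delta> \<subseteq> G"
  proof (rule Heine_Borel_lemma)
    show "compact {0..T}" by simp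
    show "{0..T} \<subseteq> \<Union> ((\<lambda>t. ball t (d t)) ` {0..T})" using d(1) by (auto intro!: centre_in_ball[THEN iffD2])
  qed auto
  show ?thesis
  proof (rule that[OF \<delta>(1)])
    fix s t assume st: "s \<in> {0..T}" "t \<in> {0..T}" "\<bar>s - t\<bar> < \<delta>"
    then obtain u where u: "u \<in> {0..T}" "ball t \<delta> \<subseteq> ball u (d u)" using \<delta>(2)[of t] by auto
    have "s \<in> ball t \<delta>" "t \<in> ball t \<delta>" using st \<delta>(1) by (auto simp: dist_real_def)
    then have "s \<in> ball u (d u)" "t \<in> ball u (d u)" using u(2) by blast+
    then have "\<bar>s - u\<bar> < d u" "\<bar>t - u\<bar> < d u" by (auto simp: dist_real_def abs_minus_commute)
    then have "L2_norm M (\<lambda>x. f s x - f u x) < e / 2" "L2_norm M (\<lambda>x. f t x - f u x) < e / 2"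
      using d(2) u(1) st by auto
    then show "L2_norm M (\<lambda>x. f s x - f t x) \<le> e"
      using L2_norm_triangle_diff[OF L2_cont_onD(1)[OF f st(1)] L2_cont_onD(1)[OF f u(1)] L2_cont_onD(1)[OF f st(2)]]
        L2_norm_minus_commute[of M "f u" "f t"] by linarith
  qed
qed

lemma riemann_sum_tendsto_integral:
  fixes \<phi> :: "real \<Rightarrow> complex"
  assumes T: "T > 0" and cont: "continuous_on {0..T} \<phi>"
  shows "(\<lambda>n. \<Sum>i<Suc n. (T / Suc n) *\<^sub>R \<phi> (real i * (T / Suc n))) \<longlonglongrightarrow> integral {0..T} \<phi>"
proof (rule LIMSEQ_I)
  fix r :: real assume r: "r > 0"
  \<comment> \<open>A cell of length h contributes an error of at most h e, in total T e = r /
    2.\<close>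
  define e where "e = r / (2 * T)"
  have e: "e > 0" using r T by (simp add: e_def)
  have "uniformly_continuous_on {0..T} \<phi>" using cont by (rule compact_uniformly_continuous) simp
  then obtain \<delta> where \<delta>: "\<delta> > 0" "\<And>s t. s \<in> {0..T} \<Longrightarrow> t \<in> {0..T} \<Longrightarrow> dist s t < \<delta> \<Longrightarrow> dist (\<phi> s) (\<phi> t) < e"
    using e unfolding uniformly_continuous_on_def by metis
  obtain N :: nat where N: "real N > T / \<delta>" using reals_Archimedean2 by blast
  show "\<exists>no. \<forall>n\<ge>no. norm ((\<Sum>i<Suc n. (T / Suc n) *\<^sub>R \<phi> (real i * (T / Suc n))) - integral {0..T} \<phi>) < r"
  proof (intro exI allI impI)
    fix n assume n: "n \<ge> N"
    define h where "h = T / Suc n"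
    have "T < N * \<delta>" using N \<delta>(1) by (simp add: field_simps)
    also have "\<dots> \<le> Suc n * \<delta>" using \<delta>(1) n by (intro mult_right_mono) auto
    finally have h: "h > 0" "h < \<delta>" "Suc n * h = T"
      using T by (simp_all add: h_def divide_less_eq mult.commute del: of_nat_Suc)
    have "norm (integral {0..k * h} \<phi> - (\<Sum>i<k. h *\<^sub>R \<phi> (real i * h))) \<le> k * (h * e)" if "k \<le> Suc n" for k
      using that
    proof (induction k)
      case (Suc k)
      have kh: "real k * h \<le> Suc k * h" "Suc k * h \<le> T" "0 \<le> k * h"
        using h Suc.prems mult_right_mono[of "real (Suc k)" "real (Suc n)" h] by auto
      have sub: "continuous_on {a..b} \<phi>" if "0 \<le> a" "b \<le> T" for a b
        by (rule continuous_on_subset[OF cont]) (use that in auto)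
      have comb: "integral {0..Suc k * h} \<phi> = integral {0..k * h} \<phi> + integral {k * h..Suc k * h} \<phi>"
        using kh by (intro Henstock_Kurzweil_Integration.integral_combine[symmetric] integrable_continuous_real sub) auto
      have "integral {k * h..Suc k * h} (\<lambda>t. \<phi> t - \<phi> (k * h)) = integral {k * h..Suc k * h} \<phi> - h *\<^sub>R \<phi> (k * h)"
        using kh by (subst Henstock_Kurzweil_Integration.integral_diff) (auto intro!: integrable_continuous_real sub simp: algebra_simps)
      moreover have "norm (integral {k * h..Suc k * h} (\<lambda>t. \<phi> t - \<phi> (k * h))) \<le> e * (Suc k * h - k * h)"
      proof (rule integral_bound[OF kh(1)])
        show "continuous_on {k * h..Suc k * h} (\<lambda>t. \<phi> t - \<phi> (k * h))"
          using kh by (intro continuous_intros sub) auto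
        fix t assume t: "t \<in> {k * h..Suc k * h}"
        then have "dist t (k * h) < \<delta>" using h(2) by (auto simp: dist_real_def algebra_simps)
        then show "norm (\<phi> t - \<phi> (k * h)) \<le> e"
          using \<delta>(2)[of t "k * h"] t kh by (auto simp: dist_norm)
      qed
      ultimately have "norm (integral {k * h..Suc k * h} \<phi> - h *\<^sub>R \<phi> (k * h)) \<le> e * (Suc k * h - k * h)"
        by (simp only:)
      then have "norm (integral {k * h..Suc k * h} \<phi> - h *\<^sub>R \<phi> (k * h)) \<le> h * e"
        by (simp add: algebra_simps)
      moreover have "integral {0..Suc k * h} \<phi> - (\<Sum>i<Suc k. h *\<^sub>R \<phi> (real i * h)) =
          (integral {0..k * h} \<phi> - (\<Sum>i<k. h *\<^sub>R \<phi> (real i * h))) + (integral {k * h..Suc k * h} \<phi> - h *\<^sub>R \<phi> (k * h))"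
        unfolding comb by simp
      ultimately have "norm (integral {0..Suc k * h} \<phi> - (\<Sum>i<Suc k. h *\<^sub>R \<phi> (real i * h))) \<le> k * (h * e) + h * e"
        using Suc.IH Suc.prems by (simp only:) (rule order_trans[OF norm_triangle_ineq], simp)
      then show ?case by (simp add: algebra_simps)
    qed simp
    from this[of "Suc n"] have "norm (integral {0..T} \<phi> - (\<Sum>i<Suc n. h *\<^sub>R \<phi> (real i * h))) \<le> T * e"
      using h(3) by (simp only: order_refl mult.assoc[symmetric] simp_thms)
    also have "\<dots> < r" using T r by (simp add: e_def)
    finally show "norm ((\<Sum>i<Suc n. (T / Suc n) *\<^sub>R \<phi> (real i * (T / Suc n))) - integral {0..T} \<phi>) < r"
      unfolding h_def by (simp only: norm_minus_commute)
  qed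
qed

text \<open>Rewrites a Riemann sum with n cells over the grid refined m times: the fine cell k lies
  in the coarse cell k div m. Sums over the two grids can then be compared term by term.\<close>

lemma sum_div_blocks:
  fixes g :: "nat \<Rightarrow> 'b::real_vector"
  assumes "m > 0"
  shows "(\<Sum>k<n*m. g (k div m)) = (\<Sum>i<n. real m *\<^sub>R g i)"
proof (induction n)
  case (Suc n)
  have "{..<Suc n * m} = {..<n*m} \<union> {n*m..<n*m+m}" by auto
  then have "(\<Sum>k<Suc n*m. g (k div m)) = (\<Sum>k<n*m. g (k div m)) + (\<Sum>k\<in>{n*m..<n*m+m}. g (k div m))"
    using sum.union_disjoint[of "{..<n*m}" "{n*m..<n*m+m}" "\<lambda>k. g (k div m)"]
    by (simp only: finite_lessThan finite_atLeastLessThan ivl_disj_int simp_thms)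
  also have "(\<Sum>k\<in>{n*m..<n*m+m}. g (k div m)) = (\<Sum>k\<in>{n*m..<n*m+m}. g n)"
  proof (rule sum.cong)
    fix k assume "k \<in> {n*m..<n*m+m}"
    then have "k div m = n" by (intro div_nat_eqI) (auto simp: mult.commute)
    then show "g (k div m) = g n" by simp
  qed simp
  also have "\<dots> = real m *\<^sub>R g n" by (simp add: sum_constant_scaleR)
  finally show ?case using Suc by simp
qed simp

text \<open>The integral is the limit of its Riemann sums, which are Cauchy in \<open>L\<^sup>2\<close>.\<close>

lemma L2_curve_integral:
  assumes T: "T > 0" and f: "L2_cont_on M T f"
  obtains F where "sq_integrable M F"
    "\<And>w. sq_integrable M w \<Longrightarrow> L2_ip M F w = integral {0..T} (\<lambda>t. L2_ip M (f t) w)"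
proof -
  define R where "R n x = (\<Sum>i<n. (T / n) *\<^sub>R f (real i * (T / n)) x)" for n x
  have node: "real i * (T / n) \<in> {0..T}" if "i < n" for i n :: nat
  proof -
    have "real i * T \<le> real n * T" using that T by (intro mult_right_mono) auto
    then show ?thesis using T that by (simp add: field_simps)
  qed
  have sq_node: "sq_integrable M (\<lambda>x. (T / n) *\<^sub>R f (real i * (T / n)) x)" if "i < n" for i n :: nat
    by (rule sq_integrable_scaleR[OF L2_cont_onD(1)[OF f node[OF that]]])
  have sqR: "sq_integrable M (R n)" for n
    unfolding R_def[abs_def] by (rule sq_integrable_sum) (rule sq_node, simp)
  \<comment> \<open>A grid is compared with its own refinement only, since two unrelated grids have
    no common indexing of their sample points.\<close>
  have refine: "\<exists>N>0. \<forall>n\<ge>N. \<forall>m>0. L2_norm M (\<lambda>x. R n x - R (n * m) x) \<le> e" if e: "e > 0" for e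
  proof -
    obtain \<delta> where \<delta>: "\<delta> > 0"
      "\<And>s t. s \<in> {0..T} \<Longrightarrow> t \<in> {0..T} \<Longrightarrow> \<bar>s - t\<bar> < \<delta> \<Longrightarrow> L2_norm M (\<lambda>x. f s x - f t x) \<le> e / T"
      using L2_cont_on_uniform[OF f, of "e / T"] e T by auto
    obtain N :: nat where N: "real N > T / \<delta>" using reals_Archimedean2 by blast
    have "T / \<delta> > 0" using T \<delta>(1) by simp
    then have "N > 0" using N by linarith
    moreover have "L2_norm M (\<lambda>x. R n x - R (n * m) x) \<le> e" if n: "n \<ge> N" and m: "m > 0" for n m
    proof -
      have n0: "n > 0" using n \<open>N > 0\<close> by simp
      define h where "h = T / (real n * real m)"
      have h: "h > 0" using T n0 m by (simp add: h_def)
      have hm: "real m * h = T / n" "real n * (real m * h) = T" using n0 m by (simp_all add: h_def)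
      have lt: "k div m < n" if "k < n * m" for k using that by (simp add: less_mult_imp_div_less)
      have Rn: "R n x = (\<Sum>k<n*m. h *\<^sub>R f (real (k div m) * (T / n)) x)" for x
        using sum_div_blocks[OF m, of "\<lambda>i. h *\<^sub>R f (real i * (T / n)) x" n] by (simp add: R_def hm(1)[symmetric])
      have "R n x - R (n * m) x = (\<Sum>k<n*m. h *\<^sub>R (f (real (k div m) * (T / n)) x - f (real k * h) x))" for x
        unfolding Rn by (simp add: R_def h_def sum_subtractf scaleR_diff_right)
      then have "L2_norm M (\<lambda>x. R n x - R (n * m) x) = L2_norm M (\<lambda>x. \<Sum>k<n*m. h *\<^sub>R (f (real (k div m) * (T / n)) x - f (real k * h) x))"
        by simp
      also have "\<dots> \<le> (\<Sum>k<n*m. L2_norm M (\<lambda>x. h *\<^sub>R (f (real (k div m) * (T / n)) x - f (real k * h) x)))"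
      proof (rule L2_norm_sum)
        fix k assume k: "k \<in> {..<n*m}"
        have "real k * h \<in> {0..T}" using node[of k "n * m"] k by (simp add: h_def)
        then show "sq_integrable M (\<lambda>x. h *\<^sub>R (f (real (k div m) * (T / n)) x - f (real k * h) x))"
          using k lt node by (intro sq_integrable_scaleR sq_integrable_diff L2_cont_onD(1)[OF f]) auto
      qed
      also have "\<dots> \<le> (\<Sum>k<n*m. h * (e / T))"
      proof (rule sum_mono)
        fix k assume "k \<in> {..<n*m}"
        then have k: "k < n * m" by simp
        have kh: "real k * h \<in> {0..T}" using node[of k "n * m"] k by (simp add: h_def)
        \<comment> \<open>Matching sample points differ by (k mod m) h, which is below m h = T/n,
          and T/n < \<delta> by the choice of N.\<close>
        have "real k = real (k div m) * real m + real (k mod m)"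
          by (metis div_mult_mod_eq of_nat_add of_nat_mult)
        then have "(k div m) * (T / n) - k * h = - (real (k mod m) * h)"
          unfolding hm(1)[symmetric] by (simp add: algebra_simps)
        moreover have "real (k mod m) * h < real m * h" using h m by (intro mult_strict_right_mono) auto
        moreover have "real m * h < \<delta>"
        proof -
          have "T < N * \<delta>" using N \<delta>(1) by (simp add: field_simps)
          also have "\<dots> \<le> n * \<delta>" using \<delta>(1) n by (intro mult_right_mono) auto
          finally show ?thesis unfolding hm(1) using n0 by (simp add: divide_less_eq mult.commute)
        qed
        moreover have "0 \<le> real (k mod m) * h" using h by simp
        ultimately have "\<bar>(k div m) * (T / n) - k * h\<bar> < \<delta>" by linarith
        then have "L2_norm M (\<lambda>x. f (real (k div m) * (T / n)) x - f (real k * h) x) \<le> e / T"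
          using node[OF lt[OF k]] kh by (intro \<delta>(2)) auto
        then show "L2_norm M (\<lambda>x. h *\<^sub>R (f (real (k div m) * (T / n)) x - f (real k * h) x)) \<le> h * (e / T)"
          using h by (simp only: L2_norm_scaleR abs_of_pos) (rule mult_left_mono, auto)
      qed
      also have "\<dots> = real n * (real m * h) * (e / T)" by simp
      also have "\<dots> = e" unfolding hm(2) using T by simp
      finally show ?thesis .
    qed
    ultimately show ?thesis by blast
  qed
  \<comment> \<open>Both sums are compared with the one over the common refinement into m n
    cells.\<close>
  have cauchy: "\<exists>N. \<forall>m\<ge>N. \<forall>n\<ge>N. L2_norm M (\<lambda>x. R m x - R n x) \<le> e" if e: "e > 0" for e
  proof -
    obtain N where N: "N > 0" "\<And>n m. n \<ge> N \<Longrightarrow> m > 0 \<Longrightarrow> L2_norm M (\<lambda>x. R n x - R (n * m) x) \<le> e / 2"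
      using refine[of "e / 2"] e by auto
    have "L2_norm M (\<lambda>x. R m x - R n x) \<le> e" if "m \<ge> N" "n \<ge> N" for m n
    proof -
      have mn: "m > 0" "n > 0" using that N(1) by auto
      have "L2_norm M (\<lambda>x. R n x - R (m * n) x) \<le> e / 2" using N(2)[OF that(2) mn(1)] by (simp add: mult.commute)
      moreover have "L2_norm M (\<lambda>x. R m x - R (m * n) x) \<le> e / 2" using N(2)[OF that(1) mn(2)] .
      ultimately show ?thesis
        using L2_norm_triangle_diff[OF sqR[of m] sqR[of "m * n"] sqR[of n]] L2_norm_minus_commute[of M "R (m * n)" "R n"]
        by linarith
    qed
    then show ?thesis by blast
  qed
  obtain F where F: "sq_integrable M F" "(\<lambda>n. L2_norm M (\<lambda>x. R n x - F x)) \<longlonglongrightarrow> 0"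
    using L2_complete[OF sqR cauchy] by blast
  show ?thesis
  proof (rule that[OF F(1)])
    fix w assume w: "sq_integrable M w"
    have "(\<lambda>n. L2_ip M (R n) w - L2_ip M F w) \<longlonglongrightarrow> 0"
    proof (rule Lim_null_comparison)
      show "\<forall>\<^sub>F n in sequentially. norm (L2_ip M (R n) w - L2_ip M F w) \<le> L2_norm M (\<lambda>x. R n x - F x) * L2_norm M w"
      proof (rule always_eventually, rule allI)
        fix n show "norm (L2_ip M (R n) w - L2_ip M F w) \<le> L2_norm M (\<lambda>x. R n x - F x) * L2_norm M w"
          using L2_cauchy_schwarz[OF sq_integrable_diff[OF sqR[of n] F(1)] w]
          by (simp only: L2_ip_diff_left[OF sqR F(1) w])
      qed
      show "(\<lambda>n. L2_norm M (\<lambda>x. R n x - F x) * L2_norm M w) \<longlonglongrightarrow> 0"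
        using tendsto_mult_left_zero[OF F(2), of "L2_norm M w"] .
    qed
    then have "(\<lambda>n. L2_ip M (R n) w) \<longlonglongrightarrow> L2_ip M F w" by (rule Lim_null[THEN iffD2])
    \<comment> \<open>The shift drops the meaningless sum with zero cells and matches the indexing
      of \<open>riemann_sum_tendsto_integral\<close>.\<close>
    then have "(\<lambda>n. L2_ip M (R (Suc n)) w) \<longlonglongrightarrow> L2_ip M F w" by (rule LIMSEQ_Suc)
    moreover have "L2_ip M (R (Suc n)) w = (\<Sum>i<Suc n. (T / Suc n) *\<^sub>R L2_ip M (f (real i * (T / Suc n))) w)" for n
    proof -
      have "L2_ip M (R (Suc n)) w = (\<Sum>i<Suc n. L2_ip M (\<lambda>x. (T / Suc n) *\<^sub>R f (real i * (T / Suc n)) x) w)"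
        unfolding R_def[abs_def] by (rule L2_ip_sum_left) (use sq_node[of _ "Suc n"] w in auto)
      then show ?thesis by (simp only: L2_ip_scaleR_left scaleR_conv_of_real[where 'a = complex])
    qed
    ultimately show "L2_ip M F w = integral {0..T} (\<lambda>t. L2_ip M (f t) w)"
      using riemann_sum_tendsto_integral[OF T L2_cont_on_ip[OF f w]] LIMSEQ_unique by (simp only:)
  qed
qed

section \<open>Fourier series\<close>

definition fcoef :: "real \<Rightarrow> int \<Rightarrow> (real \<Rightarrow> complex) \<Rightarrow> complex" where
  "fcoef \<omega> n \<phi> = (\<omega> / (2 * pi)) * integral {0..period \<omega>} (\<lambda>t. cis (- (real_of_int n * \<omega> * t)) * \<phi> t)"

text \<open>A field-valued Fourier coefficient described by its pairings. This determines it up to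
  null sets, and every identity that is linear in the field and holds after testing passes to
  it.\<close>

definition is_fcoef :: "'a measure \<Rightarrow> real \<Rightarrow> (real \<Rightarrow> 'a \<Rightarrow> complex^3) \<Rightarrow> int \<Rightarrow> ('a \<Rightarrow> complex^3) \<Rightarrow> bool" where
  "is_fcoef M \<omega> f n c \<longleftrightarrow> sq_integrable M c \<and>
     (\<forall>w. sq_integrable M w \<longrightarrow> L2_ip M c w = fcoef \<omega> n (\<lambda>t. L2_ip M (f t) w))"

lemma cis_period: "\<omega> \<noteq> 0 \<Longrightarrow> cis (real_of_int n * \<omega> * period \<omega>) = 1"
proof -
  assume "\<omega> \<noteq> 0"
  then have "real_of_int n * \<omega> * period \<omega> = 2 * pi * real_of_int n" by simp
  moreover have "real_of_int n \<in> \<int>" by simp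
  ultimately show ?thesis using cis_multiple_2pi by metis
qed

lemma fcoef_integrable:
  assumes "continuous_on {0..period \<omega>} \<phi>"
  shows "(\<lambda>t. cis (- (real_of_int n * \<omega> * t)) * \<phi> t) integrable_on {0..period \<omega>}"
  by (intro integrable_continuous_real continuous_intros assms)

lemma fcoef_add:
  assumes "continuous_on {0..period \<omega>} \<phi>" "continuous_on {0..period \<omega>} \<rho>"
  shows "fcoef \<omega> n (\<lambda>t. \<phi> t + \<rho> t) = fcoef \<omega> n \<phi> + fcoef \<omega> n \<rho>"
  unfolding fcoef_def distrib_left
  by (subst Henstock_Kurzweil_Integration.integral_add) (auto intro: fcoef_integrable[OF assms(1)] fcoef_integrable[OF assms(2)] simp: distrib_left)

lemma fcoef_mult: "fcoef \<omega> n (\<lambda>t. k * \<phi> t) = k * fcoef \<omega> n \<phi>"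
proof -
  have "(\<lambda>t. cis (- (real_of_int n * \<omega> * t)) * (k * \<phi> t)) = (\<lambda>t. k * (cis (- (real_of_int n * \<omega> * t)) * \<phi> t))"
    by (simp add: mult_ac)
  then show ?thesis unfolding fcoef_def by (simp only: integral_mult_right mult_ac)
qed

lemma fcoef_diff:
  assumes "continuous_on {0..period \<omega>} \<phi>" "continuous_on {0..period \<omega>} \<rho>"
  shows "fcoef \<omega> n (\<lambda>t. \<phi> t - \<rho> t) = fcoef \<omega> n \<phi> - fcoef \<omega> n \<rho>"
  using fcoef_add[OF assms(1) continuous_on_mult_left[OF assms(2), of "-1"], of n] fcoef_mult[of \<omega> n "-1" \<rho>]
  by simp

text \<open>The end points are left out because the evolution equation is imposed on the open
  interval only; they do not affect the integral.\<close>

lemma fcoef_cong: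
  assumes "\<And>t. t \<in> {0<..<period \<omega>} \<Longrightarrow> \<phi> t = \<rho> t"
  shows "fcoef \<omega> n \<phi> = fcoef \<omega> n \<rho>"
proof -
  have "integral {0..period \<omega>} (\<lambda>t. cis (- (real_of_int n * \<omega> * t)) * \<phi> t) =
      integral {0..period \<omega>} (\<lambda>t. cis (- (real_of_int n * \<omega> * t)) * \<rho> t)"
    using assms by (intro integral_spike[of "{0, period \<omega>}"]) auto
  then show ?thesis by (simp add: fcoef_def)
qed

lemma fcoef_cnj:
  "fcoef \<omega> (- n) (\<lambda>t. cnj (\<phi> t)) = cnj (fcoef \<omega> n \<phi>)"
proof -
  have "(\<lambda>t. cis (- (real_of_int (- n) * \<omega> * t)) * cnj (\<phi> t)) = (\<lambda>t. cnj (cis (- (real_of_int n * \<omega> * t)) * \<phi> t))"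
    by (simp add: cis_cnj)
  then show ?thesis unfolding fcoef_def
    by (simp only: Henstock_Kurzweil_Integration.integral_cnj[symmetric]) simp
qed

lemma fcoef_cis:
  assumes w: "\<omega> > 0"
  shows "fcoef \<omega> n (\<lambda>t. cis (real_of_int m * \<omega> * t)) = (if m = n then 1 else 0)"
proof -
  define k where "k = m - n"
  have T: "period \<omega> \<ge> 0" using w by simp
  have e: "cis (- (real_of_int n * \<omega> * t)) * cis (real_of_int m * \<omega> * t) = cis (real_of_int k * \<omega> * t)" for t
    by (simp add: cis_mult k_def algebra_simps)
  show ?thesis
  proof (cases "m = n")
    case True
    then have k1: "cis (real_of_int k * \<omega> * t) = 1" for t by (simp add: k_def)
    have "fcoef \<omega> n (\<lambda>t. cis (real_of_int m * \<omega> * t)) = (\<omega> / (2 * pi)) * integral {0..period \<omega>} (\<lambda>t. 1::complex)"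
      unfolding fcoef_def e k1 ..
    also have "integral {0..period \<omega>} (\<lambda>t. 1::complex) = complex_of_real (period \<omega>)"
      using T by (simp add: scaleR_conv_of_real[where 'a = complex])
    also have "complex_of_real (\<omega> / (2 * pi)) * complex_of_real (period \<omega>) = 1"
      using w by (simp flip: of_real_mult)
    finally show ?thesis using True by simp
  next
    case False
    then have k0: "real_of_int k * \<omega> \<noteq> 0" using w by (simp add: k_def)
    define C where "C = \<i> * complex_of_real (real_of_int k * \<omega>)"
    have C0: "C \<noteq> 0" using k0 by (simp add: C_def)
    have "((\<lambda>t. cis (real_of_int k * \<omega> * t) / C) has_vector_derivative cis (real_of_int k * \<omega> * t)) (at t within {0..period \<omega>})" for t
    proof -
      have "((\<lambda>t. exp (t *\<^sub>R C)) has_vector_derivative C * exp (t *\<^sub>R C)) (at t within {0..period \<omega>})"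
        by (rule has_vector_derivative_at_within[OF exp_scaleR_has_vector_derivative_left])
      from has_vector_derivative_divide[OF this, of C]
      show ?thesis using C0 by (simp add: cis_conv_exp C_def scaleR_conv_of_real mult_ac)
    qed
    from fundamental_theorem_of_calculus[OF T this]
    have "((\<lambda>t. cis (real_of_int k * \<omega> * t)) has_integral
        cis (real_of_int k * \<omega> * period \<omega>) / C - cis (real_of_int k * \<omega> * 0) / C) {0..period \<omega>}" by blast
    then have "integral {0..period \<omega>} (\<lambda>t. cis (real_of_int k * \<omega> * t)) = 0"
      using w cis_period[of \<omega> k] by (intro integral_unique) simp
    then show ?thesis using False unfolding fcoef_def e by simp
  qed
qed

text \<open>Integration by parts over one period: the boundary terms cancel because both the
  function and the exponential take equal values at the two ends.\<close>

lemma fcoef_deriv: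
  assumes w: "\<omega> > 0"
    and der: "\<And>t. t \<in> {0..period \<omega>} \<Longrightarrow> (\<phi> has_vector_derivative \<phi>' t) (at t within {0..period \<omega>})"
    and cont: "continuous_on {0..period \<omega>} \<phi>'" and per: "\<phi> (period \<omega>) = \<phi> 0"
  shows "fcoef \<omega> n \<phi>' = \<i> * of_int n * complex_of_real \<omega> * fcoef \<omega> n \<phi>"
proof -
  have T: "period \<omega> \<ge> 0" using w by simp
  have cphi: "continuous_on {0..period \<omega>} \<phi>"
    using der by (meson continuous_on_vector_derivative)
  define C where "C = \<i> * of_int n * complex_of_real \<omega>"
  let ?E = "\<lambda>t. cis (- (real_of_int n * \<omega> * t))"
  have E: "(?E has_vector_derivative - (C * ?E t)) (at t within {0..period \<omega>})" for t
  proof -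
    have "((\<lambda>t. exp (t *\<^sub>R (- C))) has_vector_derivative (- C) * exp (t *\<^sub>R (- C))) (at t within {0..period \<omega>})"
      by (rule has_vector_derivative_at_within[OF exp_scaleR_has_vector_derivative_left])
    then show ?thesis by (simp add: cis_conv_exp C_def scaleR_conv_of_real mult_ac)
  qed
  have "((\<lambda>t. ?E t * \<phi> t) has_vector_derivative ?E t * \<phi>' t + (- (C * ?E t)) * \<phi> t) (at t within {0..period \<omega>})"
    if "t \<in> {0..period \<omega>}" for t
    by (rule has_vector_derivative_mult[OF E der[OF that]])
  from fundamental_theorem_of_calculus[OF T this]
  have "((\<lambda>t. ?E t * \<phi>' t + (- (C * ?E t)) * \<phi> t) has_integral
      ?E (period \<omega>) * \<phi> (period \<omega>) - ?E 0 * \<phi> 0) {0..period \<omega>}" by blast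
  moreover have "?E (period \<omega>) = 1" using cis_period[of \<omega> "- n"] w by simp
  ultimately have "((\<lambda>t. ?E t * \<phi>' t + (- (C * ?E t)) * \<phi> t) has_integral 0) {0..period \<omega>}"
    using per by simp
  then have "integral {0..period \<omega>} (\<lambda>t. ?E t * \<phi>' t - C * (?E t * \<phi> t)) = 0"
    by (intro integral_unique) (simp add: mult.assoc)
  then have "integral {0..period \<omega>} (\<lambda>t. ?E t * \<phi>' t) = C * integral {0..period \<omega>} (\<lambda>t. ?E t * \<phi> t)"
    using fcoef_integrable[OF cont, of n] fcoef_integrable[OF cphi, of n]
    by (subst (asm) Henstock_Kurzweil_Integration.integral_diff) (auto intro: integrable_on_mult_right)
  then show ?thesis by (simp add: fcoef_def C_def)
qed

lemma L2_cont_on_mult: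
  assumes f: "L2_cont_on M T f" and k: "continuous_on {0..T} k"
  shows "L2_cont_on M T (\<lambda>t x. k t *s f t x)"
  unfolding L2_cont_on_def
proof (intro ballI conjI)
  fix t assume t: "t \<in> {0..T}"
  note sqt = L2_cont_onD(1)[OF f t]
  show "sq_integrable M (\<lambda>x. k t *s f t x)" by (rule sq_integrable_scale[OF sqt])
  show "((\<lambda>s. L2_norm M (\<lambda>x. k s *s f s x - k t *s f t x)) \<longlongrightarrow> 0) (at t within {0..T})"
  proof (rule Lim_null_comparison)
    show "\<forall>\<^sub>F s in at t within {0..T}. norm (L2_norm M (\<lambda>x. k s *s f s x - k t *s f t x)) \<le>
        cmod (k s) * L2_norm M (\<lambda>x. f s x - f t x) + cmod (k s - k t) * L2_norm M (f t)"
      unfolding eventually_at_filter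
    proof (rule always_eventually, intro allI impI)
      fix s assume s: "s \<noteq> t" "s \<in> {0..T}"
      have "k s *s f s x - k t *s f t x = k s *s (f s x - f t x) + (k s - k t) *s f t x" for x
        by (simp add: vec_eq_iff algebra_simps)
      then have "L2_norm M (\<lambda>x. k s *s f s x - k t *s f t x) = L2_norm M (\<lambda>x. k s *s (f s x - f t x) + (k s - k t) *s f t x)"
        by (simp only:)
      also have "\<dots> \<le> L2_norm M (\<lambda>x. k s *s (f s x - f t x)) + L2_norm M (\<lambda>x. (k s - k t) *s f t x)"
        by (intro L2_norm_triangle sq_integrable_scale sq_integrable_diff L2_cont_onD(1)[OF f] s t)
      finally show "norm (L2_norm M (\<lambda>x. k s *s f s x - k t *s f t x)) \<le>
          cmod (k s) * L2_norm M (\<lambda>x. f s x - f t x) + cmod (k s - k t) * L2_norm M (f t)"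
        by (simp only: L2_norm_scale real_norm_def abs_of_nonneg[OF L2_norm_nonneg])
    qed
    have kt: "(k \<longlongrightarrow> k t) (at t within {0..T})" using k t by (simp add: continuous_on_def)
    have "((\<lambda>s. cmod (k s) * L2_norm M (\<lambda>x. f s x - f t x) + cmod (k s - k t) * L2_norm M (f t)) \<longlongrightarrow>
        cmod (k t) * 0 + cmod (k t - k t) * L2_norm M (f t)) (at t within {0..T})"
      by (intro tendsto_intros kt L2_cont_onD(2)[OF f t])
    then show "((\<lambda>s. cmod (k s) * L2_norm M (\<lambda>x. f s x - f t x) + cmod (k s - k t) * L2_norm M (f t)) \<longlongrightarrow> 0) (at t within {0..T})"
      by simp
  qed
qed

lemma is_fcoef_exists:
  assumes w: "\<omega> > 0" and f: "L2_cont_on M (period \<omega>) f"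
  shows "\<exists>c. is_fcoef M \<omega> f n c"
proof -
  have T: "period \<omega> > 0" using w by simp
  have "L2_cont_on M (period \<omega>) (\<lambda>t x. cis (- (real_of_int n * \<omega> * t)) *s f t x)"
    by (intro L2_cont_on_mult f continuous_intros)
  from L2_curve_integral[OF T this] obtain F where F: "sq_integrable M F"
    "\<And>w. sq_integrable M w \<Longrightarrow> L2_ip M F w =
       integral {0..period \<omega>} (\<lambda>t. L2_ip M (\<lambda>x. cis (- (real_of_int n * \<omega> * t)) *s f t x) w)" by blast
  have "is_fcoef M \<omega> f n (\<lambda>x. complex_of_real (\<omega> / (2 * pi)) *s F x)"
    unfolding is_fcoef_def fcoef_def L2_ip_scale_left using F
    by (auto intro: sq_integrable_scale simp: L2_ip_scale_left)
  then show ?thesis by blast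
qed

text \<open>Integrating the pointwise inequality \<open>0 \<le> \<parallel>f(t) - \<Sum> exp(i n \<omega> t) d\<^sub>n\<parallel>\<^sup>2\<close>.\<close>

lemma L2_bessel:
  assumes w: "\<omega> > 0" and f: "L2_cont_on M (period \<omega>) f"
    and B: "\<And>t. t \<in> {0..period \<omega>} \<Longrightarrow> L2_norm M (f t) \<le> B"
    and d: "\<And>n. n \<in> I \<Longrightarrow> is_fcoef M \<omega> f n (d n)" and I: "finite I"
  shows "(\<Sum>n\<in>I. (L2_norm M (d n))\<^sup>2) \<le> B\<^sup>2"
proof -
  define E where "E n t = cis (real_of_int n * \<omega> * t)" for n t
  have T: "period \<omega> > 0" using w by simp
  have sqd: "sq_integrable M (d n)" if "n \<in> I" for n using d[OF that] by (simp add: is_fcoef_def)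
  \<comment> \<open>The expanded squared norm of the difference between \<open>f t\<close> and the
    trigonometric sum, with the constant B^2 in place of the squared norm of \<open>f t\<close>. It
    can only be larger, and every other term is a character times a constant or a continuous
    pairing.\<close>
  define G where "G t = complex_of_real (B\<^sup>2) - (\<Sum>n\<in>I. E (- n) t * L2_ip M (f t) (d n))
      - (\<Sum>n\<in>I. E n t * cnj (L2_ip M (f t) (d n)))
      + (\<Sum>n\<in>I. \<Sum>m\<in>I. E (n - m) t * L2_ip M (d n) (d m))" for t
  have Gpos: "Re (G t) \<ge> 0" if t: "t \<in> {0..period \<omega>}" for t
  proof -
    define s where "s x = (\<Sum>n\<in>I. E n t *s d n x)" for x
    have sqs: "sq_integrable M s" unfolding s_def[abs_def]
      by (intro sq_integrable_sum sq_integrable_scale sqd)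
    note sqf = L2_cont_onD(1)[OF f t]
    have "0 \<le> Re (L2_ip M (\<lambda>x. f t x - s x) (\<lambda>x. f t x - s x))"
      by (simp add: L2_ip_self)
    also have "L2_ip M (\<lambda>x. f t x - s x) (\<lambda>x. f t x - s x) =
        L2_ip M (f t) (f t) - L2_ip M (f t) s - cnj (L2_ip M (f t) s) + L2_ip M s s"
      using sqs sqf by (simp add: L2_ip_diff_left L2_ip_diff_right sq_integrable_diff L2_ip_commute[of M s "f t"])
    also have fs: "L2_ip M (f t) s = (\<Sum>n\<in>I. E (- n) t * L2_ip M (f t) (d n))"
      unfolding s_def[abs_def] using sqd sqf
      by (subst L2_ip_sum_right) (auto intro: sq_integrable_scale simp: L2_ip_scale_right E_def cis_cnj)
    also have "cnj (\<Sum>n\<in>I. E (- n) t * L2_ip M (f t) (d n)) = (\<Sum>n\<in>I. E n t * cnj (L2_ip M (f t) (d n)))"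
      by (simp add: cis_cnj E_def)
    also have "L2_ip M s s = (\<Sum>n\<in>I. \<Sum>m\<in>I. E (n - m) t * L2_ip M (d n) (d m))"
    proof -
      have "L2_ip M s s = (\<Sum>n\<in>I. E n t * L2_ip M (d n) s)"
        unfolding s_def[abs_def] using sqd sqs[unfolded s_def[abs_def]]
        by (subst L2_ip_sum_left) (auto intro: sq_integrable_scale simp: L2_ip_scale_left)
      also have "\<dots> = (\<Sum>n\<in>I. E n t * (\<Sum>m\<in>I. E (- m) t * L2_ip M (d n) (d m)))"
        unfolding s_def[abs_def] using sqd
        by (intro sum.cong refl, subst L2_ip_sum_right) (auto intro: sq_integrable_scale simp: L2_ip_scale_right E_def cis_cnj)
      also have "\<dots> = (\<Sum>n\<in>I. \<Sum>m\<in>I. E (n - m) t * L2_ip M (d n) (d m))"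
        unfolding sum_distrib_left mult.assoc[symmetric] E_def cis_mult by (simp add: algebra_simps)
      finally show ?thesis .
    qed
    finally have "0 \<le> Re (L2_ip M (f t) (f t)) + Re (G t) - B\<^sup>2" by (simp add: G_def)
    moreover have "Re (L2_ip M (f t) (f t)) \<le> B\<^sup>2"
      unfolding L2_ip_self using power_mono[OF B[OF t], of 2] by simp
    ultimately show ?thesis by simp
  qed
  have cf: "continuous_on {0..period \<omega>} (\<lambda>t. L2_ip M (f t) (d n))" if "n \<in> I" for n
    by (rule L2_cont_on_ip[OF f sqd[OF that]])
  have coef_e: "continuous_on {0..period \<omega>} (E n)" for n unfolding E_def[abs_def] by (intro continuous_intros)
  have contG: "continuous_on {0..period \<omega>} G"
    unfolding G_def[abs_def]
    by (intro continuous_on_add continuous_on_diff continuous_on_sum continuous_on_mult continuous_on_cnj continuous_on_const coef_e cf)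
  \<comment> \<open>In the mean over a period each single sum contributes the squared norms with a
    minus sign, and orthogonality of the characters reduces the double sum to its diagonal with a
    plus sign; one negative copy remains.\<close>
  have "fcoef \<omega> 0 G = complex_of_real (B\<^sup>2 - (\<Sum>n\<in>I. (L2_norm M (d n))\<^sup>2))"
  proof -
    let ?F = "fcoef \<omega> 0"
    have fsum: "?F (\<lambda>t. \<Sum>n\<in>J. g n t) = (\<Sum>n\<in>J. ?F (g n))"
      if "\<And>n. n \<in> J \<Longrightarrow> continuous_on {0..period \<omega>} (g n)" "finite J" for g :: "int \<Rightarrow> real \<Rightarrow> complex" and J
      using that(2,1)
    proof (induction J rule: finite_induct)
      case empty show ?case by (simp add: fcoef_def)
    next
      case (insert n J)
      then show ?case by (simp add: fcoef_add continuous_on_sum)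
    qed
    have self: "L2_ip M (d n) (d n) = fcoef \<omega> n (\<lambda>t. L2_ip M (f t) (d n))" if "n \<in> I" for n
      using d[OF that] sqd[OF that] by (simp add: is_fcoef_def)
    have shift: "fcoef \<omega> 0 (\<lambda>t. E (- n) t * \<phi> t) = fcoef \<omega> n \<phi>" for n \<phi>
      by (simp add: fcoef_def E_def)
    have a: "?F (\<lambda>t. E (- n) t * L2_ip M (f t) (d n)) = of_real ((L2_norm M (d n))\<^sup>2)" if "n \<in> I" for n
      unfolding shift self[OF that, symmetric] L2_ip_self ..
    have b: "?F (\<lambda>t. E n t * cnj (L2_ip M (f t) (d n))) = of_real ((L2_norm M (d n))\<^sup>2)" if "n \<in> I" for n
    proof -
      have "?F (\<lambda>t. E n t * cnj (L2_ip M (f t) (d n))) = fcoef \<omega> (- 0) (\<lambda>t. cnj (E (- n) t * L2_ip M (f t) (d n)))"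
        by (simp add: E_def cis_cnj)
      also have "\<dots> = cnj (?F (\<lambda>t. E (- n) t * L2_ip M (f t) (d n)))" by (rule fcoef_cnj)
      finally show ?thesis using a[OF that] by simp
    qed
    have c: "?F (\<lambda>t. E (n - m) t * z) = (if n = m then z else 0)" for n m z
    proof -
      have "?F (\<lambda>t. E (n - m) t * z) = z * ?F (\<lambda>t. cis (real_of_int (n - m) * \<omega> * t))"
        unfolding fcoef_mult[symmetric] E_def by (simp add: mult.commute)
      then show ?thesis unfolding fcoef_cis[OF w] by simp
    qed
    have one: "?F (\<lambda>t. z) = z" for z
      using c[of 0 0 z] by (simp add: E_def)
    have "?F G = ?F (\<lambda>t. complex_of_real (B\<^sup>2)) - ?F (\<lambda>t. \<Sum>n\<in>I. E (- n) t * L2_ip M (f t) (d n))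
      - ?F (\<lambda>t. \<Sum>n\<in>I. E n t * cnj (L2_ip M (f t) (d n)))
      + ?F (\<lambda>t. \<Sum>n\<in>I. \<Sum>m\<in>I. E (n - m) t * L2_ip M (d n) (d m))"
      unfolding G_def[abs_def]
      by (subst fcoef_add fcoef_diff, (intro continuous_on_add continuous_on_diff continuous_on_sum continuous_on_mult continuous_on_cnj continuous_on_const coef_e cf; assumption)+)+ (rule refl)
    also have "?F (\<lambda>t. \<Sum>n\<in>I. E (- n) t * L2_ip M (f t) (d n)) = (\<Sum>n\<in>I. of_real ((L2_norm M (d n))\<^sup>2))"
      using I by (subst fsum) (auto intro!: continuous_on_mult coef_e cf simp: a)
    also have "?F (\<lambda>t. \<Sum>n\<in>I. E n t * cnj (L2_ip M (f t) (d n))) = (\<Sum>n\<in>I. of_real ((L2_norm M (d n))\<^sup>2))"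
      using I by (subst fsum) (auto intro!: continuous_on_mult continuous_on_cnj coef_e cf simp: b)
    also have "?F (\<lambda>t. \<Sum>n\<in>I. \<Sum>m\<in>I. E (n - m) t * L2_ip M (d n) (d m)) = (\<Sum>n\<in>I. of_real ((L2_norm M (d n))\<^sup>2))"
    proof -
      have "?F (\<lambda>t. \<Sum>n\<in>I. \<Sum>m\<in>I. E (n - m) t * L2_ip M (d n) (d m)) =
          (\<Sum>n\<in>I. \<Sum>m\<in>I. ?F (\<lambda>t. E (n - m) t * L2_ip M (d n) (d m)))"
        using I by (subst fsum) (auto intro!: continuous_on_sum continuous_on_mult coef_e continuous_on_const sum.cong fsum)
      also have "\<dots> = (\<Sum>n\<in>I. L2_ip M (d n) (d n))" unfolding c using I by simp
      finally show ?thesis by (simp only: L2_ip_self)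
    qed
    also have "?F (\<lambda>t. complex_of_real (B\<^sup>2)) = complex_of_real (B\<^sup>2)" by (rule one)
    finally show ?thesis by simp
  qed
  moreover have "Re (fcoef \<omega> 0 G) \<ge> 0"
  proof -
    have "G integrable_on {0..period \<omega>}" by (rule integrable_continuous_real[OF contG])
    then have "(G has_integral integral {0..period \<omega>} G) {0..period \<omega>}" by (rule integrable_integral)
    from has_integral_linear[OF this bounded_linear_Re]
    have "((\<lambda>t. Re (G t)) has_integral Re (integral {0..period \<omega>} G)) {0..period \<omega>}"
      by (simp add: o_def)
    then have "Re (integral {0..period \<omega>} G) \<ge> 0" by (rule has_integral_nonneg) (rule Gpos)
    then show ?thesis using w by (simp add: fcoef_def)
  qed
  ultimately show ?thesis by simp
qed

lemma summable_of_bounded_sums: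
  fixes a :: "nat \<Rightarrow> real"
  assumes "\<And>n. a n \<ge> 0" "\<And>J. finite J \<Longrightarrow> (\<Sum>n\<in>J. a n) \<le> C"
  shows "summable a"
  using assms by (intro bounded_imp_summable[of a C]) auto

text \<open>Bessel's inequality for scalar functions is the one for \<open>L\<^sup>2\<close> of a one-point space.\<close>

lemma riemann_lebesgue:
  fixes g :: "real \<Rightarrow> complex" and k :: "nat \<Rightarrow> int"
  assumes w: "\<omega> > 0" and g: "continuous_on {0..period \<omega>} g" and k: "inj k"
  shows "(\<lambda>N. fcoef \<omega> (k N) g) \<longlonglongrightarrow> 0"
proof -
  define M where "M = count_space {()}"
  have sq: "sq_integrable M h" for h :: "unit \<Rightarrow> complex^3"
    by (simp add: sq_integrable_def M_def integrable_count_space)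
  have n2: "L2_norm M h = norm (h ())" for h :: "unit \<Rightarrow> complex^3"
    by (simp add: L2_norm_def M_def lebesgue_integral_count_space_finite)
  have ip: "L2_ip M h v = hdot (h ()) (v ())" for h v :: "unit \<Rightarrow> complex^3"
    by (simp add: L2_ip_def M_def lebesgue_integral_count_space_finite)
  define a :: "complex^3" where "a = axis 1 1"
  have a: "norm a = 1" by (simp add: a_def norm_eq_1 inner_axis_axis)
  define f where "f t x = g t *s a" for t and x :: unit
  have f: "L2_cont_on M (period \<omega>) f"
    unfolding L2_cont_on_def
  proof (intro ballI conjI sq)
    fix t assume t: "t \<in> {0..period \<omega>}"
    have "L2_norm M (\<lambda>x. f s x - f t x) = cmod (g s - g t)" for s
    proof -
      have "g s *s a - g t *s a = (g s - g t) *s a" by (simp add: vec_eq_iff algebra_simps)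
      then show ?thesis unfolding n2 f_def by (simp only: norm_vscale a)
    qed
    moreover have "(g \<longlongrightarrow> g t) (at t within {0..period \<omega>})" using g t by (simp add: continuous_on_def)
    ultimately show "((\<lambda>s. L2_norm M (\<lambda>x. f s x - f t x)) \<longlongrightarrow> 0) (at t within {0..period \<omega>})"
      using tendsto_norm_zero[OF Lim_null[THEN iffD1]] by simp
  qed
  obtain B where B: "\<And>t. t \<in> {0..period \<omega>} \<Longrightarrow> L2_norm M (f t) \<le> B"
    using L2_cont_on_bounded[OF f] by blast
  have d: "is_fcoef M \<omega> f n (\<lambda>x. fcoef \<omega> n g *s a)" for n
  proof -
    have "fcoef \<omega> n (\<lambda>t. g t * z) = fcoef \<omega> n g * z" for z
      using fcoef_mult[of \<omega> n z g] by (simp add: mult.commute)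
    then show ?thesis unfolding is_fcoef_def ip f_def hdot_scale_left using sq by simp
  qed
  have "(\<Sum>N\<in>J. (cmod (fcoef \<omega> (k N) g))\<^sup>2) \<le> B\<^sup>2" if J: "finite J" for J
  proof -
    have "(\<Sum>N\<in>J. (cmod (fcoef \<omega> (k N) g))\<^sup>2) = (\<Sum>n\<in>k ` J. (L2_norm M (\<lambda>x. fcoef \<omega> n g *s a))\<^sup>2)"
      unfolding n2 norm_vscale a by (subst sum.reindex) (auto intro: inj_on_subset[OF k])
    also have "\<dots> \<le> B\<^sup>2"
      by (rule L2_bessel[OF w f B d]) (use J in auto)
    finally show ?thesis .
  qed
  then have "summable (\<lambda>N. (cmod (fcoef \<omega> (k N) g))\<^sup>2)"
    by (intro summable_of_bounded_sums[where C = "B\<^sup>2"]) auto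
  then have "(\<lambda>N. (cmod (fcoef \<omega> (k N) g))\<^sup>2) \<longlonglongrightarrow> 0" by (rule summable_LIMSEQ_zero)
  then have "(\<lambda>N. sqrt ((cmod (fcoef \<omega> (k N) g))\<^sup>2)) \<longlonglongrightarrow> sqrt 0" by (rule tendsto_real_sqrt)
  then show ?thesis by (simp add: tendsto_norm_zero_iff)
qed

lemma has_vector_derivative_quotient_iff:
  fixes f :: "real \<Rightarrow> 'b::real_normed_vector"
  shows "(f has_vector_derivative D) (at t within S) \<longleftrightarrow>
    ((\<lambda>s. (f s - f t) /\<^sub>R (s - t)) \<longlongrightarrow> D) (at t within S)"
proof -
  let ?r = "\<lambda>y. (1 / norm (y - t)) *\<^sub>R (f y - (f t + (y - t) *\<^sub>R D))"
  have "norm (?r y) = norm ((f y - f t) /\<^sub>R (y - t) - D)" if "y \<noteq> t" for y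
  proof -
    have "(f y - f t) /\<^sub>R (y - t) - D = (1 / (y - t)) *\<^sub>R (f y - (f t + (y - t) *\<^sub>R D))"
      using that by (simp add: scaleR_diff_right scaleR_add_right divide_inverse)
    then show ?thesis by simp
  qed
  then have "((\<lambda>y. norm (?r y)) \<longlongrightarrow> 0) (at t within S) \<longleftrightarrow>
      ((\<lambda>y. norm ((f y - f t) /\<^sub>R (y - t) - D)) \<longlongrightarrow> 0) (at t within S)"
    by (intro Lim_cong_within) auto
  moreover have "(f has_vector_derivative D) (at t within S) \<longleftrightarrow> (?r \<longlongrightarrow> 0) (at t within S)"
    by (simp add: has_vector_derivative_def has_derivative_within bounded_linear_scaleR_left)
  ultimately show ?thesis unfolding tendsto_norm_zero_iff by (simp add: Lim_null[symmetric])
qed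

text \<open>Chernoff's proof: \<open>\<phi> - \<phi>(0) = (exp(i \<omega> t) - 1) g\<close> with \<open>g\<close> continuous, so the partial sums telescope.\<close>

lemma fourier_sum_tendsto:
  assumes w: "\<omega> > 0"
    and der: "\<And>t. t \<in> {0..period \<omega>} \<Longrightarrow> (\<phi> has_vector_derivative \<phi>' t) (at t within {0..period \<omega>})"
    and per: "\<phi> (period \<omega>) = \<phi> 0"
  shows "(\<lambda>N. \<Sum>n\<in>{- int N..int N}. fcoef \<omega> n \<phi>) \<longlonglongrightarrow> \<phi> 0"
proof -
  define T where "T = period \<omega>"
  have T: "T > 0" using w by (simp add: T_def)
  define e where "e t = cis (\<omega> * t) - 1" for t
  have e0: "e 0 = 0" "e T = 0" using w cis_period[of \<omega> 1] by (simp_all add: e_def T_def)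
  have ne: "e t \<noteq> 0" if "0 < t" "t < T" for t
  proof
    assume "e t = 0"
    then have "cos (\<omega> * t) = 1" by (simp add: e_def complex_eq_iff)
    then obtain n :: int where n: "\<omega> * t = n * 2 * pi" by (auto simp: cos_one_2pi_int)
    have "0 < \<omega> * t" "\<omega> * t < 2 * pi" using that w by (auto simp: T_def field_simps)
    then have "0 < real_of_int n" "real_of_int n < 1" using n by (auto simp: zero_less_mult_iff)
    then have "0 < n" "n < 1" by simp_all
    then show False by simp
  qed
  have eder: "(e has_vector_derivative \<i> * complex_of_real \<omega> * cis (\<omega> * t)) (at t within {0..T})" for t
  proof -
    have "((\<lambda>t. exp (t *\<^sub>R (\<i> * complex_of_real \<omega>)) - 1) has_vector_derivative
        (\<i> * complex_of_real \<omega>) * exp (t *\<^sub>R (\<i> * complex_of_real \<omega>)) - 0) (at t within {0..T})"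
      by (intro has_vector_derivative_diff has_vector_derivative_const
          has_vector_derivative_at_within[OF exp_scaleR_has_vector_derivative_left])
    then show ?thesis by (simp add: e_def[abs_def] cis_conv_exp scaleR_conv_of_real[where 'a = complex] mult_ac)
  qed
  have quot: "((\<lambda>s. (f s - f t) / complex_of_real (s - t)) \<longlongrightarrow> D) (at t within {0..T})"
    if "(f has_vector_derivative D) (at t within {0..T})" for f :: "real \<Rightarrow> complex" and D t
  proof -
    have "((\<lambda>s. (f s - f t) /\<^sub>R (s - t)) \<longlongrightarrow> D) (at t within {0..T})"
      using that by (simp add: has_vector_derivative_quotient_iff)
    then show ?thesis by (simp add: scaleR_conv_of_real[where 'a = complex] divide_inverse mult.commute)
  qed
  \<comment> \<open>At the end points the quotient has the form 0/0; its value there is the ratio of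
    the derivatives, and e' = i \<omega> because the exponential equals 1.\<close>
  define g where "g t = (if t = 0 \<or> t = T then \<phi>' t / (\<i> * complex_of_real \<omega>) else (\<phi> t - \<phi> 0) / e t)" for t
  have g: "continuous_on {0..T} g"
    unfolding continuous_on_def
  proof
    fix t assume t: "t \<in> {0..T}"
    show "(g \<longlongrightarrow> g t) (at t within {0..T})"
    proof (cases "t = 0 \<or> t = T")
      case True
      have ph: "\<phi> t = \<phi> 0" "e t = 0" "cis (\<omega> * t) = 1" using True per e0 by (auto simp: T_def e_def)
      have "((\<lambda>s. ((\<phi> s - \<phi> t) / complex_of_real (s - t)) / ((e s - e t) / complex_of_real (s - t))) \<longlongrightarrow>
          \<phi>' t / (\<i> * complex_of_real \<omega> * cis (\<omega> * t))) (at t within {0..T})"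
        using w der t by (intro tendsto_divide quot eder) (auto simp: T_def)
      moreover have "\<forall>\<^sub>F s in at t within {0..T}.
          ((\<phi> s - \<phi> t) / complex_of_real (s - t)) / ((e s - e t) / complex_of_real (s - t)) = g s"
      proof -
        have "\<forall>\<^sub>F s in at t within {0..T}. s \<in> {0..T} \<and> s \<noteq> t"
          by (auto simp: eventually_at_filter)
        \<comment> \<open>Excludes the opposite end point, where \<open>g\<close> is not given by
          the quotient.\<close>
        moreover have "\<forall>\<^sub>F s in at t within {0..T}. dist s t < T"
          using T by (auto simp: eventually_at intro: exI[of _ T])
        ultimately show ?thesis
        proof eventually_elim
          case (elim s)
          then have "s \<noteq> 0" "s \<noteq> T" using True by (auto simp: dist_real_def)
          then show ?case using elim ph by (simp add: g_def)
        qed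
      qed
      ultimately have "(g \<longlongrightarrow> \<phi>' t / (\<i> * complex_of_real \<omega> * cis (\<omega> * t))) (at t within {0..T})"
        by (rule Lim_transform_eventually)
      then show ?thesis using True ph(3) by (auto simp: g_def)
    next
      case False
      have "(\<phi> \<longlongrightarrow> \<phi> t) (at t within {0..T})"
        using has_vector_derivative_continuous[OF der] t by (auto simp: T_def continuous_within)
      moreover have "(e \<longlongrightarrow> e t) (at t within {0..T})"
        using has_vector_derivative_continuous[OF eder] by (auto simp: continuous_within)
      moreover have "e t \<noteq> 0" using False t by (intro ne) auto
      ultimately have "((\<lambda>s. (\<phi> s - \<phi> 0) / e s) \<longlongrightarrow> (\<phi> t - \<phi> 0) / e t) (at t within {0..T})"
        by (intro tendsto_intros)
      moreover have "\<forall>\<^sub>F s in at t within {0..T}. (\<phi> s - \<phi> 0) / e s = g s"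
      proof -
        have "\<forall>\<^sub>F s in at t within {0..T}. s \<noteq> 0" "\<forall>\<^sub>F s in at t within {0..T}. s \<noteq> T"
          using False by (auto intro!: tendsto_imp_eventually_ne[OF tendsto_ident_at])
        then show ?thesis by eventually_elim (simp add: g_def)
      qed
      ultimately show ?thesis using False by (auto simp: g_def intro: Lim_transform_eventually)
    qed
  qed
  have cphi: "continuous_on {0..T} \<phi>"
    using der unfolding T_def by (meson continuous_on_vector_derivative)
  \<comment> \<open>Multiplication by exp(i \<omega> t) lowers the index of a coefficient by one, so
    \<phi> - \<phi>(0) has the coefficients g(n-1) - g(n).\<close>
  have step: "fcoef \<omega> n \<phi> = (if n = 0 then \<phi> 0 else 0) + (fcoef \<omega> (n - 1) g - fcoef \<omega> n g)" for n
  proof -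
    have "fcoef \<omega> n \<phi> - fcoef \<omega> n (\<lambda>t. \<phi> 0) = fcoef \<omega> n (\<lambda>t. \<phi> t - \<phi> 0)"
      using cphi by (intro fcoef_diff[symmetric]) (auto simp: T_def)
    also have "\<dots> = fcoef \<omega> n (\<lambda>t. cis (\<omega> * t) * g t - g t)"
    proof (rule fcoef_cong)
      fix t assume "t \<in> {0<..<period \<omega>}"
      then have "e t \<noteq> 0" "t \<noteq> 0" "t \<noteq> T" using ne by (auto simp: T_def)
      moreover have "cis (\<omega> * t) * g t - g t = e t * g t" by (simp add: e_def algebra_simps)
      ultimately show "\<phi> t - \<phi> 0 = cis (\<omega> * t) * g t - g t" by (simp add: g_def)
    qed
    also have "\<dots> = fcoef \<omega> n (\<lambda>t. cis (\<omega> * t) * g t) - fcoef \<omega> n g"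
      using g unfolding T_def by (intro fcoef_diff continuous_intros)
    also have "fcoef \<omega> n (\<lambda>t. cis (\<omega> * t) * g t) = fcoef \<omega> (n - 1) g"
    proof -
      have "cis (- (real_of_int n * \<omega> * t)) * (cis (\<omega> * t) * g t) = cis (- (real_of_int (n - 1) * \<omega> * t)) * g t" for t
        unfolding mult.assoc[symmetric] cis_mult by (simp add: algebra_simps)
      then show ?thesis unfolding fcoef_def by (simp only:)
    qed
    finally have "fcoef \<omega> n \<phi> = fcoef \<omega> n (\<lambda>t. \<phi> 0) + (fcoef \<omega> (n - 1) g - fcoef \<omega> n g)" by (simp add: algebra_simps)
    moreover have "fcoef \<omega> n (\<lambda>t. \<phi> 0) = (if n = 0 then \<phi> 0 else 0)"
      using fcoef_mult[of \<omega> n "\<phi> 0" "\<lambda>t. cis (real_of_int 0 * \<omega> * t)"] fcoef_cis[OF w, of n 0] by simp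
    ultimately show ?thesis by simp
  qed
  have sum: "(\<Sum>n\<in>{- int N..int N}. fcoef \<omega> n \<phi>) = \<phi> 0 + (fcoef \<omega> (- int N - 1) g - fcoef \<omega> (int N) g)" for N
  proof (induction N)
    case 0
    show ?case by (simp add: step)
  next
    case (Suc N)
    have "{- int (Suc N)..int (Suc N)} = insert (- int (Suc N)) (insert (int (Suc N)) {- int N..int N})" by auto
    then have "(\<Sum>n\<in>{- int (Suc N)..int (Suc N)}. fcoef \<omega> n \<phi>) =
        fcoef \<omega> (- int (Suc N)) \<phi> + (fcoef \<omega> (int (Suc N)) \<phi> + (\<Sum>n\<in>{- int N..int N}. fcoef \<omega> n \<phi>))"
      by simp
    also have "fcoef \<omega> (int (Suc N)) \<phi> = fcoef \<omega> (int N) g - fcoef \<omega> (int (Suc N)) g"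
      using step[of "int (Suc N)"] by simp
    also have "fcoef \<omega> (- int (Suc N)) \<phi> = fcoef \<omega> (- int (Suc N) - 1) g - fcoef \<omega> (- int N - 1) g"
    proof -
      have e: "- int (Suc N) = - int N - 1" by simp
      show ?thesis unfolding e by (subst step) simp
    qed
    finally show ?case using Suc by (simp add: algebra_simps)
  qed
  have g': "continuous_on {0..period \<omega>} g" using g by (simp add: T_def)
  \<comment> \<open>Two coefficients of g survive the telescoping, with indices running to minus and
    plus infinity; both vanish in the limit by \<open>riemann_lebesgue\<close>.\<close>
  have "(\<lambda>N. \<phi> 0 + (fcoef \<omega> (- int N - 1) g - fcoef \<omega> (int N) g)) \<longlonglongrightarrow> \<phi> 0 + (0 - 0)"
    by (intro tendsto_intros riemann_lebesgue[OF w g']) (auto simp: inj_on_def)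
  then show ?thesis unfolding sum by simp
qed

section \<open>Differentiable curves in L2 and convergence of their Fourier series\<close>

definition L2_deriv_on :: "'a measure \<Rightarrow> real \<Rightarrow> (real \<Rightarrow> 'a \<Rightarrow> complex^3) \<Rightarrow> (real \<Rightarrow> 'a \<Rightarrow> complex^3) \<Rightarrow> bool" where
  "L2_deriv_on M T f f' \<longleftrightarrow> (\<forall>t\<in>{0..T}.
     ((\<lambda>s. L2_norm M (\<lambda>x. (f s x - f t x) /\<^sub>R (s - t) - f' t x)) \<longlongrightarrow> 0) (at t within {0..T}))"

text \<open>By Cauchy-Schwarz a derivative in norm is also a derivative of each pairing, so the
  scalar Fourier lemmas apply to the pairings.\<close>

lemma L2_deriv_on_ip:
  assumes d: "L2_deriv_on M T f f'" and f: "L2_cont_on M T f" and f': "L2_cont_on M T f'"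
    and v: "sq_integrable M v" and t: "t \<in> {0..T}"
  shows "((\<lambda>t. L2_ip M (f t) v) has_vector_derivative L2_ip M (f' t) v) (at t within {0..T})"
  unfolding has_vector_derivative_quotient_iff
proof -
  let ?q = "\<lambda>s x. (f s x - f t x) /\<^sub>R (s - t) - f' t x"
  have "((\<lambda>s. (L2_ip M (f s) v - L2_ip M (f t) v) /\<^sub>R (s - t) - L2_ip M (f' t) v) \<longlongrightarrow> 0) (at t within {0..T})"
  proof (rule Lim_null_comparison)
    show "\<forall>\<^sub>F s in at t within {0..T}. norm ((L2_ip M (f s) v - L2_ip M (f t) v) /\<^sub>R (s - t) - L2_ip M (f' t) v)
        \<le> L2_norm M (?q s) * L2_norm M v"
      unfolding eventually_at_filter
    proof (rule always_eventually, intro allI impI)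
      fix s assume s: "s \<noteq> t" "s \<in> {0..T}"
      note sq = L2_cont_onD(1)[OF f s(2)] L2_cont_onD(1)[OF f t] L2_cont_onD(1)[OF f' t]
      have sqd: "sq_integrable M (\<lambda>x. (f s x - f t x) /\<^sub>R (s - t))"
        by (intro sq_integrable_scaleR sq_integrable_diff sq)
      have "L2_ip M (?q s) v = (L2_ip M (f s) v - L2_ip M (f t) v) /\<^sub>R (s - t) - L2_ip M (f' t) v"
        unfolding L2_ip_diff_left[OF sqd sq(3) v] L2_ip_scaleR_left L2_ip_diff_left[OF sq(1,2) v]
        by (simp only: scaleR_conv_of_real[where 'a = complex])
      then show "norm ((L2_ip M (f s) v - L2_ip M (f t) v) /\<^sub>R (s - t) - L2_ip M (f' t) v) \<le> L2_norm M (?q s) * L2_norm M v"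
        using L2_cauchy_schwarz[OF sq_integrable_diff[OF sqd sq(3)] v] by (simp only:)
    qed
    show "((\<lambda>s. L2_norm M (?q s) * L2_norm M v) \<longlongrightarrow> 0) (at t within {0..T})"
      using d t by (intro tendsto_mult_left_zero) (simp add: L2_deriv_on_def)
  qed
  then show "((\<lambda>s. (L2_ip M (f s) v - L2_ip M (f t) v) /\<^sub>R (s - t)) \<longlongrightarrow> L2_ip M (f' t) v) (at t within {0..T})"
    by (rule Lim_null[THEN iffD2])
qed

lemma is_fcoef_deriv:
  assumes w: "\<omega> > 0" and d: "L2_deriv_on M (period \<omega>) f f'"
    and f: "L2_cont_on M (period \<omega>) f" and f': "L2_cont_on M (period \<omega>) f'"
    and per: "AE x in M. f (period \<omega>) x = f 0 x" and c: "is_fcoef M \<omega> f n c"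
  shows "is_fcoef M \<omega> f' n (\<lambda>x. (\<i> * of_int n * complex_of_real \<omega>) *s c x)"
  unfolding is_fcoef_def
proof (intro conjI allI impI)
  show "sq_integrable M (\<lambda>x. (\<i> * of_int n * complex_of_real \<omega>) *s c x)"
    using c by (intro sq_integrable_scale) (simp add: is_fcoef_def)
  fix v assume v: "sq_integrable M v"
  have T: "period \<omega> \<in> {0..period \<omega>}" "0 \<in> {0..period \<omega>}" using w by auto
  have "fcoef \<omega> n (\<lambda>t. L2_ip M (f' t) v) = \<i> * of_int n * complex_of_real \<omega> * fcoef \<omega> n (\<lambda>t. L2_ip M (f t) v)"
  proof (rule fcoef_deriv[OF w L2_deriv_on_ip[OF d f f' v] L2_cont_on_ip[OF f' v]])
    show "L2_ip M (f (period \<omega>)) v = L2_ip M (f 0) v"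
      by (rule L2_ip_cong_AE[OF per]) (use L2_cont_onD(1)[OF f] T v in \<open>auto simp: sq_integrable_def\<close>)
  qed
  then show "L2_ip M (\<lambda>x. (\<i> * of_int n * complex_of_real \<omega>) *s c x) v = fcoef \<omega> n (\<lambda>t. L2_ip M (f' t) v)"
    using c v by (simp add: L2_ip_scale_left is_fcoef_def)
qed

text \<open>Bessel's inequality for \<open>f'\<close> makes the Fourier series of \<open>f\<close> absolutely convergent.\<close>

lemma L2_fourier_summable:
  assumes w: "\<omega> > 0" and d: "L2_deriv_on M (period \<omega>) f f'"
    and f: "L2_cont_on M (period \<omega>) f" and f': "L2_cont_on M (period \<omega>) f'"
    and per: "AE x in M. f (period \<omega>) x = f 0 x" and c: "\<And>n. is_fcoef M \<omega> f n (c n)"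
  obtains s where "sq_integrable M s"
    "(\<lambda>N. L2_norm M (\<lambda>x. (\<Sum>l=2..N. c (int l) x) - s x)) \<longlonglongrightarrow> 0"
proof -
  have sqc: "sq_integrable M (c n)" for n using c[of n] by (simp add: is_fcoef_def)
  obtain B where B: "\<And>t. t \<in> {0..period \<omega>} \<Longrightarrow> L2_norm M (f' t) \<le> B"
    using L2_cont_on_bounded[OF f'] by blast
  define D where "D l = real l * \<omega> * L2_norm M (c (int l))" for l
  have D: "L2_norm M (\<lambda>x. (\<i> * of_int (int l) * complex_of_real \<omega>) *s c (int l) x) = D l" for l
    using w by (simp add: L2_norm_scale D_def norm_mult)
  have "(\<Sum>l\<in>J. (D l)\<^sup>2) \<le> B\<^sup>2" if J: "finite J" for J
  proof -
    have "(\<Sum>l\<in>J. (D l)\<^sup>2) = (\<Sum>n\<in>int ` J. (L2_norm M (\<lambda>x. (\<i> * of_int n * complex_of_real \<omega>) *s c n x))\<^sup>2)"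
      unfolding D[symmetric] by (subst sum.reindex) auto
    also have "\<dots> \<le> B\<^sup>2"
      by (rule L2_bessel[OF w f' B is_fcoef_deriv[OF w d f f' per c]]) (use J in auto)
    finally show ?thesis .
  qed
  then have sD: "summable (\<lambda>l. (D l)\<^sup>2)"
    by (intro summable_of_bounded_sums[where C = "B\<^sup>2"]) auto
  have "summable (\<lambda>l. inverse (real l ^ 2))"
    by (rule inverse_power_summable) simp
  then have "summable (\<lambda>l. (D l)\<^sup>2 + (1 / \<omega>\<^sup>2) * inverse (real l ^ 2))"
    by (intro summable_add sD summable_mult)
  then have sc: "summable (\<lambda>l. L2_norm M (c (int l)))"
  proof (rule summable_comparison_test'[where N = 1])
    fix l :: nat assume l: "l \<ge> 1"
    define a where "a = L2_norm M (c (int l))"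
    define k where "k = real l * \<omega>"
    have k: "k > 0" using l w by (simp add: k_def)
    \<comment> \<open>The arithmetic-geometric inequality splits the norm into the square of the
      corresponding coefficient of f', summable by Bessel, and a multiple of 1/l^2.\<close>
    have "2 * (k * a) * (1 / k) \<le> (k * a)\<^sup>2 + (1 / k)\<^sup>2" by (rule sum_squares_bound)
    moreover have "(k * a) * (1 / k) = a" using k by simp
    moreover have "a \<ge> 0" by (simp add: a_def)
    ultimately have "a \<le> (k * a)\<^sup>2 + (1 / k)\<^sup>2" by linarith
    moreover have "(1 / k)\<^sup>2 = (1 / \<omega>\<^sup>2) * inverse (real l ^ 2)"
      by (simp add: k_def power_mult_distrib power_divide field_simps)
    ultimately show "norm (L2_norm M (c (int l))) \<le> (D l)\<^sup>2 + (1 / \<omega>\<^sup>2) * inverse (real l ^ 2)"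
      by (simp add: a_def k_def D_def)
  qed
  define P where "P N x = (\<Sum>l=2..N. c (int l) x)" for N x
  have sqP: "sq_integrable M (P N)" for N
    unfolding P_def[abs_def] by (intro sq_integrable_sum sqc)
  have diff: "L2_norm M (\<lambda>x. P m x - P n x) \<le> norm (\<Sum>l\<in>{Suc n..<Suc m}. L2_norm M (c (int l)))" if "n \<le> m" "n \<ge> 2" for m n
  proof -
    have "{2..m} = {2..n} \<union> {Suc n..<Suc m}" using that by auto
    then have "P m x = P n x + (\<Sum>l\<in>{Suc n..<Suc m}. c (int l) x)" for x
      unfolding P_def by (simp only:) (rule sum.union_disjoint, auto)
    then have "L2_norm M (\<lambda>x. P m x - P n x) = L2_norm M (\<lambda>x. \<Sum>l\<in>{Suc n..<Suc m}. c (int l) x)" by simp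
    also have "\<dots> \<le> (\<Sum>l\<in>{Suc n..<Suc m}. L2_norm M (c (int l)))" by (rule L2_norm_sum[OF sqc])
    finally show ?thesis by simp
  qed
  have "\<exists>N. \<forall>m\<ge>N. \<forall>n\<ge>N. L2_norm M (\<lambda>x. P m x - P n x) \<le> r" if r: "r > 0" for r
  proof -
    obtain N where N: "\<And>m n. m \<ge> N \<Longrightarrow> norm (\<Sum>l\<in>{m..<n}. L2_norm M (c (int l))) < r"
      using sc r unfolding summable_Cauchy by blast
    have *: "L2_norm M (\<lambda>x. P m x - P n x) \<le> r" if "n \<ge> max N 2" "n \<le> m" for m n
      using order_trans[OF diff[of n m] less_imp_le[OF N[of "Suc n" "Suc m"]]] that by simp
    show ?thesis
    proof (intro exI allI impI)
      fix m n assume "m \<ge> max N 2" "n \<ge> max N 2"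
      then show "L2_norm M (\<lambda>x. P m x - P n x) \<le> r"
        using *[of n m] *[of m n] L2_norm_minus_commute[of M "P m" "P n"] by (cases "n \<le> m") auto
    qed
  qed
  from L2_complete[OF sqP this] obtain s where s: "sq_integrable M s" "(\<lambda>N. L2_norm M (\<lambda>x. P N x - s x)) \<longlonglongrightarrow> 0"
    by blast
  show ?thesis by (rule that[OF s(1) s(2)[unfolded P_def]])
qed

section \<open>Weak curl and tangential trace\<close>

lemma bdot_hdot: "bdot v x = hdot v (cvec x)"
  by (simp add: bdot_def hdot_def cvec_def)

lemma hdot_cvec: "hdot (cvec a) (cvec b) = complex_of_real (a \<bullet> b)"
  by (simp add: hdot_def cvec_def inner_vec_def)

lemma norm_cvec [simp]: "norm (cvec a) = norm a"
  by (simp add: cvec_def norm_vec_def L2_set_def)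

lemma cvec_zero [simp]: "cvec 0 = 0"
  by (simp add: cvec_def vec_eq_iff)

lemma measurable_cvec [measurable (raw)]:
  "f \<in> borel_measurable M \<Longrightarrow> (\<lambda>x. cvec (f x)) \<in> borel_measurable M"
  by (auto simp: measurable_vec_iff cvec_def
      intro!: borel_measurable_continuous_on[where f = complex_of_real] continuous_on_of_real continuous_on_id)

lemma measurable_ccross [measurable (raw)]:
  assumes "f \<in> borel_measurable M" "g \<in> borel_measurable M"
  shows "(\<lambda>x. ccross (f x) (g x)) \<in> borel_measurable M"
proof -
  have "(\<lambda>x. ccross (f x) (g x) $ i) \<in> borel_measurable M" for i
    using assms exhaust_3[of i] unfolding measurable_vec_iff
    by (auto simp: ccross_def vector_3 intro!: borel_measurable_diff borel_measurable_times)
  then show ?thesis by (simp add: measurable_vec_iff)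
qed

lemma measurable_cross3:
  fixes f g :: "'a \<Rightarrow> real^3"
  assumes "f \<in> borel_measurable M" "g \<in> borel_measurable M"
  shows "(\<lambda>x. cross3 (f x) (g x)) \<in> borel_measurable M"
proof -
  have "(\<lambda>x. cross3 (f x) (g x) $ i) \<in> borel_measurable M" for i
    using assms exhaust_3[of i] unfolding measurable_vec_iff
    by (auto simp: cross3_def vector_3 intro!: borel_measurable_diff borel_measurable_times)
  then show ?thesis by (simp add: measurable_vec_iff)
qed

lemma norm_cross3_le: "norm (cross3 a b) \<le> norm a * norm b"
proof (rule power2_le_imp_le)
  show "(norm (cross3 a b))\<^sup>2 \<le> (norm a * norm b)\<^sup>2"
    using norm_cross_dot[of a b] zero_le_power2[of "a \<bullet> b"] by linarith
qed simp

lemma bdot_ccross: "bdot (ccross (cvec n) g) p = hdot g (cvec (cross3 p n))"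
  by (simp add: bdot_def hdot_def ccross_def cvec_def cross3_def sum_3 vector_3 algebra_simps)

text \<open>The double cross product formula. For a unit normal and tangential \<open>g\<close> the
  result is -g, so \<open>g\<close> can be recovered from its cross product with the normal.\<close>

lemma ccross_twice:
  "ccross (cvec n) (ccross (cvec n) g) = bdot g n *s cvec n - complex_of_real (n \<bullet> n) *s g"
  by (simp add: bdot_def ccross_def cvec_def sum_3 vector_3 vec_eq_iff forall_3 inner_vec_def algebra_simps)

text \<open>A crude bound: each component is at most 2 |n| |g|, and 2 sqrt(3) \<le> 4.\<close>

lemma norm_ccross_le: "norm (ccross (cvec n) g) \<le> 4 * norm n * norm g"
proof -
  have c: "cmod (complex_of_real (n $ i) * g $ j) \<le> norm n * norm g" for i j
    using component_le_norm_cart[of n i] Finite_Cartesian_Product.norm_nth_le[of g j]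
    by (simp add: norm_mult mult_mono)
  have d: "cmod (complex_of_real (n $ i) * g $ j - complex_of_real (n $ k) * g $ l) \<le> 2 * (norm n * norm g)" for i j k l
    using norm_triangle_ineq4[of "complex_of_real (n $ i) * g $ j" "complex_of_real (n $ k) * g $ l"] c[of i j] c[of k l] by linarith
  have "norm (ccross (cvec n) g) = sqrt (\<Sum>i\<in>UNIV. (cmod (ccross (cvec n) g $ i))\<^sup>2)"
    by (simp add: norm_vec_def L2_set_def)
  also have "\<dots> \<le> sqrt (\<Sum>i\<in>(UNIV::3 set). (2 * (norm n * norm g))\<^sup>2)"
  proof (intro real_sqrt_le_mono sum_mono power_mono norm_ge_zero)
    fix i :: 3
    show "cmod (ccross (cvec n) g $ i) \<le> 2 * (norm n * norm g)"
      using exhaust_3[of i] by (auto simp: ccross_def cvec_def vector_3 d)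
  qed
  also have "\<dots> = sqrt (3 * (2 * (norm n * norm g))\<^sup>2)" by simp
  also have "\<dots> \<le> sqrt ((4 * (norm n * norm g))\<^sup>2)"
    by (intro real_sqrt_le_mono) (simp add: power_mult_distrib)
  also have "\<dots> = 4 * norm n * norm g"
    by (simp only: real_sqrt_abs abs_mult abs_norm_cancel abs_numeral mult.assoc)
  finally show ?thesis .
qed

lemma sq_integrable_compact:
  assumes M: "tame M" and w: "continuous_on UNIV w" and K: "compact K" "\<And>x. x \<notin> K \<Longrightarrow> w x = 0"
  shows "sq_integrable M (\<lambda>x. cvec (w x))"
  unfolding sq_integrable_def
proof
  have [measurable]: "w \<in> borel_measurable M"
    by (rule tame_measurable[OF M borel_measurable_continuous_onI[OF w]])
  show "(\<lambda>x. cvec (w x)) \<in> borel_measurable M" by measurable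
  have "bounded (w ` K)"
    by (intro compact_imp_bounded compact_continuous_image continuous_on_subset[OF w] K(1)) simp
  then obtain B where B: "\<And>x. x \<in> K \<Longrightarrow> norm (w x) \<le> B" unfolding bounded_iff by blast
  have KM: "K \<inter> space M \<in> sets M" by (rule tame_sets[OF M borel_compact[OF K(1)]])
  have "emeasure M (K \<inter> space M) < \<infinity>" using M K(1) by (simp add: tame_def)
  then have "integrable M (\<lambda>x. B\<^sup>2 * indicator (K \<inter> space M) x)"
    using KM by (intro integrable_mult_right integrable_real_indicator)
  then show "integrable M (\<lambda>x. (norm (cvec (w x)))\<^sup>2)"
  proof (rule Bochner_Integration.integrable_bound)
    show "(\<lambda>x. (norm (cvec (w x)))\<^sup>2) \<in> borel_measurable M" by measurable
    show "AE x in M. norm ((norm (cvec (w x)))\<^sup>2) \<le> norm (B\<^sup>2 * indicator (K \<inter> space M) x)"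
    proof (rule AE_I2)
      fix x assume x: "x \<in> space M"
      show "norm ((norm (cvec (w x)))\<^sup>2) \<le> norm (B\<^sup>2 * indicator (K \<inter> space M) x)"
        using B[of x] K(2)[of x] x by (cases "x \<in> K") (auto intro: power_mono)
    qed
  qed
qed

lemma sq_integrable_test:
  assumes "tame M" "\<phi> \<in> test_fields"
  shows "sq_integrable M (\<lambda>x. cvec (\<phi> x))" "sq_integrable M (\<lambda>x. cvec (classical_curl \<phi> x))"
proof -
  have K: "compact (fsupport \<phi>)" using assms(2) by (simp add: test_fields_def)
  show "sq_integrable M (\<lambda>x. cvec (\<phi> x))" "sq_integrable M (\<lambda>x. cvec (classical_curl \<phi> x))"
    using off_fsupport[of _ \<phi>]
    by (intro sq_integrable_compact[OF assms(1) _ K] test_field_continuous[OF assms(2)]; simp)+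
qed

section \<open>Uniqueness of weak curls and tangential traces\<close>

lemma has_curl_iff:
  "has_curl S v c \<longleftrightarrow> sq_integrable (lebesgue_on S) v \<and> sq_integrable (lebesgue_on S) c \<and>
     (\<forall>\<phi>\<in>test_fields. fsupport \<phi> \<subseteq> S \<longrightarrow>
        L2_ip (lebesgue_on S) c (\<lambda>x. cvec (\<phi> x)) = L2_ip (lebesgue_on S) v (\<lambda>x. cvec (classical_curl \<phi> x)))"
  by (simp add: has_curl_def L2_ip_def bdot_hdot)

text \<open>The difference of two weak curls annihilates all test fields supported in S, so the
  fundamental lemma applies on S. This makes the choice hidden in \<open>curl\<close>
  harmless.\<close>

lemma has_curl_unique:
  assumes S: "open S" and c: "has_curl S v c" "has_curl S v c'"
  shows "AE x in lebesgue_on S. c x = c' x"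
proof -
  note tame = tame_lebesgue_on[OF S]
  have sq: "sq_integrable (lebesgue_on S) c" "sq_integrable (lebesgue_on S) c'" using c by (auto simp: has_curl_def)
  have "AE x in lebesgue_on S. c x - c' x = 0"
  proof (rule fundamental_lemma[OF tame S])
    show "AE x in lebesgue_on S. x \<in> S" by (rule AE_I2) (simp add: space_restrict_space)
    show "sq_integrable (lebesgue_on S) (\<lambda>x. c x - c' x)" by (rule sq_integrable_diff[OF sq])
    fix \<phi> assume \<phi>: "\<phi> \<in> test_fields" "fsupport \<phi> \<subseteq> S"
    have "L2_ip (lebesgue_on S) (\<lambda>x. c x - c' x) (\<lambda>x. cvec (\<phi> x)) = 0"
      using c \<phi> unfolding L2_ip_diff_left[OF sq sq_integrable_test(1)[OF tame \<phi>(1)]] has_curl_iff by simp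
    then show "(LINT x|lebesgue_on S. bdot (c x - c' x) (\<phi> x)) = 0" by (simp add: L2_ip_def bdot_hdot)
  qed
  then show ?thesis by eventually_elim simp
qed

text \<open>The common hypotheses for the two boundary pieces. Closedness of the rest of the
  boundary makes its complement the open set \<open>W\<close> needed in
  \<open>fundamental_lemma\<close>.\<close>

definition trace_geometry :: "(real^3) set \<Rightarrow> (real^3 \<Rightarrow> real^3) \<Rightarrow> (real^3) set \<Rightarrow> bool" where
  "trace_geometry S n G \<longleftrightarrow> open S \<and> tame (surface G) \<and> closed (frontier S - G) \<and>
     n \<in> borel_measurable (surface G) \<and> (AE x in surface G. norm (n x) = 1)"

text \<open>The trace relation with the curl as an explicit argument, and with the triple product
  in the boundary term rotated so that the trace is paired with a fixed square integrable field.\<close>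

definition has_tr ::
  "(real^3) set \<Rightarrow> (real^3 \<Rightarrow> real^3) \<Rightarrow> (real^3) set \<Rightarrow>
   (real^3 \<Rightarrow> complex^3) \<Rightarrow> (real^3 \<Rightarrow> complex^3) \<Rightarrow> (real^3 \<Rightarrow> complex^3) \<Rightarrow> bool" where
  "has_tr S n G v c g \<longleftrightarrow>
     sq_integrable (surface G) g \<and>
     (AE x in surface G. bdot (g x) (n x) = 0) \<and>
     (\<forall>\<phi>\<in>test_fields. fsupport \<phi> \<inter> (frontier S - G) = {} \<longrightarrow>
        L2_ip (lebesgue_on S) c (\<lambda>x. cvec (\<phi> x)) - L2_ip (lebesgue_on S) v (\<lambda>x. cvec (classical_curl \<phi> x)) =
        L2_ip (surface G) g (\<lambda>x. cvec (cross3 (\<phi> x) (n x))))"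

lemma has_trD:
  assumes "has_tr S n G v c g" "\<phi> \<in> test_fields" "fsupport \<phi> \<inter> (frontier S - G) = {}"
  shows "L2_ip (lebesgue_on S) c (\<lambda>x. cvec (\<phi> x)) - L2_ip (lebesgue_on S) v (\<lambda>x. cvec (classical_curl \<phi> x)) =
        L2_ip (surface G) g (\<lambda>x. cvec (cross3 (\<phi> x) (n x)))"
  using assms by (simp add: has_tr_def)

lemma curl_has_curl: "has_curl S v c \<Longrightarrow> has_curl S v (curl S v)"
  unfolding curl_def using someI[of "\<lambda>c. has_curl S v c" c] by simp

text \<open>Weak curls are equal almost everywhere, so the pairing does not see which representative
  \<open>curl\<close> has picked, and any known curl \<open>c\<close> may take its place.\<close>

lemma has_ttrace_iff:
  assumes S: "open S" and c: "has_curl S v c"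
  shows "has_ttrace S n G v g \<longleftrightarrow> has_tr S n G v c g"
proof -
  note cc = curl_has_curl[OF c]
  have "(LINT x|lebesgue_on S. bdot (curl S v x) (\<phi> x)) = L2_ip (lebesgue_on S) c (\<lambda>x. cvec (\<phi> x))"
    if "\<phi> \<in> test_fields" for \<phi>
    unfolding bdot_hdot L2_ip_def[symmetric]
    using has_curl_unique[OF S cc c] cc c sq_integrable_test[OF tame_lebesgue_on[OF S] that]
    by (intro L2_ip_cong_AE) (auto simp: has_curl_def sq_integrable_def)
  then show ?thesis
    unfolding has_ttrace_def has_tr_def bdot_ccross by (simp add: L2_ip_def bdot_hdot)
qed

lemma sq_integrable_cross_test:
  assumes G: "trace_geometry S n G" and \<phi>: "\<phi> \<in> test_fields"
  shows "sq_integrable (surface G) (\<lambda>x. cvec (cross3 (\<phi> x) (n x)))"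
proof -
  have t: "tame (surface G)" and n: "n \<in> borel_measurable (surface G)" "AE x in surface G. norm (n x) = 1"
    using G by (auto simp: trace_geometry_def)
  have \<phi>m: "\<phi> \<in> borel_measurable (surface G)"
    by (rule tame_measurable[OF t borel_measurable_continuous_onI[OF test_field_continuous(1)[OF \<phi>]]])
  show ?thesis
  proof (rule sq_integrable_bound[OF sq_integrable_test(1)[OF t \<phi>], of _ 1])
    show "(\<lambda>x. cvec (cross3 (\<phi> x) (n x))) \<in> borel_measurable (surface G)"
      by (intro measurable_cvec measurable_cross3 \<phi>m n)
    show "AE x in surface G. norm (cvec (cross3 (\<phi> x) (n x))) \<le> 1 * norm (cvec (\<phi> x))"
      using n(2) by eventually_elim (use norm_cross3_le in \<open>simp, metis mult.right_neutral\<close>)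
  qed
qed

text \<open>Test fields that avoid the rest of the boundary still determine a field on G, so n
  \<times> (g - g') vanishes almost everywhere. A second cross product with n recovers g - g', which
  is tangential, up to its sign.\<close>

lemma has_tr_unique:
  assumes G: "trace_geometry S n G" and g: "has_tr S n G v c g" "has_tr S n G v c g'"
  shows "AE x in surface G. g x = g' x"
proof -
  have t: "tame (surface G)" and n: "n \<in> borel_measurable (surface G)" "AE x in surface G. norm (n x) = 1"
    and cl: "closed (frontier S - G)"
    using G by (auto simp: trace_geometry_def)
  have sq: "sq_integrable (surface G) g" "sq_integrable (surface G) g'" using g by (auto simp: has_tr_def)
  note sqd = sq_integrable_diff[OF sq]
  have sqk: "sq_integrable (surface G) (\<lambda>x. ccross (cvec (n x)) (g x - g' x))"
  proof (rule sq_integrable_bound[OF sqd, of _ 4])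
    show "(\<lambda>x. ccross (cvec (n x)) (g x - g' x)) \<in> borel_measurable (surface G)"
      using sqd n(1) by (intro measurable_ccross measurable_cvec) (auto simp: sq_integrable_def)
    show "AE x in surface G. norm (ccross (cvec (n x)) (g x - g' x)) \<le> 4 * norm (g x - g' x)"
      using n(2) by eventually_elim (use norm_ccross_le in \<open>metis mult.right_neutral\<close>)
  qed
  have "AE x in surface G. ccross (cvec (n x)) (g x - g' x) = 0"
  proof (rule fundamental_lemma[OF t _ _ sqk])
    show "open (- (frontier S - G))" by (rule open_Compl[OF cl])
    show "AE x in surface G. x \<in> - (frontier S - G)" by (rule AE_I2) simp
    fix \<phi> assume \<phi>: "\<phi> \<in> test_fields" "fsupport \<phi> \<subseteq> - (frontier S - G)"
    then have dis: "fsupport \<phi> \<inter> (frontier S - G) = {}" by blast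
    have "L2_ip (surface G) (\<lambda>x. g x - g' x) (\<lambda>x. cvec (cross3 (\<phi> x) (n x))) = 0"
      unfolding L2_ip_diff_left[OF sq sq_integrable_cross_test[OF G \<phi>(1)]]
      using has_trD[OF g(1) \<phi>(1) dis] has_trD[OF g(2) \<phi>(1) dis] by simp
    then show "(LINT x|surface G. bdot (ccross (cvec (n x)) (g x - g' x)) (\<phi> x)) = 0"
      by (simp add: L2_ip_def bdot_ccross)
  qed
  moreover have "AE x in surface G. bdot (g x) (n x) = 0" "AE x in surface G. bdot (g' x) (n x) = 0"
    using g by (auto simp: has_tr_def)
  ultimately show ?thesis
    using n(2)
  proof eventually_elim
    case (elim x)
    have "bdot (g x - g' x) (n x) = 0" using elim by (simp add: bdot_hdot hdot_diff_left)
    then have "complex_of_real (n x \<bullet> n x) *s (g x - g' x) = - ccross (cvec (n x)) 0"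
      using ccross_twice[of "n x" "g x - g' x"] elim(1) by simp
    moreover have "n x \<bullet> n x = 1" using elim by (simp add: norm_eq_1)
    ultimately show ?case by (simp add: ccross_def vec_eq_iff forall_3 vector_3)
  qed
qed

section \<open>Linearity, conjugation and compactly supported fields\<close>

lemma has_curl_add:
  assumes S: "open S" and "has_curl S v c" "has_curl S v' c'"
  shows "has_curl S (\<lambda>x. v x + v' x) (\<lambda>x. c x + c' x)"
  using assms sq_integrable_test[OF tame_lebesgue_on[OF S]]
  by (simp add: has_curl_iff sq_integrable_add L2_ip_add_left)

lemma has_curl_scale:
  assumes "has_curl S v c" shows "has_curl S (\<lambda>x. k *s v x) (\<lambda>x. k *s c x)"
  using assms by (simp add: has_curl_iff sq_integrable_scale L2_ip_scale_left)

lemma has_tr_add: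
  assumes G: "trace_geometry S n G" and c: "has_curl S v c" "has_curl S v' c'"
    and g: "has_tr S n G v c g" "has_tr S n G v' c' g'"
  shows "has_tr S n G (\<lambda>x. v x + v' x) (\<lambda>x. c x + c' x) (\<lambda>x. g x + g' x)"
  unfolding has_tr_def
proof (intro conjI ballI impI)
  have S: "open S" using G by (simp add: trace_geometry_def)
  show "sq_integrable (surface G) (\<lambda>x. g x + g' x)" using g by (auto simp: has_tr_def intro: sq_integrable_add)
  have "AE x in surface G. bdot (g x) (n x) = 0" "AE x in surface G. bdot (g' x) (n x) = 0"
    using g by (auto simp: has_tr_def)
  then show "AE x in surface G. bdot (g x + g' x) (n x) = 0"
    by eventually_elim (simp add: bdot_hdot hdot_add_left)
  fix \<phi> assume \<phi>: "\<phi> \<in> test_fields" "fsupport \<phi> \<inter> (frontier S - G) = {}"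
  have sq: "sq_integrable (lebesgue_on S) c" "sq_integrable (lebesgue_on S) c'"
    "sq_integrable (lebesgue_on S) v" "sq_integrable (lebesgue_on S) v'"
    "sq_integrable (surface G) g" "sq_integrable (surface G) g'"
    using c g by (auto simp: has_curl_def has_tr_def)
  note t = sq_integrable_test[OF tame_lebesgue_on[OF S] \<phi>(1)] sq_integrable_cross_test[OF G \<phi>(1)]
  show "L2_ip (lebesgue_on S) (\<lambda>x. c x + c' x) (\<lambda>x. cvec (\<phi> x)) -
      L2_ip (lebesgue_on S) (\<lambda>x. v x + v' x) (\<lambda>x. cvec (classical_curl \<phi> x)) =
      L2_ip (surface G) (\<lambda>x. g x + g' x) (\<lambda>x. cvec (cross3 (\<phi> x) (n x)))"
    unfolding L2_ip_add_left[OF sq(1,2) t(1)] L2_ip_add_left[OF sq(3,4) t(2)] L2_ip_add_left[OF sq(5,6) t(3)]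
    using g \<phi> by (simp add: has_tr_def algebra_simps)
qed

lemma has_tr_scale:
  assumes g: "has_tr S n G v c g"
  shows "has_tr S n G (\<lambda>x. k *s v x) (\<lambda>x. k *s c x) (\<lambda>x. k *s g x)"
  using assms unfolding has_tr_def L2_ip_scale_left right_diff_distrib[symmetric]
  by (auto simp: sq_integrable_scale bdot_hdot hdot_scale_left)

definition cnj_vec :: "complex^3 \<Rightarrow> complex^3" where
  "cnj_vec v = (\<chi> i. cnj (v $ i))"

lemma norm_cnj_vec [simp]: "norm (cnj_vec v) = norm v"
  by (simp add: cnj_vec_def norm_vec_def)

lemma hdot_cnj_vec: "hdot (cnj_vec v) w = cnj (hdot v (cnj_vec w))"
  by (simp add: hdot_def cnj_vec_def)

lemma cnj_vec_cvec [simp]: "cnj_vec (cvec x) = cvec x"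
  by (simp add: cnj_vec_def cvec_def)

lemma sq_integrable_cnj_vec:
  assumes "sq_integrable M f" shows "sq_integrable M (\<lambda>x. cnj_vec (f x))"
  unfolding sq_integrable_def
proof
  have "(\<lambda>x. f x $ i) \<in> borel_measurable M" for i
    using assms by (auto simp: sq_integrable_def measurable_vec_iff)
  then have "(\<lambda>x. cnj (f x $ i)) \<in> borel_measurable M" for i
    by (rule borel_measurable_continuous_on[OF continuous_on_cnj[OF continuous_on_id]])
  then show "(\<lambda>x. cnj_vec (f x)) \<in> borel_measurable M" by (simp add: measurable_vec_iff cnj_vec_def)
qed (use assms in \<open>simp add: sq_integrable_def\<close>)

lemma L2_ip_cnj_vec: "L2_ip M (\<lambda>x. cnj_vec (f x)) w = cnj (L2_ip M f (\<lambda>x. cnj_vec (w x)))"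
  unfolding L2_ip_def hdot_cnj_vec by (rule Bochner_Integration.integral_cnj)

lemma has_curl_cnj_vec:
  assumes "has_curl S v c" shows "has_curl S (\<lambda>x. cnj_vec (v x)) (\<lambda>x. cnj_vec (c x))"
  using assms by (simp add: has_curl_iff sq_integrable_cnj_vec L2_ip_cnj_vec)

lemma has_tr_cnj_vec:
  assumes "has_tr S n G v c g"
  shows "has_tr S n G (\<lambda>x. cnj_vec (v x)) (\<lambda>x. cnj_vec (c x)) (\<lambda>x. cnj_vec (g x))"
  using assms unfolding has_tr_def L2_ip_cnj_vec complex_cnj_diff[symmetric]
  by (auto simp: sq_integrable_cnj_vec bdot_hdot hdot_cnj_vec)

lemma L2_ip_lebesgue_on_cvec:
  assumes S: "open S" and sub: "\<And>x. x \<notin> S \<Longrightarrow> a x \<bullet> b x = 0"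
    and ab: "(\<lambda>x. a x \<bullet> b x) \<in> borel_measurable borel"
  shows "L2_ip (lebesgue_on S) (\<lambda>x. cvec (a x)) (\<lambda>x. cvec (b x)) = complex_of_real (LINT x|lborel. a x \<bullet> b x)"
proof -
  have "L2_ip (lebesgue_on S) (\<lambda>x. cvec (a x)) (\<lambda>x. cvec (b x)) = complex_of_real (LINT x|lebesgue_on S. a x \<bullet> b x)"
    unfolding L2_ip_def hdot_cvec by (rule integral_complex_of_real)
  also have "(LINT x|lebesgue_on S. a x \<bullet> b x) = (LINT x|lebesgue. indicator S x *\<^sub>R (a x \<bullet> b x))"
    using S by (intro integral_restrict_space) (simp add: borel_open)
  also have "\<dots> = (LINT x|lebesgue. a x \<bullet> b x)"
    using sub by (intro Bochner_Integration.integral_cong) (auto simp: indicator_def)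
  also have "\<dots> = (LINT x|lborel. a x \<bullet> b x)"
    using ab by (intro integral_completion) simp
  finally show ?thesis .
qed

text \<open>Only \<phi> is supported in S, while \<psi> may be nonzero on the boundary. Since \<phi>
  vanishes outside S, both integrals extend to the whole space, where \<open>curl_by_parts\<close>
  applies. This gives the weak curl and the zero trace of \<phi> at once.\<close>

lemma test_green:
  assumes S: "open S" and \<phi>: "\<phi> \<in> test_fields" "fsupport \<phi> \<subseteq> S" and \<psi>: "\<psi> \<in> test_fields"
  shows "L2_ip (lebesgue_on S) (\<lambda>x. cvec (classical_curl \<phi> x)) (\<lambda>x. cvec (\<psi> x)) =
    L2_ip (lebesgue_on S) (\<lambda>x. cvec (\<phi> x)) (\<lambda>x. cvec (classical_curl \<psi> x))"
proof -
  have m: "(\<lambda>x. classical_curl \<phi> x \<bullet> \<psi> x) \<in> borel_measurable borel" "(\<lambda>x. \<phi> x \<bullet> classical_curl \<psi> x) \<in> borel_measurable borel"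
    by (intro borel_measurable_continuous_onI continuous_on_inner test_field_continuous \<phi> \<psi>)+
  have off: "classical_curl \<phi> x \<bullet> \<psi> x = 0" "\<phi> x \<bullet> classical_curl \<psi> x = 0" if "x \<notin> S" for x
  proof -
    have "x \<notin> fsupport \<phi>" using \<phi>(2) that by blast
    then show "classical_curl \<phi> x \<bullet> \<psi> x = 0" "\<phi> x \<bullet> classical_curl \<psi> x = 0" by (simp_all add: off_fsupport)
  qed
  show ?thesis
    using L2_ip_lebesgue_on_cvec[OF S off(1) m(1)] L2_ip_lebesgue_on_cvec[OF S off(2) m(2)]
      curl_by_parts[OF \<phi>(1) \<psi>] by simp
qed

lemma test_has_curl:
  assumes S: "open S" and \<phi>: "\<phi> \<in> test_fields" "fsupport \<phi> \<subseteq> S"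
  shows "has_curl S (\<lambda>x. cvec (\<phi> x)) (\<lambda>x. cvec (classical_curl \<phi> x))"
  unfolding has_curl_iff using sq_integrable_test[OF tame_lebesgue_on[OF S] \<phi>(1)] test_green[OF S \<phi>] by simp

text \<open>Fields supported in the interior therefore belong to the trace spaces with zero trace,
  and they supply the localised test fields when the kernel of the sesquilinear form is
  determined.\<close>

lemma test_has_tr:
  assumes S: "open S" and \<phi>: "\<phi> \<in> test_fields" "fsupport \<phi> \<subseteq> S"
  shows "has_tr S n G (\<lambda>x. cvec (\<phi> x)) (\<lambda>x. cvec (classical_curl \<phi> x)) (\<lambda>x. 0)"
  unfolding has_tr_def using test_green[OF S \<phi>] by (simp add: bdot_hdot)

lemma zero_has_curl: "has_curl S (\<lambda>x. 0) (\<lambda>x. 0)"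
  by (simp add: has_curl_iff)

lemma zero_has_tr: "has_tr S n G (\<lambda>x. 0) (\<lambda>x. 0) (\<lambda>x. 0)"
  by (simp add: has_tr_def bdot_hdot)

lemma has_curl_fcoef:
  assumes S: "open S" and c: "\<And>t. t \<in> {0..period \<omega>} \<Longrightarrow> has_curl S (f t) (fc t)"
    and F: "is_fcoef (lebesgue_on S) \<omega> f n F" "is_fcoef (lebesgue_on S) \<omega> fc n Fc"
  shows "has_curl S F Fc"
  unfolding has_curl_iff
proof (intro conjI ballI impI)
  show "sq_integrable (lebesgue_on S) F" "sq_integrable (lebesgue_on S) Fc" using F by (auto simp: is_fcoef_def)
  fix \<phi> assume \<phi>: "\<phi> \<in> test_fields" "fsupport \<phi> \<subseteq> S"
  note t = sq_integrable_test[OF tame_lebesgue_on[OF S] \<phi>(1)]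
  have "fcoef \<omega> n (\<lambda>t. L2_ip (lebesgue_on S) (fc t) (\<lambda>x. cvec (\<phi> x))) =
      fcoef \<omega> n (\<lambda>t. L2_ip (lebesgue_on S) (f t) (\<lambda>x. cvec (classical_curl \<phi> x)))"
    using c \<phi> by (intro fcoef_cong) (simp add: has_curl_iff)
  then show "L2_ip (lebesgue_on S) Fc (\<lambda>x. cvec (\<phi> x)) = L2_ip (lebesgue_on S) F (\<lambda>x. cvec (classical_curl \<phi> x))"
    using F t by (simp add: is_fcoef_def)
qed

text \<open>The weak identity passes to the coefficients by linearity. Tangentiality is a pointwise
  condition and has to be turned into a pairing: tested with its own normal part, the coefficient
  pairs to zero, because all traces along the curve are tangential.\<close>

lemma has_tr_fcoef:
  assumes G: "trace_geometry S n G" and g: "\<And>t. t \<in> {0..period \<omega>} \<Longrightarrow> has_tr S n G (f t) (fc t) (fg t)"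
    and cont: "L2_cont_on (lebesgue_on S) (period \<omega>) f" "L2_cont_on (lebesgue_on S) (period \<omega>) fc"
    and F: "is_fcoef (lebesgue_on S) \<omega> f k F" "is_fcoef (lebesgue_on S) \<omega> fc k Fc" "is_fcoef (surface G) \<omega> fg k Fg"
  shows "has_tr S n G F Fc Fg"
  unfolding has_tr_def
proof (intro conjI ballI impI)
  have S: "open S" and n: "n \<in> borel_measurable (surface G)" "AE x in surface G. norm (n x) = 1"
    using G by (auto simp: trace_geometry_def)
  show sqg: "sq_integrable (surface G) Fg" using F by (auto simp: is_fcoef_def)
  have [measurable]: "Fg \<in> borel_measurable (surface G)" "n \<in> borel_measurable (surface G)"
    using sqg n by (auto simp: sq_integrable_def)
  \<comment> \<open>The normal part of \<open>Fg\<close>; it is square integrable since the normal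
    has length 1, and its pairing with \<open>Fg\<close> is the integral of the squared normal
    component.\<close>
  define w where "w x = hdot (Fg x) (cvec (n x)) *s cvec (n x)" for x
  have sqw: "sq_integrable (surface G) w"
  proof (rule sq_integrable_bound[OF sqg, of _ 1])
    show "w \<in> borel_measurable (surface G)" unfolding w_def[abs_def] by measurable
    show "AE x in surface G. norm (w x) \<le> 1 * norm (Fg x)"
      using n(2)
    proof eventually_elim
      case (elim x)
      then show ?case using norm_hdot_le[of "Fg x" "cvec (n x)"] by (simp add: w_def norm_vscale)
    qed
  qed
  have "L2_ip (surface G) (fg t) w = 0" if "t \<in> {0..period \<omega>}" for t
  proof -
    have "AE x in surface G. bdot (fg t x) (n x) = 0"
      using g[OF that] by (simp add: has_tr_def)
    then have "AE x in surface G. hdot (fg t x) (w x) = 0"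
    proof eventually_elim
      case (elim x)
      have "hdot (fg t x) (w x) = cnj (hdot (Fg x) (cvec (n x))) * hdot (fg t x) (cvec (n x))"
        unfolding w_def hdot_scale_right ..
      then show ?case using elim by (simp add: bdot_hdot)
    qed
    then show ?thesis unfolding L2_ip_def by (rule integral_eq_zero_AE)
  qed
  then have "fcoef \<omega> k (\<lambda>t. L2_ip (surface G) (fg t) w) = fcoef \<omega> k (\<lambda>t. 0)"
    by (intro fcoef_cong) auto
  then have "L2_ip (surface G) Fg w = 0"
    using F(3) sqw fcoef_mult[of \<omega> k 0 "\<lambda>t. 0"] by (simp add: is_fcoef_def)
  moreover have hw: "hdot (Fg x) (w x) = complex_of_real ((cmod (bdot (Fg x) (n x)))\<^sup>2)" for x
    by (simp add: w_def bdot_hdot hdot_scale_right complex_norm_square[symmetric] mult.commute)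
  moreover have "L2_ip (surface G) Fg w = complex_of_real (LINT x|surface G. (cmod (bdot (Fg x) (n x)))\<^sup>2)"
    unfolding L2_ip_def hw by (rule integral_complex_of_real)
  ultimately have "(LINT x|surface G. (cmod (bdot (Fg x) (n x)))\<^sup>2) = 0"
    by simp
  moreover have "integrable (surface G) (\<lambda>x. (cmod (bdot (Fg x) (n x)))\<^sup>2)"
  proof (rule Bochner_Integration.integrable_bound)
    show "integrable (surface G) (\<lambda>x. (norm (Fg x))\<^sup>2)" using sqg by (simp add: sq_integrable_def)
    show "(\<lambda>x. (cmod (bdot (Fg x) (n x)))\<^sup>2) \<in> borel_measurable (surface G)" unfolding bdot_hdot by measurable
    show "AE x in surface G. norm ((cmod (bdot (Fg x) (n x)))\<^sup>2) \<le> norm ((norm (Fg x))\<^sup>2)"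
      using n(2)
    proof eventually_elim
      case (elim x)
      then show ?case using norm_hdot_le[of "Fg x" "cvec (n x)"] by (simp add: bdot_hdot power_mono)
    qed
  qed
  ultimately have "AE x in surface G. (cmod (bdot (Fg x) (n x)))\<^sup>2 = 0"
    by (subst (asm) integral_nonneg_eq_0_iff_AE) auto
  then show "AE x in surface G. bdot (Fg x) (n x) = 0" by eventually_elim simp
  fix \<phi> assume \<phi>: "\<phi> \<in> test_fields" "fsupport \<phi> \<inter> (frontier S - G) = {}"
  note t = sq_integrable_test[OF tame_lebesgue_on[OF S] \<phi>(1)] sq_integrable_cross_test[OF G \<phi>(1)]
  let ?a = "\<lambda>t. L2_ip (lebesgue_on S) (fc t) (\<lambda>x. cvec (\<phi> x))"
  let ?b = "\<lambda>t. L2_ip (lebesgue_on S) (f t) (\<lambda>x. cvec (classical_curl \<phi> x))"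
  have "fcoef \<omega> k ?a - fcoef \<omega> k ?b = fcoef \<omega> k (\<lambda>t. ?a t - ?b t)"
    by (intro fcoef_diff[symmetric] L2_cont_on_ip cont t)
  also have "\<dots> = fcoef \<omega> k (\<lambda>t. L2_ip (surface G) (fg t) (\<lambda>x. cvec (cross3 (\<phi> x) (n x))))"
    using g \<phi> by (intro fcoef_cong) (simp add: has_tr_def)
  finally show "L2_ip (lebesgue_on S) Fc (\<lambda>x. cvec (\<phi> x)) - L2_ip (lebesgue_on S) F (\<lambda>x. cvec (classical_curl \<phi> x)) =
      L2_ip (surface G) Fg (\<lambda>x. cvec (cross3 (\<phi> x) (n x)))"
    using F t by (simp add: is_fcoef_def)
qed

section \<open>Coefficients\<close>

lemma mat_app_nth: "mat_app A v $ i = (\<Sum>j\<in>UNIV. complex_of_real (A $ i $ j) * v $ j)"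
  by (simp add: mat_app_def matrix_vector_mult_def map_matrix_def)

lemma mat_app_add: "mat_app A (v + w) = mat_app A v + mat_app A w"
  by (simp add: mat_app_def matrix_vector_right_distrib)

lemma mat_app_scale: "mat_app A (k *s v) = k *s mat_app A v"
  by (simp add: vec_eq_iff mat_app_nth sum_distrib_left mult_ac)

lemma mat_app_zero [simp]: "mat_app A 0 = 0"
  by (simp add: vec_eq_iff mat_app_nth)

lemma mat_app_zero_mat [simp]: "mat_app 0 v = 0"
  by (simp add: vec_eq_iff mat_app_nth)

lemma mat_app_cnj_vec: "mat_app A (cnj_vec v) = cnj_vec (mat_app A v)"
  by (simp add: vec_eq_iff mat_app_nth cnj_vec_def)

lemma mat_app_cvec: "mat_app A (cvec x) = cvec (A *v x)"
  by (simp add: vec_eq_iff mat_app_nth cvec_def matrix_vector_mult_def)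

lemma hdot_mat_app: "hdot (mat_app A v) w = hdot v (mat_app (transpose A) w)"
proof -
  have "hdot (mat_app A v) w = (\<Sum>i\<in>UNIV. \<Sum>j\<in>UNIV. complex_of_real (A $ i $ j) * v $ j * cnj (w $ i))"
    by (simp add: hdot_def mat_app_nth sum_distrib_right)
  also have "\<dots> = (\<Sum>j\<in>UNIV. \<Sum>i\<in>UNIV. complex_of_real (A $ i $ j) * v $ j * cnj (w $ i))"
    by (rule sum.swap)
  also have "\<dots> = hdot v (mat_app (transpose A) w)"
    by (simp add: hdot_def mat_app_nth sum_distrib_left transpose_def mult_ac)
  finally show ?thesis .
qed

lemma norm_le_sum3:
  fixes v :: "complex^3" assumes "\<And>i. cmod (v $ i) \<le> C" shows "norm v \<le> 3 * C"
proof -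
  have "norm v \<le> (\<Sum>i\<in>UNIV. cmod (v $ i))"
    unfolding norm_vec_def by (rule L2_set_le_sum) simp
  also have "\<dots> \<le> (\<Sum>i\<in>(UNIV::3 set). C)" by (intro sum_mono assms)
  finally show ?thesis by simp
qed

text \<open>The constant is crude: a factor 3 from the row sum and a factor 3 from passing from the
  components to the norm.\<close>

lemma norm_mat_app_le: "norm (mat_app A v) \<le> 9 * norm A * norm v"
proof -
  have "cmod (mat_app A v $ i) \<le> 3 * (norm A * norm v)" for i
  proof -
    have "cmod (mat_app A v $ i) \<le> (\<Sum>j\<in>UNIV. cmod (complex_of_real (A $ i $ j) * v $ j))"
      unfolding mat_app_nth by (rule norm_sum)
    also have "\<dots> \<le> (\<Sum>j\<in>(UNIV::3 set). norm A * norm v)"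
    proof (rule sum_mono)
      fix j :: 3
      have "\<bar>A $ i $ j\<bar> \<le> norm A"
        using Finite_Cartesian_Product.norm_nth_le[of "A $ i" j] Finite_Cartesian_Product.norm_nth_le[of A i] by simp
      then show "cmod (complex_of_real (A $ i $ j) * v $ j) \<le> norm A * norm v"
        using Finite_Cartesian_Product.norm_nth_le[of v j] by (simp add: norm_mult mult_mono)
    qed
    finally show ?thesis by simp
  qed
  from norm_le_sum3[OF this] show ?thesis by simp
qed

lemma measurable_mat_app:
  assumes "A \<in> borel_measurable M" "f \<in> borel_measurable M"
  shows "(\<lambda>x. mat_app (A x) (f x)) \<in> borel_measurable M"
proof -
  have A: "(\<lambda>x. A x $ i $ j) \<in> borel_measurable M" for i j
    using assms(1) by (auto simp: measurable_vec_iff)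
  have cA: "(\<lambda>x. complex_of_real (A x $ i $ j)) \<in> borel_measurable M" for i j
    by (rule borel_measurable_continuous_on[OF _ A]) (intro continuous_on_of_real continuous_on_id)
  have "(\<lambda>x. f x $ j) \<in> borel_measurable M" for j using assms(2) by (auto simp: measurable_vec_iff)
  then have "(\<lambda>x. mat_app (A x) (f x) $ i) \<in> borel_measurable M" for i
    unfolding mat_app_nth by (intro borel_measurable_sum borel_measurable_times cA)
  then show ?thesis by (simp add: measurable_vec_iff)
qed

lemma sym_bounded_sq:
  assumes A: "sym_bounded_coeff M A" and f: "sq_integrable M f"
  shows "sq_integrable M (\<lambda>x. mat_app (A x) (f x))"
proof -
  obtain C where C: "AE x in M. norm (A x) \<le> C" and Am: "A \<in> borel_measurable M"
    using A by (auto simp: sym_bounded_coeff_def)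
  show ?thesis
  proof (rule sq_integrable_bound[OF f])
    show "(\<lambda>x. mat_app (A x) (f x)) \<in> borel_measurable M"
      by (rule measurable_mat_app[OF Am]) (use f in \<open>simp add: sq_integrable_def\<close>)
    show "AE x in M. norm (mat_app (A x) (f x)) \<le> 9 * C * norm (f x)"
      using C
    proof eventually_elim
      case (elim x)
      have "norm (mat_app (A x) (f x)) \<le> 9 * norm (A x) * norm (f x)" by (rule norm_mat_app_le)
      also have "\<dots> \<le> 9 * C * norm (f x)" using elim by (intro mult_right_mono) auto
      finally show ?case .
    qed
  qed
qed

text \<open>A real symmetric matrix is Hermitian. The lemma moves coefficients onto the fixed test
  field, so that the solution stands alone in the left slot of each pairing.\<close>

lemma sym_bounded_adjoint:
  assumes A: "sym_bounded_coeff M A" and f: "sq_integrable M f" and g: "sq_integrable M g"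
  shows "L2_ip M (\<lambda>x. mat_app (A x) (f x)) g = L2_ip M f (\<lambda>x. mat_app (A x) (g x))"
  unfolding L2_ip_def
proof (rule integral_cong_AE)
  have sq: "sq_integrable M (\<lambda>x. mat_app (A x) (f x))" "sq_integrable M (\<lambda>x. mat_app (A x) (g x))"
    using sym_bounded_sq[OF A] f g by auto
  show "(\<lambda>x. hdot (mat_app (A x) (f x)) (g x)) \<in> borel_measurable M"
    "(\<lambda>x. hdot (f x) (mat_app (A x) (g x))) \<in> borel_measurable M"
    using integrable_hdot[OF sq(1) g] integrable_hdot[OF f sq(2)] by auto
  have "AE x in M. transpose (A x) = A x" using A by (simp add: sym_bounded_coeff_def)
  then show "AE x in M. hdot (mat_app (A x) (f x)) (g x) = hdot (f x) (mat_app (A x) (g x))"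
    by eventually_elim (simp add: hdot_mat_app)
qed

definition rpart :: "complex^3 \<Rightarrow> real^3" where "rpart v = (\<chi> i. Re (v $ i))"
definition ipart :: "complex^3 \<Rightarrow> real^3" where "ipart v = (\<chi> i. Im (v $ i))"

lemma Re_hdot_parts: "Re (hdot v w) = rpart v \<bullet> rpart w + ipart v \<bullet> ipart w"
  by (simp add: hdot_def rpart_def ipart_def inner_vec_def sum.distrib)

lemma norm_parts: "(norm v)\<^sup>2 = (norm (rpart v))\<^sup>2 + (norm (ipart v))\<^sup>2"
  using Re_hdot_parts[of v v] Re_hdot[of v v] by (simp add: power2_norm_eq_inner)

lemma parts_mat_app: "rpart (mat_app A v) = A *v rpart v" "ipart (mat_app A v) = A *v ipart v"
  by (simp_all add: vec_eq_iff rpart_def ipart_def mat_app_nth matrix_vector_mult_def)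

text \<open>The real part of the Hermitian form is the sum of the real forms at the real and the
  imaginary part. The predicate \<open>P\<close> lets the lemma cover ellipticity on all vectors and
  on tangential vectors only.\<close>

lemma elliptic_complex:
  assumes "\<And>\<xi>. P \<xi> \<Longrightarrow> c * (norm \<xi>)\<^sup>2 \<le> \<xi> \<bullet> (A *v \<xi>)" "P (rpart v)" "P (ipart v)"
  shows "c * (norm v)\<^sup>2 \<le> Re (hdot (mat_app A v) v)"
proof -
  have "Re (hdot (mat_app A v) v) = rpart v \<bullet> (A *v rpart v) + ipart v \<bullet> (A *v ipart v)"
    unfolding Re_hdot_parts parts_mat_app by (simp only: inner_commute[of "rpart v"] inner_commute[of "ipart v"])
  then show ?thesis
    using assms(1)[OF assms(2)] assms(1)[OF assms(3)] unfolding norm_parts[of v] distrib_left by linarith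
qed

lemma Re_L2_ip:
  assumes "sq_integrable M f" "sq_integrable M g"
  shows "Re (L2_ip M f g) = (LINT x|M. Re (hdot (f x) (g x)))"
  unfolding L2_ip_def by (rule integral_bounded_linear[OF bounded_linear_Re integrable_hdot[OF assms], symmetric])

lemma L2_elliptic:
  assumes f: "sq_integrable M f" and Af: "sq_integrable M (\<lambda>x. mat_app (A x) (f x))"
    and el: "AE x in M. c * (norm (f x))\<^sup>2 \<le> Re (hdot (mat_app (A x) (f x)) (f x))"
  shows "c * (L2_norm M f)\<^sup>2 \<le> Re (L2_ip M (\<lambda>x. mat_app (A x) (f x)) f)"
proof -
  have int: "integrable M (\<lambda>x. Re (hdot (mat_app (A x) (f x)) (f x)))"
    using integrable_bounded_linear[OF bounded_linear_Re integrable_hdot[OF Af f]] .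
  have "c * (L2_norm M f)\<^sup>2 = (LINT x|M. c * (norm (f x))\<^sup>2)" by (simp add: L2_norm_sq)
  also have "\<dots> \<le> (LINT x|M. Re (hdot (mat_app (A x) (f x)) (f x)))"
    using f int el by (intro integral_mono_AE) (auto simp: sq_integrable_def)
  finally show ?thesis by (simp only: Re_L2_ip[OF Af f])
qed

section \<open>The inverse impedance\<close>

text \<open>\<open>Y + n n\<^sup>T\<close> is the inverse of \<open>Z + n n\<^sup>T\<close>. Hence \<open>Y\<close> is symmetric and bounded, and it is
  measurable by Cramer's rule, although only its values are prescribed.\<close>

context
  fixes Z Y :: "real^3^3" and n :: "real^3" and c :: real
  assumes n: "norm n = 1" and Zt: "transpose Z = Z" and Zn: "Z *v n = 0" and Yn: "Y *v n = 0"
    and c: "c > 0" and el: "\<And>\<xi>. n \<bullet> \<xi> = 0 \<Longrightarrow> c * (norm \<xi>)\<^sup>2 \<le> \<xi> \<bullet> (Z *v \<xi>)"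
    and YZ: "\<And>\<xi>. n \<bullet> \<xi> = 0 \<Longrightarrow> Y *v (Z *v \<xi>) = \<xi> \<and> Z *v (Y *v \<xi>) = \<xi>"
begin

lemma nn: "n \<bullet> n = 1" using n by (simp add: norm_eq_1)

lemma Z_sym: "(Z *v x) \<bullet> y = x \<bullet> (Z *v y)"
  using dot_lmul_matrix[of x Z y] Zt by (metis transpose_matrix_vector)

text \<open>Z annihilates the normal, so the tangential part \<tau> of Y \<xi> still satisfies Z
  \<tau> = \<xi>; applying Y on the tangent plane returns \<tau> itself.\<close>

lemma Y_tangential:
  assumes "n \<bullet> \<xi> = 0" shows "n \<bullet> (Y *v \<xi>) = 0"
proof -
  define \<tau> where "\<tau> = Y *v \<xi> - (n \<bullet> (Y *v \<xi>)) *\<^sub>R n"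
  have t: "n \<bullet> \<tau> = 0" by (simp add: \<tau>_def inner_diff_right nn)
  have "Z *v \<tau> = \<xi>"
    unfolding \<tau>_def using YZ[OF assms] Zn by (simp add: matrix_vector_mult_diff_distrib matrix_vector_mult_scaleR)
  then have "Y *v \<xi> = \<tau>" using YZ[OF t] by simp
  then show ?thesis using t by simp
qed

text \<open>Ellipticity of Z at the tangential vector Y \<xi>, then Cauchy-Schwarz and cancellation
  of one factor |Y \<xi>|.\<close>

lemma Y_bound_tangential:
  assumes "n \<bullet> \<xi> = 0" shows "c * norm (Y *v \<xi>) \<le> norm \<xi>"
proof (cases "Y *v \<xi> = 0")
  case False
  have "c * (norm (Y *v \<xi>))\<^sup>2 \<le> (Y *v \<xi>) \<bullet> \<xi>"
    using el[OF Y_tangential[OF assms]] YZ[OF assms] by simp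
  also have "\<dots> \<le> norm (Y *v \<xi>) * norm \<xi>" by (rule norm_cauchy_schwarz)
  finally show ?thesis using False by (simp add: power2_eq_square mult.assoc[symmetric])
qed simp

lemma tangential_part: "n \<bullet> (x - (n \<bullet> x) *\<^sub>R n) = 0"
  by (simp add: inner_diff_right nn)

lemma Y_tangential_part: "Y *v x = Y *v (x - (n \<bullet> x) *\<^sub>R n)"
  using Yn by (simp add: matrix_vector_mult_diff_distrib matrix_vector_mult_scaleR)

text \<open>Writing a tangential vector as Z applied to its image under Y carries the symmetry of Z
  over to Y. Normal parts contribute nothing, since Y annihilates them and has tangential
  values.\<close>

lemma Y_sym: "(Y *v x) \<bullet> y = x \<bullet> (Y *v y)"
proof -
  let ?P = "\<lambda>x. x - (n \<bullet> x) *\<^sub>R n"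
  have 1: "(Y *v x) \<bullet> y = (Y *v ?P x) \<bullet> ?P y" for x y
  proof -
    have "(Y *v ?P x) \<bullet> ?P y = (Y *v ?P x) \<bullet> y - (n \<bullet> y) * (n \<bullet> (Y *v ?P x))"
      by (simp only: inner_diff_right inner_scaleR_right inner_commute[of n "Y *v ?P x"])
    then show ?thesis using Y_tangential[OF tangential_part, of x] Y_tangential_part[of x] by simp
  qed
  have "(Y *v ?P x) \<bullet> ?P y = (Y *v ?P x) \<bullet> (Z *v (Y *v ?P y))"
    using YZ[OF tangential_part, of y] by simp
  also have "\<dots> = (Z *v (Y *v ?P x)) \<bullet> (Y *v ?P y)" by (rule Z_sym[symmetric])
  also have "\<dots> = ?P x \<bullet> (Y *v ?P y)" using YZ[OF tangential_part, of x] by simp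
  finally show ?thesis using 1[of x y] 1[of y x] by (simp add: inner_commute)
qed

lemma Y_transpose: "transpose Y = Y"
proof -
  have "Y $ i $ j = Y $ j $ i" for i j
    using Y_sym[of "axis j 1" "axis i 1"] by (simp add: inner_axis inner_axis' matrix_vector_mul_component column_def matrix_vector_mult_basis)
  then show ?thesis by (simp add: transpose_def vec_eq_iff)
qed

text \<open>Each column is Y applied to the tangential part of a unit vector, which has norm at most
  1; so each of the nine entries is at most 1/c.\<close>

lemma Y_bound: "norm Y \<le> 9 / c"
proof -
  have e: "\<bar>Y $ i $ j\<bar> \<le> 1 / c" for i j
  proof -
    let ?x = "axis j 1 :: real^3"
    have "\<bar>Y $ i $ j\<bar> \<le> norm (Y *v ?x)"
      using component_le_norm_cart[of "Y *v ?x" i] by (simp add: matrix_vector_mult_basis column_def)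
    also have "\<dots> = norm (Y *v (?x - (n \<bullet> ?x) *\<^sub>R n))" using Y_tangential_part[of ?x] by simp
    also have "\<dots> \<le> norm (?x - (n \<bullet> ?x) *\<^sub>R n) / c"
      using Y_bound_tangential[OF tangential_part, of ?x] c by (simp add: field_simps)
    also have "norm (?x - (n \<bullet> ?x) *\<^sub>R n) \<le> 1"
    proof (rule power2_le_imp_le)
      let ?p = "?x - (n \<bullet> ?x) *\<^sub>R n"
      have "?p \<bullet> ?p = ?p \<bullet> ?x - (n \<bullet> ?x) * (n \<bullet> ?p)"
        by (simp only: inner_diff_right[of ?p] inner_scaleR_right inner_commute[of n ?p])
      also have "\<dots> = ?x \<bullet> ?x - (n \<bullet> ?x) * (n \<bullet> ?x)"
        unfolding tangential_part by (simp only: inner_diff_left inner_scaleR_left mult_zero_right diff_0_right)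
      also have "?x \<bullet> ?x = 1" by (simp add: inner_axis_axis)
      finally have "(norm ?p)\<^sup>2 = 1 - (n \<bullet> ?x)\<^sup>2"
        by (simp only: power2_norm_eq_inner power2_eq_square[of "n \<bullet> ?x"])
      then show "(norm (?x - (n \<bullet> ?x) *\<^sub>R n))\<^sup>2 \<le> 1\<^sup>2" by simp
    qed simp
    finally show ?thesis using c by (simp add: divide_right_mono)
  qed
  have "norm Y \<le> (\<Sum>i\<in>UNIV. norm (Y $ i))" unfolding norm_vec_def[of Y] by (rule L2_set_le_sum) simp
  also have "\<dots> \<le> (\<Sum>i\<in>(UNIV::3 set). \<Sum>j\<in>(UNIV::3 set). 1 / c)"
    by (intro sum_mono order_trans[OF norm_le_l1_cart] e)
  finally show ?thesis by simp
qed

text \<open>With \<eta> = Y \<xi>, ellipticity of Z bounds \<xi> \<bullet> \<eta> = \<eta> \<bullet>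
  Z \<eta> from below by c |\<eta>|^2, and \<xi> = Z \<eta> has norm at most 9 C |\<eta>|.\<close>

lemma Y_elliptic:
  assumes "n \<bullet> \<xi> = 0" "norm Z \<le> C" "C > 0"
  shows "(c / (9 * C)\<^sup>2) * (norm \<xi>)\<^sup>2 \<le> \<xi> \<bullet> (Y *v \<xi>)"
proof -
  let ?\<eta> = "Y *v \<xi>"
  have "norm \<xi> = norm (mat_app Z (cvec ?\<eta>))" using YZ[OF assms(1)] by (simp add: mat_app_cvec)
  also have "\<dots> \<le> 9 * norm Z * norm (cvec ?\<eta>)" by (rule norm_mat_app_le)
  also have "\<dots> \<le> 9 * C * norm ?\<eta>" using assms(2) by (simp add: mult_right_mono)
  finally have "(norm \<xi>)\<^sup>2 \<le> (9 * C * norm ?\<eta>)\<^sup>2" by (intro power_mono) auto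
  then have "(c / (9 * C)\<^sup>2) * (norm \<xi>)\<^sup>2 \<le> (c / (9 * C)\<^sup>2) * (9 * C * norm ?\<eta>)\<^sup>2"
    using c by (intro mult_left_mono) auto
  also have "\<dots> = c * (norm ?\<eta>)\<^sup>2" using assms(3) by (simp add: power_mult_distrib)
  also have "\<dots> \<le> ?\<eta> \<bullet> (Z *v ?\<eta>)" by (rule el[OF Y_tangential[OF assms(1)]])
  also have "\<dots> = \<xi> \<bullet> ?\<eta>" using YZ[OF assms(1)] by (simp add: inner_commute)
  finally show ?thesis .
qed

lemma Y_cramer:
  defines "A \<equiv> (\<chi> i j. Z $ i $ j + n $ i * n $ j)"
  shows "Y $ i $ k = det (\<chi> a b. if b = i then axis k 1 $ a else A $ a $ b) / det A - n $ i * n $ k"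
proof -
  have Av: "A *v x = Z *v x + (n \<bullet> x) *\<^sub>R n" for x
    by (simp add: A_def vec_eq_iff matrix_vector_mult_def inner_vec_def ring_distribs sum.distrib sum_distrib_left mult_ac)
  define B where "B x = Y *v x + (n \<bullet> x) *\<^sub>R n" for x
  have AB: "A *v (B x) = x" for x
  proof -
    have t: "n \<bullet> (Y *v x) = 0" using Y_tangential[OF tangential_part, of x] Y_tangential_part[of x] by simp
    have "Z *v (Y *v x) = x - (n \<bullet> x) *\<^sub>R n"
      using YZ[OF tangential_part, of x] Y_tangential_part[of x] by simp
    then show ?thesis
      unfolding Av B_def using t Zn
      by (simp add: matrix_vector_right_distrib matrix_vector_mult_scaleR inner_add_right nn)
  qed
  have "surj (\<lambda>x. A *v x)" using AB by (metis surjI)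
  then have "det A \<noteq> 0"
    using det_nz_iff_inj[of "\<lambda>x. A *v x"] linear_surj_imp_inj[of "\<lambda>x. A *v x"] matrix_of_matrix_vector_mul by (metis invertible_det_nz matrix_left_invertible_injective matrix_vector_mul_linear invertible_left_inverse)
  then have "B (axis k 1) = (\<chi> i. det (\<chi> a b. if b = i then axis k 1 $ a else A $ a $ b) / det A)"
    using cramer[of A "B (axis k 1)" "axis k 1"] AB by simp
  then have "B (axis k 1) $ i = det (\<chi> a b. if b = i then axis k 1 $ a else A $ a $ b) / det A" by simp
  moreover have "B (axis k 1) $ i = Y $ i $ k + n $ k * n $ i"
    by (simp add: B_def matrix_vector_mult_basis column_def inner_axis)
  ultimately show ?thesis by (simp add: mult.commute)
qed

end

lemma measurable_det:
  fixes A :: "'a \<Rightarrow> real^3^3"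
  assumes "A \<in> borel_measurable M" shows "(\<lambda>x. det (A x)) \<in> borel_measurable M"
proof -
  have "(\<lambda>x. A x $ i $ j) \<in> borel_measurable M" for i j using assms by (auto simp: measurable_vec_iff)
  then show ?thesis unfolding det_def
    by (intro borel_measurable_sum borel_measurable_times borel_measurable_prod) auto
qed

text \<open>Completeness makes every subset of a null set measurable, so changing a function on a
  null set preserves measurability.\<close>

lemma completion_measurable_cong_AE:
  fixes f g :: "'a \<Rightarrow> 'b::topological_space"
  assumes g: "g \<in> borel_measurable (completion N)" and eq: "AE x in completion N. f x = g x"
  shows "f \<in> borel_measurable (completion N)"
proof (rule measurableI)
  fix B :: "'b set" assume B: "B \<in> sets borel"
  obtain E where E: "{x \<in> space (completion N). f x \<noteq> g x} \<subseteq> E" "E \<in> null_sets (completion N)"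
    using eq by (auto elim!: AE_E simp: null_sets_def)
  have gB: "g -` B \<inter> space (completion N) \<in> sets (completion N)" by (rule measurable_sets[OF g B])
  have "(f -` B \<inter> space (completion N)) \<inter> E \<in> sets (completion N)"
    using null_sets_completion_subset[of _ E N] E(2) by (meson inf_le2 null_setsD2)
  moreover have "(g -` B \<inter> space (completion N)) - E \<in> sets (completion N)" using gB E(2) by auto
  moreover have "f -` B \<inter> space (completion N) =
      ((f -` B \<inter> space (completion N)) \<inter> E) \<union> ((g -` B \<inter> space (completion N)) - E)"
    using E(1) by auto
  ultimately show "f -` B \<inter> space (completion N) \<in> sets (completion N)" by (metis sets.Un)
qed simp

lemma inverse_impedance:
  assumes n: "n \<in> borel_measurable (surface G)" "AE x in surface G. norm (n x) = 1"
    and Z: "sym_bounded_coeff (surface G) Z" and Zn: "AE x in surface G. Z x *v n x = 0"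
    and c: "c > 0" and el: "AE x in surface G. \<forall>\<xi>. n x \<bullet> \<xi> = 0 \<longrightarrow> c * (norm \<xi>)\<^sup>2 \<le> \<xi> \<bullet> (Z x *v \<xi>)"
    and Y: "AE x in surface G. Y x *v n x = 0 \<and>
        (\<forall>\<xi>. n x \<bullet> \<xi> = 0 \<longrightarrow> Y x *v (Z x *v \<xi>) = \<xi> \<and> Z x *v (Y x *v \<xi>) = \<xi>)"
  shows "sym_bounded_coeff (surface G) Y"
    and "\<exists>c>0. AE x in surface G. \<forall>\<xi>. n x \<bullet> \<xi> = 0 \<longrightarrow> c * (norm \<xi>)\<^sup>2 \<le> \<xi> \<bullet> (Y x *v \<xi>)"
proof -
  have Zm: "Z \<in> borel_measurable (surface G)" and Zt: "AE x in surface G. transpose (Z x) = Z x"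
    using Z by (auto simp: sym_bounded_coeff_def)
  obtain C0 where C0: "AE x in surface G. norm (Z x) \<le> C0" using Z by (auto simp: sym_bounded_coeff_def)
  define C where "C = max C0 1"
  have C: "AE x in surface G. norm (Z x) \<le> C" using C0 by eventually_elim (simp add: C_def)
  have C1: "C > 0" by (simp add: C_def)
  have all: "AE x in surface G. norm (n x) = 1 \<and> transpose (Z x) = Z x \<and> Z x *v n x = 0 \<and> Y x *v n x = 0 \<and> norm (Z x) \<le> C \<and>
      (\<forall>\<xi>. n x \<bullet> \<xi> = 0 \<longrightarrow> c * (norm \<xi>)\<^sup>2 \<le> \<xi> \<bullet> (Z x *v \<xi>)) \<and>
      (\<forall>\<xi>. n x \<bullet> \<xi> = 0 \<longrightarrow> Y x *v (Z x *v \<xi>) = \<xi> \<and> Z x *v (Y x *v \<xi>) = \<xi>)"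
    using n(2) Zt Zn el Y C by eventually_elim blast
  define A where "A x = (\<chi> i j. Z x $ i $ j + n x $ i * n x $ j)" for x
  have nm: "(\<lambda>x. n x $ i) \<in> borel_measurable (surface G)" for i
    using n(1) by (auto simp: measurable_vec_iff)
  have Zc: "(\<lambda>x. Z x $ i $ j) \<in> borel_measurable (surface G)" for i j
    using Zm by (auto simp: measurable_vec_iff)
  have Ac: "(\<lambda>x. A x $ i $ j) \<in> borel_measurable (surface G)" for i j
    using nm Zc by (simp add: A_def)
  then have Am: "A \<in> borel_measurable (surface G)" by (simp add: measurable_vec_iff)
  \<comment> \<open>The Cramer expression is defined and measurable everywhere; \<open>Y\<close> is
    known to agree with it only where the pointwise relations hold.\<close>
  define Y' where "Y' x = (\<chi> i k. det (\<chi> a b. if b = i then axis k 1 $ a else A x $ a $ b) / det (A x) - n x $ i * n x $ k)" for x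
  have "(\<lambda>x. \<chi> a b. if b = i then axis k 1 $ a else A x $ a $ b) \<in> borel_measurable (surface G)" for i k :: 3
    using Ac by (simp add: measurable_vec_iff)
  then have "(\<lambda>x. Y' x $ i $ k) \<in> borel_measurable (surface G)" for i k
    unfolding Y'_def using nm by (simp, intro borel_measurable_diff borel_measurable_divide borel_measurable_times measurable_det Am nm)
  then have Y'm: "Y' \<in> borel_measurable (surface G)" by (simp add: measurable_vec_iff)
  have eqY: "AE x in surface G. Y x = Y' x"
    using all
  proof eventually_elim
    case (elim x)
    have "Y x $ i $ k = Y' x $ i $ k" for i k
      using Y_cramer[of "n x" "Z x" "Y x" c i k] elim c unfolding Y'_def A_def by simp
    then show ?case by (simp add: vec_eq_iff)
  qed
  have "Y \<in> borel_measurable (surface G)"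
    using completion_measurable_cong_AE[OF Y'm[unfolded surface_def] eqY[unfolded surface_def]]
    by (simp only: surface_def)
  moreover have "AE x in surface G. transpose (Y x) = Y x"
    using all by eventually_elim (rule Y_transpose, use c in auto)
  moreover have "AE x in surface G. norm (Y x) \<le> 9 / c"
    using all by eventually_elim (rule Y_bound, use c in auto)
  ultimately show "sym_bounded_coeff (surface G) Y" unfolding sym_bounded_coeff_def by blast
  have "AE x in surface G. \<forall>\<xi>. n x \<bullet> \<xi> = 0 \<longrightarrow> (c / (9 * C)\<^sup>2) * (norm \<xi>)\<^sup>2 \<le> \<xi> \<bullet> (Y x *v \<xi>)"
    using all
  proof (eventually_elim, intro allI impI)
    fix x \<xi> assume *: "norm (n x) = 1 \<and> transpose (Z x) = Z x \<and> Z x *v n x = 0 \<and> Y x *v n x = 0 \<and> norm (Z x) \<le> C \<and>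
      (\<forall>\<xi>. n x \<bullet> \<xi> = 0 \<longrightarrow> c * (norm \<xi>)\<^sup>2 \<le> \<xi> \<bullet> (Z x *v \<xi>)) \<and>
      (\<forall>\<xi>. n x \<bullet> \<xi> = 0 \<longrightarrow> Y x *v (Z x *v \<xi>) = \<xi> \<and> Z x *v (Y x *v \<xi>) = \<xi>)" and t: "n x \<bullet> \<xi> = 0"
    show "(c / (9 * C)\<^sup>2) * (norm \<xi>)\<^sup>2 \<le> \<xi> \<bullet> (Y x *v \<xi>)"
      by (rule Y_elliptic[where n = "n x" and Z = "Z x"]) (use * t c C1 in auto)
  qed
  moreover have "c / (9 * C)\<^sup>2 > 0" using c C1 by simp
  ultimately show "\<exists>c>0. AE x in surface G. \<forall>\<xi>. n x \<bullet> \<xi> = 0 \<longrightarrow> c * (norm \<xi>)\<^sup>2 \<le> \<xi> \<bullet> (Y x *v \<xi>)" by blast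
qed

section \<open>The Maxwell spaces\<close>

definition re_vec :: "complex^3 \<Rightarrow> complex^3" where
  "re_vec v = (1/2) *s (v + cnj_vec v)"

lemma rev_nth: "re_vec v $ i = complex_of_real (Re (v $ i))"
  by (simp add: re_vec_def cnj_vec_def complex_eq_iff)

lemma re_pair_rev: "re_pair p = (re_vec (fst p), re_vec (snd p))"
  by (simp add: re_pair_def rev_nth vec_eq_iff)

lemma rev_rev [simp]: "re_vec (re_vec v) = re_vec v"
  by (simp add: vec_eq_iff rev_nth)

lemma cnj_vec_rev [simp]: "cnj_vec (re_vec v) = re_vec v"
  by (simp add: vec_eq_iff rev_nth cnj_vec_def)

lemma cnj_vec_real: "re_vec v = v \<Longrightarrow> cnj_vec v = v"
  by (metis cnj_vec_rev)

lemma rev_zero [simp]: "re_vec 0 = 0"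
  by (simp add: vec_eq_iff rev_nth)

text \<open>The imaginary part is the real part of -i v, so a single operation suffices to reduce
  complex test fields to real ones.\<close>

lemma rev_decomp: "v = re_vec v + \<i> *s re_vec ((- \<i>) *s v)"
  by (simp add: vec_eq_iff rev_nth complex_eq_iff)

lemma sq_integrable_rev:
  assumes "sq_integrable M f" shows "sq_integrable M (\<lambda>x. re_vec (f x))"
  unfolding re_vec_def by (intro sq_integrable_scale sq_integrable_add sq_integrable_cnj_vec assms)

lemma L2_ip_decomp:
  assumes f: "sq_integrable M f" and v: "sq_integrable M v"
  shows "L2_ip M f v = L2_ip M f (\<lambda>x. re_vec (v x)) - \<i> * L2_ip M f (\<lambda>x. re_vec ((- \<i>) *s v x))"
proof -
  have sq: "sq_integrable M (\<lambda>x. re_vec (v x))" "sq_integrable M (\<lambda>x. re_vec ((- \<i>) *s v x))"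
    by (intro sq_integrable_rev sq_integrable_scale v)+
  have "L2_ip M f v = L2_ip M f (\<lambda>x. re_vec (v x) + \<i> *s re_vec ((- \<i>) *s v x))"
    by (simp only: rev_decomp[symmetric])
  also have "\<dots> = L2_ip M f (\<lambda>x. re_vec (v x)) + cnj \<i> * L2_ip M f (\<lambda>x. re_vec ((- \<i>) *s v x))"
    using L2_ip_add_right[OF sq(1) sq_integrable_scale[OF sq(2)] f] by (simp only: L2_ip_scale_right)
  finally show ?thesis by simp
qed

lemma L2_ip_rev_left:
  assumes f: "sq_integrable M f" and g: "sq_integrable M g" and real: "AE x in M. re_vec (g x) = g x"
  shows "L2_ip M (\<lambda>x. re_vec (f x)) g = complex_of_real (Re (L2_ip M f g))"
proof -
  have "L2_ip M (\<lambda>x. cnj_vec (f x)) g = cnj (L2_ip M f (\<lambda>x. cnj_vec (g x)))" by (rule L2_ip_cnj_vec)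
  also have "L2_ip M f (\<lambda>x. cnj_vec (g x)) = L2_ip M f g"
  proof (rule L2_ip_cong_AE)
    show "AE x in M. cnj_vec (g x) = g x" using real by eventually_elim (rule cnj_vec_real)
  qed (use f g sq_integrable_cnj_vec[OF g] in \<open>auto simp: sq_integrable_def\<close>)
  finally have "L2_ip M (\<lambda>x. cnj_vec (f x)) g = cnj (L2_ip M f g)" .
  then have "L2_ip M (\<lambda>x. re_vec (f x)) g = (1/2) * (L2_ip M f g + cnj (L2_ip M f g))"
    unfolding re_vec_def L2_ip_scale_left L2_ip_add_left[OF f sq_integrable_cnj_vec[OF f] g] by simp
  then show ?thesis by (simp add: complex_eq_iff)
qed

lemma mat_app_rev: "mat_app A (re_vec v) = re_vec (mat_app A v)"
  by (simp add: re_vec_def mat_app_scale mat_app_add mat_app_cnj_vec)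

definition re_field :: "emfield \<Rightarrow> emfield" where
  "re_field W = (\<lambda>x. re_pair (W x))"

definition scale_field :: "complex \<Rightarrow> emfield \<Rightarrow> emfield" where
  "scale_field k W = (\<lambda>x. (k *s fst (W x), k *s snd (W x)))"

lemma re_field_parts: "fst (re_field W x) = re_vec (fst (W x))" "snd (re_field W x) = re_vec (snd (W x))"
  by (simp_all add: re_field_def re_pair_rev)

lemma scale_field_parts: "fst (scale_field k W x) = k *s fst (W x)" "snd (scale_field k W x) = k *s snd (W x)"
  by (simp_all add: scale_field_def)

lemma real_valued_re_field: "real_valued D (re_field W)"
  by (simp add: real_valued_def re_field_def re_pair_rev)

lemma real_valuedD:
  assumes "real_valued D W"
  shows "AE x in lebesgue_on (Dom D). re_vec (epart W x) = epart W x"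
    "AE x in lebesgue_on (Dom D). re_vec (hpart W x) = hpart W x"
  using assms unfolding real_valued_def re_pair_rev by (eventually_elim, metis fst_conv snd_conv)+

section \<open>Fields with an explicit curl and trace\<close>

locale maxwell_problem =
  fixes D :: maxwell
  assumes setting: "maxwell_setting D"
begin

abbreviation M :: "(real^3) measure" where "M \<equiv> lebesgue_on (Dom D)"
abbreviation N :: "(real^3) measure" where "N \<equiv> surface (GamI D)"

lemma open_dom: "open (Dom D)" and lip_dom: "lipschitz_boundary (Dom D)"
  using setting by (simp_all add: maxwell_setting_def lipschitz_domain_def)

lemma geometry_piece:
  assumes G: "openin (top_of_set (frontier (Dom D))) G"
  shows "trace_geometry (Dom D) (nrml D) G"
proof -
  let ?F = "frontier (Dom D)"
  obtain V where V: "open V" "G = ?F \<inter> V" using G by (auto simp: openin_open)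
  have Fb: "?F \<in> sets borel" by simp
  have Gb: "G \<in> sets borel" unfolding V(2) using V(1) by (intro sets.Int Fb) simp
  have GF: "G \<subseteq> ?F" using V(2) by blast
  have "?F - G = ?F \<inter> - V" using V(2) by blast
  then have cl: "closed (?F - G)" using V(1) by (simp add: closed_Int frontier_closed closed_Compl)
  have nm: "nrml D \<in> borel_measurable (surface ?F)" and out: "AE x in surface ?F. outward_unit_normal_at (Dom D) x (nrml D x)"
    using setting by (simp_all add: maxwell_setting_def)
  have "AE x in surface ?F. norm (nrml D x) = 1"
    using out by eventually_elim (simp add: outward_unit_normal_at_def)
  from surface_mono_AE[OF Gb Fb GF this] surface_mono_measurable[OF Gb Fb GF nm]
    tame_surface[OF open_dom lip_dom Gb GF] cl open_dom
  show ?thesis by (simp add: trace_geometry_def)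
qed

lemma geometry: "trace_geometry (Dom D) (nrml D) (GamI D)" "trace_geometry (Dom D) (nrml D) (GamP D)"
  using setting by (auto simp: maxwell_setting_def intro: geometry_piece)

text \<open>A field with one admissible curl and one admissible trace. Sums, multiples and
  conjugates of such triples are formed entrywise, without comparing the choices made by
  \<open>curl\<close> and \<open>ttrace\<close>.\<close>

definition in_X where
  "in_X v c g \<longleftrightarrow> has_curl (Dom D) v c \<and> has_tr (Dom D) (nrml D) (GamI D) v c g"

definition zero_on_P where
  "zero_on_P v c \<longleftrightarrow> has_tr (Dom D) (nrml D) (GamP D) v c (\<lambda>x. 0)"

lemma in_X_sq:
  assumes "in_X v c g" shows "sq_integrable M v" "sq_integrable M c" "sq_integrable N g"
  using assms by (auto simp: in_X_def has_curl_def has_tr_def)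

text \<open>The passage back to the chosen representatives: by uniqueness they agree almost
  everywhere with the explicit curl and trace.\<close>

lemma in_X_I:
  assumes "in_X v c g"
  shows "v \<in> space_X D" "AE x in M. dcurl D v x = c x" "AE x in N. itrace D v x = g x"
proof -
  have c: "has_curl (Dom D) v c" and g: "has_tr (Dom D) (nrml D) (GamI D) v c g"
    using assms by (auto simp: in_X_def)
  have tt: "has_ttrace (Dom D) (nrml D) (GamI D) v g" using g has_ttrace_iff[OF open_dom c] by blast
  show "v \<in> space_X D" unfolding space_X_def using c tt by blast
  show "AE x in M. dcurl D v x = c x" by (rule has_curl_unique[OF open_dom curl_has_curl[OF c] c])
  have "has_ttrace (Dom D) (nrml D) (GamI D) v (itrace D v)"
    unfolding ttrace_def using someI[of "has_ttrace (Dom D) (nrml D) (GamI D) v" g] tt by simp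
  then have "has_tr (Dom D) (nrml D) (GamI D) v c (itrace D v)" using has_ttrace_iff[OF open_dom c] by blast
  then show "AE x in N. itrace D v x = g x" by (rule has_tr_unique[OF geometry(1) _ g])
qed

lemma in_X_D:
  assumes "v \<in> space_X D" shows "in_X v (dcurl D v) (itrace D v)"
proof -
  obtain c g where c: "has_curl (Dom D) v c" and g: "has_ttrace (Dom D) (nrml D) (GamI D) v g"
    using assms by (auto simp: space_X_def)
  note cc = curl_has_curl[OF c]
  have "has_ttrace (Dom D) (nrml D) (GamI D) v (itrace D v)"
    unfolding ttrace_def using someI[of "has_ttrace (Dom D) (nrml D) (GamI D) v" g] g by simp
  then show ?thesis unfolding in_X_def using cc has_ttrace_iff[OF open_dom cc] by blast
qed

lemma space_XP_iff:
  assumes "in_X v c g" shows "v \<in> space_XP D \<longleftrightarrow> zero_on_P v c"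
  using in_X_I(1)[OF assms] has_ttrace_iff[OF open_dom, of v c] assms
  unfolding space_XP_def zero_on_P_def in_X_def by blast

lemma in_X_add: "in_X v c g \<Longrightarrow> in_X v' c' g' \<Longrightarrow> in_X (\<lambda>x. v x + v' x) (\<lambda>x. c x + c' x) (\<lambda>x. g x + g' x)"
  unfolding in_X_def by (blast intro: has_curl_add[OF open_dom] has_tr_add[OF geometry(1)])

lemma in_X_scale: "in_X v c g \<Longrightarrow> in_X (\<lambda>x. k *s v x) (\<lambda>x. k *s c x) (\<lambda>x. k *s g x)"
  unfolding in_X_def by (blast intro: has_curl_scale has_tr_scale)

lemma in_X_cnj_vec: "in_X v c g \<Longrightarrow> in_X (\<lambda>x. cnj_vec (v x)) (\<lambda>x. cnj_vec (c x)) (\<lambda>x. cnj_vec (g x))"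
  unfolding in_X_def by (blast intro: has_curl_cnj_vec has_tr_cnj_vec)

lemma in_X_rev: "in_X v c g \<Longrightarrow> in_X (\<lambda>x. re_vec (v x)) (\<lambda>x. re_vec (c x)) (\<lambda>x. re_vec (g x))"
  unfolding re_vec_def by (intro in_X_scale in_X_add in_X_cnj_vec)

lemma zero_on_P_scale:
  assumes "zero_on_P v c" shows "zero_on_P (\<lambda>x. k *s v x) (\<lambda>x. k *s c x)"
  using has_tr_scale[OF assms[unfolded zero_on_P_def], of k] by (simp add: zero_on_P_def)

lemma zero_on_P_rev:
  assumes x: "in_X v c g" and p: "zero_on_P v c" shows "zero_on_P (\<lambda>x. re_vec (v x)) (\<lambda>x. re_vec (c x))"
proof -
  have c: "has_curl (Dom D) v c" using x by (simp add: in_X_def)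
  have "has_tr (Dom D) (nrml D) (GamP D) (\<lambda>x. v x + cnj_vec (v x)) (\<lambda>x. c x + cnj_vec (c x)) (\<lambda>x. 0 + cnj_vec 0)"
    by (rule has_tr_add[OF geometry(2) c has_curl_cnj_vec[OF c] p[unfolded zero_on_P_def] has_tr_cnj_vec[OF p[unfolded zero_on_P_def]]])
  moreover have "0 + cnj_vec 0 = 0" by (simp add: cnj_vec_def vec_eq_iff)
  ultimately have "zero_on_P (\<lambda>x. v x + cnj_vec (v x)) (\<lambda>x. c x + cnj_vec (c x))" by (simp add: zero_on_P_def)
  then show ?thesis unfolding re_vec_def by (rule zero_on_P_scale)
qed

lemma in_X_zero: "in_X (\<lambda>x. 0) (\<lambda>x. 0) (\<lambda>x. 0)"
  by (simp add: in_X_def zero_has_curl zero_has_tr)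

lemma zero_on_P_zero: "zero_on_P (\<lambda>x. 0) (\<lambda>x. 0)"
  by (simp add: zero_on_P_def zero_has_tr)

lemma in_X_test:
  assumes "\<phi> \<in> test_fields" "fsupport \<phi> \<subseteq> Dom D"
  shows "in_X (\<lambda>x. cvec (\<phi> x)) (\<lambda>x. cvec (classical_curl \<phi> x)) (\<lambda>x. 0)"
    "zero_on_P (\<lambda>x. cvec (\<phi> x)) (\<lambda>x. cvec (classical_curl \<phi> x))"
  unfolding in_X_def zero_on_P_def using test_has_curl[OF open_dom assms] test_has_tr[OF open_dom assms] by auto

definition in_V where
  "in_V U ce ch te th \<longleftrightarrow> in_X (epart U) ce te \<and> zero_on_P (epart U) ce \<and> in_X (hpart U) ch th"

lemma in_V_space_V: "in_V U ce ch te th \<Longrightarrow> U \<in> space_V D"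
  unfolding in_V_def space_V_def using space_XP_iff in_X_I(1) by blast

lemma space_V_in_V:
  assumes "U \<in> space_V D"
  shows "in_V U (dcurl D (epart U)) (dcurl D (hpart U)) (itrace D (epart U)) (itrace D (hpart U))"
proof -
  have e: "epart U \<in> space_XP D" and h: "hpart U \<in> space_X D" using assms by (auto simp: space_V_def)
  then have "epart U \<in> space_X D" by (simp add: space_XP_def)
  note x = in_X_D[OF this]
  show ?thesis unfolding in_V_def using x in_X_D[OF h] space_XP_iff[OF x] e by blast
qed

lemma in_V_sq:
  assumes "in_V U ce ch te th"
  shows "sq_integrable M (epart U)" "sq_integrable M (hpart U)" "sq_integrable M ce" "sq_integrable M ch"
    "sq_integrable N te" "sq_integrable N th"
  using assms unfolding in_V_def by (auto dest: in_X_sq)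

lemma V_L: "U \<in> space_V D \<Longrightarrow> U \<in> space_L D"
  using in_V_sq[OF space_V_in_V] by (auto simp: space_L_def)

lemma in_V_re: "in_V U ce ch te th \<Longrightarrow>
    in_V (re_field U) (\<lambda>x. re_vec (ce x)) (\<lambda>x. re_vec (ch x)) (\<lambda>x. re_vec (te x)) (\<lambda>x. re_vec (th x))"
  unfolding in_V_def re_field_parts by (elim conjE) (intro conjI in_X_rev zero_on_P_rev; assumption)

lemma in_V_scale: "in_V U ce ch te th \<Longrightarrow>
    in_V (scale_field k U) (\<lambda>x. k *s ce x) (\<lambda>x. k *s ch x) (\<lambda>x. k *s te x) (\<lambda>x. k *s th x)"
  unfolding in_V_def scale_field_parts by (elim conjE) (intro conjI in_X_scale zero_on_P_scale; assumption)

lemma re_field_real_V: "U \<in> space_V D \<Longrightarrow> re_field U \<in> real_V D"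
  using in_V_space_V[OF in_V_re[OF space_V_in_V]] real_valued_re_field by (auto simp: real_V_def)

lemma scale_field_V: "U \<in> space_V D \<Longrightarrow> scale_field k U \<in> space_V D"
  using in_V_space_V[OF in_V_scale[OF space_V_in_V]] by auto

lemma eps_coeff: "sym_bounded_coeff M (eps D)" and mu_coeff: "sym_bounded_coeff M (mu D)"
  and sig_coeff: "sym_bounded_coeff M (sig D)" and Z_coeff: "sym_bounded_coeff N (Zimp D)"
  using setting by (simp_all add: maxwell_setting_def)

lemma normal_facts: "nrml D \<in> borel_measurable N" "AE x in N. norm (nrml D x) = 1"
  using geometry(1) by (auto simp: trace_geometry_def)

lemma Z_elliptic: "\<exists>c>0. AE x in N. \<forall>\<xi>. nrml D x \<bullet> \<xi> = 0 \<longrightarrow> c * (norm \<xi>)\<^sup>2 \<le> \<xi> \<bullet> (Zimp D x *v \<xi>)"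
  using setting by (simp add: maxwell_setting_def)

lemma Y_coeff: "sym_bounded_coeff N (Yimp D)"
  and Y_elliptic: "\<exists>c>0. AE x in N. \<forall>\<xi>. nrml D x \<bullet> \<xi> = 0 \<longrightarrow> c * (norm \<xi>)\<^sup>2 \<le> \<xi> \<bullet> (Yimp D x *v \<xi>)"
proof -
  obtain c where c: "c > 0" "AE x in N. \<forall>\<xi>. nrml D x \<bullet> \<xi> = 0 \<longrightarrow> c * (norm \<xi>)\<^sup>2 \<le> \<xi> \<bullet> (Zimp D x *v \<xi>)"
    using Z_elliptic by blast
  have Zn: "AE x in N. Zimp D x *v nrml D x = 0"
    and Y: "AE x in N. Yimp D x *v nrml D x = 0 \<and>
        (\<forall>\<xi>. nrml D x \<bullet> \<xi> = 0 \<longrightarrow> Yimp D x *v (Zimp D x *v \<xi>) = \<xi> \<and> Zimp D x *v (Yimp D x *v \<xi>) = \<xi>)"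
    using setting by (simp_all add: maxwell_setting_def)
  show "sym_bounded_coeff N (Yimp D)"
    by (rule inverse_impedance(1)[OF normal_facts Z_coeff Zn c Y])
  show "\<exists>c>0. AE x in N. \<forall>\<xi>. nrml D x \<bullet> \<xi> = 0 \<longrightarrow> c * (norm \<xi>)\<^sup>2 \<le> \<xi> \<bullet> (Yimp D x *v \<xi>)"
    by (rule inverse_impedance(2)[OF normal_facts Z_coeff Zn c Y])
qed

section \<open>The energy product and the sesquilinear form\<close>

lemma em_ip_adj:
  assumes "U \<in> space_L D" "W \<in> space_L D"
  shows "em_ip D U W = L2_ip M (epart U) (\<lambda>x. mat_app (eps D x) (epart W x)) +
    L2_ip M (hpart U) (\<lambda>x. mat_app (mu D x) (hpart W x))"
  using assms unfolding em_ip_def space_L_def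
  by (simp add: sym_bounded_adjoint[OF eps_coeff] sym_bounded_adjoint[OF mu_coeff])

text \<open>The sesquilinear form with curls and traces as explicit arguments and the matrix
  coefficients on the test side. Each summand pairs one datum of the solution with a fixed square
  integrable field, the shape that passes to Fourier coefficients.\<close>

definition graph_form where
  "graph_form e h te th v cv tv cw tw =
     L2_ip M e (\<lambda>x. mat_app (sig D x) (v x)) + L2_ip N te (\<lambda>x. mat_app (Yimp D x) (tv x)) +
     L2_ip N th (\<lambda>x. mat_app (Zimp D x) (tw x)) + L2_ip M h cv - L2_ip M e cw"

lemma em_form_in_V:
  assumes U: "in_V U ce ch te th" and W: "in_V W cv cw tv tw"
  shows "em_form D U W = graph_form (epart U) (hpart U) te th (epart W) cv tv cw tw"
proof -
  note sU = in_V_sq[OF U] and sW = in_V_sq[OF W]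
  note sU' = in_V_sq[OF space_V_in_V[OF in_V_space_V[OF U]]] and sW' = in_V_sq[OF space_V_in_V[OF in_V_space_V[OF W]]]
  have Ue: "AE x in N. itrace D (epart U) x = te x" and Uh: "AE x in N. itrace D (hpart U) x = th x"
    using U unfolding in_V_def by (auto dest: in_X_I)
  have We: "AE x in N. itrace D (epart W) x = tv x" and Wh: "AE x in N. itrace D (hpart W) x = tw x"
    and Wce: "AE x in M. dcurl D (epart W) x = cv x" and Wch: "AE x in M. dcurl D (hpart W) x = cw x"
    using W unfolding in_V_def by (auto dest: in_X_I)
  have 1: "L2_ip M (\<lambda>x. mat_app (sig D x) (epart U x)) (epart W) = L2_ip M (epart U) (\<lambda>x. mat_app (sig D x) (epart W x))"
    by (rule sym_bounded_adjoint[OF sig_coeff sU(1) sW(1)])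
  have 2: "L2_ip N (\<lambda>x. mat_app (Yimp D x) (itrace D (epart U) x)) (itrace D (epart W)) = L2_ip N te (\<lambda>x. mat_app (Yimp D x) (tv x))"
  proof -
    have "L2_ip N (\<lambda>x. mat_app (Yimp D x) (itrace D (epart U) x)) (itrace D (epart W)) =
        L2_ip N (itrace D (epart U)) (\<lambda>x. mat_app (Yimp D x) (itrace D (epart W) x))"
      by (rule sym_bounded_adjoint[OF Y_coeff sU'(5) sW'(5)])
    also have "\<dots> = L2_ip N te (\<lambda>x. mat_app (Yimp D x) (tv x))"
    proof (rule L2_ip_cong_AE[OF Ue])
      show "AE x in N. mat_app (Yimp D x) (itrace D (epart W) x) = mat_app (Yimp D x) (tv x)"
        using We by eventually_elim simp
    qed (intro sq_meas sU' sU sym_bounded_sq[OF Y_coeff] sW' sW)+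
    finally show ?thesis .
  qed
  have 3: "L2_ip N (\<lambda>x. mat_app (Zimp D x) (itrace D (hpart U) x)) (itrace D (hpart W)) = L2_ip N th (\<lambda>x. mat_app (Zimp D x) (tw x))"
  proof -
    have "L2_ip N (\<lambda>x. mat_app (Zimp D x) (itrace D (hpart U) x)) (itrace D (hpart W)) =
        L2_ip N (itrace D (hpart U)) (\<lambda>x. mat_app (Zimp D x) (itrace D (hpart W) x))"
      by (rule sym_bounded_adjoint[OF Z_coeff sU'(6) sW'(6)])
    also have "\<dots> = L2_ip N th (\<lambda>x. mat_app (Zimp D x) (tw x))"
    proof (rule L2_ip_cong_AE[OF Uh])
      show "AE x in N. mat_app (Zimp D x) (itrace D (hpart W) x) = mat_app (Zimp D x) (tw x)"
        using Wh by eventually_elim simp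
    qed (intro sq_meas sU' sU sym_bounded_sq[OF Z_coeff] sW' sW)+
    finally show ?thesis .
  qed
  have 4: "L2_ip M (hpart U) (dcurl D (epart W)) = L2_ip M (hpart U) cv"
    by (rule L2_ip_cong_AE[OF _ Wce]) (auto intro: sq_meas sU sW sW')
  have 5: "L2_ip M (epart U) (dcurl D (hpart W)) = L2_ip M (epart U) cw"
    by (rule L2_ip_cong_AE[OF _ Wch]) (auto intro: sq_meas sU sW sW')
  show ?thesis unfolding em_form_def graph_form_def by (simp only: 1 2 3 4 5)
qed

text \<open>Real test fields suffice, since both forms are conjugate linear in the test field.\<close>

lemma em_ip_decomp:
  assumes U: "U \<in> space_L D" and W: "W \<in> space_L D"
  shows "em_ip D U W = em_ip D U (re_field W) - \<i> * em_ip D U (re_field (scale_field (- \<i>) W))"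
proof -
  have s: "sq_integrable M (\<lambda>x. mat_app (eps D x) (epart U x))" "sq_integrable M (\<lambda>x. mat_app (mu D x) (hpart U x))"
    "sq_integrable M (epart W)" "sq_integrable M (hpart W)"
    using U W sym_bounded_sq[OF eps_coeff] sym_bounded_sq[OF mu_coeff] by (auto simp: space_L_def)
  show ?thesis unfolding em_ip_def re_field_parts scale_field_parts L2_ip_decomp[OF s(1,3)] L2_ip_decomp[OF s(2,4)]
    by (simp add: algebra_simps)
qed

lemma em_form_decomp:
  assumes U: "U \<in> space_V D" and W: "W \<in> space_V D"
  shows "em_form D U W = em_form D U (re_field W) - \<i> * em_form D U (re_field (scale_field (- \<i>) W))"
proof -
  note u = space_V_in_V[OF U] and w = space_V_in_V[OF W]
  note su = in_V_sq[OF u] and sw = in_V_sq[OF w]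
  have d1: "L2_ip M f (\<lambda>x. mat_app (A x) (v x)) = L2_ip M f (\<lambda>x. mat_app (A x) (re_vec (v x))) - \<i> * L2_ip M f (\<lambda>x. mat_app (A x) (re_vec ((- \<i>) *s v x)))"
    if "sq_integrable M f" "sq_integrable M v" "sym_bounded_coeff M A" for M :: "(real^3) measure" and f v A
    using L2_ip_decomp[OF that(1) sym_bounded_sq[OF that(3,2)]] by (simp only: mat_app_rev mat_app_scale)
  show ?thesis
    unfolding em_form_in_V[OF u w] em_form_in_V[OF u in_V_re[OF w]] em_form_in_V[OF u in_V_re[OF in_V_scale[OF w]]]
      graph_form_def re_field_parts scale_field_parts
      d1[OF su(1) sw(1) sig_coeff] d1[OF su(5) sw(5) Y_coeff] d1[OF su(6) sw(6) Z_coeff]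
      L2_ip_decomp[OF su(2) sw(3)] L2_ip_decomp[OF su(1) sw(4)]
    by (simp add: algebra_simps)
qed

lemma em_ip_re:
  assumes U: "U \<in> space_L D" and W: "W \<in> real_L D"
  shows "em_ip D (re_field U) W = complex_of_real (Re (em_ip D U W))"
proof -
  have s: "sq_integrable M (epart U)" "sq_integrable M (hpart U)" "sq_integrable M (epart W)" "sq_integrable M (hpart W)"
    and r: "real_valued D W"
    using U W by (auto simp: space_L_def real_L_def)
  show ?thesis
    unfolding em_ip_def re_field_parts mat_app_rev
      L2_ip_rev_left[OF sym_bounded_sq[OF eps_coeff s(1)] s(3) real_valuedD(1)[OF r]]
      L2_ip_rev_left[OF sym_bounded_sq[OF mu_coeff s(2)] s(4) real_valuedD(2)[OF r]]
    by simp
qed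

lemma elliptic_lower:
  assumes el: "unif_elliptic M A" and A: "sym_bounded_coeff M A"
  shows "\<exists>c>0. \<forall>f. sq_integrable M f \<longrightarrow> c * (L2_norm M f)\<^sup>2 \<le> Re (L2_ip M (\<lambda>x. mat_app (A x) (f x)) f)"
proof -
  obtain c where c: "c > 0" "AE x in M. \<forall>\<xi>. c * (norm \<xi>)\<^sup>2 \<le> \<xi> \<bullet> (A x *v \<xi>)"
    using el by (auto simp: unif_elliptic_def)
  have "c * (L2_norm M f)\<^sup>2 \<le> Re (L2_ip M (\<lambda>x. mat_app (A x) (f x)) f)" if f: "sq_integrable M f" for f
  proof (rule L2_elliptic[OF f sym_bounded_sq[OF A f]])
    show "AE x in M. c * (norm (f x))\<^sup>2 \<le> Re (hdot (mat_app (A x) (f x)) (f x))"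
      using c(2)
    proof eventually_elim
      case (elim x)
      then show ?case by (intro elliptic_complex[where P = "\<lambda>_. True"]) auto
    qed
  qed
  with c(1) show ?thesis by blast
qed

text \<open>Ellipticity of \<open>eps\<close> and \<open>mu\<close>, with the smaller of the two
  constants. Hence convergence in the energy norm implies convergence of both components in
  L2.\<close>

lemma em_lower: "\<exists>c>0. \<forall>U\<in>space_L D. c * ((L2_norm M (epart U))\<^sup>2 + (L2_norm M (hpart U))\<^sup>2) \<le> Re (em_ip D U U)"
proof -
  have el: "unif_elliptic M (eps D)" "unif_elliptic M (mu D)" using setting by (simp_all add: maxwell_setting_def)
  obtain a where a: "a > 0" "\<And>f. sq_integrable M f \<Longrightarrow> a * (L2_norm M f)\<^sup>2 \<le> Re (L2_ip M (\<lambda>x. mat_app (eps D x) (f x)) f)"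
    using elliptic_lower[OF el(1) eps_coeff] by blast
  obtain b where b: "b > 0" "\<And>f. sq_integrable M f \<Longrightarrow> b * (L2_norm M f)\<^sup>2 \<le> Re (L2_ip M (\<lambda>x. mat_app (mu D x) (f x)) f)"
    using elliptic_lower[OF el(2) mu_coeff] by blast
  have "min a b * ((L2_norm M (epart U))\<^sup>2 + (L2_norm M (hpart U))\<^sup>2) \<le> Re (em_ip D U U)" if U: "U \<in> space_L D" for U
  proof -
    have s: "sq_integrable M (epart U)" "sq_integrable M (hpart U)" using U by (auto simp: space_L_def)
    have "min a b * (L2_norm M (epart U))\<^sup>2 \<le> a * (L2_norm M (epart U))\<^sup>2" "min a b * (L2_norm M (hpart U))\<^sup>2 \<le> b * (L2_norm M (hpart U))\<^sup>2"
      by (intro mult_right_mono; simp)+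
    with a(2)[OF s(1)] b(2)[OF s(2)] show ?thesis by (simp add: em_ip_def distrib_left)
  qed
  moreover have "min a b > 0" using a(1) b(1) by simp
  ultimately show ?thesis by blast
qed

lemma em_norm_sq:
  assumes "U \<in> space_L D" shows "(em_norm D U)\<^sup>2 = Re (em_ip D U U)" "Re (em_ip D U U) \<ge> 0"
proof -
  obtain c where c: "c > 0" "\<forall>U\<in>space_L D. c * ((L2_norm M (epart U))\<^sup>2 + (L2_norm M (hpart U))\<^sup>2) \<le> Re (em_ip D U U)"
    using em_lower by blast
  have "0 \<le> c * ((L2_norm M (epart U))\<^sup>2 + (L2_norm M (hpart U))\<^sup>2)" using c(1) by simp
  then show "Re (em_ip D U U) \<ge> 0" using c(2) assms by force
  then show "(em_norm D U)\<^sup>2 = Re (em_ip D U U)" by (simp add: em_norm_def)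
qed

lemma em_norm_lower:
  "\<exists>c\<ge>0. \<forall>U\<in>space_L D. L2_norm M (epart U) \<le> c * em_norm D U \<and> L2_norm M (hpart U) \<le> c * em_norm D U"
proof -
  obtain c where c: "c > 0" "\<And>U. U \<in> space_L D \<Longrightarrow> c * ((L2_norm M (epart U))\<^sup>2 + (L2_norm M (hpart U))\<^sup>2) \<le> Re (em_ip D U U)"
    using em_lower by blast
  define k where "k = sqrt (1 / c)"
  have k: "k \<ge> 0" "k\<^sup>2 = 1 / c" using c(1) by (simp_all add: k_def)
  have "L2_norm M (epart U) \<le> k * em_norm D U \<and> L2_norm M (hpart U) \<le> k * em_norm D U" if U: "U \<in> space_L D" for U
  proof -
    have n: "em_norm D U \<ge> 0" using em_norm_sq(2)[OF U] by (simp add: em_norm_def)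
    have "(L2_norm M (epart U))\<^sup>2 + (L2_norm M (hpart U))\<^sup>2 \<le> Re (em_ip D U U) / c"
      using c(2)[OF U] c(1) by (simp add: pos_le_divide_eq mult.commute)
    then have b: "(L2_norm M (epart U))\<^sup>2 + (L2_norm M (hpart U))\<^sup>2 \<le> (k * em_norm D U)\<^sup>2"
      by (simp add: power_mult_distrib k(2) em_norm_sq(1)[OF U])
    have "(L2_norm M (epart U))\<^sup>2 \<le> (k * em_norm D U)\<^sup>2" "(L2_norm M (hpart U))\<^sup>2 \<le> (k * em_norm D U)\<^sup>2"
      using b zero_le_power2[of "L2_norm M (hpart U)"] zero_le_power2[of "L2_norm M (epart U)"] by linarith+
    then show ?thesis using k(1) n by (auto intro: power2_le_imp_le)
  qed
  with k(1) show ?thesis by blast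
qed

lemma em_norm_eq_0:
  assumes U: "U \<in> space_L D" and z: "em_norm D U = 0" shows "AE x in M. U x = 0"
proof -
  obtain c where c: "\<And>U. U \<in> space_L D \<Longrightarrow> L2_norm M (epart U) \<le> c * em_norm D U \<and> L2_norm M (hpart U) \<le> c * em_norm D U"
    using em_norm_lower by blast
  have "L2_norm M (epart U) = 0" "L2_norm M (hpart U) = 0"
    using c[OF U] z L2_norm_nonneg[of M "epart U"] L2_norm_nonneg[of M "hpart U"] by simp_all
  then have "AE x in M. epart U x = 0" "AE x in M. hpart U x = 0"
    using U L2_norm_eq_0 by (auto simp: space_L_def)
  then show ?thesis by eventually_elim (simp add: prod_eq_iff)
qed

text \<open>The direction opposite to \<open>em_norm_lower\<close>: bounded coefficients control the
  energy norm by the L2 norms, in which the Fourier series is shown to converge.\<close>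

lemma em_norm_tendsto:
  assumes L: "\<And>n. F n \<in> space_L D" and e: "(\<lambda>n. L2_norm M (epart (F n))) \<longlonglongrightarrow> 0" and h: "(\<lambda>n. L2_norm M (hpart (F n))) \<longlonglongrightarrow> 0"
  shows "(\<lambda>n. em_norm D (F n)) \<longlonglongrightarrow> 0"
proof -
  have lim: "(\<lambda>n. L2_ip M (\<lambda>x. mat_app (A x) (f n x)) (f n)) \<longlonglongrightarrow> 0"
    if A: "sym_bounded_coeff M A" and f: "\<And>n. sq_integrable M (f n)" and l: "(\<lambda>n. L2_norm M (f n)) \<longlonglongrightarrow> 0" for A f
  proof -
    obtain C where C: "AE x in M. norm (A x) \<le> C" using A by (auto simp: sym_bounded_coeff_def)
    have b: "L2_norm M (\<lambda>x. mat_app (A x) (f n x)) \<le> \<bar>9 * C\<bar> * L2_norm M (f n)" for n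
    proof (rule power2_le_imp_le)
      have "(L2_norm M (\<lambda>x. mat_app (A x) (f n x)))\<^sup>2 \<le> (LINT x|M. (9 * C)\<^sup>2 * (norm (f n x))\<^sup>2)"
        unfolding L2_norm_sq
      proof (rule integral_mono_AE)
        show "integrable M (\<lambda>x. (norm (mat_app (A x) (f n x)))\<^sup>2)" "integrable M (\<lambda>x. (9 * C)\<^sup>2 * (norm (f n x))\<^sup>2)"
          using f sym_bounded_sq[OF A f] by (simp_all add: sq_integrable_def)
        show "AE x in M. (norm (mat_app (A x) (f n x)))\<^sup>2 \<le> (9 * C)\<^sup>2 * (norm (f n x))\<^sup>2"
          using C
        proof eventually_elim
          case (elim x)
          have "norm (mat_app (A x) (f n x)) \<le> 9 * norm (A x) * norm (f n x)" by (rule norm_mat_app_le)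
          also have "\<dots> \<le> 9 * C * norm (f n x)" using elim by (intro mult_right_mono) auto
          finally show ?case unfolding power_mult_distrib[symmetric] by (intro power_mono) auto
        qed
      qed
      also have "\<dots> = (\<bar>9 * C\<bar> * L2_norm M (f n))\<^sup>2" by (simp add: L2_norm_sq power_mult_distrib)
      finally show "(L2_norm M (\<lambda>x. mat_app (A x) (f n x)))\<^sup>2 \<le> (\<bar>9 * C\<bar> * L2_norm M (f n))\<^sup>2" .
    qed simp
    show ?thesis
    proof (rule Lim_null_comparison)
      show "\<forall>\<^sub>F n in sequentially. norm (L2_ip M (\<lambda>x. mat_app (A x) (f n x)) (f n)) \<le> \<bar>9 * C\<bar> * L2_norm M (f n) * L2_norm M (f n)"
      proof (rule always_eventually, rule allI)
        fix n
        show "norm (L2_ip M (\<lambda>x. mat_app (A x) (f n x)) (f n)) \<le> \<bar>9 * C\<bar> * L2_norm M (f n) * L2_norm M (f n)"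
          by (rule order_trans[OF L2_cauchy_schwarz[OF sym_bounded_sq[OF A f] f] mult_right_mono[OF b L2_norm_nonneg]])
      qed
      have "(\<lambda>n. \<bar>9 * C\<bar> * L2_norm M (f n) * L2_norm M (f n)) \<longlonglongrightarrow> \<bar>9 * C\<bar> * 0 * 0" by (intro tendsto_intros l)
      then show "(\<lambda>n. \<bar>9 * C\<bar> * L2_norm M (f n) * L2_norm M (f n)) \<longlonglongrightarrow> 0" by simp
    qed
  qed
  have s: "sq_integrable M (epart (F n))" "sq_integrable M (hpart (F n))" for n using L[of n] by (auto simp: space_L_def)
  have "(\<lambda>n. sqrt (Re (em_ip D (F n) (F n)))) \<longlonglongrightarrow> sqrt (Re (0 + 0))"
    unfolding em_ip_def by (intro tendsto_intros lim eps_coeff mu_coeff s e h)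
  then show ?thesis by (simp add: em_norm_def)
qed

text \<open>Turns continuity of a curve in \<open>V_norm\<close> into continuity of its curls and
  traces as curves in L2.\<close>

lemma V_norm_ge:
  assumes "U \<in> space_L D"
  shows "em_norm D U \<le> V_norm D U" "L2_norm M (dcurl D (epart U)) \<le> V_norm D U" "L2_norm M (dcurl D (hpart U)) \<le> V_norm D U"
    "L2_norm N (itrace D (epart U)) \<le> V_norm D U" "L2_norm N (itrace D (hpart U)) \<le> V_norm D U"
  unfolding V_norm_def L2_ip_self
  by (intro real_le_rsqrt; simp)+

end

section \<open>Periodic solutions\<close>

lemma L2_ip_AE_zero_right:
  assumes "AE x in M. g x = 0" shows "L2_ip M f g = 0"
  unfolding L2_ip_def by (rule integral_eq_zero_AE) (use assms in \<open>eventually_elim, simp\<close>)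

lemma L2_ip_AE_zero_left:
  assumes "AE x in M. f x = 0" shows "L2_ip M f g = 0"
  using L2_ip_AE_zero_right[OF assms, of g] L2_ip_commute[of M f g] by simp

context maxwell_problem
begin

section \<open>Linearity of the energy product in its first argument\<close>

lemma space_L_add: "U \<in> space_L D \<Longrightarrow> W \<in> space_L D \<Longrightarrow> (\<lambda>x. U x + W x) \<in> space_L D"
  by (simp add: space_L_def sq_integrable_add)

lemma space_L_diff: "U \<in> space_L D \<Longrightarrow> W \<in> space_L D \<Longrightarrow> (\<lambda>x. U x - W x) \<in> space_L D"
  by (simp add: space_L_def sq_integrable_diff)

lemma space_L_scaleR: "U \<in> space_L D \<Longrightarrow> (\<lambda>x. r *\<^sub>R U x) \<in> space_L D"
  by (simp add: space_L_def sq_integrable_scaleR)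

lemma space_L_scale_field: "U \<in> space_L D \<Longrightarrow> scale_field k U \<in> space_L D"
  by (simp add: space_L_def scale_field_parts sq_integrable_scale)

lemma space_L_re_field: "U \<in> space_L D \<Longrightarrow> re_field U \<in> space_L D"
  by (simp add: space_L_def re_field_parts sq_integrable_rev)

lemma space_L_sum: "(\<And>i. i \<in> I \<Longrightarrow> F i \<in> space_L D) \<Longrightarrow> (\<lambda>x. \<Sum>i\<in>I. F i x) \<in> space_L D"
  by (simp add: space_L_def fst_sum snd_sum sq_integrable_sum)

lemma em_ip_add_left:
  assumes "U \<in> space_L D" "U' \<in> space_L D" "W \<in> space_L D"
  shows "em_ip D (\<lambda>x. U x + U' x) W = em_ip D U W + em_ip D U' W"
proof -
  have s: "sq_integrable M (epart U)" "sq_integrable M (hpart U)" "sq_integrable M (epart U')" "sq_integrable M (hpart U')"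
    "sq_integrable M (\<lambda>x. mat_app (eps D x) (epart W x))" "sq_integrable M (\<lambda>x. mat_app (mu D x) (hpart W x))"
    using assms sym_bounded_sq[OF eps_coeff] sym_bounded_sq[OF mu_coeff] by (auto simp: space_L_def)
  show ?thesis
    unfolding em_ip_adj[OF space_L_add[OF assms(1,2)] assms(3)] em_ip_adj[OF assms(1,3)] em_ip_adj[OF assms(2,3)] fst_add snd_add
      L2_ip_add_left[OF s(1,3,5)] L2_ip_add_left[OF s(2,4,6)] by simp
qed

lemma em_ip_scale_field_left: "em_ip D (scale_field k U) W = k * em_ip D U W"
  unfolding em_ip_def scale_field_parts mat_app_scale L2_ip_scale_left by (simp add: distrib_left)

lemma em_ip_scaleR_left: "em_ip D (\<lambda>x. r *\<^sub>R U x) W = complex_of_real r * em_ip D U W"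
proof -
  have "(\<lambda>x. r *\<^sub>R U x) = scale_field (complex_of_real r) U"
    by (simp add: scale_field_def fun_eq_iff prod_eq_iff scaleR_vscale)
  then show ?thesis by (simp only: em_ip_scale_field_left)
qed

lemma em_ip_diff_left:
  assumes "U \<in> space_L D" "U' \<in> space_L D" "W \<in> space_L D"
  shows "em_ip D (\<lambda>x. U x - U' x) W = em_ip D U W - em_ip D U' W"
  using em_ip_add_left[OF assms(1) space_L_scaleR[OF assms(2), of "-1"] assms(3)] em_ip_scaleR_left[of "-1" U' W]
  by simp

lemma em_ip_sum_left:
  assumes "\<And>i. i \<in> I \<Longrightarrow> F i \<in> space_L D" "W \<in> space_L D"
  shows "em_ip D (\<lambda>x. \<Sum>i\<in>I. F i x) W = (\<Sum>i\<in>I. em_ip D (F i) W)"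
  using assms(1)
proof (induction I rule: infinite_finite_induct)
  case (insert i I)
  then have "em_ip D (\<lambda>x. F i x + (\<Sum>i\<in>I. F i x)) W = em_ip D (F i) W + em_ip D (\<lambda>x. \<Sum>i\<in>I. F i x) W"
    by (intro em_ip_add_left space_L_sum assms(2)) auto
  with insert show ?case by simp
qed (use em_ip_scaleR_left[of 0 "\<lambda>x. 0" W] in auto)

lemma em_ip_cong_left:
  assumes "U \<in> space_L D" "U' \<in> space_L D" "W \<in> space_L D" "AE x in M. U x = U' x"
  shows "em_ip D U W = em_ip D U' W"
proof -
  have s: "sq_integrable M (epart U)" "sq_integrable M (hpart U)" "sq_integrable M (epart U')" "sq_integrable M (hpart U')"
    "sq_integrable M (\<lambda>x. mat_app (eps D x) (epart W x))" "sq_integrable M (\<lambda>x. mat_app (mu D x) (hpart W x))"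
    using assms sym_bounded_sq[OF eps_coeff] sym_bounded_sq[OF mu_coeff] by (auto simp: space_L_def)
  have "AE x in M. epart U x = epart U' x" "AE x in M. hpart U x = hpart U' x"
    using assms(4) by (eventually_elim, simp)+
  then show ?thesis
    unfolding em_ip_adj[OF assms(1,3)] em_ip_adj[OF assms(2,3)]
    using s[THEN sq_meas] by (intro arg_cong2[of _ _ _ _ "(+)"] L2_ip_cong_AE) auto
qed

lemma in_V_diff:
  assumes U: "in_V U ce ch te th" and U': "in_V U' ce' ch' te' th'"
  shows "in_X (\<lambda>x. epart U x - epart U' x) (\<lambda>x. ce x - ce' x) (\<lambda>x. te x - te' x)"
    "in_X (\<lambda>x. hpart U x - hpart U' x) (\<lambda>x. ch x - ch' x) (\<lambda>x. th x - th' x)"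
proof -
  have d: "in_X (\<lambda>x. v x - v' x) (\<lambda>x. c x - c' x) (\<lambda>x. g x - g' x)" if "in_X v c g" "in_X v' c' g'" for v v' c c' g g'
    using in_X_add[OF that(1) in_X_scale[OF that(2), of "-1"]] by (simp add: vector_sneg_minus1[symmetric])
  show "in_X (\<lambda>x. epart U x - epart U' x) (\<lambda>x. ce x - ce' x) (\<lambda>x. te x - te' x)"
    "in_X (\<lambda>x. hpart U x - hpart U' x) (\<lambda>x. ch x - ch' x) (\<lambda>x. th x - th' x)"
    using U U' unfolding in_V_def by (auto intro: d)
qed

lemma em_norm_null_parts:
  assumes L: "\<And>s. s \<in> S \<Longrightarrow> s \<noteq> t \<Longrightarrow> F s \<in> space_L D" and lim: "((\<lambda>s. em_norm D (F s)) \<longlongrightarrow> 0) (at t within S)"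
  shows "((\<lambda>s. L2_norm M (epart (F s))) \<longlongrightarrow> 0) (at t within S)" "((\<lambda>s. L2_norm M (hpart (F s))) \<longlongrightarrow> 0) (at t within S)"
proof -
  obtain c where c: "\<And>U. U \<in> space_L D \<Longrightarrow> L2_norm M (epart U) \<le> c * em_norm D U \<and> L2_norm M (hpart U) \<le> c * em_norm D U"
    using em_norm_lower by blast
  have l: "((\<lambda>s. c * em_norm D (F s)) \<longlongrightarrow> 0) (at t within S)" using tendsto_mult_right_zero[OF lim, of c] .
  show "((\<lambda>s. L2_norm M (epart (F s))) \<longlongrightarrow> 0) (at t within S)"
  proof (rule Lim_null_comparison[OF _ l])
    show "\<forall>\<^sub>F s in at t within S. norm (L2_norm M (epart (F s))) \<le> c * em_norm D (F s)"
      unfolding eventually_at_filter using c[OF L] by (intro always_eventually) simp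
  qed
  show "((\<lambda>s. L2_norm M (hpart (F s))) \<longlongrightarrow> 0) (at t within S)"
  proof (rule Lim_null_comparison[OF _ l])
    show "\<forall>\<^sub>F s in at t within S. norm (L2_norm M (hpart (F s))) \<le> c * em_norm D (F s)"
      unfolding eventually_at_filter using c[OF L] by (intro always_eventually) simp
  qed
qed

text \<open>In general \<open>sig\<close> is only semidefinite, being elliptic on
  \<open>Dom_sig D\<close> and zero elsewhere. A vanishing quadratic form still forces \<sigma> v =
  0: on \<open>Dom_sig D\<close> because v = 0, elsewhere because the matrix is zero.\<close>

lemma sigma_semidefinite:
  "AE x in M. \<forall>v. 0 \<le> Re (hdot (mat_app (sig D x) v) v) \<and>
     (Re (hdot (mat_app (sig D x) v) v) = 0 \<longrightarrow> mat_app (sig D x) v = 0)"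
proof -
  have op: "open (Dom_sig D)" and sub: "Dom_sig D \<subseteq> Dom D" and off: "AE x in M. x \<notin> Dom_sig D \<longrightarrow> sig D x = 0"
    and el: "unif_elliptic (lebesgue_on (Dom_sig D)) (sig D)"
    using setting by (simp_all add: maxwell_setting_def)
  obtain c where c: "c > 0" "AE x in lebesgue_on (Dom_sig D). \<forall>\<xi>. c * (norm \<xi>)\<^sup>2 \<le> \<xi> \<bullet> (sig D x *v \<xi>)"
    using el by (auto simp: unif_elliptic_def)
  have s: "Dom_sig D \<inter> space lebesgue \<in> sets lebesgue" "Dom D \<inter> space lebesgue \<in> sets lebesgue"
    using op open_dom by (simp_all add: borel_open)
  have "AE x in lebesgue. x \<in> Dom_sig D \<longrightarrow> (\<forall>\<xi>. c * (norm \<xi>)\<^sup>2 \<le> \<xi> \<bullet> (sig D x *v \<xi>))"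
    using c(2) unfolding AE_restrict_space_iff[OF s(1)] .
  then have "AE x in M. x \<in> Dom_sig D \<longrightarrow> (\<forall>\<xi>. c * (norm \<xi>)\<^sup>2 \<le> \<xi> \<bullet> (sig D x *v \<xi>))"
    unfolding AE_restrict_space_iff[OF s(2)] by eventually_elim blast
  then show ?thesis using off
  proof eventually_elim
    case (elim x)
    show ?case
    proof (cases "x \<in> Dom_sig D")
      case True
      have l: "c * (norm v)\<^sup>2 \<le> Re (hdot (mat_app (sig D x) v) v)" for v
        using elim(1) True by (intro elliptic_complex[where P = "\<lambda>_. True"]) auto
      show ?thesis
      proof (intro allI conjI impI)
        fix v :: "complex^3"
        have "0 \<le> c * (norm v)\<^sup>2" using c(1) by simp
        then show "0 \<le> Re (hdot (mat_app (sig D x) v) v)" using l[of v] by linarith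
        assume "Re (hdot (mat_app (sig D x) v) v) = 0"
        then have "c * (norm v)\<^sup>2 \<le> 0" using l[of v] by simp
        then have "v = 0" using c(1) by (simp add: mult_le_0_iff)
        then show "mat_app (sig D x) v = 0" by simp
      qed
    next
      case False
      then show ?thesis using elim(2) by simp
    qed
  qed
qed

lemma tangential_parts:
  assumes "bdot g n = 0" shows "n \<bullet> rpart g = 0" "n \<bullet> ipart g = 0"
proof -
  have "bdot g n = complex_of_real (n \<bullet> rpart g) + \<i> * complex_of_real (n \<bullet> ipart g)"
    by (simp add: bdot_def inner_vec_def rpart_def ipart_def complex_eq_iff mult.commute)
  then show "n \<bullet> rpart g = 0" "n \<bullet> ipart g = 0" using assms by (simp_all add: complex_eq_iff)
qed

text \<open>The lower bound holds for tangential vectors only. It applies to traces because the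
  normal is real, so the real and imaginary parts of a tangential field are tangential too.\<close>

lemma tangential_elliptic_zero:
  assumes A: "sym_bounded_coeff N A" and el: "\<exists>c>0. AE x in N. \<forall>\<xi>. nrml D x \<bullet> \<xi> = 0 \<longrightarrow> c * (norm \<xi>)\<^sup>2 \<le> \<xi> \<bullet> (A x *v \<xi>)"
    and g: "sq_integrable N g" "AE x in N. bdot (g x) (nrml D x) = 0"
  shows "0 \<le> Re (L2_ip N g (\<lambda>x. mat_app (A x) (g x)))"
    "Re (L2_ip N g (\<lambda>x. mat_app (A x) (g x))) = 0 \<Longrightarrow> AE x in N. g x = 0"
proof -
  obtain c where c: "c > 0" "AE x in N. \<forall>\<xi>. nrml D x \<bullet> \<xi> = 0 \<longrightarrow> c * (norm \<xi>)\<^sup>2 \<le> \<xi> \<bullet> (A x *v \<xi>)"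
    using el by blast
  have "AE x in N. c * (norm (g x))\<^sup>2 \<le> Re (hdot (mat_app (A x) (g x)) (g x))"
    using c(2) g(2)
  proof eventually_elim
    case (elim x)
    then show ?case by (intro elliptic_complex[where P = "\<lambda>\<xi>. nrml D x \<bullet> \<xi> = 0"] tangential_parts) auto
  qed
  then have "c * (L2_norm N g)\<^sup>2 \<le> Re (L2_ip N (\<lambda>x. mat_app (A x) (g x)) g)"
    by (rule L2_elliptic[OF g(1) sym_bounded_sq[OF A g(1)]])
  then have b: "c * (L2_norm N g)\<^sup>2 \<le> Re (L2_ip N g (\<lambda>x. mat_app (A x) (g x)))"
    by (simp only: sym_bounded_adjoint[OF A g(1) g(1)])
  have "0 \<le> c * (L2_norm N g)\<^sup>2" using c(1) by simp
  then show "0 \<le> Re (L2_ip N g (\<lambda>x. mat_app (A x) (g x)))" using b by linarith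
  assume "Re (L2_ip N g (\<lambda>x. mat_app (A x) (g x))) = 0"
  then have "L2_norm N g = 0" using b c(1) by (simp add: mult_le_0_iff)
  then show "AE x in N. g x = 0" by (rule L2_norm_eq_0[OF g(1)])
qed

lemma graph_form_zero_left:
  "graph_form e h te th (\<lambda>x. 0) (\<lambda>x. 0) (\<lambda>x. 0) cw tw = L2_ip N th (\<lambda>x. mat_app (Zimp D x) (tw x)) - L2_ip M e cw"
  by (simp add: graph_form_def)

lemma graph_form_zero_right:
  "graph_form e h te th v cv tv (\<lambda>x. 0) (\<lambda>x. 0) =
    L2_ip M e (\<lambda>x. mat_app (sig D x) (v x)) + L2_ip N te (\<lambda>x. mat_app (Yimp D x) (tv x)) + L2_ip M h cv"
  by (simp add: graph_form_def)

text \<open>Kernel of the form: the test field \<open>(0, \<phi>)\<close> gives \<open>curl e = 0\<close>, then \<open>(e, 0)\<close> gives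
  \<open>\<sigma> e = 0\<close> and the trace of \<open>e\<close>, then \<open>(\<phi>, 0)\<close> gives \<open>curl h = 0\<close>, and \<open>(0, h)\<close> the trace of \<open>h\<close>.\<close>

lemma form_kernel:
  assumes U: "in_V U ce ch te th" and z: "\<And>W. W \<in> space_V D \<Longrightarrow> em_form D U W = 0"
  shows "AE x in M. ce x = 0" "AE x in M. ch x = 0" "AE x in N. te x = 0" "AE x in N. th x = 0"
    "AE x in M. mat_app (sig D x) (epart U x) = 0"
proof -
  note s = in_V_sq[OF U]
  have ctc: "has_curl (Dom D) (epart U) ce" "has_curl (Dom D) (hpart U) ch"
    and tang: "AE x in N. bdot (te x) (nrml D x) = 0" "AE x in N. bdot (th x) (nrml D x) = 0"
    using U by (auto simp: in_V_def in_X_def has_tr_def)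
  have left: "graph_form (epart U) (hpart U) te th v cv tv (\<lambda>x. 0) (\<lambda>x. 0) = 0" if "in_X v cv tv" "zero_on_P v cv" for v cv tv
  proof -
    have "in_V (\<lambda>x. (v x, 0)) cv (\<lambda>x. 0) tv (\<lambda>x. 0)" unfolding in_V_def using that in_X_zero by simp
    from em_form_in_V[OF U this] z[OF in_V_space_V[OF this]] show ?thesis by simp
  qed
  have right: "graph_form (epart U) (hpart U) te th (\<lambda>x. 0) (\<lambda>x. 0) (\<lambda>x. 0) cw tw = 0" if "in_X w cw tw" for w cw tw
  proof -
    have "in_V (\<lambda>x. (0, w x)) (\<lambda>x. 0) cw (\<lambda>x. 0) tw" unfolding in_V_def using that in_X_zero zero_on_P_zero by simp
    from em_form_in_V[OF U this] z[OF in_V_space_V[OF this]] show ?thesis by simp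
  qed
  have "has_curl (Dom D) (epart U) (\<lambda>x. 0)"
    unfolding has_curl_iff
  proof (intro conjI ballI impI)
    fix \<phi> assume \<phi>: "\<phi> \<in> test_fields" "fsupport \<phi> \<subseteq> Dom D"
    show "L2_ip M (\<lambda>x. 0) (\<lambda>x. cvec (\<phi> x)) = L2_ip M (epart U) (\<lambda>x. cvec (classical_curl \<phi> x))"
      using right[OF in_X_test(1)[OF \<phi>]] by (simp add: graph_form_zero_left)
  qed (use s in auto)
  then show ce: "AE x in M. ce x = 0" using has_curl_unique[OF open_dom ctc(1)] by blast
  have XPe: "in_X (epart U) ce te" "zero_on_P (epart U) ce" and Xh: "in_X (hpart U) ch th" using U by (auto simp: in_V_def)
  have sq\<sigma>: "sq_integrable M (\<lambda>x. mat_app (sig D x) (epart U x))" by (rule sym_bounded_sq[OF sig_coeff s(1)])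
  have int: "integrable M (\<lambda>x. Re (hdot (mat_app (sig D x) (epart U x)) (epart U x)))"
    using integrable_bounded_linear[OF bounded_linear_Re integrable_hdot[OF sq\<sigma> s(1)]] .
  have nn: "AE x in M. 0 \<le> Re (hdot (mat_app (sig D x) (epart U x)) (epart U x))"
    using sigma_semidefinite by eventually_elim blast
  have Re\<sigma>: "Re (L2_ip M (epart U) (\<lambda>x. mat_app (sig D x) (epart U x))) =
      (LINT x|M. Re (hdot (mat_app (sig D x) (epart U x)) (epart U x)))"
    unfolding sym_bounded_adjoint[OF sig_coeff s(1) s(1), symmetric] by (rule Re_L2_ip[OF sq\<sigma> s(1)])
  have \<sigma>0: "Re (L2_ip M (epart U) (\<lambda>x. mat_app (sig D x) (epart U x))) \<ge> 0"
    unfolding Re\<sigma> by (rule integral_nonneg_AE[OF nn])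
  note Yel = tangential_elliptic_zero[OF Y_coeff Y_elliptic s(5) tang(1)]
  \<comment> \<open>The remaining term pairs h with the curl of e, which is already known to vanish.
    The two real parts that are left are nonnegative and add up to zero.\<close>
  have "L2_ip M (epart U) (\<lambda>x. mat_app (sig D x) (epart U x)) + L2_ip N te (\<lambda>x. mat_app (Yimp D x) (te x)) = 0"
    using left[OF XPe] L2_ip_AE_zero_right[OF ce] by (simp add: graph_form_zero_right)
  then have "Re (L2_ip M (epart U) (\<lambda>x. mat_app (sig D x) (epart U x))) + Re (L2_ip N te (\<lambda>x. mat_app (Yimp D x) (te x))) = 0"
    by (metis plus_complex.simps(1) zero_complex.simps(1))
  then have r0: "Re (L2_ip M (epart U) (\<lambda>x. mat_app (sig D x) (epart U x))) = 0"
    "Re (L2_ip N te (\<lambda>x. mat_app (Yimp D x) (te x))) = 0"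
    using \<sigma>0 Yel(1) by linarith+
  show te: "AE x in N. te x = 0" by (rule Yel(2)[OF r0(2)])
  have "AE x in M. Re (hdot (mat_app (sig D x) (epart U x)) (epart U x)) = 0"
    using integral_nonneg_eq_0_iff_AE[OF int nn] r0(1) Re\<sigma> by simp
  then show se: "AE x in M. mat_app (sig D x) (epart U x) = 0"
    using sigma_semidefinite by eventually_elim blast
  have "has_curl (Dom D) (hpart U) (\<lambda>x. 0)"
    unfolding has_curl_iff
  proof (intro conjI ballI impI)
    fix \<phi> assume \<phi>: "\<phi> \<in> test_fields" "fsupport \<phi> \<subseteq> Dom D"
    have "L2_ip M (epart U) (\<lambda>x. mat_app (sig D x) (cvec (\<phi> x))) = L2_ip M (\<lambda>x. mat_app (sig D x) (epart U x)) (\<lambda>x. cvec (\<phi> x))"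
      by (rule sym_bounded_adjoint[OF sig_coeff s(1), symmetric])
        (rule sq_integrable_test(1)[OF tame_lebesgue_on[OF open_dom] \<phi>(1)])
    also have "\<dots> = 0" by (rule L2_ip_AE_zero_left[OF se])
    finally show "L2_ip M (\<lambda>x. 0) (\<lambda>x. cvec (\<phi> x)) = L2_ip M (hpart U) (\<lambda>x. cvec (classical_curl \<phi> x))"
      using left[OF in_X_test[OF \<phi>]] by (simp add: graph_form_zero_right)
  qed (use s in auto)
  then show ch: "AE x in M. ch x = 0" using has_curl_unique[OF open_dom ctc(2)] by blast
  have "L2_ip N th (\<lambda>x. mat_app (Zimp D x) (th x)) = 0"
    using right[OF Xh] L2_ip_AE_zero_right[OF ch] by (simp add: graph_form_zero_left)
  then show "AE x in N. th x = 0"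
    using tangential_elliptic_zero(2)[OF Z_coeff Z_elliptic s(6) tang(2)] by simp
qed

lemma in_V_space_K:
  assumes U: "in_V U ce ch te th" and "AE x in M. ce x = 0" "AE x in M. ch x = 0" "AE x in N. te x = 0" "AE x in N. th x = 0"
  shows "U \<in> space_K D"
proof -
  have "in_X (epart U) ce te" "in_X (hpart U) ch th" using U by (auto simp: in_V_def)
  note e = in_X_I(2,3)[OF this(1)] and h = in_X_I(2,3)[OF this(2)]
  have z: "ccross 0 n = 0" for n by (simp add: ccross_def vec_eq_iff forall_3 vector_3)
  have "AE x in N. ccross (itrace D (epart U) x) (cvec (nrml D x)) = 0 \<and> ccross (itrace D (hpart U) x) (cvec (nrml D x)) = 0"
    using e(2) h(2) assms(4,5) by eventually_elim (simp add: z)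
  moreover have "AE x in M. dcurl D (epart U) x = 0 \<and> dcurl D (hpart U) x = 0"
    using e(1) h(1) assms(2,3) by eventually_elim simp
  ultimately show ?thesis using in_V_space_V[OF U] by (simp add: space_K_def)
qed

lemma graph_form_AE_zero:
  assumes "AE x in M. mat_app (sig D x) (v x) = 0" "AE x in M. cv x = 0" "AE x in N. tv x = 0" "AE x in M. cw x = 0" "AE x in N. tw x = 0"
  shows "graph_form e h te th v cv tv cw tw = 0"
proof -
  have "AE x in N. mat_app (Yimp D x) (tv x) = 0" "AE x in N. mat_app (Zimp D x) (tw x) = 0"
    using assms(3,5) by (eventually_elim, simp)+
  then show ?thesis unfolding graph_form_def using assms by (simp add: L2_ip_AE_zero_right)
qed

end

text \<open>The derivative is known to vanish only inside the interval, as the evolution equation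
  is; the integral in the fundamental theorem of calculus ignores the two end points.\<close>

lemma constant_of_zero_derivative:
  fixes \<phi> :: "real \<Rightarrow> complex"
  assumes der: "\<And>t. t \<in> {0..T} \<Longrightarrow> (\<phi> has_vector_derivative \<phi>' t) (at t within {0..T})"
    and zero: "\<And>t. t \<in> {0<..<T} \<Longrightarrow> \<phi>' t = 0" and t: "t \<in> {0..T}"
  shows "\<phi> t = \<phi> 0"
proof -
  have "(\<phi> has_vector_derivative \<phi>' s) (at s within {0..t})" if "s \<in> {0..t}" for s
    using der[of s] that t by (auto intro: has_vector_derivative_within_subset)
  then have "(\<phi>' has_integral \<phi> t - \<phi> 0) {0..t}"
    using t by (intro fundamental_theorem_of_calculus) auto
  moreover have "(\<phi>' has_integral 0) {0..t}"
    by (rule has_integral_spike_finite[OF _ _ has_integral_0, of "{0, T}"]) (use t zero in auto)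
  ultimately show ?thesis by (metis has_integral_unique right_minus_eq)
qed

locale periodic_maxwell = maxwell_problem +
  fixes \<omega> :: real and \<psi> :: emfield and R R' :: "real \<Rightarrow> emfield"
  assumes omega: "\<omega> > 0" and psi: "\<psi> \<in> space_L D"
    and R_V: "\<And>t. t \<in> {0..period \<omega>} \<Longrightarrow> R t \<in> real_V D"
    and R_cont: "\<And>t. t \<in> {0..period \<omega>} \<Longrightarrow> ((\<lambda>s. V_norm D (\<lambda>x. R s x - R t x)) \<longlongrightarrow> 0) (at t within {0..period \<omega>})"
    and R'_L: "\<And>t. t \<in> {0..period \<omega>} \<Longrightarrow> R' t \<in> real_L D"
    and R'_deriv: "\<And>t. t \<in> {0..period \<omega>} \<Longrightarrow>
      ((\<lambda>s. em_norm D (\<lambda>x. (R s x - R t x) /\<^sub>R (s - t) - R' t x)) \<longlongrightarrow> 0) (at t within {0..period \<omega>})"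
    and R'_cont: "\<And>t. t \<in> {0..period \<omega>} \<Longrightarrow> ((\<lambda>s. em_norm D (\<lambda>x. R' s x - R' t x)) \<longlongrightarrow> 0) (at t within {0..period \<omega>})"
    and R_eq: "\<And>t v. t \<in> {0<..<period \<omega>} \<Longrightarrow> v \<in> real_V D \<Longrightarrow>
      em_ip D (R' t) v + em_form D (R t) v = em_ip D (source_at \<psi> \<omega> t) v"
    and R_per: "AE x in M. R (period \<omega>) x = R 0 x"
begin

section \<open>Continuity of the periodic solution with its curls and traces\<close>

abbreviation I :: "real set" where "I \<equiv> {0..period \<omega>}"

abbreviation "ce t \<equiv> dcurl D (epart (R t))"
abbreviation "ch t \<equiv> dcurl D (hpart (R t))"
abbreviation "te t \<equiv> itrace D (epart (R t))"
abbreviation "th t \<equiv> itrace D (hpart (R t))"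

lemma ends: "0 \<in> I" "period \<omega> \<in> I"
  using omega by auto

lemma R_in_V: "t \<in> I \<Longrightarrow> in_V (R t) (ce t) (ch t) (te t) (th t)"
  using R_V by (intro space_V_in_V) (simp add: real_V_def)

lemma R_L: "t \<in> I \<Longrightarrow> R t \<in> space_L D"
  using R_V V_L by (simp add: real_V_def)

lemma R_real: "t \<in> I \<Longrightarrow> real_valued D (R t)"
  using R_V by (simp add: real_V_def)

lemma R'_space_L: "t \<in> I \<Longrightarrow> R' t \<in> space_L D"
  using R'_L by (simp add: real_L_def)

lemma null_le:
  assumes "\<And>s. s \<in> I \<Longrightarrow> 0 \<le> f s \<and> f s \<le> (g s::real)" "(g \<longlongrightarrow> 0) (at t within I)"
  shows "(f \<longlongrightarrow> 0) (at t within I)"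
proof (rule Lim_null_comparison[OF _ assms(2)])
  show "\<forall>\<^sub>F s in at t within I. norm (f s) \<le> g s"
    unfolding eventually_at_filter using assms(1) by (intro always_eventually) simp
qed

lemma em_norm_nonneg: "U \<in> space_L D \<Longrightarrow> 0 \<le> em_norm D U"
  using em_norm_sq(2) by (simp add: em_norm_def)

lemma cont_L:
  "L2_cont_on M (period \<omega>) (\<lambda>t. epart (R t))" "L2_cont_on M (period \<omega>) (\<lambda>t. hpart (R t))"
  "L2_cont_on M (period \<omega>) (\<lambda>t. epart (R' t))" "L2_cont_on M (period \<omega>) (\<lambda>t. hpart (R' t))"
proof -
  have cont: "L2_cont_on M (period \<omega>) (\<lambda>t. epart (Q t))" "L2_cont_on M (period \<omega>) (\<lambda>t. hpart (Q t))"
    if L: "\<And>t. t \<in> I \<Longrightarrow> Q t \<in> space_L D"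
      and lim: "\<And>t. t \<in> I \<Longrightarrow> ((\<lambda>s. em_norm D (\<lambda>x. Q s x - Q t x)) \<longlongrightarrow> 0) (at t within I)" for Q
  proof -
    have "((\<lambda>s. L2_norm M (epart (\<lambda>x. Q s x - Q t x))) \<longlongrightarrow> 0) (at t within I)"
      "((\<lambda>s. L2_norm M (hpart (\<lambda>x. Q s x - Q t x))) \<longlongrightarrow> 0) (at t within I)" if t: "t \<in> I" for t
      using em_norm_null_parts[OF space_L_diff[OF L L[OF t]] lim[OF t]] by simp_all
    then show "L2_cont_on M (period \<omega>) (\<lambda>t. epart (Q t))" "L2_cont_on M (period \<omega>) (\<lambda>t. hpart (Q t))"
      using L by (simp_all add: L2_cont_on_def space_L_def)
  qed
  have em: "((\<lambda>s. em_norm D (\<lambda>x. R s x - R t x)) \<longlongrightarrow> 0) (at t within I)" if t: "t \<in> I" for t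
  proof (rule null_le[OF _ R_cont[OF t]])
    fix s assume s: "s \<in> I"
    note L = space_L_diff[OF R_L[OF s] R_L[OF t]]
    show "0 \<le> em_norm D (\<lambda>x. R s x - R t x) \<and> em_norm D (\<lambda>x. R s x - R t x) \<le> V_norm D (\<lambda>x. R s x - R t x)"
      using V_norm_ge(1)[OF L] em_norm_nonneg[OF L] by simp
  qed
  show "L2_cont_on M (period \<omega>) (\<lambda>t. epart (R t))" "L2_cont_on M (period \<omega>) (\<lambda>t. hpart (R t))"
    using cont[OF R_L em] by simp_all
  show "L2_cont_on M (period \<omega>) (\<lambda>t. epart (R' t))" "L2_cont_on M (period \<omega>) (\<lambda>t. hpart (R' t))"
    using cont[OF R'_space_L R'_cont] by simp_all
qed

text \<open>\<open>V_norm\<close> controls the chosen curl and trace of a difference of states,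
  which agree only almost everywhere with the difference of the chosen curls and traces. The
  auxiliary family \<open>g\<close> stands for the former, \<open>f\<close> for the latter.\<close>

lemma cont_graph:
  "L2_cont_on M (period \<omega>) ce" "L2_cont_on M (period \<omega>) ch"
  "L2_cont_on N (period \<omega>) te" "L2_cont_on N (period \<omega>) th"
proof -
  have c: "L2_cont_on X (period \<omega>) f"
    if sq: "\<And>t. t \<in> I \<Longrightarrow> sq_integrable X (f t)"
      and sqg: "\<And>s t. s \<in> I \<Longrightarrow> t \<in> I \<Longrightarrow> sq_integrable X (g s t)"
      and le: "\<And>s t. s \<in> I \<Longrightarrow> t \<in> I \<Longrightarrow> L2_norm X (g s t) \<le> V_norm D (\<lambda>x. R s x - R t x)"
      and eq: "\<And>s t. s \<in> I \<Longrightarrow> t \<in> I \<Longrightarrow> AE x in X. g s t x = f s x - f t x"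
    for X :: "(real^3) measure" and f g
    unfolding L2_cont_on_def
  proof (intro ballI conjI sq)
    fix t assume t: "t \<in> I"
    show "((\<lambda>s. L2_norm X (\<lambda>x. f s x - f t x)) \<longlongrightarrow> 0) (at t within I)"
    proof (rule null_le[OF _ R_cont[OF t]])
      fix s assume s: "s \<in> I"
      have "L2_norm X (g s t) = L2_norm X (\<lambda>x. f s x - f t x)"
        by (rule L2_norm_cong_AE[OF eq[OF s t] sq_meas[OF sqg[OF s t]] sq_meas[OF sq_integrable_diff[OF sq[OF s] sq[OF t]]]])
      then show "0 \<le> L2_norm X (\<lambda>x. f s x - f t x) \<and> L2_norm X (\<lambda>x. f s x - f t x) \<le> V_norm D (\<lambda>x. R s x - R t x)"
        using le[OF s t] by simp
    qed
  qed
  have X: "in_X (epart (\<lambda>x. R s x - R t x)) (\<lambda>x. ce s x - ce t x) (\<lambda>x. te s x - te t x)"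
    "in_X (hpart (\<lambda>x. R s x - R t x)) (\<lambda>x. ch s x - ch t x) (\<lambda>x. th s x - th t x)" if "s \<in> I" "t \<in> I" for s t
    using in_V_diff[OF R_in_V[OF that(1)] R_in_V[OF that(2)]] by simp_all
  note sq = in_X_sq(2,3)[OF in_X_D[OF in_X_I(1)]]
  note ge = V_norm_ge[OF space_L_diff[OF R_L R_L]]
  note vs = in_V_sq[OF R_in_V]
  show "L2_cont_on M (period \<omega>) ce"
    by (rule c[where g = "\<lambda>s t. dcurl D (epart (\<lambda>x. R s x - R t x))", OF vs(3) sq(1)[OF X(1)] ge(2) in_X_I(2)[OF X(1)]])
  show "L2_cont_on M (period \<omega>) ch"
    by (rule c[where g = "\<lambda>s t. dcurl D (hpart (\<lambda>x. R s x - R t x))", OF vs(4) sq(1)[OF X(2)] ge(3) in_X_I(2)[OF X(2)]])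
  show "L2_cont_on N (period \<omega>) te"
    by (rule c[where g = "\<lambda>s t. itrace D (epart (\<lambda>x. R s x - R t x))", OF vs(5) sq(2)[OF X(1)] ge(4) in_X_I(3)[OF X(1)]])
  show "L2_cont_on N (period \<omega>) th"
    by (rule c[where g = "\<lambda>s t. itrace D (hpart (\<lambda>x. R s x - R t x))", OF vs(6) sq(2)[OF X(2)] ge(5) in_X_I(3)[OF X(2)]])
qed

lemma deriv_parts:
  "L2_deriv_on M (period \<omega>) (\<lambda>t. epart (R t)) (\<lambda>t. epart (R' t))"
  "L2_deriv_on M (period \<omega>) (\<lambda>t. hpart (R t)) (\<lambda>t. hpart (R' t))"
proof -
  have "((\<lambda>s. L2_norm M (epart (\<lambda>x. (R s x - R t x) /\<^sub>R (s - t) - R' t x))) \<longlongrightarrow> 0) (at t within I)"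
    "((\<lambda>s. L2_norm M (hpart (\<lambda>x. (R s x - R t x) /\<^sub>R (s - t) - R' t x))) \<longlongrightarrow> 0) (at t within I)" if t: "t \<in> I" for t
    using em_norm_null_parts[OF space_L_diff[OF space_L_scaleR[OF space_L_diff[OF R_L R_L[OF t]]] R'_space_L[OF t]] R'_deriv[OF t]]
    by simp_all
  then show "L2_deriv_on M (period \<omega>) (\<lambda>t. epart (R t)) (\<lambda>t. epart (R' t))"
    "L2_deriv_on M (period \<omega>) (\<lambda>t. hpart (R t)) (\<lambda>t. hpart (R' t))"
    by (simp_all add: L2_deriv_on_def)
qed

lemma per_parts:
  "AE x in M. epart (R (period \<omega>)) x = epart (R 0) x" "AE x in M. hpart (R (period \<omega>)) x = hpart (R 0) x"
  using R_per by (eventually_elim, simp)+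

lemma test_sq:
  assumes "W \<in> space_L D"
  shows "sq_integrable M (\<lambda>x. mat_app (eps D x) (epart W x))" "sq_integrable M (\<lambda>x. mat_app (mu D x) (hpart W x))"
  using assms sym_bounded_sq[OF eps_coeff] sym_bounded_sq[OF mu_coeff] by (auto simp: space_L_def)

lemma ip_deriv:
  assumes W: "W \<in> space_L D" and t: "t \<in> I"
  shows "((\<lambda>t. em_ip D (R t) W) has_vector_derivative em_ip D (R' t) W) (at t within I)"
proof -
  note s = test_sq[OF W]
  have "((\<lambda>t. L2_ip M (epart (R t)) (\<lambda>x. mat_app (eps D x) (epart W x)) + L2_ip M (hpart (R t)) (\<lambda>x. mat_app (mu D x) (hpart W x)))
      has_vector_derivative em_ip D (R' t) W) (at t within I)"
    unfolding em_ip_adj[OF R'_space_L[OF t] W]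
    by (intro has_vector_derivative_add L2_deriv_on_ip[OF deriv_parts(1) cont_L(1,3) s(1) t] L2_deriv_on_ip[OF deriv_parts(2) cont_L(2,4) s(2) t])
  then show ?thesis
    by (rule has_vector_derivative_transform[OF t, rotated]) (simp add: em_ip_adj[OF R_L W])
qed

lemma ip_cont:
  assumes W: "W \<in> space_L D"
  shows "continuous_on I (\<lambda>t. em_ip D (R t) W)" "continuous_on I (\<lambda>t. em_ip D (R' t) W)"
proof -
  note s = test_sq[OF W]
  have "continuous_on I (\<lambda>t. L2_ip M (epart (R t)) (\<lambda>x. mat_app (eps D x) (epart W x)) + L2_ip M (hpart (R t)) (\<lambda>x. mat_app (mu D x) (hpart W x)))"
    by (intro continuous_on_add L2_cont_on_ip cont_L s)
  then show "continuous_on I (\<lambda>t. em_ip D (R t) W)"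
    by (rule continuous_on_eq) (simp add: em_ip_adj[OF R_L W])
  have "continuous_on I (\<lambda>t. L2_ip M (epart (R' t)) (\<lambda>x. mat_app (eps D x) (epart W x)) + L2_ip M (hpart (R' t)) (\<lambda>x. mat_app (mu D x) (hpart W x)))"
    by (intro continuous_on_add L2_cont_on_ip cont_L s)
  then show "continuous_on I (\<lambda>t. em_ip D (R' t) W)"
    by (rule continuous_on_eq) (simp add: em_ip_adj[OF R'_space_L W])
qed

lemma ip_per:
  assumes W: "W \<in> space_L D" shows "em_ip D (R (period \<omega>)) W = em_ip D (R 0) W"
  by (rule em_ip_cong_left[OF R_L[OF ends(2)] R_L[OF ends(1)] W R_per])

section \<open>Fourier modes of the solution\<close>

definition coef_e where "coef_e n = (SOME c. is_fcoef M \<omega> (\<lambda>t. epart (R t)) n c)"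
definition coef_h where "coef_h n = (SOME c. is_fcoef M \<omega> (\<lambda>t. hpart (R t)) n c)"
definition coef_curl_e where "coef_curl_e n = (SOME c. is_fcoef M \<omega> ce n c)"
definition coef_curl_h where "coef_curl_h n = (SOME c. is_fcoef M \<omega> ch n c)"
definition coef_trace_e where "coef_trace_e n = (SOME c. is_fcoef N \<omega> te n c)"
definition coef_trace_h where "coef_trace_h n = (SOME c. is_fcoef N \<omega> th n c)"

lemma fcoefs:
  "is_fcoef M \<omega> (\<lambda>t. epart (R t)) n (coef_e n)" "is_fcoef M \<omega> (\<lambda>t. hpart (R t)) n (coef_h n)"
  "is_fcoef M \<omega> ce n (coef_curl_e n)" "is_fcoef M \<omega> ch n (coef_curl_h n)" "is_fcoef N \<omega> te n (coef_trace_e n)" "is_fcoef N \<omega> th n (coef_trace_h n)"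
  unfolding coef_e_def coef_h_def coef_curl_e_def coef_curl_h_def coef_trace_e_def coef_trace_h_def
  by (rule someI_ex[OF is_fcoef_exists[OF omega]], rule cont_L cont_graph)+

definition mode :: "int \<Rightarrow> emfield" where "mode n = (\<lambda>x. (coef_e n x, coef_h n x))"

lemma mode_parts: "fst (mode n x) = coef_e n x" "snd (mode n x) = coef_h n x"
  by (simp_all add: mode_def)

lemma is_fcoef_zero: "is_fcoef X \<omega> (\<lambda>t x. 0) n (\<lambda>x. 0)"
  using fcoef_mult[of \<omega> n 0 "\<lambda>t. 0"] by (simp add: is_fcoef_def)

text \<open>The six coefficients are chosen independently of each other. They fit together because
  the weak identities hold at every time and are linear, hence hold between the
  coefficients.\<close>

lemma mode_in_V: "in_V (mode n) (coef_curl_e n) (coef_curl_h n) (coef_trace_e n) (coef_trace_h n)"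
proof -
  have e: "t \<in> I \<Longrightarrow> has_curl (Dom D) (epart (R t)) (ce t)" "t \<in> I \<Longrightarrow> has_tr (Dom D) (nrml D) (GamI D) (epart (R t)) (ce t) (te t)"
    "t \<in> I \<Longrightarrow> has_tr (Dom D) (nrml D) (GamP D) (epart (R t)) (ce t) (\<lambda>x. 0)"
    "t \<in> I \<Longrightarrow> has_curl (Dom D) (hpart (R t)) (ch t)" "t \<in> I \<Longrightarrow> has_tr (Dom D) (nrml D) (GamI D) (hpart (R t)) (ch t) (th t)" for t
    using R_in_V[of t] by (simp_all add: in_V_def in_X_def zero_on_P_def)
  have "has_curl (Dom D) (coef_e n) (coef_curl_e n)" by (rule has_curl_fcoef[OF open_dom e(1) fcoefs(1,3)])
  moreover have "has_tr (Dom D) (nrml D) (GamI D) (coef_e n) (coef_curl_e n) (coef_trace_e n)"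
    by (rule has_tr_fcoef[OF geometry(1) e(2) cont_L(1) cont_graph(1) fcoefs(1,3,5)])
  \<comment> \<open>On this piece the trace is zero at all times, and zero is a Fourier coefficient
    of the zero curve.\<close>
  moreover have "has_tr (Dom D) (nrml D) (GamP D) (coef_e n) (coef_curl_e n) (\<lambda>x. 0)"
    by (rule has_tr_fcoef[OF geometry(2) e(3) cont_L(1) cont_graph(1) fcoefs(1,3) is_fcoef_zero])
  moreover have "has_curl (Dom D) (coef_h n) (coef_curl_h n)" by (rule has_curl_fcoef[OF open_dom e(4) fcoefs(2,4)])
  moreover have "has_tr (Dom D) (nrml D) (GamI D) (coef_h n) (coef_curl_h n) (coef_trace_h n)"
    by (rule has_tr_fcoef[OF geometry(1) e(5) cont_L(2) cont_graph(2) fcoefs(2,4,6)])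
  ultimately show ?thesis by (simp add: in_V_def in_X_def zero_on_P_def mode_parts)
qed

lemma mode_V: "mode n \<in> space_V D" by (rule in_V_space_V[OF mode_in_V])
lemma mode_L: "mode n \<in> space_L D" by (rule V_L[OF mode_V])

lemma fcoef_ip:
  assumes "is_fcoef X \<omega> f n c" "sq_integrable X w"
  shows "L2_ip X c w = fcoef \<omega> n (\<lambda>t. L2_ip X (f t) w)"
  using assms by (simp add: is_fcoef_def)

lemma em_ip_mode:
  assumes W: "W \<in> space_L D" shows "em_ip D (mode n) W = fcoef \<omega> n (\<lambda>t. em_ip D (R t) W)"
proof -
  note s = test_sq[OF W]
  have "em_ip D (mode n) W = fcoef \<omega> n (\<lambda>t. L2_ip M (epart (R t)) (\<lambda>x. mat_app (eps D x) (epart W x))) +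
      fcoef \<omega> n (\<lambda>t. L2_ip M (hpart (R t)) (\<lambda>x. mat_app (mu D x) (hpart W x)))"
    unfolding em_ip_adj[OF mode_L W] mode_parts fcoef_ip[OF fcoefs(1) s(1)] fcoef_ip[OF fcoefs(2) s(2)] ..
  also have "\<dots> = fcoef \<omega> n (\<lambda>t. L2_ip M (epart (R t)) (\<lambda>x. mat_app (eps D x) (epart W x)) +
      L2_ip M (hpart (R t)) (\<lambda>x. mat_app (mu D x) (hpart W x)))"
    by (intro fcoef_add[symmetric] L2_cont_on_ip cont_L s)
  also have "\<dots> = fcoef \<omega> n (\<lambda>t. em_ip D (R t) W)"
    by (rule fcoef_cong) (simp add: em_ip_adj[OF R_L W])
  finally show ?thesis .
qed

lemma em_form_mode:
  assumes W: "W \<in> space_V D"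
  shows "em_form D (mode n) W = fcoef \<omega> n (\<lambda>t. em_form D (R t) W)" "continuous_on I (\<lambda>t. em_form D (R t) W)"
proof -
  note w = space_V_in_V[OF W]
  note s = in_V_sq[OF w]
  note s1 = sym_bounded_sq[OF sig_coeff s(1)] and s2 = sym_bounded_sq[OF Y_coeff s(5)] and s3 = sym_bounded_sq[OF Z_coeff s(6)]
  let ?a = "\<lambda>t. L2_ip M (epart (R t)) (\<lambda>x. mat_app (sig D x) (epart W x))"
  let ?b = "\<lambda>t. L2_ip N (te t) (\<lambda>x. mat_app (Yimp D x) (itrace D (epart W) x))"
  let ?c = "\<lambda>t. L2_ip N (th t) (\<lambda>x. mat_app (Zimp D x) (itrace D (hpart W) x))"
  let ?d = "\<lambda>t. L2_ip M (hpart (R t)) (dcurl D (epart W))"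
  let ?e = "\<lambda>t. L2_ip M (epart (R t)) (dcurl D (hpart W))"
  have cont: "continuous_on I ?a" "continuous_on I ?b" "continuous_on I ?c" "continuous_on I ?d" "continuous_on I ?e"
    by (intro L2_cont_on_ip cont_L cont_graph s1 s2 s3 s)+
  have R: "em_form D (R t) W = ?a t + ?b t + ?c t + ?d t - ?e t" if "t \<in> I" for t
    unfolding em_form_in_V[OF R_in_V[OF that] w] graph_form_def ..
  have "continuous_on I (\<lambda>t. ?a t + ?b t + ?c t + ?d t - ?e t)"
    by (intro continuous_on_add continuous_on_diff cont)
  then show "continuous_on I (\<lambda>t. em_form D (R t) W)" by (rule continuous_on_eq) (simp add: R)
  have "em_form D (mode n) W = fcoef \<omega> n ?a + fcoef \<omega> n ?b + fcoef \<omega> n ?c + fcoef \<omega> n ?d - fcoef \<omega> n ?e"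
    unfolding em_form_in_V[OF mode_in_V w] graph_form_def mode_parts fcoef_ip[OF fcoefs(1) s1] fcoef_ip[OF fcoefs(5) s2]
      fcoef_ip[OF fcoefs(6) s3] fcoef_ip[OF fcoefs(2) s(3)] fcoef_ip[OF fcoefs(1) s(4)] ..
  also have "\<dots> = fcoef \<omega> n (\<lambda>t. ?a t + ?b t + ?c t + ?d t - ?e t)"
  proof -
    have "fcoef \<omega> n (\<lambda>t. ?a t + ?b t + ?c t + ?d t - ?e t) = fcoef \<omega> n (\<lambda>t. ?a t + ?b t + ?c t + ?d t) - fcoef \<omega> n ?e"
      by (intro fcoef_diff continuous_on_add cont)
    also have "fcoef \<omega> n (\<lambda>t. ?a t + ?b t + ?c t + ?d t) = fcoef \<omega> n (\<lambda>t. ?a t + ?b t + ?c t) + fcoef \<omega> n ?d"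
      by (intro fcoef_add continuous_on_add cont)
    also have "fcoef \<omega> n (\<lambda>t. ?a t + ?b t + ?c t) = fcoef \<omega> n (\<lambda>t. ?a t + ?b t) + fcoef \<omega> n ?c"
      by (intro fcoef_add continuous_on_add cont)
    also have "fcoef \<omega> n (\<lambda>t. ?a t + ?b t) = fcoef \<omega> n ?a + fcoef \<omega> n ?b"
      by (intro fcoef_add cont)
    finally show ?thesis ..
  qed
  also have "\<dots> = fcoef \<omega> n (\<lambda>t. em_form D (R t) W)" by (rule fcoef_cong) (simp add: R)
  finally show "em_form D (mode n) W = fcoef \<omega> n (\<lambda>t. em_form D (R t) W)" .
qed

section \<open>The equation satisfied by each mode\<close>

lemma source_re_field: "source_at \<psi> \<omega> t = re_field (scale_field (cis (\<omega> * t)) \<psi>)"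
  by (simp add: source_at_def re_field_def scale_field_def)

lemma source_L: "source_at \<psi> \<omega> t \<in> space_L D"
  unfolding source_re_field by (intro space_L_re_field space_L_scale_field psi)

text \<open>The equation is given for real test fields. Both sides are conjugate linear in the test
  field, so a complex one is split into its real part and the real part of -i times it.\<close>

lemma evolution_complex:
  assumes t: "t \<in> {0<..<period \<omega>}" and W: "W \<in> space_V D"
  shows "em_ip D (R' t) W + em_form D (R t) W = em_ip D (source_at \<psi> \<omega> t) W"
proof -
  have tI: "t \<in> I" using t by auto
  have RV: "R t \<in> space_V D" using R_V[OF tI] by (simp add: real_V_def)
  note re = R_eq[OF t re_field_real_V[OF W]] and im = R_eq[OF t re_field_real_V[OF scale_field_V[OF W]], of "- \<i>"]
  have "em_ip D (R' t) W + em_form D (R t) W =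
      (em_ip D (R' t) (re_field W) + em_form D (R t) (re_field W)) - \<i> * (em_ip D (R' t) (re_field (scale_field (- \<i>) W)) + em_form D (R t) (re_field (scale_field (- \<i>) W)))"
    unfolding em_ip_decomp[OF R'_space_L[OF tI] V_L[OF W]] em_form_decomp[OF RV W] by (simp add: algebra_simps)
  also have "\<dots> = em_ip D (source_at \<psi> \<omega> t) W"
    unfolding re im by (rule em_ip_decomp[OF source_L V_L[OF W], symmetric])
  finally show ?thesis .
qed

definition cnj_field :: "emfield \<Rightarrow> emfield" where
  "cnj_field W = (\<lambda>x. (cnj_vec (fst (W x)), cnj_vec (snd (W x))))"

text \<open>Half the sum of \<psi> exp(i \<omega> t) and its conjugate: the source contains the
  frequencies 1 and -1 only, so all other modes solve homogeneous equations.\<close>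

lemma source_ip:
  assumes W: "W \<in> space_L D"
  shows "em_ip D (source_at \<psi> \<omega> t) W =
    (1/2) * (em_ip D \<psi> W * cis (real_of_int 1 * \<omega> * t) + em_ip D (cnj_field \<psi>) W * cis (real_of_int (- 1) * \<omega> * t))"
proof -
  have cL: "cnj_field \<psi> \<in> space_L D" using psi by (simp add: cnj_field_def space_L_def sq_integrable_cnj_vec)
  have "cnj_vec (cis a *s v) = cis (- a) *s cnj_vec v" for a v by (simp add: vec_eq_iff cnj_vec_def cis_cnj)
  then have "source_at \<psi> \<omega> t = scale_field (1/2) (\<lambda>x. scale_field (cis (\<omega> * t)) \<psi> x + scale_field (cis (- (\<omega> * t))) (cnj_field \<psi>) x)"
    unfolding source_re_field by (simp add: fun_eq_iff prod_eq_iff re_field_parts scale_field_parts re_vec_def cnj_field_def)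
  then show ?thesis
    by (simp only: em_ip_scale_field_left em_ip_add_left[OF space_L_scale_field[OF psi] space_L_scale_field[OF cL] W]) (simp add: mult.commute)
qed

lemma fcoef_source:
  assumes W: "W \<in> space_L D"
  shows "fcoef \<omega> n (\<lambda>t. em_ip D (source_at \<psi> \<omega> t) W) =
    (1/2) * ((if n = 1 then em_ip D \<psi> W else 0) + (if n = -1 then em_ip D (cnj_field \<psi>) W else 0))"
proof -
  have c: "continuous_on I (\<lambda>t. z * cis (real_of_int m * \<omega> * t))" for z m by (intro continuous_intros)
  show ?thesis
    unfolding source_ip[OF W] fcoef_mult fcoef_add[OF c c] fcoef_cis[OF omega] by auto
qed

text \<open>One identity with three uses: n = 0 puts the mean into the kernel of the form, n = 1 is
  the time-harmonic problem with half the source, and n \<ge> 2 gives the homogeneous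
  equations.\<close>

lemma mode_equation:
  assumes W: "W \<in> space_V D"
  shows "\<i> * of_int n * complex_of_real \<omega> * em_ip D (mode n) W + em_form D (mode n) W =
    (1/2) * ((if n = 1 then em_ip D \<psi> W else 0) + (if n = -1 then em_ip D (cnj_field \<psi>) W else 0))"
proof -
  note WL = V_L[OF W]
  have "\<i> * of_int n * complex_of_real \<omega> * em_ip D (mode n) W + em_form D (mode n) W =
      fcoef \<omega> n (\<lambda>t. em_ip D (R' t) W) + fcoef \<omega> n (\<lambda>t. em_form D (R t) W)"
    unfolding em_ip_mode[OF WL] em_form_mode(1)[OF W]
    by (simp only: fcoef_deriv[OF omega ip_deriv[OF WL] ip_cont(2)[OF WL] ip_per[OF WL]])
  also have "\<dots> = fcoef \<omega> n (\<lambda>t. em_ip D (R' t) W + em_form D (R t) W)"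
    by (rule fcoef_add[OF ip_cont(2)[OF WL] em_form_mode(2)[OF W], symmetric])
  also have "\<dots> = fcoef \<omega> n (\<lambda>t. em_ip D (source_at \<psi> \<omega> t) W)"
    by (rule fcoef_cong) (rule evolution_complex[OF _ W])
  finally show ?thesis unfolding fcoef_source[OF WL] .
qed

text \<open>Orthogonality of the initial value is assumed against real fields, so the argument is
  run with the real part W of the mean as test field. Each of the five terms of the form contains a
  datum of W that vanishes.\<close>

lemma mean_zero:
  assumes psiK: "\<psi> \<in> K_perp D" and perp: "\<And>W. W \<in> real_K D \<Longrightarrow> em_ip D (R 0) W = 0"
  shows "AE x in M. re_field (mode 0) x = 0"
proof -
  let ?W = "re_field (mode 0)"
  have "em_form D (mode 0) W = 0" if "W \<in> space_V D" for W using mode_equation[OF that, of 0] by simp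
  then have k: "AE x in M. coef_curl_e 0 x = 0" "AE x in M. coef_curl_h 0 x = 0" "AE x in N. coef_trace_e 0 x = 0" "AE x in N. coef_trace_h 0 x = 0"
    "AE x in M. mat_app (sig D x) (epart (mode 0) x) = 0"
    using form_kernel[OF mode_in_V] by simp_all
  have WT: "in_V ?W (\<lambda>x. re_vec (coef_curl_e 0 x)) (\<lambda>x. re_vec (coef_curl_h 0 x)) (\<lambda>x. re_vec (coef_trace_e 0 x)) (\<lambda>x. re_vec (coef_trace_h 0 x))"
    by (rule in_V_re[OF mode_in_V])
  have z: "AE x in M. re_vec (coef_curl_e 0 x) = 0" "AE x in M. re_vec (coef_curl_h 0 x) = 0" "AE x in N. re_vec (coef_trace_e 0 x) = 0" "AE x in N. re_vec (coef_trace_h 0 x) = 0"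
  proof -
    have r: "AE x in X. re_vec (f x) = 0" if "AE x in X. f x = 0" for X :: "(real^3) measure" and f
      using that by eventually_elim simp
    show "AE x in M. re_vec (coef_curl_e 0 x) = 0" "AE x in M. re_vec (coef_curl_h 0 x) = 0" "AE x in N. re_vec (coef_trace_e 0 x) = 0" "AE x in N. re_vec (coef_trace_h 0 x) = 0"
      using k(1-4) by (simp_all only: r)
  qed
  have z\<sigma>: "AE x in M. mat_app (sig D x) (epart ?W x) = 0"
    using k(5) by eventually_elim (simp add: re_field_parts mat_app_rev)
  have WK: "?W \<in> space_K D" by (rule in_V_space_K[OF WT z])
  have WL: "?W \<in> space_L D" by (rule V_L[OF in_V_space_V[OF WT]])
  have WrL: "?W \<in> real_L D" using WL real_valued_re_field by (simp add: real_L_def)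
  have "em_ip D (R' t) ?W = 0" if t: "t \<in> {0<..<period \<omega>}" for t
  proof -
    have tI: "t \<in> I" using t by auto
    have "em_form D (R t) ?W = 0"
      unfolding em_form_in_V[OF R_in_V[OF tI] WT] by (rule graph_form_AE_zero[OF z\<sigma> z(1,3,2,4)])
    \<comment> \<open>The source is the real part of a phase times \<psi>, and W is real, so its
      pairing with W is the real part of that phase times (\<psi>, W) = 0.\<close>
    moreover have "em_ip D (source_at \<psi> \<omega> t) ?W = 0"
    proof -
      have "em_ip D \<psi> ?W = 0" using psiK WK by (simp add: K_perp_def)
      then show ?thesis unfolding source_re_field em_ip_re[OF space_L_scale_field[OF psi] WrL] em_ip_scale_field_left by simp
    qed
    ultimately show ?thesis using evolution_complex[OF t in_V_space_V[OF WT]] by simp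
  qed
  note const = constant_of_zero_derivative[OF ip_deriv[OF WL] this]
  have "em_ip D (R 0) ?W = 0" using perp[of ?W] WK real_valued_re_field by (simp add: real_K_def)
  then have "fcoef \<omega> 0 (\<lambda>t. em_ip D (R t) ?W) = fcoef \<omega> 0 (\<lambda>t. 0)"
    using const by (intro fcoef_cong) auto
  then have "em_ip D (mode 0) ?W = 0"
    using em_ip_mode[OF WL, of 0] fcoef_mult[of \<omega> 0 0 "\<lambda>t. 0"] by simp
  then have "em_ip D ?W ?W = 0" using em_ip_re[OF mode_L WrL] by simp
  then have "em_norm D ?W = 0" by (simp add: em_norm_def)
  then show ?thesis by (rule em_norm_eq_0[OF WL])
qed

text \<open>For a real function the coefficients at l and -l are conjugate, which turns the
  symmetric sum over all integers into twice a sum over l \<ge> 1.\<close>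

lemma sum_real_fcoef:
  assumes "\<And>t. t \<in> {0<..<period \<omega>} \<Longrightarrow> cnj (\<phi> t) = \<phi> t"
  shows "Re (\<Sum>n\<in>{- int m..int m}. fcoef \<omega> n \<phi>) = Re (fcoef \<omega> 0 \<phi>) + 2 * (\<Sum>l=1..m. Re (fcoef \<omega> (int l) \<phi>))"
proof (induction m)
  case (Suc m)
  have "fcoef \<omega> (- int (Suc m)) \<phi> = fcoef \<omega> (- int (Suc m)) (\<lambda>t. cnj (\<phi> t))"
    using assms by (intro fcoef_cong) simp
  then have c: "Re (fcoef \<omega> (- int (Suc m)) \<phi>) = Re (fcoef \<omega> (int (Suc m)) \<phi>)"
    using fcoef_cnj[of \<omega> "int (Suc m)" \<phi>] by simp
  have "{- int (Suc m)..int (Suc m)} = insert (- int (Suc m)) (insert (int (Suc m)) {- int m..int m})" by auto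
  then have "Re (\<Sum>n\<in>{- int (Suc m)..int (Suc m)}. fcoef \<omega> n \<phi>) =
      Re (fcoef \<omega> (- int (Suc m)) \<phi>) + (Re (fcoef \<omega> (int (Suc m)) \<phi>) + Re (\<Sum>n\<in>{- int m..int m}. fcoef \<omega> n \<phi>))"
    by simp
  with c Suc show ?case by simp
qed simp

section \<open>Comparison with the time-harmonic solution and reconstruction of the initial
  value\<close>

lemma em_form_scale_field_left:
  assumes U: "U \<in> space_V D" and W: "W \<in> space_V D"
  shows "em_form D (scale_field k U) W = k * em_form D U W"
  unfolding em_form_in_V[OF in_V_scale[OF space_V_in_V[OF U]] space_V_in_V[OF W]] em_form_in_V[OF space_V_in_V[OF U] space_V_in_V[OF W]]
    graph_form_def scale_field_parts L2_ip_scale_left by (simp add: algebra_simps)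

text \<open>The source enters the equation of the first mode with weight one half, so the doubled
  mode solves the time-harmonic problem; well-posedness gives uniqueness.\<close>

lemma first_coefficient:
  assumes wp: "well_posed D \<omega>" and U: "harmonic_solution D \<omega> \<psi> U"
  shows "AE x in M. scale_field 2 (mode 1) x = U x"
proof -
  have "harmonic_solution D \<omega> \<psi> (scale_field 2 (mode 1))"
    unfolding harmonic_solution_def
  proof (intro conjI ballI scale_field_V mode_V)
    fix w assume w: "w \<in> space_V D"
    show "\<i> * complex_of_real \<omega> * em_ip D (scale_field 2 (mode 1)) w + em_form D (scale_field 2 (mode 1)) w = em_ip D \<psi> w"
      using mode_equation[OF w, of 1] unfolding em_ip_scale_field_left em_form_scale_field_left[OF mode_V w] by (simp add: algebra_simps)
  qed
  moreover obtain S where "\<And>S'. harmonic_solution D \<omega> \<psi> S' \<Longrightarrow> AE x in M. S' x = S x"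
    using wp psi unfolding well_posed_def by blast
  ultimately have "AE x in M. scale_field 2 (mode 1) x = S x" "AE x in M. U x = S x" using U by blast+
  then show ?thesis by eventually_elim simp
qed

lemma em_ip_tendsto_0:
  assumes L: "\<And>n. F n \<in> space_L D" and W: "W \<in> space_L D"
    and e: "(\<lambda>n. L2_norm M (epart (F n))) \<longlonglongrightarrow> 0" and h: "(\<lambda>n. L2_norm M (hpart (F n))) \<longlonglongrightarrow> 0"
  shows "(\<lambda>n. em_ip D (F n) W) \<longlonglongrightarrow> 0"
proof -
  note s = test_sq[OF W]
  have lim: "(\<lambda>n. L2_ip M (f n) w) \<longlonglongrightarrow> 0"
    if f: "\<And>n. sq_integrable M (f n)" and w: "sq_integrable M w" and l: "(\<lambda>n. L2_norm M (f n)) \<longlonglongrightarrow> 0" for f w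
  proof (rule Lim_null_comparison[OF _ tendsto_mult_left_zero[OF l, of "L2_norm M w"]])
    show "\<forall>\<^sub>F n in sequentially. norm (L2_ip M (f n) w) \<le> L2_norm M (f n) * L2_norm M w"
      by (intro always_eventually allI L2_cauchy_schwarz f w)
  qed
  have sF: "sq_integrable M (epart (F n))" "sq_integrable M (hpart (F n))" for n using L[of n] by (auto simp: space_L_def)
  show ?thesis
    unfolding em_ip_adj[OF L W] using tendsto_add[OF lim[OF sF(1) s(1) e] lim[OF sF(2) s(2) h]] by simp
qed

text \<open>The norm limit S exists by absolute convergence, independently of the value of the
  solution at time 0. The two are linked only afterwards, by pairing with real fields.\<close>

lemma representation:
  assumes wp: "well_posed D \<omega>" and U: "harmonic_solution D \<omega> \<psi> U"
    and psiK: "\<psi> \<in> K_perp D" and perp: "\<And>W. W \<in> real_K D \<Longrightarrow> em_ip D (R 0) W = 0"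
  shows "\<exists>(Ul :: nat \<Rightarrow> emfield) (S :: emfield).
           (\<forall>l\<ge>2. Ul l \<in> space_V D \<and>
              (\<forall>v\<in>space_V D.
                 \<i> * of_nat l * complex_of_real \<omega> * em_ip D (Ul l) v + em_form D (Ul l) v = 0)) \<and>
           S \<in> space_L D \<and>
           (\<lambda>N. em_norm D (\<lambda>x. (\<Sum>l=2..N. Ul l x) - S x)) \<longlonglongrightarrow> 0 \<and>
           (AE x in M. R 0 x = re_pair (U x + S x))"
proof -
  \<comment> \<open>The factor 2 collects the conjugate modes l and -l; the equation is homogeneous,
    so it is not affected.\<close>
  define Ul where "Ul l = scale_field 2 (mode (int l))" for l
  have UlV: "Ul l \<in> space_V D" for l unfolding Ul_def by (intro scale_field_V mode_V)
  have Ul_eq: "\<i> * of_nat l * complex_of_real \<omega> * em_ip D (Ul l) v + em_form D (Ul l) v = 0"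
    if l: "l \<ge> 2" and v: "v \<in> space_V D" for l v
  proof -
    have ne: "int l \<noteq> 1" "int l \<noteq> - 1" using l by auto
    have "\<i> * of_int (int l) * complex_of_real \<omega> * em_ip D (mode (int l)) v + em_form D (mode (int l)) v = 0"
      using mode_equation[OF v, of "int l"] unfolding if_not_P[OF ne(1)] if_not_P[OF ne(2)] by simp
    then have "2 * (\<i> * of_nat l * complex_of_real \<omega> * em_ip D (mode (int l)) v + em_form D (mode (int l)) v) = 0" by simp
    then show ?thesis
      unfolding Ul_def em_ip_scale_field_left em_form_scale_field_left[OF mode_V v] by (simp only: distrib_left mult_ac)
  qed
  obtain sE where sE: "sq_integrable M sE" "(\<lambda>N. L2_norm M (\<lambda>x. (\<Sum>l=2..N. coef_e (int l) x) - sE x)) \<longlonglongrightarrow> 0"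
    using L2_fourier_summable[OF omega deriv_parts(1) cont_L(1,3) per_parts(1) fcoefs(1)] by blast
  obtain sH where sH: "sq_integrable M sH" "(\<lambda>N. L2_norm M (\<lambda>x. (\<Sum>l=2..N. coef_h (int l) x) - sH x)) \<longlonglongrightarrow> 0"
    using L2_fourier_summable[OF omega deriv_parts(2) cont_L(2,4) per_parts(2) fcoefs(2)] by blast
  define S where "S = scale_field 2 (\<lambda>x. (sE x, sH x))"
  have SL: "S \<in> space_L D" unfolding S_def by (intro space_L_scale_field) (simp add: space_L_def sE sH)
  define F where "F k = (\<lambda>x. (\<Sum>l=2..k. Ul l x) - S x)" for k
  have PL: "(\<lambda>x. \<Sum>l=2..k. Ul l x) \<in> space_L D" for k by (intro space_L_sum V_L UlV)
  have FL: "F k \<in> space_L D" for k unfolding F_def by (intro space_L_diff PL SL)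
  have scale: "2 *s (a::complex^3) - 2 *s b = 2 *s (a - b)" "(\<Sum>i\<in>J. 2 *s g i) = 2 *s (\<Sum>i\<in>J. g i :: complex^3)" for a b J and g :: "nat \<Rightarrow> _"
    by (simp_all add: vec_eq_iff algebra_simps sum_distrib_left)
  have parts: "epart (F k) = (\<lambda>x. 2 *s ((\<Sum>l=2..k. coef_e (int l) x) - sE x))" "hpart (F k) = (\<lambda>x. 2 *s ((\<Sum>l=2..k. coef_h (int l) x) - sH x))" for k
    unfolding F_def Ul_def S_def by (simp_all only: fst_sum snd_sum fst_diff snd_diff scale_field_parts mode_parts fst_conv snd_conv scale)
  have Fe: "(\<lambda>k. L2_norm M (epart (F k))) \<longlonglongrightarrow> 0"
    unfolding parts L2_norm_scale norm_numeral by (rule tendsto_mult_right_zero[OF sE(2)])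
  have Fh: "(\<lambda>k. L2_norm M (hpart (F k))) \<longlonglongrightarrow> 0"
    unfolding parts L2_norm_scale norm_numeral by (rule tendsto_mult_right_zero[OF sH(2)])
  have Fnorm: "(\<lambda>k. em_norm D (F k)) \<longlonglongrightarrow> 0" by (rule em_norm_tendsto[OF FL Fe Fh])
  have UL: "U \<in> space_L D" using U V_L by (simp add: harmonic_solution_def)
  note C1 = first_coefficient[OF wp U]
  have C0: "AE x in M. re_field (mode 0) x = 0" by (rule mean_zero[OF psiK perp])
  have USL: "(\<lambda>x. U x + S x) \<in> space_L D" by (rule space_L_add[OF UL SL])
  have R0L: "R 0 \<in> space_L D" by (rule R_L[OF ends(1)])
  \<comment> \<open>Against a fixed real w the partial sums have two limits that must agree: the
    pairing with R(0), by the scalar Fourier theorem, and the pairing with U + S, by norm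
    convergence.\<close>
  have key: "Re (em_ip D (R 0) w) = Re (em_ip D (\<lambda>x. U x + S x) w)" if w: "w \<in> real_L D" for w
  proof -
    have wL: "w \<in> space_L D" using w by (simp add: real_L_def)
    define \<phi> where "\<phi> t = em_ip D (R t) w" for t
    have real: "cnj (\<phi> t) = \<phi> t" if "t \<in> {0<..<period \<omega>}" for t
    proof -
      have t: "t \<in> I" using that by auto
      have "AE x in M. re_field (R t) x = R t x" using R_real[OF t] by (simp add: real_valued_def re_field_def)
      from em_ip_cong_left[OF space_L_re_field[OF R_L[OF t]] R_L[OF t] wL this] em_ip_re[OF R_L[OF t] w]
      show ?thesis by (simp add: \<phi>_def complex_eq_iff)
    qed
    have a: "fcoef \<omega> n \<phi> = em_ip D (mode n) w" for n
      unfolding \<phi>_def using em_ip_mode[OF wL] by simp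
    have zero: "(\<lambda>x. 0) \<in> space_L D" by (simp add: space_L_def)
    have "em_ip D (re_field (mode 0)) w = 0"
      using em_ip_cong_left[OF space_L_re_field[OF mode_L] zero wL C0] em_ip_scaleR_left[of 0 "\<lambda>x. 0" w] by simp
    then have a0: "Re (fcoef \<omega> 0 \<phi>) = 0" unfolding a using em_ip_re[OF mode_L w, of 0] by simp
    have a1: "2 * fcoef \<omega> 1 \<phi> = em_ip D U w"
      using em_ip_cong_left[OF space_L_scale_field[OF mode_L] UL wL C1] unfolding a em_ip_scale_field_left .
    have "(\<lambda>k. em_ip D (F k) w) \<longlonglongrightarrow> 0" by (rule em_ip_tendsto_0[OF FL wL Fe Fh])
    moreover have "em_ip D (F k) w = (\<Sum>l=2..k. 2 * fcoef \<omega> (int l) \<phi>) - em_ip D S w" for k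
    proof -
      have "em_ip D (F k) w = (\<Sum>l=2..k. em_ip D (Ul l) w) - em_ip D S w"
        unfolding F_def em_ip_diff_left[OF PL SL wL] em_ip_sum_left[OF V_L[OF UlV] wL] ..
      then show ?thesis unfolding Ul_def em_ip_scale_field_left a .
    qed
    ultimately have "(\<lambda>k. (\<Sum>l=2..k. 2 * fcoef \<omega> (int l) \<phi>) - em_ip D S w) \<longlonglongrightarrow> 0" by simp
    then have "(\<lambda>k. \<Sum>l=2..k. 2 * fcoef \<omega> (int l) \<phi>) \<longlonglongrightarrow> em_ip D S w" by (rule Lim_null[THEN iffD2])
    then have l1: "(\<lambda>k. Re (\<Sum>l=2..k. 2 * fcoef \<omega> (int l) \<phi>)) \<longlonglongrightarrow> Re (em_ip D S w)" by (rule tendsto_Re)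
    have "(\<lambda>k. \<Sum>n\<in>{- int k..int k}. fcoef \<omega> n \<phi>) \<longlonglongrightarrow> \<phi> 0"
      by (rule fourier_sum_tendsto[OF omega, of \<phi> "\<lambda>t. em_ip D (R' t) w"])
        (use ip_deriv[OF wL] ip_per[OF wL] in \<open>simp_all add: \<phi>_def[abs_def]\<close>)
    then have l2: "(\<lambda>k. Re (\<Sum>n\<in>{- int k..int k}. fcoef \<omega> n \<phi>)) \<longlonglongrightarrow> Re (\<phi> 0)" by (rule tendsto_Re)
    have "\<forall>\<^sub>F k in sequentially. Re (\<Sum>n\<in>{- int k..int k}. fcoef \<omega> n \<phi>) =
        Re (em_ip D U w) + Re (\<Sum>l=2..k. 2 * fcoef \<omega> (int l) \<phi>)"
      using eventually_ge_at_top[of 1]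
    proof eventually_elim
      case (elim k)
      \<comment> \<open>The term l = 1 is separated because its doubled value is the contribution of
        U.\<close>
      have split: "{1..k} = insert 1 {2..k}" using elim by auto
      have "Re (\<Sum>n\<in>{- int k..int k}. fcoef \<omega> n \<phi>) = 2 * (\<Sum>l=1..k. Re (fcoef \<omega> (int l) \<phi>))"
        using sum_real_fcoef[OF real] a0 by simp
      also have "\<dots> = Re (2 * fcoef \<omega> 1 \<phi>) + (\<Sum>l=2..k. Re (2 * fcoef \<omega> (int l) \<phi>))"
        unfolding split by (simp add: sum_distrib_left)
      finally show ?case unfolding a1 by simp
    qed
    from Lim_transform_eventually[OF l2 this] tendsto_add[OF tendsto_const l1, of "Re (em_ip D U w)"]
    have "Re (\<phi> 0) = Re (em_ip D U w) + Re (em_ip D S w)" by (rule LIMSEQ_unique)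
    then show ?thesis by (simp add: \<phi>_def em_ip_add_left[OF UL SL wL])
  qed
  \<comment> \<open>The difference to be shown null is real, hence an admissible test field in
    \<open>key\<close>; testing it against itself makes its energy norm zero.\<close>
  define w where "w = (\<lambda>x. R 0 x - re_field (\<lambda>x. U x + S x) x)"
  have reL: "re_field (\<lambda>x. U x + S x) \<in> space_L D" by (rule space_L_re_field[OF USL])
  have wL: "w \<in> space_L D" unfolding w_def by (rule space_L_diff[OF R0L reL])
  have "AE x in M. re_pair (w x) = w x"
    using R_real[OF ends(1)] unfolding real_valued_def
  proof eventually_elim
    case (elim x)
    have d: "re_vec (a - re_vec b) = re_vec a - re_vec b" for a b by (simp add: vec_eq_iff rev_nth)
    show ?case
      using elim by (simp add: w_def re_field_def re_pair_rev prod_eq_iff d)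
  qed
  then have wr: "w \<in> real_L D" using wL by (simp add: real_L_def real_valued_def)
  have "Re (em_ip D w w) = Re (em_ip D (R 0) w) - Re (em_ip D (re_field (\<lambda>x. U x + S x)) w)"
  proof -
    have "em_ip D w w = em_ip D (R 0) w - em_ip D (re_field (\<lambda>x. U x + S x)) w"
      using em_ip_diff_left[OF R0L reL wL] unfolding w_def[symmetric] .
    then show ?thesis by simp
  qed
  also have "\<dots> = 0" unfolding em_ip_re[OF USL wr] using key[OF wr] by simp
  finally have "em_norm D w = 0" by (simp add: em_norm_def)
  from em_norm_eq_0[OF wL this] have "AE x in M. R 0 x = re_pair (U x + S x)"
    by eventually_elim (simp add: w_def re_field_def)
  then show ?thesis using UlV Ul_eq SL Fnorm unfolding F_def by blast
qed

end

theorem theorem4p5: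
  fixes D :: maxwell and \<omega> :: real and \<psi> U U0 :: emfield
  assumes "maxwell_setting D"
    and "\<omega> > 0"
    and "well_posed D \<omega>"
    and "\<psi> \<in> space_L D"
    and "harmonic_solution D \<omega> \<psi> U"
    and "U0 \<in> real_VI D"
    and "\<exists>R. evolution D \<psi> \<omega> U0 R"
    and "functional_J D \<psi> \<omega> U0 = 0"
    and "\<psi> \<in> K_perp D"
    and "U0 \<in> real_V D \<inter> real_K_perp D"
  shows "\<exists>(Ul :: nat \<Rightarrow> emfield) (S :: emfield).
           (\<forall>l\<ge>2. Ul l \<in> space_V D \<and>
              (\<forall>v\<in>space_V D.
                 \<i> * of_nat l * complex_of_real \<omega> * em_ip D (Ul l) v + em_form D (Ul l) v = 0)) \<and>
           S \<in> space_L D \<and>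
           (\<lambda>N. em_norm D (\<lambda>x. (\<Sum>l=2..N. Ul l x) - S x)) \<longlonglongrightarrow> 0 \<and>
           (AE x in lebesgue_on (Dom D). U0 x = re_pair (U x + S x))"
proof -
  interpret maxwell_problem D by unfold_locales (rule assms(1))
  \<comment> \<open>The same choice as in \<open>propagator\<close>, so that the final state of R is
    literally the value of the propagator.\<close>
  define R where "R = (SOME R. evolution D \<psi> \<omega> U0 R)"
  have ev: "evolution D \<psi> \<omega> U0 R" unfolding R_def by (rule someI_ex[OF assms(7)])
  have propag: "propagator D \<psi> \<omega> U0 = R (period \<omega>)"
    using assms(7) by (simp add: propagator_def R_def)
  have R0: "AE x in M. R 0 x = U0 x"
    and RV: "\<And>t. t \<in> {0..period \<omega>} \<Longrightarrow> R t \<in> real_VI D \<and>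
        ((\<lambda>s. V_norm D (\<lambda>x. R s x - R t x)) \<longlongrightarrow> 0) (at t within {0..period \<omega>})"
    using ev by (simp_all only: evolution_def)
  obtain R' where R': "\<And>t. t \<in> {0..period \<omega>} \<Longrightarrow> R' t \<in> real_L D \<and>
           ((\<lambda>s. em_norm D (\<lambda>x. (R s x - R t x) /\<^sub>R (s - t) - R' t x)) \<longlongrightarrow> 0)
             (at t within {0..period \<omega>}) \<and>
           ((\<lambda>s. em_norm D (\<lambda>x. R' s x - R' t x)) \<longlongrightarrow> 0) (at t within {0..period \<omega>})"
    and eq: "\<And>t v. t \<in> {0<..<period \<omega>} \<Longrightarrow> v \<in> real_V D \<Longrightarrow>
           em_ip D (R' t) v + em_form D (R t) v = em_ip D (source_at \<psi> \<omega> t) v"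
    using ev unfolding evolution_def by blast
  have T: "0 \<in> {0..period \<omega>}" "period \<omega> \<in> {0..period \<omega>}" using assms(2) by auto
  have RL: "R t \<in> space_L D" if "t \<in> {0..period \<omega>}" for t
    using RV[OF that] V_L by (simp add: real_VI_def real_V_def)
  have U0L: "U0 \<in> space_L D" using assms(10) V_L by (simp add: real_V_def)
  \<comment> \<open>Half the square of this norm is \<open>functional_J\<close>; definiteness of the
    energy norm then yields periodicity almost everywhere.\<close>
  have "em_norm D (\<lambda>x. R (period \<omega>) x - U0 x) = 0"
    using assms(8) by (simp add: functional_J_def propag)
  then have "AE x in M. R (period \<omega>) x - U0 x = 0"
    by (rule em_norm_eq_0[OF space_L_diff[OF RL[OF T(2)] U0L]])
  with R0 have per: "AE x in M. R (period \<omega>) x = R 0 x" by eventually_elim simp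
  interpret periodic_maxwell D \<omega> \<psi> R R'
    by unfold_locales (use assms(2,4) RV R' eq per in \<open>simp_all add: real_VI_def\<close>)
  have perp: "em_ip D (R 0) W = 0" if W: "W \<in> real_K D" for W
  proof -
    have WL: "W \<in> space_L D" using W V_L by (simp add: real_K_def space_K_def)
    have "em_ip D (R 0) W = em_ip D U0 W" by (rule em_ip_cong_left[OF RL[OF T(1)] U0L WL R0])
    then show ?thesis using assms(10) W by (simp add: real_K_perp_def)
  qed
  obtain Ul S where *: "\<forall>l\<ge>2. Ul l \<in> space_V D \<and>
        (\<forall>v\<in>space_V D. \<i> * of_nat l * complex_of_real \<omega> * em_ip D (Ul l) v + em_form D (Ul l) v = 0)"
      "S \<in> space_L D" "(\<lambda>N. em_norm D (\<lambda>x. (\<Sum>l=2..N. Ul l x) - S x)) \<longlonglongrightarrow> 0"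
      "AE x in M. R 0 x = re_pair (U x + S x)"
    using representation[OF assms(3,5,9) perp] by blast
  have "AE x in M. U0 x = re_pair (U x + S x)" using R0 *(4) by eventually_elim simp
  with *(1-3) show ?thesis by blast
qed

end
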